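(* Let $0<\alpha<1$, $\theta>-\alpha$, $n\ge1$, and let $H$ be a non-atomic probability measure on a Polish space $\mathcal{Y}$. A random probability measure $P_{\alpha,\theta}$ with law $\mathcal{PD}_{\alpha,\theta}(dP|H)$ satisfies the equality in distribution $$P_{\alpha,\theta}(\cdot)=p_n\,P_{\alpha,\theta+n(\mathbf{p})\alpha}(\cdot)+(1-p_n)\frac{\sum_{j=1}^{n(\mathbf{p})}G_{j,n}\delta_{Y_j^*}(\cdot)}{\sum_{j=1}^{n(\mathbf{p})}G_{j,n}},\qquad p_n=\frac{G_{\theta+n(\mathbf{p})\alpha}}{G_{\theta+n(\mathbf{p})\alpha}+\sum_{j=1}^{n(\mathbf{p})}G_{j,n}},$$ where $\mathbf{p}$ has distribution $PD(\mathbf{p}|\alpha,\theta)$ and, given $\mathbf{p}$, the following are mutually independent: $P_{\alpha,\theta+n(\mathbf{p})\alpha}$ with law $\mathcal{PD}_{\alpha,\theta+n(\mathbf{p})\alpha}(dP|H)$, $G_{\theta+n(\mathbf{p})\alpha}$ gamma with shape $\theta+n(\mathbf{p})\alpha$ and rate $1$, $G_{j,n}$ gamma with shape $e_{j,n}-\alpha$ and rate $1$ ($j=1,\dots,n(\mathbf{p})$), and $Y_1^*,\dots,Y_{n(\mathbf{p})}^*$ i.i.d. $H$. Moreover, if $P$ has law $\mathcal{PD}_{\alpha,\theta}(dP|H)$ and, given $P$, $Y_1,\dots,Y_n$ are i.i.d. $P$, then the posterior distribution of $P$ given $\mathbf{Y}=(\mathbf{Y}^*,\mathbf{p})$ is the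 law of the random measure on the right-hand side above with $\mathbf{p}$ and the $Y_j^*$ held fixed.
   Context: $\mathcal{PD}_{\alpha,\theta}(dP|H)$, $\theta>-\alpha$, is the law of $P=\mu/T$, where $\mu(dy)=\int_0^\infty sN(ds,dy)$, $T=\mu(\mathcal{Y})$, and $N$ has law proportional to $T^{-\theta}$ times the law of a Poisson random measure on $(0,\infty)\times\mathcal{Y}$ with intensity $\frac{1}{\Gamma(1-\alpha)}s^{-\alpha-1}ds\,H(dy)$ (two-parameter Poisson–Dirichlet random probability measure). $\mathbf{p}=\{C_1,\dots,C_{n(\mathbf{p})}\}$ ranges over partitions of $\{1,\dots,n\}$, $e_{j,n}=|C_j|$, $PD(\mathbf{p}|\alpha,\theta)=\frac{\prod_{j=1}^{n(\mathbf{p})-1}(\theta+j\alpha)}{\prod_{j=1}^{n-1}(\theta+j)}\prod_{j=1}^{n(\mathbf{p})}\frac{\Gamma(e_{j,n}-\alpha)}{\Gamma(1-\alpha)}$. For a sample $\mathbf{Y}=(Y_1,\dots,Y_n)$, $\mathbf{Y}^*$ are its distinct values and $\mathbf{p}$ the partition with $Y_i=Y_j^*$ iff $i\in C_j$. *)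

theory Defs
  imports "HOL-Probability.Probability"
begin

text \<open>
  The space of all measures on the measurable space \<open>K\<close>, with the \<open>\<sigma>\<close>-algebra generated by
  the evaluations; the analogue of \<^const>\<open>subprob_algebra\<close> without the bound on the total mass.
\<close>

definition measure_algebra :: "'b measure \<Rightarrow> 'b measure measure" where
  "measure_algebra K =
     (SUP A \<in> sets K. vimage_algebra {N. sets N = sets K} (\<lambda>N. emeasure N A) borel)"

text \<open>
  For \<open>\<nu> A = 0\<close> the Poisson probabilities below read \<open>N A = 0\<close> almost surely, since \<open>0 ^ 0 = 1\<close>.
\<close>

definition poisson_random_measure :: "'w measure \<Rightarrow> ('w \<Rightarrow> 'b measure) \<Rightarrow> 'b measure \<Rightarrow> bool" where
  "poisson_random_measure M N \<nu> \<longleftrightarrow>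
     prob_space M \<and>
     N \<in> M \<rightarrow>\<^sub>M measure_algebra \<nu> \<and>
     (\<forall>A \<in> sets \<nu>. emeasure \<nu> A < \<infinity> \<longrightarrow>
        (\<forall>k::nat. measure M {\<omega> \<in> space M. emeasure (N \<omega>) A = of_nat k} =
           exp (- measure \<nu> A) * measure \<nu> A ^ k / fact k)) \<and>
     (\<forall>A \<in> sets \<nu>. emeasure \<nu> A = \<infinity> \<longrightarrow> (AE \<omega> in M. emeasure (N \<omega>) A = \<infinity>)) \<and>
     (\<forall>(I::nat set) A. finite I \<longrightarrow> A ` I \<subseteq> sets \<nu> \<longrightarrow> disjoint_family_on A I \<longrightarrow>
        prob_space.indep_vars M (\<lambda>_. borel) (\<lambda>i \<omega>. emeasure (N \<omega>) (A i)) I)"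

text \<open>The law of a Poisson random measure with (\<open>\<sigma>\<close>-finite) intensity \<open>\<nu>\<close>.\<close>

definition PRM_law :: "'b measure \<Rightarrow> 'b measure measure" where
  "PRM_law \<nu> =
     (THE L. sets L = sets (measure_algebra \<nu>) \<and> poisson_random_measure L (\<lambda>N. N) \<nu>)"

definition stable_intensity :: "real \<Rightarrow> 'a::topological_space measure \<Rightarrow> (real \<times> 'a) measure" where
  "stable_intensity \<alpha> H =
     density (restrict_space lborel {0<..}) (\<lambda>s. ennreal (s powr (- \<alpha> - 1) / Gamma (1 - \<alpha>)))
       \<Otimes>\<^sub>M H"

text \<open>\<open>\<mu>(dy) = \<integral> s N(ds,dy)\<close>\<close>

definition crm :: "(real \<times> 'a::topological_space) measure \<Rightarrow> 'a measure" where
  "crm N = distr (density N (\<lambda>(s, y). ennreal s)) borel snd"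

definition total_mass :: "(real \<times> 'a::topological_space) measure \<Rightarrow> ennreal" where
  "total_mass N = emeasure (crm N) UNIV"

text \<open>
  The random measures below are probability measures only almost surely (one needs
  \<open>0 < T < \<infinity>\<close>, and strictly positive gamma variables). On the exceptional null event the value is
  replaced by the probability measure \<open>H\<close>, so that one has a measurable map into
  \<^term>\<open>prob_algebra borel\<close> that is defined everywhere.
\<close>

definition prob_or :: "'a measure \<Rightarrow> 'a measure \<Rightarrow> 'a measure" where
  "prob_or H \<mu> = (if prob_space \<mu> then \<mu> else H)"

text \<open>
  The law of \<open>P = \<mu> / T\<close> when \<open>N\<close> has law proportional to \<open>T powr (- \<theta>)\<close> times the Poisson law.
\<close>

definition PD_law :: "real \<Rightarrow> real \<Rightarrow> 'a::topological_space measure \<Rightarrow> 'a measure measure" where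
  "PD_law \<alpha> \<theta> H =
     (let L = PRM_law (stable_intensity \<alpha> H);
          w = (\<lambda>N. ennreal (enn2real (total_mass N) powr (- \<theta>)))
      in distr (density L (\<lambda>N. w N / (\<integral>\<^sup>+ N'. w N' \<partial>L))) (prob_algebra borel)
           (\<lambda>N. prob_or H (scale_measure (1 / total_mass N) (crm N))))"

text \<open>
  Blocks are not numbered: families indexed by \<open>j = 1, \<dots>, n(p)\<close> are indexed by the blocks
  \<open>C \<in> p\<close> themselves, and \<open>n(p)\<close> is \<^term>\<open>card p\<close>.
\<close>

definition PD_eppf :: "real \<Rightarrow> real \<Rightarrow> nat \<Rightarrow> nat set set \<Rightarrow> real" where
  "PD_eppf \<alpha> \<theta> n p =
     (\<Prod>j = 1..card p - 1. \<theta> + real j * \<alpha>) / (\<Prod>j = 1..n - 1. \<theta> + real j) *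
     (\<Prod>C\<in>p. Gamma (real (card C) - \<alpha>) / Gamma (1 - \<alpha>))"

definition PD_partition :: "real \<Rightarrow> real \<Rightarrow> nat \<Rightarrow> nat set set measure" where
  "PD_partition \<alpha> \<theta> n =
     point_measure {p. partition_on {1..n} p} (\<lambda>p. ennreal (PD_eppf \<alpha> \<theta> n p))"

text \<open>Gamma distribution with shape \<open>a > 0\<close> and rate \<open>1\<close>.\<close>

definition gamma_law :: "real \<Rightarrow> real measure" where
  "gamma_law a =
     density lborel (\<lambda>x. ennreal (if 0 < x then x powr (a - 1) * exp (- x) / Gamma a else 0))"

text \<open>
  The measure \<open>p\<^sub>n Q + (1 - p\<^sub>n) (\<Sum>\<^sub>C G\<^sub>C \<delta>(y\<^sub>C)) / \<Sum>\<^sub>C G\<^sub>C\<close> with \<open>p\<^sub>n = g / (g + \<Sum>\<^sub>C G\<^sub>C)\<close>.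
\<close>

definition mix_measure ::
  "nat set set \<Rightarrow> 'a::topological_space measure \<Rightarrow> real \<Rightarrow> (nat set \<Rightarrow> real) \<Rightarrow> (nat set \<Rightarrow> 'a) \<Rightarrow> 'a measure"
where
  "mix_measure p Q g G y =
     (let S = (\<Sum>C\<in>p. G C); pn = g / (g + S)
      in measure_of UNIV (sets borel)
           (\<lambda>B. ennreal pn * emeasure Q B +
                ennreal (1 - pn) * (\<Sum>C\<in>p. ennreal (G C / S) * emeasure (return borel (y C)) B)))"

text \<open>Law of the random measure \<^const>\<open>mix_measure\<close> for fixed \<open>p\<close>, with random \<open>y\<^sub>C\<close> i.i.d. \<open>H\<close>.\<close>

definition mix_law ::
  "real \<Rightarrow> real \<Rightarrow> 'a::topological_space measure \<Rightarrow> nat set set \<Rightarrow> 'a measure measure" where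
  "mix_law \<alpha> \<theta> H p =
     distr (PD_law \<alpha> (\<theta> + real (card p) * \<alpha>) H
              \<Otimes>\<^sub>M gamma_law (\<theta> + real (card p) * \<alpha>)
              \<Otimes>\<^sub>M (\<Pi>\<^sub>M C\<in>p. gamma_law (real (card C) - \<alpha>))
              \<Otimes>\<^sub>M (\<Pi>\<^sub>M C\<in>p. H))
       (prob_algebra borel)
       (\<lambda>(Q, g, G, y). prob_or H (mix_measure p Q g G y))"

text \<open>Law of the same random measure with both \<open>p\<close> and the \<open>y\<^sub>C\<close> held fixed.\<close>

definition mix_law_fixed ::
  "real \<Rightarrow> real \<Rightarrow> 'a::topological_space measure \<Rightarrow> nat set set \<Rightarrow> (nat set \<Rightarrow> 'a) \<Rightarrow> 'a measure measure"
where
  "mix_law_fixed \<alpha> \<theta> H p y =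
     distr (PD_law \<alpha> (\<theta> + real (card p) * \<alpha>) H
              \<Otimes>\<^sub>M gamma_law (\<theta> + real (card p) * \<alpha>)
              \<Otimes>\<^sub>M (\<Pi>\<^sub>M C\<in>p. gamma_law (real (card C) - \<alpha>)))
       (prob_algebra borel)
       (\<lambda>(Q, g, G). prob_or H (mix_measure p Q g G y))"

text \<open>The partition of \<open>{1..n}\<close> induced by ties, and the common sample value on each block.\<close>

definition sample_partition :: "nat \<Rightarrow> (nat \<Rightarrow> 'a) \<Rightarrow> nat set set" where
  "sample_partition n y = (\<lambda>i. {j \<in> {1..n}. y j = y i}) ` {1..n}"

definition sample_value :: "(nat \<Rightarrow> 'a) \<Rightarrow> nat set \<Rightarrow> 'a" where
  "sample_value y C = the_elem (y ` C)"

text \<open>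
  \<open>\<kappa>\<close> is a regular conditional distribution of \<open>X\<close> (valued in \<open>S\<close>) given \<open>Z\<close> (valued in \<open>R\<close>).
\<close>

definition regular_cond_distr ::
  "'w measure \<Rightarrow> ('w \<Rightarrow> 'x) \<Rightarrow> 'x measure \<Rightarrow> ('w \<Rightarrow> 'z) \<Rightarrow> 'z measure \<Rightarrow> ('z \<Rightarrow> 'x measure) \<Rightarrow> bool" where
  "regular_cond_distr M X S Z R \<kappa> \<longleftrightarrow>
     X \<in> M \<rightarrow>\<^sub>M S \<and> Z \<in> M \<rightarrow>\<^sub>M R \<and> \<kappa> \<in> R \<rightarrow>\<^sub>M prob_algebra S \<and>
     (\<forall>A \<in> sets S. \<forall>B \<in> sets R.
        emeasure M {\<omega> \<in> space M. X \<omega> \<in> A \<and> Z \<omega> \<in> B} =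
        (\<integral>\<^sup>+ \<omega>. emeasure (\<kappa> (Z \<omega>)) A * indicator B (Z \<omega>) \<partial>M))"

end

theory Submission
  imports Defs
begin

text \<open>
  Let \<open>\<mu>\<close> be the stable random measure and \<open>T\<close> its total mass. A Poisson random measure
  satisfies the Mecke equation \<open>E (\<integral> f dN) G(N) = \<integral> f(x) E G(N + \<delta>\<^sub>x) \<nu>(dx)\<close>. Iterating it,
  \<open>E \<phi>(\<mu>) \<mu>(B\<^sub>1) \<dots> \<mu>(B\<^sub>n)\<close> becomes a sum over the partitions \<open>p\<close> of \<open>{1..n}\<close> recording which of
  the \<open>n\<close> factors pick the same atom: each block \<open>C\<close> contributes an atom of size \<open>s\<^sub>C\<close>, with
  weight \<open>s\<^sub>C powr (card C - \<alpha> - 1)\<close>, at a location with law \<open>H\<close>. For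
  \<open>\<phi>(\<mu>) = T powr (- \<theta> - n) \<psi>(\<mu> / T)\<close> the substitution \<open>s\<^sub>C = T r\<^sub>C\<close> replaces the tilting exponent by
  \<open>\<theta> + card p * \<alpha>\<close> and makes \<open>r\<close> independent of \<open>\<mu> / T\<close>, with the law of the ratios of the gamma
  variables \<open>G\<^sub>C\<close> to \<open>G\<^bsub>\<theta> + card p * \<alpha>\<^esub>\<close>. So the joint law of \<open>P\<close> and the sample is the asserted
  mixture. The constants follow from the case \<open>n = 1\<close>, which expresses \<open>E T powr (- \<theta> - \<alpha>)\<close> by
  \<open>E T powr (- \<theta>)\<close>. As \<open>H\<close> has no atoms, the sample determines the partition and the locations,
  so the mixture components are the posterior laws.
\<close>

section \<open>Spaces of measures\<close>

text \<open>\<open>PRM_law\<close> is a definite description, so nothing can be computed from it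
  before existence and uniqueness are known. The Mecke equation is verified for an explicit
  construction and shown to imply the defining Poisson properties; uniqueness then hands it over to
  \<open>PRM_law\<close>. The exponents fit as follows. With \<open>k = card p\<close>, the
  substitution turns weights and differentials into T to the power n - k * \<alpha>, which against T
  to the power -\<theta> - n leaves -\<theta> - k * \<alpha>. The total mass becomes T * (1 + sum
  r), and its power -(\<theta> + n) is the one in the density of the gamma ratios, since the shapes
  \<theta> + k * \<alpha> and card C - \<alpha> add up to \<theta> + n. Integrals are taken in
  \<open>ennreal\<close>, so the identities need no integrability; but dividing by E T powr (-
  \<theta>) requires a finite value. For -\<alpha> < \<theta> \<le> 0 this is a direct estimate;
  larger \<theta> are reached in steps of \<alpha>.\<close>

lemma space_measure_algebra: "space (measure_algebra K) = {N. sets N = sets K}"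
  by (auto simp: measure_algebra_def space_Sup_eq_UN)

lemma measure_algebra_cong: "sets K = sets K' \<Longrightarrow> measure_algebra K = measure_algebra K'"
  by (simp add: measure_algebra_def)

lemma measurable_emeasure_measure_algebra [measurable]:
  "A \<in> sets K \<Longrightarrow> (\<lambda>N. emeasure N A) \<in> borel_measurable (measure_algebra K)"
  by (auto intro!: measurable_Sup1 measurable_vimage_algebra1 simp: measure_algebra_def)

lemma measurable_measure_algebraI:
  assumes "\<And>x. x \<in> space M \<Longrightarrow> sets (f x) = sets K"
    and "\<And>A. A \<in> sets K \<Longrightarrow> (\<lambda>x. emeasure (f x) A) \<in> borel_measurable M"
  shows "f \<in> M \<rightarrow>\<^sub>M measure_algebra K"
  unfolding measure_algebra_def
  by (rule measurable_Sup2) (use assms in \<open>auto intro!: measurable_vimage_algebra2\<close>)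

text \<open>Measurability is built into \<open>measure_algebra\<close> only for evaluations at sets;
  it passes to integrals by the usual induction over indicators, multiples, sums and increasing
  limits.\<close>

lemma borel_measurable_nn_integral_measure_algebra [measurable]:
  assumes "f \<in> borel_measurable K"
  shows "(\<lambda>N. \<integral>\<^sup>+x. f x \<partial>N) \<in> borel_measurable (measure_algebra K)"
  using assms
proof (induct f rule: borel_measurable_induct)
  case (cong f g)
  have "(\<lambda>N. \<integral>\<^sup>+x. f x \<partial>N) \<in> borel_measurable (measure_algebra K) \<longleftrightarrow>
    (\<lambda>N. \<integral>\<^sup>+x. g x \<partial>N) \<in> borel_measurable (measure_algebra K)"
    by (intro measurable_cong nn_integral_cong)
      (use cong in \<open>auto simp: space_measure_algebra dest!: sets_eq_imp_space_eq\<close>)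
  with cong show ?case by simp
next
  case (set A)
  have "(\<lambda>N. \<integral>\<^sup>+x. indicator A x \<partial>N) \<in> borel_measurable (measure_algebra K) \<longleftrightarrow>
    (\<lambda>N. emeasure N A) \<in> borel_measurable (measure_algebra K)"
    by (intro measurable_cong nn_integral_indicator) (use set in \<open>auto simp: space_measure_algebra\<close>)
  with set show ?case by simp
next
  case (mult u c)
  have "(\<lambda>N. \<integral>\<^sup>+x. c * u x \<partial>N) \<in> borel_measurable (measure_algebra K) \<longleftrightarrow>
    (\<lambda>N. c * \<integral>\<^sup>+x. u x \<partial>N) \<in> borel_measurable (measure_algebra K)"
    by (intro measurable_cong nn_integral_cmult) (use mult in \<open>auto simp: space_measure_algebra cong: measurable_cong_sets\<close>)
  with mult show ?case by simp
next
  case (add u v)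
  have "(\<lambda>N. \<integral>\<^sup>+x. v x + u x \<partial>N) \<in> borel_measurable (measure_algebra K) \<longleftrightarrow>
    (\<lambda>N. (\<integral>\<^sup>+x. v x \<partial>N) + (\<integral>\<^sup>+x. u x \<partial>N)) \<in> borel_measurable (measure_algebra K)"
    by (intro measurable_cong nn_integral_add) (use add in \<open>auto simp: space_measure_algebra cong: measurable_cong_sets\<close>)
  with add show ?case by simp
next
  case (seq U)
  have "(\<lambda>N. \<integral>\<^sup>+x. (SUP i. U i) x \<partial>N) \<in> borel_measurable (measure_algebra K) \<longleftrightarrow>
    (\<lambda>N. SUP i. \<integral>\<^sup>+x. U i x \<partial>N) \<in> borel_measurable (measure_algebra K)"
    unfolding SUP_apply
    by (intro measurable_cong nn_integral_monotone_convergence_SUP)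
      (use seq in \<open>auto simp: space_measure_algebra cong: measurable_cong_sets\<close>)
  with seq show ?case by (simp add: image_image)
qed

section \<open>Sums of measures and added points\<close>

text \<open>The sum is written as an integral over counting measure, so countable additivity is an
  interchange of nonnegative sums for any index set. \<open>K\<close> supplies the measurable sets
  even if \<open>I\<close> is empty. Point insertion, superposition and finite families of atoms are
  all instances.\<close>

definition sum_measure :: "'b measure \<Rightarrow> ('i \<Rightarrow> 'b measure) \<Rightarrow> 'i set \<Rightarrow> 'b measure" where
  "sum_measure K F I =
     measure_of (space K) (sets K) (\<lambda>A. \<integral>\<^sup>+i. emeasure (F i) A \<partial>count_space I)"

lemma
  shows space_sum_measure: "space (sum_measure K F I) = space K"
    and sets_sum_measure [simp, measurable_cong]: "sets (sum_measure K F I) = sets K"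
  by (auto simp: sum_measure_def sets.space_closed space_measure_of_conv sets.sigma_sets_eq)

lemma emeasure_sum_measure:
  assumes "\<And>i. i \<in> I \<Longrightarrow> sets (F i) = sets K" "A \<in> sets K"
  shows "emeasure (sum_measure K F I) A = (\<integral>\<^sup>+i. emeasure (F i) A \<partial>count_space I)"
proof (rule emeasure_measure_of[OF sum_measure_def sets.space_closed])
  show "A \<in> sets (sum_measure K F I)"
    using assms by simp
  show "positive (sets (sum_measure K F I)) (\<lambda>A. \<integral>\<^sup>+i. emeasure (F i) A \<partial>count_space I)"
    by (simp add: positive_def)
  show "countably_additive (sets (sum_measure K F I)) (\<lambda>A. \<integral>\<^sup>+i. emeasure (F i) A \<partial>count_space I)"
    unfolding sets_sum_measure
  proof (rule countably_additiveI)
    fix X :: "nat \<Rightarrow> _" assume X: "range X \<subseteq> sets K" "disjoint_family X" "(\<Union>i. X i) \<in> sets K"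
    have "(\<Sum>n. \<integral>\<^sup>+i. emeasure (F i) (X n) \<partial>count_space I) =
        (\<integral>\<^sup>+i. (\<Sum>n. emeasure (F i) (X n)) \<partial>count_space I)"
      by (rule nn_integral_suminf[symmetric]) simp
    also have "\<dots> = (\<integral>\<^sup>+i. emeasure (F i) (\<Union>n. X n) \<partial>count_space I)"
      by (intro nn_integral_cong suminf_emeasure) (use X assms(1) in auto)
    finally show "(\<Sum>n. \<integral>\<^sup>+i. emeasure (F i) (X n) \<partial>count_space I) =
        (\<integral>\<^sup>+i. emeasure (F i) (\<Union>n. X n) \<partial>count_space I)" .
  qed
qed

lemma nn_integral_sum_measure:
  assumes "\<And>i. i \<in> I \<Longrightarrow> sets (F i) = sets K" "f \<in> borel_measurable K"
  shows "(\<integral>\<^sup>+x. f x \<partial>sum_measure K F I) = (\<integral>\<^sup>+i. (\<integral>\<^sup>+x. f x \<partial>F i) \<partial>count_space I)"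
  using assms(2)
proof (induct f rule: borel_measurable_induct)
  case (cong f g)
  have "(\<integral>\<^sup>+x. f x \<partial>sum_measure K F I) = (\<integral>\<^sup>+x. g x \<partial>sum_measure K F I)"
    by (intro nn_integral_cong) (use cong in \<open>simp add: space_sum_measure\<close>)
  moreover have "(\<integral>\<^sup>+i. (\<integral>\<^sup>+x. f x \<partial>F i) \<partial>count_space I) = (\<integral>\<^sup>+i. (\<integral>\<^sup>+x. g x \<partial>F i) \<partial>count_space I)"
    by (intro nn_integral_cong) (use cong assms(1)[THEN sets_eq_imp_space_eq] in auto)
  ultimately show ?case using cong by simp
next
  case (set A)
  have "(\<integral>\<^sup>+i. (\<integral>\<^sup>+x. indicator A x \<partial>F i) \<partial>count_space I) = (\<integral>\<^sup>+i. emeasure (F i) A \<partial>count_space I)"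
    by (intro nn_integral_cong nn_integral_indicator) (use set assms in auto)
  with set show ?case by (simp add: emeasure_sum_measure assms(1))
next
  case (mult u c)
  have "(\<integral>\<^sup>+i. (\<integral>\<^sup>+x. c * u x \<partial>F i) \<partial>count_space I) = (\<integral>\<^sup>+i. c * (\<integral>\<^sup>+x. u x \<partial>F i) \<partial>count_space I)"
    by (intro nn_integral_cong nn_integral_cmult)
      (use mult assms(1) in \<open>auto cong: measurable_cong_sets\<close>)
  with mult show ?case by (simp add: nn_integral_cmult)
next
  case (add u v)
  have "(\<integral>\<^sup>+i. (\<integral>\<^sup>+x. v x + u x \<partial>F i) \<partial>count_space I) =
      (\<integral>\<^sup>+i. (\<integral>\<^sup>+x. v x \<partial>F i) + (\<integral>\<^sup>+x. u x \<partial>F i) \<partial>count_space I)"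
    by (intro nn_integral_cong nn_integral_add)
      (use add assms(1) in \<open>auto cong: measurable_cong_sets\<close>)
  with add show ?case by (simp add: nn_integral_add)
next
  case (seq U)
  have "(\<integral>\<^sup>+i. (\<integral>\<^sup>+x. (SUP n. U n x) \<partial>F i) \<partial>count_space I) =
      (\<integral>\<^sup>+i. (SUP n. \<integral>\<^sup>+x. U n x \<partial>F i) \<partial>count_space I)"
    by (intro nn_integral_cong nn_integral_monotone_convergence_SUP)
      (use seq assms(1) in \<open>auto cong: measurable_cong_sets\<close>)
  also have "\<dots> = (SUP n. \<integral>\<^sup>+i. (\<integral>\<^sup>+x. U n x \<partial>F i) \<partial>count_space I)"
    by (intro nn_integral_monotone_convergence_SUP)
      (use \<open>incseq U\<close> in \<open>auto simp: incseq_def le_fun_def intro!: nn_integral_mono\<close>)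
  also have "\<dots> = (SUP n. \<integral>\<^sup>+x. U n x \<partial>sum_measure K F I)"
    using seq by simp
  also have "\<dots> = (\<integral>\<^sup>+x. (SUP n. U n x) \<partial>sum_measure K F I)"
    by (intro nn_integral_monotone_convergence_SUP[symmetric])
      (use seq in \<open>auto cong: measurable_cong_sets\<close>)
  finally show ?case by (simp add: SUP_apply image_image)
qed

definition add_point :: "'b measure \<Rightarrow> 'b \<Rightarrow> 'b measure" where
  "add_point N x = sum_measure N (\<lambda>b. if b then N else return N x) UNIV"

lemma sets_add_point [simp, measurable_cong]: "sets (add_point N x) = sets N"
  by (simp add: add_point_def)

lemma emeasure_add_point:
  "A \<in> sets N \<Longrightarrow> emeasure (add_point N x) A = emeasure N A + indicator A x"
  by (simp add: add_point_def emeasure_sum_measure nn_integral_count_space_finite UNIV_bool add.commute)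

lemma nn_integral_add_point:
  assumes "f \<in> borel_measurable N" "x \<in> space N"
  shows "(\<integral>\<^sup>+y. f y \<partial>add_point N x) = (\<integral>\<^sup>+y. f y \<partial>N) + f x"
  using assms
  by (simp add: add_point_def nn_integral_sum_measure nn_integral_count_space_finite UNIV_bool
      nn_integral_return add.commute)

lemma measurable_add_point [measurable (raw)]:
  assumes f [measurable]: "f \<in> M \<rightarrow>\<^sub>M measure_algebra K" and g [measurable]: "g \<in> M \<rightarrow>\<^sub>M K"
  shows "(\<lambda>x. add_point (f x) (g x)) \<in> M \<rightarrow>\<^sub>M measure_algebra K"
proof (rule measurable_measure_algebraI)
  have s: "sets (f x) = sets K" if "x \<in> space M" for x
    using measurable_space[OF f that] by (simp add: space_measure_algebra)
  then show "sets (add_point (f x) (g x)) = sets K" if "x \<in> space M" for x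
    using that by simp
  fix A assume A [measurable]: "A \<in> sets K"
  have "(\<lambda>x. emeasure (add_point (f x) (g x)) A) \<in> borel_measurable M \<longleftrightarrow>
     (\<lambda>x. emeasure (f x) A + indicator A (g x)) \<in> borel_measurable M"
    by (intro measurable_cong emeasure_add_point) (use s A in auto)
  then show "(\<lambda>x. emeasure (add_point (f x) (g x)) A) \<in> borel_measurable M"
    by (simp)
qed

lemma add_point_commute: "add_point (add_point N x) y = add_point (add_point N y) x"
  by (rule measure_eqI) (auto simp: emeasure_add_point add_ac)

section \<open>The Mecke equation\<close>

text \<open>The Mecke equation serves as the working form of the Poisson property, because it passes
  through the construction below and can be iterated. It is stated for products of a function of the
  point and a function of the measure, which spares joint measurability in \<open>x\<close> and
  \<open>N\<close>.\<close>

locale mecke = prob_space L for L :: "'b measure measure" +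
  fixes \<nu> :: "'b measure"
  assumes sets_L [measurable_cong]: "sets L = sets (measure_algebra \<nu>)"
    and mecke: "\<And>f G. f \<in> borel_measurable \<nu> \<Longrightarrow> G \<in> borel_measurable (measure_algebra \<nu>) \<Longrightarrow>
      (\<integral>\<^sup>+N. (\<integral>\<^sup>+x. f x \<partial>N) * G N \<partial>L) = (\<integral>\<^sup>+x. f x * (\<integral>\<^sup>+N. G (add_point N x) \<partial>L) \<partial>\<nu>)"
begin

lemma space_L: "space L = {N. sets N = sets \<nu>}"
  using sets_eq_imp_space_eq[OF sets_L] by (simp add: space_measure_algebra)

lemma measurable_L_iff: "f \<in> L \<rightarrow>\<^sub>M M \<longleftrightarrow> f \<in> measure_algebra \<nu> \<rightarrow>\<^sub>M M"
  by (rule measurable_cong_sets[OF sets_L refl, THEN eqset_imp_iff])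

lemma measurable_emeasure_L [measurable]: "A \<in> sets \<nu> \<Longrightarrow> (\<lambda>N. emeasure N A) \<in> borel_measurable L"
  by (simp add: measurable_L_iff)

lemma emeasure_event:
  assumes A: "A \<in> sets \<nu>" and E: "E \<in> events" and S: "S \<in> sets borel"
  shows "{N \<in> E. emeasure N A \<in> S} \<in> events"
proof -
  have "{N \<in> E. emeasure N A \<in> S} = E \<inter> ((\<lambda>N. emeasure N A) -` S \<inter> space L)"
    using sets.sets_into_space[OF E] by auto
  then show ?thesis using measurable_sets[OF measurable_emeasure_L[OF A] S] E by simp
qed

lemma emeasure_eq_event:
  "A \<in> sets \<nu> \<Longrightarrow> E \<in> events \<Longrightarrow> {N \<in> E. emeasure N A = c} \<in> events"
  using emeasure_event[of A E "{c}"] by simp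

section \<open>From the Mecke equation to Poisson counts and independence\<close>

text \<open>The case where \<open>f\<close> is the indicator of \<open>A\<close>. The event
  \<open>E\<close> does not see points of \<open>A\<close>, so the inserted point only raises the
  count by one. Keeping \<open>E\<close> in the identity yields independence together with the
  Poisson probabilities.\<close>

lemma mecke_count:
  assumes A [measurable]: "A \<in> sets \<nu>" and E [measurable]: "E \<in> events"
    and inv: "\<And>N x. N \<in> space L \<Longrightarrow> x \<in> A \<Longrightarrow> add_point N x \<in> E \<longleftrightarrow> N \<in> E"
    and g [measurable]: "g \<in> borel_measurable borel"
  shows "(\<integral>\<^sup>+N. emeasure N A * (g (emeasure N A) * indicator E N) \<partial>L) =
    emeasure \<nu> A * (\<integral>\<^sup>+N. g (emeasure N A + 1) * indicator E N \<partial>L)"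
proof -
  define G where "G = (\<lambda>N. g (emeasure N A) * indicator E N :: ennreal)"
  have G: "G \<in> borel_measurable (measure_algebra \<nu>)"
    unfolding G_def measurable_L_iff[symmetric] by measurable
  have "(\<integral>\<^sup>+N. emeasure N A * G N \<partial>L) = (\<integral>\<^sup>+N. (\<integral>\<^sup>+x. indicator A x \<partial>N) * G N \<partial>L)"
    by (intro nn_integral_cong) (use A in \<open>simp add: space_L\<close>)
  also have "\<dots> = (\<integral>\<^sup>+x. indicator A x * (\<integral>\<^sup>+N. G (add_point N x) \<partial>L) \<partial>\<nu>)"
    by (rule mecke) (use G in auto)
  also have "\<dots> = (\<integral>\<^sup>+x. (\<integral>\<^sup>+N. g (emeasure N A + 1) * indicator E N \<partial>L) * indicator A x \<partial>\<nu>)"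
  proof (intro nn_integral_cong)
    fix x
    have "(\<integral>\<^sup>+N. G (add_point N x) \<partial>L) = (\<integral>\<^sup>+N. g (emeasure N A + 1) * indicator E N \<partial>L)" if "x \<in> A"
      by (intro nn_integral_cong)
        (use that inv A in \<open>simp add: G_def space_L emeasure_add_point indicator_def\<close>)
    then show "indicator A x * (\<integral>\<^sup>+N. G (add_point N x) \<partial>L) =
      (\<integral>\<^sup>+N. g (emeasure N A + 1) * indicator E N \<partial>L) * indicator A x"
      by (simp add: indicator_def)
  qed
  also have "\<dots> = emeasure \<nu> A * (\<integral>\<^sup>+N. g (emeasure N A + 1) * indicator E N \<partial>L)"
    by (subst nn_integral_cmult_indicator) (simp_all add: mult.commute)
  finally show ?thesis unfolding G_def .
qed

lemma mecke_count':
  assumes A [measurable]: "A \<in> sets \<nu>" and g [measurable]: "g \<in> borel_measurable borel"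
  shows "(\<integral>\<^sup>+N. emeasure N A * g (emeasure N A) \<partial>L) =
    emeasure \<nu> A * (\<integral>\<^sup>+N. g (emeasure N A + 1) \<partial>L)"
proof -
  have "(\<integral>\<^sup>+N. emeasure N A * (g (emeasure N A) * indicator (space L) N) \<partial>L) =
    emeasure \<nu> A * (\<integral>\<^sup>+N. g (emeasure N A + 1) * indicator (space L) N \<partial>L)"
    by (rule mecke_count[OF A sets.top]) (auto simp: space_L)
  moreover have "(\<integral>\<^sup>+N. emeasure N A * (g (emeasure N A) * indicator (space L) N) \<partial>L) =
     (\<integral>\<^sup>+N. emeasure N A * g (emeasure N A) \<partial>L)"
    "(\<integral>\<^sup>+N. g (emeasure N A + 1) * indicator (space L) N \<partial>L) = (\<integral>\<^sup>+N. g (emeasure N A + 1) \<partial>L)"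
    by (auto intro!: nn_integral_cong)
  ultimately show ?thesis by simp
qed

text \<open>With \<open>g\<close> the indicator of the values up to \<open>m\<close>, the left side
  of the Mecke identity is at most \<open>m\<close>, while the right side is infinity times the
  probability that \<open>emeasure N A + 1\<close> is at most \<open>m\<close>. So that probability
  vanishes for every \<open>m\<close>.\<close>

lemma AE_infinite:
  assumes A [measurable]: "A \<in> sets \<nu>" and inf: "emeasure \<nu> A = \<infinity>"
  shows "AE N in L. emeasure N A = \<infinity>"
proof -
  have "AE N in L. \<not> emeasure N A + 1 \<le> of_nat m" for m :: nat
  proof -
    define g where "g = (\<lambda>z::ennreal. indicator {..of_nat m} z :: ennreal)"
    have g [measurable]: "g \<in> borel_measurable borel" by (simp add: g_def)
    have "(\<integral>\<^sup>+N. emeasure N A * g (emeasure N A) \<partial>L) \<le> (\<integral>\<^sup>+N. of_nat m \<partial>L)"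
      by (intro nn_integral_mono) (auto simp: g_def indicator_def)
    also have "\<dots> < \<infinity>" by (simp add: emeasure_space_1 of_nat_less_top)
    finally have "(\<integral>\<^sup>+N. g (emeasure N A + 1) \<partial>L) = 0"
      by (auto simp: mecke_count' inf ennreal_top_mult split: if_splits)
    then have "AE N in L. g (emeasure N A + 1) = 0"
      by (simp add: nn_integral_0_iff_AE)
    then show ?thesis by eventually_elim (auto simp: g_def indicator_def split: if_splits)
  qed
  then have "AE N in L. \<forall>m::nat. \<not> emeasure N A + 1 \<le> of_nat m"
    by (simp add: AE_all_countable)
  then show ?thesis
  proof eventually_elim
    case (elim N)
    show ?case
    proof (rule ccontr)
      assume "\<not> emeasure N A = \<infinity>"
      then have "emeasure N A + 1 \<noteq> top" by simp
      then obtain m :: nat where "emeasure N A + 1 < of_nat m"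
        using ennreal_Ex_less_of_nat[of "emeasure N A + 1"] by (auto simp: less_top)
      with elim show False by (meson less_imp_le)
    qed
  qed
qed

text \<open>
  The Mecke equation with the indicator of \<open>{m + 1<..<m + 2}\<close> reduces the absence of values in
  this interval to their absence in \<open>{m<..<m + 1}\<close>.
\<close>

lemma AE_integer_valued:
  assumes A [measurable]: "A \<in> sets \<nu>" and fin: "emeasure \<nu> A < \<infinity>"
  shows "AE N in L. \<exists>k::nat. emeasure N A = of_nat k"
proof -
  have "(\<integral>\<^sup>+N. emeasure N A \<partial>L) = emeasure \<nu> A"
    using mecke_count'[of A "\<lambda>_. 1"] by (simp add: emeasure_space_1)
  then have fin': "AE N in L. emeasure N A \<noteq> \<infinity>"
    by (intro nn_integral_PInf_AE) (use fin in auto)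
  have gap: "AE N in L. \<not> (of_nat m < emeasure N A \<and> emeasure N A < of_nat m + 1)" for m :: nat
  proof (induction m)
    case 0
    \<comment> \<open>A value \<open>z + 1\<close> never lies strictly between 0 and 1, so here the
      right side of the identity is zero.\<close>
    define g where "g = (\<lambda>z::ennreal. indicator {0<..<1} z :: ennreal)"
    have g [measurable]: "g \<in> borel_measurable borel" by (simp add: g_def)
    have "(\<integral>\<^sup>+N. g (emeasure N A + 1) \<partial>L) = (\<integral>\<^sup>+N. 0 \<partial>L)"
      by (intro nn_integral_cong) (auto simp: g_def indicator_def not_less)
    then have "(\<integral>\<^sup>+N. emeasure N A * g (emeasure N A) \<partial>L) = 0"
      by (simp add: mecke_count')
    then have "AE N in L. emeasure N A * g (emeasure N A) = 0"
      by (simp add: nn_integral_0_iff_AE)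
    then show ?case by eventually_elim (auto simp: g_def indicator_def split: if_splits)
  next
    case (Suc m)
    define g where "g = (\<lambda>z::ennreal. indicator {of_nat (Suc m)<..<of_nat (Suc m) + 1} z :: ennreal)"
    have g [measurable]: "g \<in> borel_measurable borel" by (simp add: g_def)
    have *: "g (z + 1) = indicator {of_nat m<..<of_nat m + 1} z" for z
    proof -
      have "of_nat (Suc m) < z + 1 \<longleftrightarrow> of_nat m < z"
        using ennreal_add_left_cancel_less[of 1 "of_nat m" z] by (simp add: add.commute)
      moreover have "z + 1 < of_nat (Suc m) + 1 \<longleftrightarrow> z < of_nat m + 1"
        using ennreal_add_left_cancel_less[of 1 z "of_nat m + 1"] by (simp add: add_ac)
      ultimately show ?thesis by (auto simp: g_def indicator_def)
    qed
    have "(\<integral>\<^sup>+N. g (emeasure N A + 1) \<partial>L) = 0"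
      using Suc.IH by (simp add: * nn_integral_0_iff_AE indicator_def)
    then have "(\<integral>\<^sup>+N. emeasure N A * g (emeasure N A) \<partial>L) = 0"
      by (simp add: mecke_count')
    then have "AE N in L. emeasure N A * g (emeasure N A) = 0"
      by (simp add: nn_integral_0_iff_AE)
    then show ?case
      by eventually_elim (auto simp: g_def indicator_def split: if_splits)
  qed
  have "AE N in L. \<forall>m::nat. \<not> (of_nat m < emeasure N A \<and> emeasure N A < of_nat m + 1)"
    using gap by (simp add: AE_all_countable)
  with fin' show ?thesis
  proof eventually_elim
    case (elim N)
    then obtain r where r: "emeasure N A = ennreal r" "r \<ge> 0"
      by (cases "emeasure N A") auto
    define m where "m = nat \<lfloor>r\<rfloor>"
    have m: "real m \<le> r" "r < real m + 1" using r by (auto simp: m_def)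
    have "\<not> (real m < r)"
    proof
      assume "real m < r"
      then have "of_nat m < emeasure N A" using r by (simp add: ennreal_of_nat_eq_real_of_nat ennreal_less_iff)
      moreover have "emeasure N A < of_nat m + 1"
        using r m by (simp add: ennreal_of_nat_eq_real_of_nat ennreal_less_iff flip: ennreal_1 ennreal_plus)
      ultimately show False using elim(2) by blast
    qed
    with m have "r = real m" by simp
    with r show ?case by (auto simp: ennreal_of_nat_eq_real_of_nat)
  qed
qed

text \<open>Let p k be the probability of \<open>E\<close> together with \<open>k\<close> points in
  \<open>A\<close>. The Mecke identity with the indicator of \<open>k + 1\<close> gives the
  recursion (k + 1) * p (k + 1) = a * p k with \<open>a = measure \<nu> A\<close>, hence p k = a ^ k
  / fact k * p 0. Summing over \<open>k\<close> determines p 0, since the count is almost surely an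
  integer.\<close>

lemma poisson_joint:
  assumes A [measurable]: "A \<in> sets \<nu>" and fin: "emeasure \<nu> A < \<infinity>"
    and E [measurable]: "E \<in> events"
    and inv: "\<And>N x. N \<in> space L \<Longrightarrow> x \<in> A \<Longrightarrow> add_point N x \<in> E \<longleftrightarrow> N \<in> E"
  shows "prob {N \<in> E. emeasure N A = of_nat k} =
    exp (- measure \<nu> A) * measure \<nu> A ^ k / fact k * prob E"
proof -
  define a where "a = measure \<nu> A"
  have a: "emeasure \<nu> A = ennreal a" "a \<ge> 0"
    using fin by (auto simp: a_def emeasure_eq_ennreal_measure)
  define p where "p k = prob {N \<in> E. emeasure N A = of_nat k}" for k :: nat
  have Ek [measurable]: "{N \<in> E. emeasure N A = of_nat k} \<in> events" for k :: nat
    by (rule emeasure_eq_event) fact+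
  have rec: "real (Suc k) * p (Suc k) = a * p k" for k
  proof -
    define g where "g = (\<lambda>z::ennreal. indicator {of_nat (Suc k)} z :: ennreal)"
    have g [measurable]: "g \<in> borel_measurable borel" by (simp add: g_def)
    have "ennreal (real (Suc k) * p (Suc k)) =
        (\<integral>\<^sup>+N. of_nat (Suc k) * indicator {N \<in> E. emeasure N A = of_nat (Suc k)} N \<partial>L)"
      by (simp add: nn_integral_cmult p_def emeasure_eq_measure ennreal_mult ennreal_of_nat_eq_real_of_nat
          del: of_nat_Suc)
    also have "\<dots> = (\<integral>\<^sup>+N. emeasure N A * (g (emeasure N A) * indicator E N) \<partial>L)"
      by (intro nn_integral_cong) (auto simp: g_def indicator_def)
    also have "\<dots> = emeasure \<nu> A * (\<integral>\<^sup>+N. g (emeasure N A + 1) * indicator E N \<partial>L)"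
      by (rule mecke_count) (use inv in auto)
    also have "(\<integral>\<^sup>+N. g (emeasure N A + 1) * indicator E N \<partial>L) =
        (\<integral>\<^sup>+N. indicator {N \<in> E. emeasure N A = of_nat k} N \<partial>L)"
    proof (intro nn_integral_cong)
      fix N
      have "emeasure N A + 1 = of_nat (Suc k) \<longleftrightarrow> emeasure N A = of_nat k"
        using ennreal_add_left_cancel[of 1 "emeasure N A" "of_nat k"] by (simp add: add.commute)
      then show "g (emeasure N A + 1) * indicator E N = indicator {N \<in> E. emeasure N A = of_nat k} N"
        by (auto simp: g_def indicator_def)
    qed
    also have "\<dots> = ennreal (p k)"
      by (simp add: p_def emeasure_eq_measure)
    finally have "ennreal (real (Suc k) * p (Suc k)) = ennreal (a * p k)"
      using a by (simp add: ennreal_mult p_def)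
    then show ?thesis
      using a by (subst (asm) ennreal_inj) (auto simp: p_def)
  qed
  have pk: "p k = a ^ k / fact k * p 0" for k
  proof (induction k)
    case (Suc k)
    have "p (Suc k) = a * p k / real (Suc k)" using rec[of k] by (simp add: field_simps)
    also have "\<dots> = a ^ Suc k / fact (Suc k) * p 0"
      unfolding Suc.IH by (simp only: fact_Suc power_Suc times_divide_eq_left times_divide_eq_right
          divide_divide_eq_left mult_ac)
    finally show ?case .
  qed simp
  have "p sums prob (\<Union>k. {N \<in> E. emeasure N A = of_nat k})"
    unfolding p_def by (rule finite_measure_UNION) (auto simp: disjoint_family_on_def)
  moreover have "prob (\<Union>k. {N \<in> E. emeasure N A = of_nat k}) = prob E"
  proof (rule measure_eq_AE)
    show "AE N in L. N \<in> (\<Union>k::nat. {N \<in> E. emeasure N A = of_nat k}) \<longleftrightarrow> N \<in> E"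
      using AE_integer_valued[OF A fin] by eventually_elim auto
  qed auto
  ultimately have 1: "p sums prob E" by simp
  have "(\<lambda>k. a ^ k / fact k * p 0) sums (exp a * p 0)"
    using sums_mult2[OF exp_converges[of a], of "p 0"] by (simp add: divide_inverse_commute)
  with 1 have "prob E = exp a * p 0"
    using sums_unique2 pk by (metis (no_types, lifting) ext)
  then have "p 0 = exp (- a) * prob E" by (simp add: exp_minus field_simps)
  with pk[of k] show ?thesis by (simp add: p_def a_def)
qed

text \<open>If \<open>A\<close> has finite intensity, the joint Poisson probabilities factor for
  each value of the count and are summed over the values in \<open>S\<close>. Otherwise the count is
  almost surely infinite, and both sides are decided by whether \<open>\<infinity>\<close> lies in
  \<open>S\<close>.\<close>

lemma emeasure_indep:
  assumes A [measurable]: "A \<in> sets \<nu>"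
    and E [measurable]: "E \<in> events"
    and inv: "\<And>N x. N \<in> space L \<Longrightarrow> x \<in> A \<Longrightarrow> add_point N x \<in> E \<longleftrightarrow> N \<in> E"
    and S [measurable]: "S \<in> sets borel"
  shows "prob {N \<in> E. emeasure N A \<in> S} = prob {N \<in> space L. emeasure N A \<in> S} * prob E"
proof (cases "emeasure \<nu> A = \<infinity>")
  case True
  have ae: "AE N in L. emeasure N A = \<infinity>" by (rule AE_infinite) fact+
  have m: "{N \<in> E. emeasure N A \<in> S} \<in> events" "{N \<in> space L. emeasure N A \<in> S} \<in> events"
    by (auto intro!: emeasure_event A E S)
  show ?thesis
  proof (cases "\<infinity> \<in> S")
    case True
    have "prob {N \<in> E. emeasure N A \<in> S} = prob E"
      by (rule measure_eq_AE) (use ae True m in auto)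
    moreover have "prob {N \<in> space L. emeasure N A \<in> S} = prob (space L)"
      by (rule measure_eq_AE) (use ae True m in auto)
    ultimately show ?thesis by (simp add: prob_space)
  next
    case False
    have "prob {N \<in> E. emeasure N A \<in> S} = prob {}"
      by (rule measure_eq_AE) (use ae False m in auto)
    moreover have "prob {N \<in> space L. emeasure N A \<in> S} = prob {}"
      by (rule measure_eq_AE) (use ae False m in auto)
    ultimately show ?thesis by simp
  qed
next
  case False
  then have fin: "emeasure \<nu> A < \<infinity>" by (simp add: less_top)
  define q where "q k = exp (- measure \<nu> A) * measure \<nu> A ^ k / fact k" for k :: nat
  have sums: "(\<lambda>k. indicator S (of_nat k) * q k * prob E) sums prob {N \<in> E. emeasure N A \<in> S}"
    if E [measurable]: "E \<in> events"
    and inv: "\<And>N x. N \<in> space L \<Longrightarrow> x \<in> A \<Longrightarrow> add_point N x \<in> E \<longleftrightarrow> N \<in> E" for E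
  proof -
    define X where "X k = (if of_nat k \<in> S then {N \<in> E. emeasure N A = of_nat k} else {})" for k :: nat
    have X: "X k \<in> events" for k by (auto simp: X_def intro!: emeasure_eq_event A E)
    have "(\<lambda>k. prob (X k)) sums prob (\<Union>k. X k)"
      using X by (intro finite_measure_UNION) (auto simp: X_def disjoint_family_on_def)
    also have "(\<lambda>k. prob (X k)) = (\<lambda>k. indicator S (of_nat k) * q k * prob E)"
      by (auto simp: X_def q_def poisson_joint[OF A fin E inv] fun_eq_iff)
    also have "prob (\<Union>k. X k) = prob {N \<in> E. emeasure N A \<in> S}"
    proof (rule measure_eq_AE)
      show "AE N in L. N \<in> (\<Union>k. X k) \<longleftrightarrow> N \<in> {N \<in> E. emeasure N A \<in> S}"
        using AE_integer_valued[OF A fin] by eventually_elim (auto simp: X_def split: if_splits)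
    qed (use X in \<open>auto intro!: emeasure_event A E S\<close>)
    finally show ?thesis .
  qed
  have "(\<lambda>k. indicator S (of_nat k) * q k * prob (space L)) sums prob {N \<in> space L. emeasure N A \<in> S}"
    by (rule sums[OF sets.top]) (auto simp: space_L)
  from sums_mult2[OF this, of "prob E"]
  have "(\<lambda>k. indicator S (of_nat k) * q k * prob E) sums (prob {N \<in> space L. emeasure N A \<in> S} * prob E)"
    by (simp add: prob_space)
  with sums[OF E inv] show ?thesis by (rule sums_unique2)
qed

text \<open>Induction on the family: by disjointness, a point added in the new set leaves the counts
  of the others unchanged, so their joint event is admissible as \<open>E\<close> in
  \<open>emeasure_indep\<close>.\<close>

lemma prob_emeasure_family:
  assumes "finite J" "A ` J \<subseteq> sets \<nu>" "disjoint_family_on A J" "\<And>j. j \<in> J \<Longrightarrow> S j \<in> sets borel"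
  shows "prob {N \<in> space L. \<forall>j\<in>J. emeasure N (A j) \<in> S j} =
    (\<Prod>j\<in>J. prob {N \<in> space L. emeasure N (A j) \<in> S j})"
  using assms
proof (induction J)
  case empty
  then show ?case by (simp add: prob_space)
next
  case (insert i J)
  define E where "E = {N \<in> space L. \<forall>j\<in>J. emeasure N (A j) \<in> S j}"
  have [measurable]: "A j \<in> sets \<nu>" "S j \<in> sets borel" if "j \<in> insert i J" for j
    using insert.prems that by auto
  have E: "E \<in> events"
    unfolding E_def using insert.hyps(1)
    by (intro sets.sets_Collect_finite_All emeasure_event) auto
  have "prob {N \<in> E. emeasure N (A i) \<in> S i} = prob {N \<in> space L. emeasure N (A i) \<in> S i} * prob E"
  proof (rule emeasure_indep[OF _ E])
    fix N x assume N: "N \<in> space L" "x \<in> A i"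
    have "emeasure (add_point N x) (A j) = emeasure N (A j)" if "j \<in> J" for j
    proof -
      have "x \<notin> A j"
        using insert.prems(2) insert.hyps(2) that N by (auto simp: disjoint_family_on_def)
      then show ?thesis using N insert.prems that by (subst emeasure_add_point) (auto simp: space_L)
    qed
    then show "add_point N x \<in> E \<longleftrightarrow> N \<in> E"
      using N by (auto simp: E_def space_L)
  qed auto
  also have "prob E = (\<Prod>j\<in>J. prob {N \<in> space L. emeasure N (A j) \<in> S j})"
    unfolding E_def using insert.prems by (intro insert.IH) (auto simp: disjoint_family_on_def)
  also have "{N \<in> E. emeasure N (A i) \<in> S i} = {N \<in> space L. \<forall>j\<in>insert i J. emeasure N (A j) \<in> S j}"
    by (auto simp: E_def)
  finally show ?case using insert.hyps by simp
qed

lemma poisson_random_measure: "poisson_random_measure L (\<lambda>N. N) \<nu>"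
  unfolding poisson_random_measure_def
proof (intro conjI ballI allI impI)
  show "prob_space L" by (rule prob_space_axioms)
  show "(\<lambda>N. N) \<in> L \<rightarrow>\<^sub>M measure_algebra \<nu>"
    by (simp add: measurable_L_iff)
next
  fix A and k :: nat assume "A \<in> sets \<nu>" "emeasure \<nu> A < \<infinity>"
  from poisson_joint[OF this sets.top]
  show "prob {N \<in> space L. emeasure N A = of_nat k} = exp (- measure \<nu> A) * measure \<nu> A ^ k / fact k"
    by (simp add: space_L prob_space[unfolded space_L])
next
  fix A assume "A \<in> sets \<nu>" "emeasure \<nu> A = \<infinity>"
  then show "AE N in L. emeasure N A = \<infinity>" by (rule AE_infinite)
next
  fix I :: "nat set" and A assume IA: "finite I" "A ` I \<subseteq> sets \<nu>" "disjoint_family_on A I"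
  then have [measurable]: "A i \<in> sets \<nu>" if "i \<in> I" for i using that by auto
  show "indep_vars (\<lambda>_. borel) (\<lambda>i N. emeasure N (A i)) I"
    unfolding indep_vars_def2
  proof (intro conjI ballI indep_setsI)
    fix i assume "i \<in> I"
    then show "random_variable borel (\<lambda>N. emeasure N (A i))"
      "{(\<lambda>N. emeasure N (A i)) -` B \<inter> space L | B. B \<in> sets borel} \<subseteq> events"
      by (auto intro!: measurable_sets[OF measurable_emeasure_L])
  next
    fix F J assume J: "J \<noteq> {}" "J \<subseteq> I" "finite J"
      and F: "\<forall>j\<in>J. F j \<in> {(\<lambda>N. emeasure N (A j)) -` B \<inter> space L | B. B \<in> sets borel}"
    then have "\<forall>j\<in>J. \<exists>B. F j = {N \<in> space L. emeasure N (A j) \<in> B} \<and> B \<in> sets borel"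
      by (fastforce simp: vimage_def)
    then obtain S where S: "\<And>j. j \<in> J \<Longrightarrow> F j = {N \<in> space L. emeasure N (A j) \<in> S j}"
      "\<And>j. j \<in> J \<Longrightarrow> S j \<in> sets borel"
      by metis
    have "(\<Inter>j\<in>J. F j) = {N \<in> space L. \<forall>j\<in>J. emeasure N (A j) \<in> S j}"
      using S(1) J(1) by auto
    moreover have "prob {N \<in> space L. \<forall>j\<in>J. emeasure N (A j) \<in> S j} =
        (\<Prod>j\<in>J. prob {N \<in> space L. emeasure N (A j) \<in> S j})"
      using J IA S by (intro prob_emeasure_family disjoint_family_on_mono[OF _ IA(3)]) auto
    ultimately show "prob (\<Inter>j\<in>J. F j) = (\<Prod>j\<in>J. prob (F j))"
      using S(1) by simp
  qed
qed

end

section \<open>Existence of Poisson random measures\<close>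

lemma null_measure_in_measure_algebra: "null_measure \<nu> \<in> space (measure_algebra \<nu>)"
  by (simp add: space_measure_algebra)

text \<open>The zero intensity is treated apart because it cannot be normalized to a probability law
  for the points.\<close>

lemma mecke_return_null_measure:
  assumes "emeasure \<nu> (space \<nu>) = 0"
  shows "mecke (return (measure_algebra \<nu>) (null_measure \<nu>)) \<nu>"
proof (rule mecke.intro[OF _ mecke_axioms.intro])
  show "prob_space (return (measure_algebra \<nu>) (null_measure \<nu>))"
    by (simp add: prob_space_return null_measure_in_measure_algebra)
next
  fix f :: "'a \<Rightarrow> ennreal" and G :: "'a measure \<Rightarrow> ennreal"
  assume f [measurable]: "f \<in> borel_measurable \<nu>" and G [measurable]: "G \<in> borel_measurable (measure_algebra \<nu>)"
  let ?L = "return (measure_algebra \<nu>) (null_measure \<nu>)"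
  have "AE x in \<nu>. False"
    using assms by (intro AE_I'[of "space \<nu>"]) (auto simp: null_sets_def)
  then have "(\<integral>\<^sup>+x. f x * (\<integral>\<^sup>+N. G (add_point N x) \<partial>?L) \<partial>\<nu>) = (\<integral>\<^sup>+x. 0 \<partial>\<nu>)"
    by (intro nn_integral_cong_AE) auto
  moreover have "(\<integral>\<^sup>+N. (\<integral>\<^sup>+x. f x \<partial>N) * G N \<partial>?L) = (\<integral>\<^sup>+x. f x \<partial>null_measure \<nu>) * G (null_measure \<nu>)"
    by (rule nn_integral_return) (use null_measure_in_measure_algebra in auto)
  ultimately show "(\<integral>\<^sup>+N. (\<integral>\<^sup>+x. f x \<partial>N) * G N \<partial>?L) =
      (\<integral>\<^sup>+x. f x * (\<integral>\<^sup>+N. G (add_point N x) \<partial>?L) \<partial>\<nu>)"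
    by simp
qed simp

section \<open>Finite intensity: a Poisson number of independent points\<close>

text \<open>The binomial point process: the law of a sum of \<open>k\<close> independent Dirac
  masses whose locations have law \<open>q\<close>.\<close>

primrec iid_points :: "'b measure \<Rightarrow> nat \<Rightarrow> 'b measure measure" where
  "iid_points q 0 = return (measure_algebra q) (null_measure q)"
| "iid_points q (Suc k) = distr (q \<Otimes>\<^sub>M iid_points q k) (measure_algebra q) (\<lambda>(x, N). add_point N x)"

lemma sets_iid_points [simp, measurable_cong]: "sets (iid_points q k) = sets (measure_algebra q)"
  by (cases k) simp_all

context prob_space
begin

lemma prob_space_iid_points: "prob_space (iid_points M k)"
proof (induction k)
  case 0
  show ?case
    by (simp add: prob_space_return null_measure_in_measure_algebra)
next
  case (Suc k)
  interpret D: prob_space "iid_points M k" by fact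
  interpret P: pair_prob_space M "iid_points M k" ..
  show ?case by (auto intro!: P.prob_space_distr)
qed

lemma nn_integral_iid_points_Suc:
  assumes [measurable]: "h \<in> borel_measurable (measure_algebra M)"
  shows "(\<integral>\<^sup>+N. h N \<partial>iid_points M (Suc k)) = (\<integral>\<^sup>+x. (\<integral>\<^sup>+N. h (add_point N x) \<partial>iid_points M k) \<partial>M)"
proof -
  interpret D: prob_space "iid_points M k" by (rule prob_space_iid_points)
  have "(\<integral>\<^sup>+N. h N \<partial>iid_points M (Suc k)) = (\<integral>\<^sup>+(x, N). h (add_point N x) \<partial>(M \<Otimes>\<^sub>M iid_points M k))"
    by (simp add: nn_integral_distr split_beta')
  also have "\<dots> = (\<integral>\<^sup>+x. (\<integral>\<^sup>+N. h (add_point N x) \<partial>iid_points M k) \<partial>M)"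
    by (subst D.nn_integral_fst[symmetric]) simp_all
  finally show ?thesis .
qed

text \<open>The Mecke equation for a fixed number of points: any of the \<open>k\<close> points may
  be the marked one, and the other \<open>k - 1\<close> are again independent. For
  \<open>k = 0\<close> the factor \<open>of_nat k\<close> annihilates the integral with the
  truncated index \<open>k - 1\<close>.\<close>

lemma mecke_iid_points:
  fixes f :: "_ \<Rightarrow> ennreal"
  assumes f [measurable]: "f \<in> borel_measurable M" and "G \<in> borel_measurable (measure_algebra M)"
  shows "(\<integral>\<^sup>+N. (\<integral>\<^sup>+x. f x \<partial>N) * G N \<partial>iid_points M k) =
    of_nat k * (\<integral>\<^sup>+x. f x * (\<integral>\<^sup>+N. G (add_point N x) \<partial>iid_points M (k - 1)) \<partial>M)"
  using assms(2)
proof (induction k arbitrary: G)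
  case 0
  have "(\<integral>\<^sup>+N. (\<integral>\<^sup>+x. f x \<partial>N) * G N \<partial>return (measure_algebra M) (null_measure M)) =
      (\<integral>\<^sup>+x. f x \<partial>null_measure M) * G (null_measure M)"
    by (rule nn_integral_return) (use null_measure_in_measure_algebra 0 in auto)
  then show ?case by simp
next
  case (Suc k)
  note [measurable] = Suc.prems
  interpret D: prob_space "iid_points M k" by (rule prob_space_iid_points)
  interpret D': prob_space "iid_points M (k - 1)" by (rule prob_space_iid_points)
  interpret Q: pair_sigma_finite M M ..
  have space_D: "space (iid_points M k) = {N. sets N = sets M}"
    using sets_eq_imp_space_eq[OF sets_iid_points, of M k] by (simp add: space_measure_algebra)
  have "(\<integral>\<^sup>+N. (\<integral>\<^sup>+x. f x \<partial>N) * G N \<partial>iid_points M (Suc k)) =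
      (\<integral>\<^sup>+z. (\<integral>\<^sup>+N. (\<integral>\<^sup>+x. f x \<partial>add_point N z) * G (add_point N z) \<partial>iid_points M k) \<partial>M)"
    by (rule nn_integral_iid_points_Suc) measurable
  also have "\<dots> = (\<integral>\<^sup>+z. (\<integral>\<^sup>+N. (\<integral>\<^sup>+x. f x \<partial>N) * G (add_point N z) + f z * G (add_point N z) \<partial>iid_points M k) \<partial>M)"
    by (intro nn_integral_cong, subst nn_integral_add_point)
      (auto simp: space_D distrib_right cong: measurable_cong_sets dest: sets_eq_imp_space_eq)
  also have "\<dots> = (\<integral>\<^sup>+z. of_nat k * (\<integral>\<^sup>+x. f x * (\<integral>\<^sup>+N. G (add_point (add_point N x) z) \<partial>iid_points M (k - 1)) \<partial>M)
      + f z * (\<integral>\<^sup>+N. G (add_point N z) \<partial>iid_points M k) \<partial>M)"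
    by (intro nn_integral_cong, subst nn_integral_add)
      (simp_all add: Suc.IH nn_integral_cmult)
  also have "\<dots> = of_nat k * (\<integral>\<^sup>+z. (\<integral>\<^sup>+x. f x * (\<integral>\<^sup>+N. G (add_point (add_point N x) z) \<partial>iid_points M (k - 1)) \<partial>M) \<partial>M)
      + (\<integral>\<^sup>+z. f z * (\<integral>\<^sup>+N. G (add_point N z) \<partial>iid_points M k) \<partial>M)"
    by (simp add: nn_integral_add nn_integral_cmult del: One_nat_def)
  \<comment> \<open>The marked point was chosen among the \<open>k\<close> old points; interchanging
    the two insertions makes the new point one of the unmarked ones, which together are
    \<open>iid_points M k\<close> again. The case split avoids truncated subtraction.\<close>
  also have "of_nat k * (\<integral>\<^sup>+z. (\<integral>\<^sup>+x. f x * (\<integral>\<^sup>+N. G (add_point (add_point N x) z) \<partial>iid_points M (k - 1)) \<partial>M) \<partial>M) =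
      of_nat k * (\<integral>\<^sup>+x. f x * (\<integral>\<^sup>+N. G (add_point N x) \<partial>iid_points M k) \<partial>M)"
  proof (cases k)
    case (Suc l)
    have "(\<integral>\<^sup>+z. (\<integral>\<^sup>+x. f x * (\<integral>\<^sup>+N. G (add_point (add_point N x) z) \<partial>iid_points M (k - 1)) \<partial>M) \<partial>M) =
      (\<integral>\<^sup>+x. (\<integral>\<^sup>+z. f x * (\<integral>\<^sup>+N. G (add_point (add_point N x) z) \<partial>iid_points M (k - 1)) \<partial>M) \<partial>M)"
      by (rule Q.Fubini') measurable
    also have "\<dots> = (\<integral>\<^sup>+x. f x * (\<integral>\<^sup>+z. (\<integral>\<^sup>+N. G (add_point (add_point N z) x) \<partial>iid_points M l) \<partial>M) \<partial>M)"
    proof (intro nn_integral_cong)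
      fix x assume [measurable]: "x \<in> space M"
      have "(\<integral>\<^sup>+z. f x * (\<integral>\<^sup>+N. G (add_point (add_point N x) z) \<partial>iid_points M (k - 1)) \<partial>M) =
          (\<integral>\<^sup>+z. f x * (\<integral>\<^sup>+N. G (add_point (add_point N z) x) \<partial>iid_points M (k - 1)) \<partial>M)"
        by (intro nn_integral_cong arg_cong2[where f = "(*)"] refl arg_cong[where f = G] add_point_commute)
      also have "\<dots> = f x * (\<integral>\<^sup>+z. (\<integral>\<^sup>+N. G (add_point (add_point N z) x) \<partial>iid_points M (k - 1)) \<partial>M)"
        by (rule nn_integral_cmult) measurable
      finally show "(\<integral>\<^sup>+z. f x * (\<integral>\<^sup>+N. G (add_point (add_point N x) z) \<partial>iid_points M (k - 1)) \<partial>M) =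
          f x * (\<integral>\<^sup>+z. (\<integral>\<^sup>+N. G (add_point (add_point N z) x) \<partial>iid_points M l) \<partial>M)"
        using Suc by simp
    qed
    also have "\<dots> = (\<integral>\<^sup>+x. f x * (\<integral>\<^sup>+N. G (add_point N x) \<partial>iid_points M (Suc l)) \<partial>M)"
      by (intro nn_integral_cong arg_cong2[where f = "(*)"] refl nn_integral_iid_points_Suc[symmetric])
        measurable
    finally show ?thesis using Suc by simp
  qed simp
  finally show ?case
    by (simp add: distrib_right add.commute)
qed

end

text \<open>A Poisson number, with mean \<open>r = measure \<nu> (space \<nu>)\<close>, of
  independent points of law \<open>\<nu>\<close> divided by \<open>r\<close>. The factor
  \<open>k\<close> from the fixed-number equation cancels against the factorial, which shifts the
  Poisson weight by one and leaves a factor \<open>r\<close>; this factor restores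
  \<open>\<nu>\<close> from the normalized law.\<close>

lemma mecke_exists_finite:
  assumes "finite_measure \<nu>"
  shows "\<exists>L. mecke L \<nu>"
proof (cases "emeasure \<nu> (space \<nu>) = 0")
  case True
  then show ?thesis using mecke_return_null_measure by blast
next
  case False
  interpret finite_measure \<nu> by fact
  define r where "r = measure \<nu> (space \<nu>)"
  have r: "r > 0" "emeasure \<nu> (space \<nu>) = ennreal r"
    using False by (auto simp: r_def emeasure_eq_measure zero_less_measure_iff)
  define q where "q = scale_measure (ennreal (1 / r)) \<nu>"
  have q [measurable_cong, simp]: "sets q = sets \<nu>" by (simp add: q_def)
  have MA: "measure_algebra q = measure_algebra \<nu>" by (rule measure_algebra_cong) simp
  have nu: "(\<integral>\<^sup>+x. h x \<partial>\<nu>) = ennreal r * (\<integral>\<^sup>+x. h x \<partial>q)" if "h \<in> borel_measurable \<nu>" for h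
    using r that by (simp add: q_def nn_integral_scale_measure flip: mult.assoc ennreal_mult)
  interpret q: prob_space q
    by standard (use r in \<open>simp add: q_def space_scale_measure flip: ennreal_mult\<close>)
  define D where "D = iid_points q"
  have sets_D [measurable_cong]: "sets (D k) = sets (measure_algebra \<nu>)" for k
    by (simp add: D_def MA)
  have prob_D: "prob_space (D k)" for k unfolding D_def by (rule q.prob_space_iid_points)
  have D [measurable]: "D \<in> measure_pmf (poisson_pmf r) \<rightarrow>\<^sub>M subprob_algebra (measure_algebra \<nu>)"
    by (auto simp: measurable_def space_subprob_algebra sets_D intro: prob_space_imp_subprob_space prob_D)
  define L where "L = measure_pmf (poisson_pmf r) \<bind> D"
  have L: "(\<integral>\<^sup>+N. h N \<partial>L) = (\<Sum>k. ennreal (r ^ k / fact k * exp (- r)) * (\<integral>\<^sup>+N. h N \<partial>D k))"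
    if [measurable]: "h \<in> borel_measurable (measure_algebra \<nu>)" for h
    unfolding L_def using r
    by (subst nn_integral_bind[OF that D]) (simp add: nn_integral_measure_pmf nn_integral_count_space_nat)
  have "mecke L \<nu>"
  proof (rule mecke.intro[OF _ mecke_axioms.intro])
    show "prob_space L"
      unfolding L_def
      by (rule measure_pmf.prob_space_bind[OF _ D]) (simp add: prob_D)
    show "sets L = sets (measure_algebra \<nu>)"
      unfolding L_def by (rule sets_bind) (auto simp: sets_D)
    fix f :: "'a \<Rightarrow> ennreal" and G :: "'a measure \<Rightarrow> ennreal"
    assume [measurable]: "f \<in> borel_measurable \<nu>" "G \<in> borel_measurable (measure_algebra \<nu>)"
    interpret D: prob_space "D k" for k by (rule prob_D)
    define I where "I k = (\<integral>\<^sup>+x. f x * (\<integral>\<^sup>+N. G (add_point N x) \<partial>D k) \<partial>q)" for k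
    have "(\<integral>\<^sup>+N. (\<integral>\<^sup>+x. f x \<partial>N) * G N \<partial>L) =
        (\<Sum>k. ennreal (r ^ k / fact k * exp (- r)) * (of_nat k * I (k - 1)))"
      unfolding I_def D_def by (subst L) (simp_all add: D_def q.mecke_iid_points MA cong: measurable_cong_sets)
    \<comment> \<open>The term \<open>k = 0\<close> vanishes, so the sum may start at one.\<close>
    also have "\<dots> = (\<Sum>k. ennreal (r ^ Suc k / fact (Suc k) * exp (- r)) * (of_nat (Suc k) * I k))"
      using suminf_offset[of "\<lambda>k. ennreal (r ^ k / fact k * exp (- r)) * (of_nat k * I (k - 1))" 1]
      by (simp del: of_nat_Suc fact_Suc)
    also have "\<dots> = (\<Sum>k. ennreal r * (ennreal (r ^ k / fact k * exp (- r)) * I k))"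
    proof (intro suminf_cong)
      fix k
      have "r ^ Suc k / fact (Suc k) * exp (- r) * real (Suc k) = r * (r ^ k / fact k * exp (- r))"
        by (simp add: field_simps del: of_nat_Suc)
      then show "ennreal (r ^ Suc k / fact (Suc k) * exp (- r)) * (of_nat (Suc k) * I k) =
          ennreal r * (ennreal (r ^ k / fact k * exp (- r)) * I k)"
        using r by (simp only: ennreal_of_nat_eq_real_of_nat mult.assoc[symmetric])
          (simp add: ennreal_mult[symmetric] mult.assoc del: of_nat_Suc fact_Suc)
    qed
    also have "\<dots> = ennreal r * (\<Sum>k. ennreal (r ^ k / fact k * exp (- r)) * I k)"
      by simp
    also have "(\<Sum>k. ennreal (r ^ k / fact k * exp (- r)) * I k) =
        (\<Sum>k. \<integral>\<^sup>+x. ennreal (r ^ k / fact k * exp (- r)) * (f x * (\<integral>\<^sup>+N. G (add_point N x) \<partial>D k)) \<partial>q)"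
      unfolding I_def by (intro suminf_cong nn_integral_cmult[symmetric]) measurable
    also have "\<dots> = (\<integral>\<^sup>+x. (\<Sum>k. ennreal (r ^ k / fact k * exp (- r)) * (f x * (\<integral>\<^sup>+N. G (add_point N x) \<partial>D k))) \<partial>q)"
      by (intro nn_integral_suminf[symmetric]) measurable
    also have "\<dots> = (\<integral>\<^sup>+x. f x * (\<integral>\<^sup>+N. G (add_point N x) \<partial>L) \<partial>q)"
    proof (intro nn_integral_cong)
      fix x assume "x \<in> space q"
      then have [measurable]: "x \<in> space \<nu>" by (simp add: q_def space_scale_measure)
      show "(\<Sum>k. ennreal (r ^ k / fact k * exp (- r)) * (f x * (\<integral>\<^sup>+N. G (add_point N x) \<partial>D k))) =
          f x * (\<integral>\<^sup>+N. G (add_point N x) \<partial>L)"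
        by (subst L) (simp_all add: mult.left_commute[of _ "f x"])
    qed
    also have "ennreal r * \<dots> = (\<integral>\<^sup>+x. f x * (\<integral>\<^sup>+N. G (add_point N x) \<partial>L) \<partial>\<nu>)"
    proof (rule nu[symmetric])
      interpret L: prob_space L by fact
      have [measurable_cong]: "sets L = sets (measure_algebra \<nu>)" by fact
      show "(\<lambda>x. f x * (\<integral>\<^sup>+N. G (add_point N x) \<partial>L)) \<in> borel_measurable \<nu>" by measurable
    qed
    finally show "(\<integral>\<^sup>+N. (\<integral>\<^sup>+x. f x \<partial>N) * G N \<partial>L) = (\<integral>\<^sup>+x. f x * (\<integral>\<^sup>+N. G (add_point N x) \<partial>L) \<partial>\<nu>)" .
  qed
  then show ?thesis ..
qed


section \<open>Sigma-finite intensity: superposition\<close>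

lemma measurable_sum_measure:
  assumes "\<And>i. i \<in> I \<Longrightarrow> (\<lambda>x. F x i) \<in> M \<rightarrow>\<^sub>M measure_algebra K" "countable I"
  shows "(\<lambda>x. sum_measure K (F x) I) \<in> M \<rightarrow>\<^sub>M measure_algebra K"
proof (rule measurable_measure_algebraI)
  fix A assume A: "A \<in> sets K"
  have [measurable]: "(\<lambda>x. emeasure (F x i) A) \<in> borel_measurable M" if "i \<in> I" for i
    by (rule measurable_compose[OF assms(1)[OF that] measurable_emeasure_measure_algebra[OF A]])
  interpret sigma_finite_measure "count_space I"
    by (rule sigma_finite_measure_count_space_countable) fact
  have s: "sets (F x i) = sets K" if "i \<in> I" "x \<in> space M" for i x
    using measurable_space[OF assms(1)[OF that(1)] that(2)] by (simp add: space_measure_algebra)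
  have "(\<lambda>x. emeasure (sum_measure K (F x) I) A) \<in> borel_measurable M \<longleftrightarrow>
      (\<lambda>x. \<integral>\<^sup>+i. emeasure (F x i) A \<partial>count_space I) \<in> borel_measurable M"
    by (intro measurable_cong emeasure_sum_measure s A)
  also have "\<dots>"
  proof (intro borel_measurable_nn_integral)
    show "(\<lambda>(x, i). emeasure (F x i) A) \<in> borel_measurable (M \<Otimes>\<^sub>M count_space I)"
      using measurable_compose[OF measurable_pair_swap'
          measurable_pair_measure_countable1[OF assms(2), of "\<lambda>(i, x). emeasure (F x i) A" M borel]]
      by (simp add: split_beta')
  qed
  finally show "(\<lambda>x. emeasure (sum_measure K (F x) I) A) \<in> borel_measurable M" .
qed simp

text \<open>The space is cut into countably many pieces of finite intensity, and independent
  processes on the pieces are added up. Inserting a point into the \<open>j\<close>-th process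
  inserts it into the sum, so the Mecke equation of each process gives the part of the equation over
  its piece, and summation over \<open>j\<close> gives the whole.\<close>

lemma mecke_exists:
  assumes "sigma_finite_measure \<nu>"
  shows "\<exists>L. mecke L \<nu>"
proof -
  interpret sigma_finite_measure \<nu> by fact
  obtain A :: "nat \<Rightarrow> _" where A: "range A \<subseteq> sets \<nu>" "(\<Union>i. A i) = space \<nu>"
      "\<And>i. emeasure \<nu> (A i) \<noteq> \<infinity>" "disjoint_family A"
    using sigma_finite_disjoint by metis
  have [measurable]: "A i \<in> sets \<nu>" for i using A by auto
  define v where "v j = density \<nu> (indicator (A j))" for j
  have sets_v [simp, measurable_cong]: "sets (v j) = sets \<nu>" for j by (simp add: v_def)
  have space_v: "space (v j) = space \<nu>" for j by (simp add: v_def)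
  have fin_v: "finite_measure (v j)" for j
    using A(3)[of j] by (intro finite_measureI) (simp add: v_def emeasure_density nn_integral_cmult_indicator)
  have "\<exists>L. mecke L (v j)" for j by (rule mecke_exists_finite) (rule fin_v)
  then obtain Lj where Lj: "\<And>j. mecke (Lj j) (v j)" by metis
  have MA: "measure_algebra (v j) = measure_algebra \<nu>" for j by (rule measure_algebra_cong) simp
  interpret Lj: mecke "Lj j" "v j" for j by (rule Lj)
  have sets_Lj [measurable_cong]: "sets (Lj j) = sets (measure_algebra \<nu>)" for j
    using Lj.sets_L[of j] by (simp add: MA)
  have space_Lj: "space (Lj j) = {N. sets N = sets \<nu>}" for j
    using Lj.space_L[of j] by simp
  define \<Omega> where "\<Omega> = (\<Pi>\<^sub>M j\<in>(UNIV :: nat set). Lj j)"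
  interpret \<Omega>: prob_space \<Omega>
    unfolding \<Omega>_def by (rule prob_space_PiM) (rule Lj.prob_space_axioms)
  define S where "S \<omega> = sum_measure \<nu> \<omega> UNIV" for \<omega> :: "nat \<Rightarrow> _"
  have S [measurable]: "S \<in> \<Omega> \<rightarrow>\<^sub>M measure_algebra \<nu>"
    unfolding S_def \<Omega>_def by (rule measurable_sum_measure) auto
  define L where "L = distr \<Omega> (measure_algebra \<nu>) S"
  have L: "(\<integral>\<^sup>+N. h N \<partial>L) = (\<integral>\<^sup>+\<omega>. h (S \<omega>) \<partial>\<Omega>)" if "h \<in> borel_measurable (measure_algebra \<nu>)" for h
    unfolding L_def by (rule nn_integral_distr) (use that in auto)
  have "mecke L \<nu>"
  proof (rule mecke.intro[OF _ mecke_axioms.intro])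
    show "prob_space L" unfolding L_def by (rule \<Omega>.prob_space_distr) measurable
    show [measurable_cong]: "sets L = sets (measure_algebra \<nu>)" unfolding L_def by simp
    interpret L: prob_space L by fact
    fix f :: "'a \<Rightarrow> ennreal" and G :: "'a measure \<Rightarrow> ennreal"
    assume f [measurable]: "f \<in> borel_measurable \<nu>" and G [measurable]: "G \<in> borel_measurable (measure_algebra \<nu>)"
    have mc [measurable]: "(\<lambda>\<omega>. \<omega> j) \<in> \<Omega> \<rightarrow>\<^sub>M measure_algebra \<nu>" for j unfolding \<Omega>_def
      by (subst measurable_cong_sets[OF refl sets_Lj[of j, symmetric]]) (rule measurable_component_singleton, simp)
    \<comment> \<open>The other processes are held fixed, and the Mecke equation is applied in
      coordinate \<open>j\<close> alone.\<close>
    have part: "(\<integral>\<^sup>+\<omega>. (\<integral>\<^sup>+x. f x \<partial>\<omega> j) * G (S \<omega>) \<partial>\<Omega>) =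
        (\<integral>\<^sup>+x. f x * (\<integral>\<^sup>+N. G (add_point N x) \<partial>L) \<partial>v j)" for j
    proof -
      define R where "R = (\<Pi>\<^sub>M i\<in>UNIV - {j}. Lj i)"
      interpret R: prob_space R
        unfolding R_def by (rule prob_space_PiM) (rule Lj.prob_space_axioms)
      interpret P: pair_prob_space "Lj j" R ..
      interpret v: finite_measure "v j" by (rule fin_v)
      interpret vR: pair_sigma_finite "v j" R ..
      have upd [measurable]: "(\<lambda>(N, X). X(j := N)) \<in> Lj j \<Otimes>\<^sub>M R \<rightarrow>\<^sub>M \<Omega>"
        unfolding \<Omega>_def R_def split_beta'
        by (rule measurable_fun_upd[where J = "UNIV - {j}"]) auto
      have split: "(\<integral>\<^sup>+\<omega>. h \<omega> \<partial>\<Omega>) = (\<integral>\<^sup>+X. (\<integral>\<^sup>+N. h (X(j := N)) \<partial>Lj j) \<partial>R)"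
        if [measurable]: "h \<in> borel_measurable \<Omega>" for h :: "_ \<Rightarrow> ennreal"
      proof -
        have "\<Omega> = distr (Lj j \<Otimes>\<^sub>M R) \<Omega> (\<lambda>(N, X). X(j := N))"
          using distr_pair_PiM_eq_PiM[of "UNIV - {j}" Lj j] Lj.prob_space_axioms
          by (simp add: \<Omega>_def R_def insert_absorb)
        then have "(\<integral>\<^sup>+\<omega>. h \<omega> \<partial>\<Omega>) = (\<integral>\<^sup>+\<omega>. h \<omega> \<partial>distr (Lj j \<Otimes>\<^sub>M R) \<Omega> (\<lambda>(N, X). X(j := N)))"
          by simp
        also have "\<dots> = (\<integral>\<^sup>+(N, X). h (X(j := N)) \<partial>(Lj j \<Otimes>\<^sub>M R))"
          by (subst nn_integral_distr) (simp_all add: split_beta')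
        also have "\<dots> = (\<integral>\<^sup>+X. (\<integral>\<^sup>+N. h (X(j := N)) \<partial>Lj j) \<partial>R)"
          by (subst P.nn_integral_snd[symmetric]) simp_all
        finally show ?thesis .
      qed
      have spR: "sets (X i) = sets \<nu>" if "X \<in> space R" "i \<noteq> j" for X i
        using that by (auto simp: R_def space_PiM PiE_iff space_Lj)
      have S_add: "S (X(j := add_point N x)) = add_point (S (X(j := N))) x"
        if X: "X \<in> space R" and N: "sets N = sets \<nu>" for X N x
      proof (rule measure_eqI)
        fix A assume "A \<in> sets (S (X(j := add_point N x)))"
        then have A: "A \<in> sets \<nu>" by (simp add: S_def)
        have "emeasure (S (X(j := add_point N x))) A =
            (\<integral>\<^sup>+i. emeasure ((X(j := N)) i) A + indicator A x * indicator {j} i \<partial>count_space UNIV)"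
          unfolding S_def using X N A spR
          by (subst emeasure_sum_measure) (auto intro!: nn_integral_cong simp: emeasure_add_point)
        also have "\<dots> = (\<integral>\<^sup>+i. emeasure ((X(j := N)) i) A \<partial>count_space UNIV) + indicator A x"
          by (simp add: nn_integral_add nn_integral_cmult_indicator)
        also have "\<dots> = emeasure (add_point (S (X(j := N))) x) A"
          using X N A spR by (simp add: emeasure_add_point S_def emeasure_sum_measure)
        finally show "emeasure (S (X(j := add_point N x))) A = emeasure (add_point (S (X(j := N))) x) A" .
      qed (simp add: S_def)
      have "(\<integral>\<^sup>+\<omega>. (\<integral>\<^sup>+x. f x \<partial>\<omega> j) * G (S \<omega>) \<partial>\<Omega>) =
          (\<integral>\<^sup>+X. (\<integral>\<^sup>+N. (\<integral>\<^sup>+x. f x \<partial>N) * G (S (X(j := N))) \<partial>Lj j) \<partial>R)"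
        by (subst split) simp_all
      also have "\<dots> = (\<integral>\<^sup>+X. (\<integral>\<^sup>+x. f x * (\<integral>\<^sup>+N. G (add_point (S (X(j := N))) x) \<partial>Lj j) \<partial>v j) \<partial>R)"
      proof (intro nn_integral_cong)
        fix X assume X: "X \<in> space R"
        have [measurable]: "(\<lambda>N. X(j := N)) \<in> Lj j \<rightarrow>\<^sub>M \<Omega>"
          using measurable_compose[OF measurable_Pair2'[OF X] upd] by simp
        have "(\<integral>\<^sup>+N. (\<integral>\<^sup>+x. f x \<partial>N) * G (S (X(j := N))) \<partial>Lj j) =
            (\<integral>\<^sup>+x. f x * (\<integral>\<^sup>+N. G (S (X(j := add_point N x))) \<partial>Lj j) \<partial>v j)"
        proof (rule Lj.mecke)
          have "(\<lambda>N. G (S (X(j := N)))) \<in> borel_measurable (Lj j)" by measurable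
          then show "(\<lambda>N. G (S (X(j := N)))) \<in> borel_measurable (measure_algebra (v j))"
            by (simp add: Lj.measurable_L_iff)
        qed simp
        also have "\<dots> = (\<integral>\<^sup>+x. f x * (\<integral>\<^sup>+N. G (add_point (S (X(j := N))) x) \<partial>Lj j) \<partial>v j)"
          using X by (intro nn_integral_cong arg_cong2[where f = "(*)"] refl)
            (simp add: S_add space_Lj)
        finally show "(\<integral>\<^sup>+N. (\<integral>\<^sup>+x. f x \<partial>N) * G (S (X(j := N))) \<partial>Lj j) =
            (\<integral>\<^sup>+x. f x * (\<integral>\<^sup>+N. G (add_point (S (X(j := N))) x) \<partial>Lj j) \<partial>v j)" .
      qed
      also have "\<dots> = (\<integral>\<^sup>+x. (\<integral>\<^sup>+X. f x * (\<integral>\<^sup>+N. G (add_point (S (X(j := N))) x) \<partial>Lj j) \<partial>R) \<partial>v j)"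
        by (rule vR.Fubini') measurable
      also have "\<dots> = (\<integral>\<^sup>+x. f x * (\<integral>\<^sup>+X. (\<integral>\<^sup>+N. G (add_point (S (X(j := N))) x) \<partial>Lj j) \<partial>R) \<partial>v j)"
        by (intro nn_integral_cong nn_integral_cmult) (simp add: space_v)
      also have "\<dots> = (\<integral>\<^sup>+x. f x * (\<integral>\<^sup>+N. G (add_point N x) \<partial>L) \<partial>v j)"
      proof (intro nn_integral_cong arg_cong2[where f = "(*)"] refl)
        fix x assume "x \<in> space (v j)"
        then have [measurable]: "x \<in> space \<nu>" by (simp add: v_def)
        show "(\<integral>\<^sup>+X. (\<integral>\<^sup>+N. G (add_point (S (X(j := N))) x) \<partial>Lj j) \<partial>R) = (\<integral>\<^sup>+N. G (add_point N x) \<partial>L)"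
          by (subst L, measurable, subst split, measurable)
      qed
      finally show ?thesis .
    qed
    have sp\<Omega>: "sets (\<omega> i) = sets \<nu>" if "\<omega> \<in> space \<Omega>" for \<omega> i
      using that by (auto simp: \<Omega>_def space_PiM PiE_iff space_Lj)
    have "(\<integral>\<^sup>+N. (\<integral>\<^sup>+x. f x \<partial>N) * G N \<partial>L) = (\<integral>\<^sup>+\<omega>. (\<integral>\<^sup>+x. f x \<partial>S \<omega>) * G (S \<omega>) \<partial>\<Omega>)"
      by (rule L) measurable
    also have "\<dots> = (\<integral>\<^sup>+\<omega>. (\<Sum>j. (\<integral>\<^sup>+x. f x \<partial>\<omega> j) * G (S \<omega>)) \<partial>\<Omega>)"
      by (intro nn_integral_cong)
        (simp add: S_def nn_integral_sum_measure sp\<Omega> nn_integral_count_space_nat)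
    also have "\<dots> = (\<Sum>j. \<integral>\<^sup>+\<omega>. (\<integral>\<^sup>+x. f x \<partial>\<omega> j) * G (S \<omega>) \<partial>\<Omega>)"
      by (rule nn_integral_suminf) measurable
    also have "\<dots> = (\<Sum>j. \<integral>\<^sup>+x. f x * (\<integral>\<^sup>+N. G (add_point N x) \<partial>L) \<partial>v j)"
      by (simp only: part)
    also have "\<dots> = (\<Sum>j. \<integral>\<^sup>+x. indicator (A j) x * (f x * (\<integral>\<^sup>+N. G (add_point N x) \<partial>L)) \<partial>\<nu>)"
      unfolding v_def by (intro suminf_cong nn_integral_density) measurable
    also have "\<dots> = (\<integral>\<^sup>+x. (\<Sum>j. indicator (A j) x * (f x * (\<integral>\<^sup>+N. G (add_point N x) \<partial>L))) \<partial>\<nu>)"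
      by (rule nn_integral_suminf[symmetric]) measurable
    also have "\<dots> = (\<integral>\<^sup>+x. f x * (\<integral>\<^sup>+N. G (add_point N x) \<partial>L) \<partial>\<nu>)"
    proof (intro nn_integral_cong)
      fix x assume "x \<in> space \<nu>"
      \<comment> \<open>Each \<open>x\<close> lies in exactly one piece.\<close>
      then have "(\<Sum>j. indicator (A j) x :: ennreal) = 1"
        using A(2,4) by (subst suminf_indicator) auto
      then show "(\<Sum>j. indicator (A j) x * (f x * (\<integral>\<^sup>+N. G (add_point N x) \<partial>L))) =
          f x * (\<integral>\<^sup>+N. G (add_point N x) \<partial>L)" by simp
    qed
    finally show "(\<integral>\<^sup>+N. (\<integral>\<^sup>+x. f x \<partial>N) * G N \<partial>L) = (\<integral>\<^sup>+x. f x * (\<integral>\<^sup>+N. G (add_point N x) \<partial>L) \<partial>\<nu>)" .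
  qed
  then show ?thesis ..
qed

section \<open>Uniqueness of the Poisson law\<close>

text \<open>For finite intensity, \<open>poisson_random_measure\<close> prescribes only the
  probabilities of the values \<open>of_nat k\<close>. As these sum to one, no mass is left for
  other values, and the law of the count is determined on all Borel sets.\<close>

lemma poisson_random_measure_prob:
  assumes "poisson_random_measure L (\<lambda>N. N) \<nu>" and A: "A \<in> sets \<nu>" and S: "S \<in> sets borel"
  shows "measure L {N \<in> space L. emeasure N A \<in> S} =
    (if emeasure \<nu> A = \<infinity> then indicator S \<infinity>
     else \<Sum>k. indicator S (of_nat k) * (exp (- measure \<nu> A) * measure \<nu> A ^ k / fact k))"
proof -
  note prm = assms(1)[unfolded poisson_random_measure_def]
  interpret prob_space L using prm by blast
  have NA [measurable]: "(\<lambda>N. emeasure N A) \<in> borel_measurable L"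
    using prm measurable_compose[OF _ measurable_emeasure_measure_algebra[OF A]] by blast
  have ev [measurable]: "{N \<in> space L. emeasure N A \<in> S'} \<in> events" if "S' \<in> sets borel" for S'
    using measurable_sets[OF NA that] by (simp add: vimage_def Int_def conj_commute)
  show ?thesis
  proof (cases "emeasure \<nu> A = \<infinity>")
    case True
    have "AE N in L. emeasure N A = \<infinity>" using prm A True by blast
    then have "prob {N \<in> space L. emeasure N A \<in> S} = prob (if \<infinity> \<in> S then space L else {})"
      by (intro measure_eq_AE) (use ev[OF S] in auto)
    then show ?thesis using True by (simp add: prob_space)
  next
    case False
    define q where "q k = exp (- measure \<nu> A) * measure \<nu> A ^ k / fact k" for k :: nat
    have q: "prob {N \<in> space L. emeasure N A = of_nat k} = q k" for k
      using prm A False by (auto simp: q_def less_top)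
    have "q sums (exp (- measure \<nu> A) * exp (measure \<nu> A))"
      unfolding q_def using sums_mult[OF exp_converges[of "measure \<nu> A"], of "exp (- measure \<nu> A)"]
      by (simp add: divide_inverse mult_ac)
    then have q1: "q sums 1" by (simp flip: exp_add)
    have e: "{N \<in> space L. emeasure N A = of_nat k} \<in> events" for k :: nat
      using ev[of "{of_nat k}"] by simp
    have "(\<lambda>k. prob {N \<in> space L. emeasure N A = of_nat k}) sums
        prob (\<Union>k. {N \<in> space L. emeasure N A = of_nat k})"
      by (intro finite_measure_UNION) (auto simp: disjoint_family_on_def e)
    with q1 have "prob (\<Union>k. {N \<in> space L. emeasure N A = of_nat k}) = 1"
      unfolding q by (rule sums_unique2[symmetric])
    then have ae: "AE N in L. N \<in> (\<Union>k. {N \<in> space L. emeasure N A = of_nat k})"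
      by (intro AE_prob_1)
    define X where "X k = (if of_nat k \<in> S then {N \<in> space L. emeasure N A = of_nat k} else {})" for k :: nat
    have X: "X k \<in> events" for k by (auto simp: X_def e)
    have "(\<lambda>k. prob (X k)) sums prob (\<Union>k. X k)"
      using X by (intro finite_measure_UNION) (auto simp: X_def disjoint_family_on_def)
    also have "(\<lambda>k. prob (X k)) = (\<lambda>k. indicator S (of_nat k) * q k)"
      by (auto simp: X_def q fun_eq_iff)
    also have "prob (\<Union>k. X k) = prob {N \<in> space L. emeasure N A \<in> S}"
    proof (rule measure_eq_AE)
      show "AE N in L. N \<in> (\<Union>k. X k) \<longleftrightarrow> N \<in> {N \<in> space L. emeasure N A \<in> S}"
        using ae by eventually_elim (auto simp: X_def split: if_splits)
    qed (use X ev[OF S] in auto)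
    finally show ?thesis using False by (simp add: q_def sums_iff)
  qed
qed

section \<open>Cylinders as a generating system\<close>

text \<open>Finite-dimensional cylinders over arbitrary, possibly overlapping sets; allowing
  overlaps makes the family closed under intersection.\<close>

definition measure_algebra_cylinders :: "'b measure \<Rightarrow> 'b measure set set" where
  "measure_algebra_cylinders K =
     {{N. sets N = sets K \<and> (\<forall>A\<in>J. emeasure N A \<in> S A)} | J S.
        finite J \<and> J \<subseteq> sets K \<and> (\<forall>A\<in>J. S A \<in> sets borel)}"

lemma Int_stable_measure_algebra_cylinders: "Int_stable (measure_algebra_cylinders K)"
  unfolding Int_stable_def
proof (intro ballI)
  fix X Y assume "X \<in> measure_algebra_cylinders K" "Y \<in> measure_algebra_cylinders K"
  then obtain J S J' S' where
    X: "X = {N. sets N = sets K \<and> (\<forall>A\<in>J. emeasure N A \<in> S A)}" "finite J" "J \<subseteq> sets K"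
      "\<forall>A\<in>J. S A \<in> sets borel" and
    Y: "Y = {N. sets N = sets K \<and> (\<forall>A\<in>J'. emeasure N A \<in> S' A)}" "finite J'" "J' \<subseteq> sets K"
      "\<forall>A\<in>J'. S' A \<in> sets borel"
    unfolding measure_algebra_cylinders_def by auto
  define S'' where "S'' A = (if A \<in> J then S A else UNIV) \<inter> (if A \<in> J' then S' A else UNIV)" for A
  have "X \<inter> Y = {N. sets N = sets K \<and> (\<forall>A\<in>J \<union> J'. emeasure N A \<in> S'' A)}"
    unfolding X Y by (auto simp: S''_def)
  moreover have "finite (J \<union> J') \<and> J \<union> J' \<subseteq> sets K \<and> (\<forall>A\<in>J \<union> J'. S'' A \<in> sets borel)"
    using X Y by (auto simp: S''_def)
  ultimately show "X \<inter> Y \<in> measure_algebra_cylinders K"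
    unfolding measure_algebra_cylinders_def by blast
qed

text \<open>Preimages under a single evaluation are cylinders over one set, and conversely a
  cylinder is a finite intersection of such preimages.\<close>

lemma sets_measure_algebra_eq_sigma_sets:
  "sets (measure_algebra K) = sigma_sets {N. sets N = sets K} (measure_algebra_cylinders K)"
proof
  let ?\<Omega> = "{N. sets N = sets K}"
  have sub: "measure_algebra_cylinders K \<subseteq> Pow ?\<Omega>"
    by (auto simp: measure_algebra_cylinders_def)
  have "(\<lambda>N. N) \<in> sigma ?\<Omega> (measure_algebra_cylinders K) \<rightarrow>\<^sub>M measure_algebra K"
  proof (rule measurable_measure_algebraI)
    fix A assume A: "A \<in> sets K"
    show "(\<lambda>N. emeasure N A) \<in> borel_measurable (sigma ?\<Omega> (measure_algebra_cylinders K))"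
    proof (rule measurableI)
      fix S :: "ennreal set" assume "S \<in> sets borel"
      then have cyl: "{N. sets N = sets K \<and> (\<forall>A\<in>{A}. emeasure N A \<in> S)} \<in> measure_algebra_cylinders K"
        unfolding measure_algebra_cylinders_def using A
        by (intro CollectI exI[of _ "{A}"] exI[of _ "\<lambda>_. S"]) auto
      have "(\<lambda>N. emeasure N A) -` S \<inter> space (sigma ?\<Omega> (measure_algebra_cylinders K)) =
          {N. sets N = sets K \<and> (\<forall>A\<in>{A}. emeasure N A \<in> S)}"
        using sub by (auto simp: space_measure_of)
      with cyl show "(\<lambda>N. emeasure N A) -` S \<inter> space (sigma ?\<Omega> (measure_algebra_cylinders K))
          \<in> sets (sigma ?\<Omega> (measure_algebra_cylinders K))"
        using sub by (simp add: sets_measure_of sigma_sets.Basic)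
    qed simp
  qed (use sub in \<open>simp add: space_measure_of\<close>)
  note id = this
  show "sets (measure_algebra K) \<subseteq> sigma_sets ?\<Omega> (measure_algebra_cylinders K)"
  proof
    fix X assume X: "X \<in> sets (measure_algebra K)"
    then have "X \<inter> ?\<Omega> = X"
      using sets.sets_into_space[OF X] by (auto simp: space_measure_algebra)
    with measurable_sets[OF id X] sub show "X \<in> sigma_sets ?\<Omega> (measure_algebra_cylinders K)"
      by (simp add: sets_measure_of space_measure_of)
  qed
next
  show "sigma_sets {N. sets N = sets K} (measure_algebra_cylinders K) \<subseteq> sets (measure_algebra K)"
  proof -
    have "measure_algebra_cylinders K \<subseteq> sets (measure_algebra K)"
    proof
      fix X assume "X \<in> measure_algebra_cylinders K"
      then obtain J S where
        X: "X = {N. sets N = sets K \<and> (\<forall>A\<in>J. emeasure N A \<in> S A)}" "finite J" "J \<subseteq> sets K"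
          "\<forall>A\<in>J. S A \<in> sets borel"
        unfolding measure_algebra_cylinders_def by auto
      have "{N \<in> space (measure_algebra K). \<forall>A\<in>J. emeasure N A \<in> S A} \<in> sets (measure_algebra K)"
      proof (rule sets.sets_Collect_finite_All[OF _ X(2)])
        fix A assume "A \<in> J"
        then show "{N \<in> space (measure_algebra K). emeasure N A \<in> S A} \<in> sets (measure_algebra K)"
          using X measurable_sets[OF measurable_emeasure_measure_algebra, of A K "S A"]
          by (simp add: vimage_def Int_def conj_commute subset_eq)
      qed
      then show "X \<in> sets (measure_algebra K)"
        by (simp add: X(1) space_measure_algebra)
    qed
    from sets.sigma_sets_subset[OF this] show ?thesis by (simp add: space_measure_algebra)
  qed
qed

text \<open>Independence is only given for disjoint sets, so the sets in \<open>J\<close> are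
  refined to the atoms of the finite algebra they generate. Each \<open>emeasure N A\<close> is a
  sum over atoms, the counts of the atoms are independent with laws fixed by \<open>\<nu>\<close>,
  and so the joint law of the original counts is fixed as well.\<close>

lemma poisson_random_measure_cylinder_eq:
  assumes L: "poisson_random_measure L (\<lambda>N. N) \<nu>" "sets L = sets (measure_algebra \<nu>)"
    and L': "poisson_random_measure L' (\<lambda>N. N) \<nu>" "sets L' = sets (measure_algebra \<nu>)"
    and J: "finite J" "J \<subseteq> sets \<nu>" "\<And>A. A \<in> J \<Longrightarrow> S A \<in> sets borel"
  shows "emeasure L {N. sets N = sets \<nu> \<and> (\<forall>A\<in>J. emeasure N A \<in> S A)} =
    emeasure L' {N. sets N = sets \<nu> \<and> (\<forall>A\<in>J. emeasure N A \<in> S A)}"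
proof -
  define atom where "atom U = {x \<in> space \<nu>. \<forall>A\<in>J. x \<in> A \<longleftrightarrow> A \<in> U}" for U
  have atom: "atom U \<in> sets \<nu>" for U
    unfolding atom_def using J
    by (intro sets.sets_Collect_finite_All sets.sets_Collect_imp) auto
  \<comment> \<open>The atoms are numbered because \<open>poisson_random_measure\<close> states
    independence for families indexed by natural numbers.\<close>
  obtain e :: "nat \<Rightarrow> 'a set set" where e: "bij_betw e {0..<card (Pow J)} (Pow J)"
    using ex_bij_betw_nat_finite[of "Pow J"] J by auto
  define I where "I = {0..<card (Pow J)}"
  have e_inj: "inj_on e I" and e_im: "e ` I = Pow J"
    using e unfolding I_def bij_betw_def by blast+
  have disj: "disjoint_family_on (\<lambda>i. atom (e i)) I"
    unfolding disjoint_family_on_def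
  proof (intro ballI impI)
    fix i j assume ij: "i \<in> I" "j \<in> I" "i \<noteq> j"
    have "e i \<noteq> e j" using inj_onD[OF e_inj] ij by blast
    moreover have "e i \<subseteq> J" "e j \<subseteq> J" using e_im ij by blast+
    ultimately show "atom (e i) \<inter> atom (e j) = {}" unfolding atom_def by blast
  qed
  have sum: "emeasure N A = (\<Sum>i\<in>{i \<in> I. A \<in> e i}. emeasure N (atom (e i)))"
    if "sets N = sets \<nu>" "A \<in> J" for N A
  proof -
    have "A = (\<Union>i\<in>{i \<in> I. A \<in> e i}. atom (e i))"
    proof (intro equalityI subsetI)
      fix x assume x: "x \<in> A"
      \<comment> \<open>The atom of \<open>x\<close> is indexed by the set of those members of
        \<open>J\<close> that contain \<open>x\<close>.\<close>
      have "{B \<in> J. x \<in> B} \<in> Pow J" by auto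
      then obtain i where "i \<in> I" "e i = {B \<in> J. x \<in> B}"
        using e_im by (metis (no_types, lifting) imageE)
      with x that sets.sets_into_space[of A \<nu>] J show "x \<in> (\<Union>i\<in>{i \<in> I. A \<in> e i}. atom (e i))"
        by (auto simp: atom_def intro!: bexI[of _ i])
    qed (use that in \<open>auto simp: atom_def\<close>)
    then have "emeasure N A = emeasure N (\<Union>i\<in>{i \<in> I. A \<in> e i}. atom (e i))" by simp
    also have "\<dots> = (\<Sum>i\<in>{i \<in> I. A \<in> e i}. emeasure N (atom (e i)))"
      by (rule sum_emeasure[symmetric])
        (use that(1) atom in \<open>auto simp: I_def intro!: disjoint_family_on_mono[OF _ disj[unfolded I_def]]\<close>)
    finally show ?thesis .
  qed
  define V where "V = {v \<in> space (\<Pi>\<^sub>M i\<in>I. (borel :: ennreal measure)).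
     \<forall>A\<in>J. (\<Sum>i\<in>{i \<in> I. A \<in> e i}. v i) \<in> S A}"
  have V: "V \<in> sets (\<Pi>\<^sub>M i\<in>I. borel)"
    unfolding V_def
  proof (rule sets.sets_Collect_finite_All[OF _ J(1)])
    fix A assume A: "A \<in> J"
    have "(\<lambda>v. \<Sum>i\<in>{i \<in> I. A \<in> e i}. v i) \<in> borel_measurable (\<Pi>\<^sub>M i\<in>I. (borel :: ennreal measure))"
      by (intro borel_measurable_sum measurable_component_singleton) simp
    from measurable_sets[OF this J(3)[OF A]]
    show "{v \<in> space (\<Pi>\<^sub>M i\<in>I. borel). (\<Sum>i\<in>{i \<in> I. A \<in> e i}. v i) \<in> S A} \<in> sets (\<Pi>\<^sub>M i\<in>I. borel)"
      by (simp add: vimage_def Int_def conj_commute)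
  qed
  define D where "D M = (\<Pi>\<^sub>M i\<in>I. distr M borel (\<lambda>N. emeasure N (atom (e i))))" for M :: "'a measure measure"
  have law: "emeasure M {N. sets N = sets \<nu> \<and> (\<forall>A\<in>J. emeasure N A \<in> S A)} = emeasure (D M) V"
    if prm: "poisson_random_measure M (\<lambda>N. N) \<nu>" and sM: "sets M = sets (measure_algebra \<nu>)" for M
  proof -
    interpret prob_space M using prm by (simp add: poisson_random_measure_def)
    have sp: "space M = {N. sets N = sets \<nu>}"
      using sets_eq_imp_space_eq[OF sM] by (simp add: space_measure_algebra)
    have m [measurable]: "(\<lambda>N. emeasure N (atom (e i))) \<in> borel_measurable M" for i
      using measurable_emeasure_measure_algebra[OF atom] by (simp add: measurable_cong_sets[OF sM refl])
    have "\<forall>(I::nat set) A. finite I \<longrightarrow> A ` I \<subseteq> sets \<nu> \<longrightarrow> disjoint_family_on A I \<longrightarrow>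
        indep_vars (\<lambda>_. borel) (\<lambda>i N. emeasure N (A i)) I"
      using prm unfolding poisson_random_measure_def by (elim conjE)
    from this[rule_format, of I "\<lambda>i. atom (e i)"]
    have "indep_vars (\<lambda>_. borel) (\<lambda>i N. emeasure N (atom (e i))) I"
      using disj atom by (simp add: I_def image_subset_iff)
    moreover have "I \<noteq> {}" using e_im by blast
    ultimately have D: "distr M (\<Pi>\<^sub>M i\<in>I. borel) (\<lambda>N. \<lambda>i\<in>I. emeasure N (atom (e i))) = D M"
      unfolding D_def using indep_vars_iff_distr_eq_PiM'[where I = I and M' = "\<lambda>_. borel"
          and X = "\<lambda>i N. emeasure N (atom (e i))"] m by blast
    have "{N. sets N = sets \<nu> \<and> (\<forall>A\<in>J. emeasure N A \<in> S A)} =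
        (\<lambda>N. \<lambda>i\<in>I. emeasure N (atom (e i))) -` V \<inter> space M"
    proof -
      have "(\<lambda>i\<in>I. emeasure N (atom (e i))) \<in> V \<longleftrightarrow> (\<forall>A\<in>J. emeasure N A \<in> S A)" if "sets N = sets \<nu>" for N
      proof -
        have "(\<Sum>i\<in>{i \<in> I. A \<in> e i}. (\<lambda>i\<in>I. emeasure N (atom (e i))) i) = emeasure N A" if "A \<in> J" for A
          by (subst sum[OF \<open>sets N = sets \<nu>\<close> that]) (rule sum.cong, simp_all)
        then show ?thesis by (simp add: V_def space_PiM)
      qed
      then show ?thesis by (auto simp: sp)
    qed
    then show ?thesis
      using V by (simp add: D[symmetric] emeasure_distr)
  qed
  have "distr L borel (\<lambda>N. emeasure N (atom (e i))) = distr L' borel (\<lambda>N. emeasure N (atom (e i)))" for i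
  proof (rule measure_eqI)
    fix T assume "T \<in> sets (distr L borel (\<lambda>N. emeasure N (atom (e i))))"
    then have T: "T \<in> sets borel" by simp
    have *: "emeasure (distr M borel (\<lambda>N. emeasure N (atom (e i)))) T =
        ennreal (measure M {N \<in> space M. emeasure N (atom (e i)) \<in> T})"
      if prm: "poisson_random_measure M (\<lambda>N. N) \<nu>" and sM: "sets M = sets (measure_algebra \<nu>)" for M
    proof -
      interpret prob_space M using prm by (simp add: poisson_random_measure_def)
      have m [measurable]: "(\<lambda>N. emeasure N (atom (e i))) \<in> borel_measurable M" for i
        using measurable_emeasure_measure_algebra[OF atom] by (simp add: measurable_cong_sets[OF sM refl])
      show ?thesis using T
        by (simp add: emeasure_distr emeasure_eq_measure vimage_def Int_def conj_commute)
    qed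
    show "emeasure (distr L borel (\<lambda>N. emeasure N (atom (e i)))) T =
        emeasure (distr L' borel (\<lambda>N. emeasure N (atom (e i)))) T"
      unfolding *[OF L] *[OF L'] poisson_random_measure_prob[OF L(1) atom T]
        poisson_random_measure_prob[OF L'(1) atom T] ..
  qed simp
  then have "D L = D L'" unfolding D_def by simp
  then show ?thesis using law[OF L] law[OF L'] by simp
qed

lemma poisson_random_measure_unique:
  assumes L: "poisson_random_measure L (\<lambda>N. N) \<nu>" "sets L = sets (measure_algebra \<nu>)"
    and L': "poisson_random_measure L' (\<lambda>N. N) \<nu>" "sets L' = sets (measure_algebra \<nu>)"
  shows "L = L'"
proof (rule measure_eqI_generator_eq[OF Int_stable_measure_algebra_cylinders])
  show "measure_algebra_cylinders \<nu> \<subseteq> Pow {N. sets N = sets \<nu>}"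
    by (auto simp: measure_algebra_cylinders_def)
  show "sets L = sigma_sets {N. sets N = sets \<nu>} (measure_algebra_cylinders \<nu>)"
    "sets L' = sigma_sets {N. sets N = sets \<nu>} (measure_algebra_cylinders \<nu>)"
    using L L' by (simp_all add: sets_measure_algebra_eq_sigma_sets)
  fix X assume "X \<in> measure_algebra_cylinders \<nu>"
  then show "emeasure L X = emeasure L' X"
    using poisson_random_measure_cylinder_eq[OF L L']
    by (auto simp: measure_algebra_cylinders_def)
next
  \<comment> \<open>The whole space is the cylinder over the empty family; having finite mass, it
    serves as a constant exhausting sequence.\<close>
  have "{N. sets N = sets \<nu> \<and> (\<forall>A\<in>{}. emeasure N A \<in> undefined A)} \<in> measure_algebra_cylinders \<nu>"
    unfolding measure_algebra_cylinders_def by (intro CollectI exI conjI) auto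
  then show "range (\<lambda>i::nat. {N. sets N = sets \<nu>}) \<subseteq> measure_algebra_cylinders \<nu>"
    by auto
  interpret prob_space L using L by (simp add: poisson_random_measure_def)
  show "emeasure L {N. sets N = sets \<nu>} \<noteq> \<infinity>" by simp
qed auto

text \<open>Uniqueness identifies the definite description with the law constructed above, and so
  carries the Mecke equation over to \<open>PRM_law\<close>.\<close>

lemma mecke_PRM_law:
  assumes "sigma_finite_measure \<nu>"
  shows "mecke (PRM_law \<nu>) \<nu>"
proof -
  obtain L where L: "mecke L \<nu>" using mecke_exists[OF assms] ..
  interpret mecke L \<nu> by fact
  have "PRM_law \<nu> = L"
    unfolding PRM_law_def
    by (rule the_equality) (use sets_L poisson_random_measure poisson_random_measure_unique in auto)
  with L show ?thesis by simp
qed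

section \<open>Ratios of gamma variables\<close>

text \<open>The linear change of variables for Lebesgue measure in \<open>card I\<close> dimensions,
  obtained by comparing the two measures on boxes.\<close>

lemma nn_integral_PiM_lborel_scale:
  fixes f :: "('i \<Rightarrow> real) \<Rightarrow> ennreal"
  assumes "finite I" and c: "c > 0" and f: "f \<in> borel_measurable (\<Pi>\<^sub>M i\<in>I. lborel)"
  shows "(\<integral>\<^sup>+x. f x \<partial>(\<Pi>\<^sub>M i\<in>I. lborel)) =
    ennreal (c ^ card I) * (\<integral>\<^sup>+x. f (\<lambda>i\<in>I. c * x i) \<partial>(\<Pi>\<^sub>M i\<in>I. lborel))"
proof -
  interpret product_sigma_finite "\<lambda>i::'i. lborel :: real measure" ..
  let ?P = "\<Pi>\<^sub>M i\<in>I. (lborel :: real measure)"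
  let ?h = "\<lambda>x::'i \<Rightarrow> real. \<lambda>i\<in>I. c * x i"
  have h [measurable]: "?h \<in> ?P \<rightarrow>\<^sub>M ?P" by measurable
  have "scale_measure (ennreal (c ^ card I)) (distr ?P ?P ?h) = ?P"
  proof (rule PiM_eqI[OF \<open>finite I\<close>])
    fix A :: "'i \<Rightarrow> real set" assume A: "\<And>i. i \<in> I \<Longrightarrow> A i \<in> sets lborel"
    have A': "(\<lambda>x. c * x) -` A i \<in> sets borel" if "i \<in> I" for i
      using A[OF that] measurable_sets_borel[of "\<lambda>x. c * x" borel] by simp
    have "?h -` Pi\<^sub>E I A \<inter> space ?P = Pi\<^sub>E I (\<lambda>i. (\<lambda>x. c * x) -` A i)"
      by (auto simp: space_PiM PiE_iff)
    then have "emeasure (distr ?P ?P ?h) (Pi\<^sub>E I A) = emeasure ?P (Pi\<^sub>E I (\<lambda>i. (\<lambda>x. c * x) -` A i))"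
      using A \<open>finite I\<close> by (subst emeasure_distr) (auto intro!: sets_PiM_I_finite)
    also have "\<dots> = (\<Prod>i\<in>I. emeasure lborel ((\<lambda>x. c * x) -` A i))"
      using A' \<open>finite I\<close> by (subst emeasure_PiM) auto
    finally have "emeasure (scale_measure (ennreal (c ^ card I)) (distr ?P ?P ?h)) (Pi\<^sub>E I A) =
        (\<Prod>i\<in>I. ennreal c * emeasure lborel ((\<lambda>x. c * x) -` A i))"
      using c by (simp add: prod.distrib ennreal_power)
    also have "\<dots> = (\<Prod>i\<in>I. emeasure lborel (A i))"
    proof (intro prod.cong refl)
      fix i assume i: "i \<in> I"
      have "emeasure lborel (A i) = emeasure (density (distr lborel borel ((*) c)) (\<lambda>_. \<bar>c\<bar>)) (A i)"
        using lborel_distr_mult'[of c] c by simp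
      also have "\<dots> = ennreal c * emeasure lborel ((\<lambda>x. c * x) -` A i)"
        using A[OF i] c by (subst emeasure_density) (simp_all add: nn_integral_cmult_indicator emeasure_distr)
      finally show "ennreal c * emeasure lborel ((\<lambda>x. c * x) -` A i) = emeasure lborel (A i)" ..
    qed
    finally show "emeasure (scale_measure (ennreal (c ^ card I)) (distr ?P ?P ?h)) (Pi\<^sub>E I A) =
        (\<Prod>i\<in>I. emeasure lborel (A i))" .
  qed simp
  then have "(\<integral>\<^sup>+x. f x \<partial>?P) = (\<integral>\<^sup>+x. f x \<partial>scale_measure (ennreal (c ^ card I)) (distr ?P ?P ?h))"
    by simp
  also have "\<dots> = ennreal (c ^ card I) * (\<integral>\<^sup>+x. f (?h x) \<partial>?P)"
    using f by (simp add: nn_integral_scale_measure nn_integral_distr)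
  finally show ?thesis .
qed

text \<open>The integral of the product density over a box factors, and boxes determine a finite
  product of sigma-finite measures.\<close>

lemma PiM_density:
  fixes M :: "'b measure" and f :: "'i \<Rightarrow> 'b \<Rightarrow> ennreal"
  assumes I: "finite I" and f: "\<And>i. i \<in> I \<Longrightarrow> f i \<in> borel_measurable M"
    and sf: "sigma_finite_measure M" "\<And>i. i \<in> I \<Longrightarrow> sigma_finite_measure (density M (f i))"
  shows "(\<Pi>\<^sub>M i\<in>I. density M (f i)) = density (\<Pi>\<^sub>M i\<in>I. M) (\<lambda>x. \<Prod>i\<in>I. f i (x i))"
proof -
  \<comment> \<open>The locale for product measures asks for a sigma-finite factor at every index,
    so the densities are extended by zero outside \<open>I\<close>.\<close>
  define g where "g i = (if i \<in> I then f i else (\<lambda>_. 0))" for i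
  have sfg: "sigma_finite_measure (density M (g i))" for i
  proof (cases "i \<in> I")
    case False
    have "finite_measure (density M (\<lambda>_. 0))"
      by (intro finite_measureI) (simp add: emeasure_density)
    then show ?thesis using False by (simp add: g_def finite_measure_def)
  qed (simp add: g_def sf)
  interpret M: product_sigma_finite "\<lambda>_::'i. M" using sf(1) by (simp add: product_sigma_finite_def)
  interpret G: product_sigma_finite "\<lambda>i. density M (g i)" using sfg by (simp add: product_sigma_finite_def)
  have "density (\<Pi>\<^sub>M i\<in>I. M) (\<lambda>x. \<Prod>i\<in>I. f i (x i)) = (\<Pi>\<^sub>M i\<in>I. density M (g i))"
  proof (rule G.PiM_eqI[OF I])
    show "sets (density (\<Pi>\<^sub>M i\<in>I. M) (\<lambda>x. \<Prod>i\<in>I. f i (x i))) = sets (\<Pi>\<^sub>M i\<in>I. density M (g i))"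
      by (simp cong: sets_PiM_cong)
    fix A assume "\<And>i. i \<in> I \<Longrightarrow> A i \<in> sets (density M (g i))"
    then have A: "\<And>i. i \<in> I \<Longrightarrow> A i \<in> sets M" by simp
    have mf: "(\<lambda>x. f i (x i)) \<in> borel_measurable (\<Pi>\<^sub>M i\<in>I. M)" if "i \<in> I" for i
      by (rule measurable_compose[OF measurable_component_singleton[OF that] f[OF that]])
    have "emeasure (density (\<Pi>\<^sub>M i\<in>I. M) (\<lambda>x. \<Prod>i\<in>I. f i (x i))) (Pi\<^sub>E I A) =
        (\<integral>\<^sup>+x. (\<Prod>i\<in>I. f i (x i)) * indicator (Pi\<^sub>E I A) x \<partial>(\<Pi>\<^sub>M i\<in>I. M))"
      using A I mf by (intro emeasure_density borel_measurable_prod sets_PiM_I_finite) auto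
    also have "\<dots> = (\<integral>\<^sup>+x. (\<Prod>i\<in>I. f i (x i) * indicator (A i) (x i)) \<partial>(\<Pi>\<^sub>M i\<in>I. M))"
    proof (intro nn_integral_cong)
      fix x assume "x \<in> space (\<Pi>\<^sub>M i\<in>I. M)"
      then have "indicator (Pi\<^sub>E I A) x = (\<Prod>i\<in>I. indicator (A i) (x i) :: ennreal)"
        using I by (auto simp: indicator_def space_PiM PiE_iff prod_zero_iff)
      then show "(\<Prod>i\<in>I. f i (x i)) * indicator (Pi\<^sub>E I A) x = (\<Prod>i\<in>I. f i (x i) * indicator (A i) (x i))"
        by (simp add: prod.distrib)
    qed
    also have "\<dots> = (\<Prod>i\<in>I. \<integral>\<^sup>+x. f i x * indicator (A i) x \<partial>M)"
      by (rule M.product_nn_integral_prod[OF I]) (use A f in auto)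
    also have "\<dots> = (\<Prod>i\<in>I. emeasure (density M (g i)) (A i))"
      by (intro prod.cong refl) (use A f in \<open>simp add: emeasure_density g_def\<close>)
    finally show "emeasure (density (\<Pi>\<^sub>M i\<in>I. M) (\<lambda>x. \<Prod>i\<in>I. f i (x i))) (Pi\<^sub>E I A) =
        (\<Prod>i\<in>I. emeasure (density M (g i)) (A i))" .
  qed
  also have "(\<Pi>\<^sub>M i\<in>I. density M (g i)) = (\<Pi>\<^sub>M i\<in>I. density M (f i))"
    by (intro PiM_cong) (simp_all add: g_def)
  finally show ?thesis ..
qed

text \<open>The Euler integral for rate one, followed by the scaling of \<open>x\<close> by
  \<open>l\<close>.\<close>

lemma nn_integral_powr_exp:
  fixes c l :: real
  assumes "c > 0" "l > 0"
  shows "(\<integral>\<^sup>+x. ennreal (if 0 < x then x powr (c - 1) * exp (- (l * x)) else 0) \<partial>lborel) =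
    ennreal (Gamma c * l powr (- c))"
proof -
  define f where "f x = ennreal (if 0 < x then x powr (c - 1) * exp (- x) else 0)" for x :: real
  have [measurable]: "f \<in> borel_measurable borel" unfolding f_def by measurable
  \<comment> \<open>The two integrands differ at most at the origin.\<close>
  have "ennreal (Gamma c) = (\<integral>\<^sup>+x. f x \<partial>lborel)"
    unfolding Gamma_conv_nn_integral_real[OF assms(1)]
    by (intro nn_integral_cong_AE AE_I[where N = "{0}"])
      (auto simp: f_def indicator_def exp_minus field_simps split: if_splits)
  also have "\<dots> = ennreal l * (\<integral>\<^sup>+x. f (l * x) \<partial>lborel)"
    using assms nn_integral_real_affine[of f l 0] by simp
  also have "(\<integral>\<^sup>+x. f (l * x) \<partial>lborel) =
      ennreal (l powr (c - 1)) * (\<integral>\<^sup>+x. ennreal (if 0 < x then x powr (c - 1) * exp (- (l * x)) else 0) \<partial>lborel)"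
    by (subst nn_integral_cmult[symmetric], measurable)
      (use assms in \<open>auto intro!: nn_integral_cong simp: f_def zero_less_mult_iff powr_mult ennreal_mult[symmetric] mult_ac\<close>)
  finally have *: "ennreal (Gamma c) = ennreal (l powr c) *
      (\<integral>\<^sup>+x. ennreal (if 0 < x then x powr (c - 1) * exp (- (l * x)) else 0) \<partial>lborel)" (is "_ = _ * ?X")
    using assms by (simp add: mult.assoc[symmetric] ennreal_mult[symmetric] powr_mult_base)
  have "ennreal (Gamma c * l powr (- c)) = ennreal (l powr (- c)) * ennreal (Gamma c)"
    using assms by (simp add: ennreal_mult[symmetric] mult.commute Gamma_real_pos less_imp_le)
  also have "\<dots> = ennreal (l powr (- c) * l powr c) * ?X"
    unfolding * by (simp add: mult.assoc[symmetric] ennreal_mult)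
  also have "l powr (- c) * l powr c = 1"
    using assms by (simp flip: powr_add)
  finally show ?thesis by simp
qed

lemma sets_gamma_law [simp, measurable_cong]: "sets (gamma_law a) = sets borel"
  by (simp add: gamma_law_def)

lemma space_gamma_law [simp]: "space (gamma_law a) = UNIV"
  by (simp add: gamma_law_def)

lemma prob_space_gamma_law:
  assumes "a > 0"
  shows "prob_space (gamma_law a)"
proof
  have "emeasure (gamma_law a) (space (gamma_law a)) =
      (\<integral>\<^sup>+x. ennreal (1 / Gamma a) * ennreal (if 0 < x then x powr (a - 1) * exp (- (1 * x)) else 0) \<partial>lborel)"
    unfolding gamma_law_def
    by (subst emeasure_density, measurable)
      (use assms in \<open>auto intro!: nn_integral_cong simp: ennreal_mult[symmetric] Gamma_real_pos less_imp_le\<close>)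
  also have "\<dots> = ennreal (1 / Gamma a) * ennreal (Gamma a * 1 powr (- a))"
    unfolding nn_integral_powr_exp[OF assms zero_less_one, symmetric]
    by (rule nn_integral_cmult) measurable
  also have "\<dots> = 1"
    using Gamma_real_pos[OF assms] by (simp add: ennreal_mult[symmetric] less_imp_neq[symmetric])
  finally show "emeasure (gamma_law a) (space (gamma_law a)) = 1" .
qed

lemma AE_gamma_law_pos: "AE x in gamma_law a. 0 < x"
  unfolding gamma_law_def by (subst AE_density) (auto split: if_splits)

section \<open>The density of the gamma ratios\<close>

text \<open>The unnormalized gamma factor without its exponential; the argument \<open>b\<close> is
  the shape, hence the exponent \<open>b - 1\<close>.\<close>

definition powr_pos :: "real \<Rightarrow> real \<Rightarrow> ennreal" where
  "powr_pos b s = ennreal (if 0 < s then s powr (b - 1) else 0)"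

lemma measurable_powr_pos [measurable]: "powr_pos b \<in> borel_measurable borel"
  unfolding powr_pos_def by measurable

text \<open>Substituting \<open>G i = g * r i\<close> in the joint gamma density collects the powers
  of \<open>g\<close> into \<open>g powr (a + sum b I - 1)\<close> and the exponentials into
  \<open>exp (- ((1 + sum r I) * g))\<close>. The integral over \<open>g\<close> is then a gamma
  integral with rate \<open>1 + sum r I\<close>. The resulting density is that of the inverted
  Dirichlet law.\<close>

lemma nn_integral_gamma_ratio:
  fixes \<Psi> :: "('i \<Rightarrow> real) \<Rightarrow> ennreal"
  assumes I: "finite I" and a: "a > 0" and b: "\<And>i. i \<in> I \<Longrightarrow> b i > 0"
    and \<Psi> [measurable]: "\<Psi> \<in> borel_measurable (\<Pi>\<^sub>M i\<in>I. borel)"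
  shows "(\<integral>\<^sup>+g. (\<integral>\<^sup>+G. \<Psi> (\<lambda>i\<in>I. G i / g) \<partial>(\<Pi>\<^sub>M i\<in>I. gamma_law (b i))) \<partial>gamma_law a) =
    ennreal (Gamma (a + sum b I) / (Gamma a * (\<Prod>i\<in>I. Gamma (b i)))) *
    (\<integral>\<^sup>+r. (\<Prod>i\<in>I. powr_pos (b i) (r i)) * ennreal ((1 + sum r I) powr (- (a + sum b I))) * \<Psi> r
      \<partial>(\<Pi>\<^sub>M i\<in>I. lborel))"
proof -
  let ?P = "\<Pi>\<^sub>M i\<in>I. (lborel :: real measure)"
  let ?C = "\<Prod>i\<in>I. Gamma (b i)"
  interpret P: product_sigma_finite "\<lambda>i::'i. lborel :: real measure" ..
  interpret P: finite_product_sigma_finite "\<lambda>i::'i. lborel :: real measure" I by standard fact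
  interpret LP: pair_sigma_finite "lborel :: real measure" ?P ..
  have [measurable_cong]: "sets ?P = sets (\<Pi>\<^sub>M i\<in>I. (borel :: real measure))"
    by (rule sets_PiM_cong) simp_all
  have Cpos: "?C > 0" using b by (intro prod_pos) (simp add: Gamma_real_pos)
  define d where "d c x = ennreal (if 0 < x then x powr (c - 1) * exp (- x) / Gamma c else 0)" for c x :: real
  have d [measurable]: "d c \<in> borel_measurable borel" for c unfolding d_def by measurable
  have gl: "gamma_law c = density lborel (d c)" for c by (simp add: gamma_law_def d_def[abs_def])
  have PG: "(\<Pi>\<^sub>M i\<in>I. gamma_law (b i)) = density ?P (\<lambda>x. \<Prod>i\<in>I. d (b i) (x i))"
    unfolding gl
  proof (rule PiM_density[OF I])
    fix i assume "i \<in> I"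
    then interpret prob_space "gamma_law (b i)" using b by (intro prob_space_gamma_law)
    show "sigma_finite_measure (density lborel (d (b i)))" unfolding gl[symmetric] ..
  qed (simp_all, standard)
  define R where "R r = sum r I" for r :: "'i \<Rightarrow> real"
  have [measurable]: "R \<in> borel_measurable ?P"
    unfolding R_def using I by (intro borel_measurable_sum) simp
  define Q where "Q r = (\<Prod>i\<in>I. powr_pos (b i) (r i)) * \<Psi> r" for r
  have Qp [measurable]: "(\<lambda>r. \<Prod>i\<in>I. powr_pos (b i) (r i)) \<in> borel_measurable ?P"
    by (intro borel_measurable_prod_ennreal) measurable
  have Q [measurable]: "Q \<in> borel_measurable ?P" unfolding Q_def by measurable
  define E where "E g r = ennreal (if 0 < g then g powr (a + sum b I - 1) * exp (- ((1 + R r) * g)) else 0)"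
    for g :: real and r
  have [measurable]: "(\<lambda>(g, r). E g r) \<in> borel_measurable (lborel \<Otimes>\<^sub>M ?P)"
    unfolding E_def by measurable
  have inner: "d a g * (\<integral>\<^sup>+G. \<Psi> (\<lambda>i\<in>I. G i / g) \<partial>(\<Pi>\<^sub>M i\<in>I. gamma_law (b i))) =
      (\<integral>\<^sup>+r. ennreal (1 / (Gamma a * ?C)) * (E g r * Q r) \<partial>?P)" for g :: real
  proof (cases "0 < g")
    case True
    have m1: "(\<lambda>x. \<lambda>i\<in>I. x i / g) \<in> ?P \<rightarrow>\<^sub>M (\<Pi>\<^sub>M i\<in>I. (borel :: real measure))" by measurable
    have m2 [measurable]: "(\<lambda>x. \<Psi> (\<lambda>i\<in>I. x i / g)) \<in> borel_measurable ?P"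
      by (rule measurable_compose[OF m1 \<Psi>])
    have m3 [measurable]: "(\<lambda>x. \<Prod>i\<in>I. d (b i) (x i)) \<in> borel_measurable ?P"
      by (intro borel_measurable_prod_ennreal) measurable
    have "(\<integral>\<^sup>+G. \<Psi> (\<lambda>i\<in>I. G i / g) \<partial>(\<Pi>\<^sub>M i\<in>I. gamma_law (b i))) =
        (\<integral>\<^sup>+x. (\<Prod>i\<in>I. d (b i) (x i)) * \<Psi> (\<lambda>i\<in>I. x i / g) \<partial>?P)"
      unfolding PG by (rule nn_integral_density) measurable
    also have "\<dots> = ennreal (g ^ card I) *
        (\<integral>\<^sup>+r. (\<Prod>i\<in>I. d (b i) ((\<lambda>i\<in>I. g * r i) i)) * \<Psi> (\<lambda>i\<in>I. (\<lambda>i\<in>I. g * r i) i / g) \<partial>?P)"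
      by (rule nn_integral_PiM_lborel_scale[OF I True]) measurable
    also have "d a g * \<dots> = (d a g * ennreal (g ^ card I)) *
        (\<integral>\<^sup>+r. (\<Prod>i\<in>I. d (b i) ((\<lambda>i\<in>I. g * r i) i)) * \<Psi> (\<lambda>i\<in>I. (\<lambda>i\<in>I. g * r i) i / g) \<partial>?P)"
      by (simp add: mult.assoc)
    also have "\<dots> = (d a g * ennreal (g ^ card I)) * (\<integral>\<^sup>+r. (\<Prod>i\<in>I. d (b i) (g * r i)) * \<Psi> r \<partial>?P)"
    proof (rule arg_cong2[where f = "(*)", OF refl nn_integral_cong])
      fix r assume "r \<in> space ?P"
      then have "(\<lambda>i\<in>I. (\<lambda>i\<in>I. g * r i) i / g) = r"
        using True by (auto simp: space_PiM PiE_iff extensional_def fun_eq_iff)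
      moreover have "(\<Prod>i\<in>I. d (b i) ((\<lambda>i\<in>I. g * r i) i)) = (\<Prod>i\<in>I. d (b i) (g * r i))"
        by (intro prod.cong) auto
      ultimately show "(\<Prod>i\<in>I. d (b i) ((\<lambda>i\<in>I. g * r i) i)) * \<Psi> (\<lambda>i\<in>I. (\<lambda>i\<in>I. g * r i) i / g) =
          (\<Prod>i\<in>I. d (b i) (g * r i)) * \<Psi> r" by simp
    qed
    also have "\<dots> = (\<integral>\<^sup>+r. (d a g * ennreal (g ^ card I)) * ((\<Prod>i\<in>I. d (b i) (g * r i)) * \<Psi> r) \<partial>?P)"
    proof (rule nn_integral_cmult[symmetric])
      have "(\<lambda>r. \<Prod>i\<in>I. d (b i) (g * r i)) \<in> borel_measurable ?P"
        by (intro borel_measurable_prod_ennreal) measurable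
      then show "(\<lambda>r. (\<Prod>i\<in>I. d (b i) (g * r i)) * \<Psi> r) \<in> borel_measurable ?P" by measurable
    qed
    also have "\<dots> = (\<integral>\<^sup>+r. ennreal (1 / (Gamma a * ?C)) * (E g r * Q r) \<partial>?P)"
    proof (intro nn_integral_cong)
      fix r
      have "(d a g * ennreal (g ^ card I)) * (\<Prod>i\<in>I. d (b i) (g * r i)) =
          ennreal (1 / (Gamma a * ?C)) * (E g r * (\<Prod>i\<in>I. powr_pos (b i) (r i)))"
      proof (cases "\<forall>i\<in>I. 0 < r i")
        case pos: True
        have "(\<Prod>i\<in>I. d (b i) (g * r i)) = (\<Prod>i\<in>I. ennreal (((g * r i) powr (b i - 1)) * exp (- (g * r i)) / Gamma (b i)))"
          using pos True by (intro prod.cong) (auto simp: d_def)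
        also have "\<dots> = ennreal (\<Prod>i\<in>I. ((g * r i) powr (b i - 1)) * exp (- (g * r i)) / Gamma (b i))"
          using b Gamma_real_pos by (intro prod_ennreal) (auto intro!: divide_nonneg_nonneg mult_nonneg_nonneg simp: less_imp_le)
        also have "(\<Prod>i\<in>I. ((g * r i) powr (b i - 1)) * exp (- (g * r i)) / Gamma (b i)) =
            (\<Prod>i\<in>I. g powr (b i - 1)) * (\<Prod>i\<in>I. r i powr (b i - 1)) * (\<Prod>i\<in>I. exp (- (g * r i))) / ?C"
          using pos True by (simp add: prod.distrib prod_dividef powr_mult less_imp_le)
        also have "(\<Prod>i\<in>I. g powr (b i - 1)) = g powr (sum b I - card I)"
          using I True by (simp add: powr_sum[symmetric] sum_subtractf)
        also have "(\<Prod>i\<in>I. exp (- (g * r i))) = exp (- (g * R r))"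
          using I by (simp add: exp_sum[symmetric] sum_negf sum_distrib_left R_def)
        finally have 1: "(\<Prod>i\<in>I. d (b i) (g * r i)) = ennreal (g powr (sum b I - card I) *
            (\<Prod>i\<in>I. r i powr (b i - 1)) * exp (- (g * R r)) / ?C)" .
        have 2: "(\<Prod>i\<in>I. powr_pos (b i) (r i)) = ennreal (\<Prod>i\<in>I. r i powr (b i - 1))"
          using pos by (subst prod_ennreal[symmetric]) (auto simp: powr_pos_def intro!: prod.cong)
        have nn: "0 \<le> (\<Prod>i\<in>I. r i powr (b i - 1))" by (intro prod_nonneg) simp
        have g1: "g powr (a - 1) * g ^ card I * g powr (sum b I - card I) = g powr (a + sum b I - 1)"
          using True by (simp add: powr_realpow[symmetric] powr_add[symmetric] add_diff_eq)
        have "g powr (a - 1) * exp (- g) / Gamma a * g ^ card I *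
            (g powr (sum b I - card I) * (\<Prod>i\<in>I. r i powr (b i - 1)) * exp (- (g * R r)) / ?C) =
            1 / (Gamma a * ?C) * ((g powr (a - 1) * g ^ card I * g powr (sum b I - card I)) *
              (exp (- g) * exp (- (g * R r))) * (\<Prod>i\<in>I. r i powr (b i - 1)))"
          by (simp add: field_simps)
        also have "exp (- g) * exp (- (g * R r)) = exp (- ((1 + R r) * g))"
          by (simp add: exp_add[symmetric] algebra_simps)
        finally have 3: "g powr (a - 1) * exp (- g) / Gamma a * g ^ card I *
            (g powr (sum b I - card I) * (\<Prod>i\<in>I. r i powr (b i - 1)) * exp (- (g * R r)) / ?C) =
            1 / (Gamma a * ?C) * (g powr (a + sum b I - 1) *
              exp (- ((1 + R r) * g)) * (\<Prod>i\<in>I. r i powr (b i - 1)))"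
          unfolding g1 .
        have G: "0 < Gamma a" using a by (rule Gamma_real_pos)
        have 4: "d a g = ennreal (g powr (a - 1) * exp (- g) / Gamma a)"
          using True by (simp add: d_def)
        show ?thesis
          unfolding 1 2 4 E_def if_P[OF True]
          using 3 nn G Cpos True
          by (simp only: ennreal_mult[symmetric] mult_nonneg_nonneg divide_nonneg_nonneg powr_ge_zero exp_ge_zero
              zero_le_power less_imp_le zero_le_one)
      next
        \<comment> \<open>Outside the positive orthant one of the gamma densities and one factor
          \<open>powr_pos\<close> vanish.\<close>
        case False
        then obtain i where i: "i \<in> I" "\<not> 0 < r i" by auto
        then have z: "(\<Prod>i\<in>I. d (b i) (g * r i)) = 0" "(\<Prod>i\<in>I. powr_pos (b i) (r i)) = 0"
          using I True by (auto simp: d_def powr_pos_def zero_less_mult_iff intro!: bexI[of _ i])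
        show ?thesis unfolding z by simp
      qed
      then show "(d a g * ennreal (g ^ card I)) * ((\<Prod>i\<in>I. d (b i) (g * r i)) * \<Psi> r) =
          ennreal (1 / (Gamma a * ?C)) * (E g r * Q r)"
        unfolding Q_def by (simp only: mult.assoc[symmetric])
    qed
    finally show ?thesis .
  qed (simp add: d_def E_def)
  have "(\<integral>\<^sup>+g. (\<integral>\<^sup>+G. \<Psi> (\<lambda>i\<in>I. G i / g) \<partial>(\<Pi>\<^sub>M i\<in>I. gamma_law (b i))) \<partial>gamma_law a) =
      (\<integral>\<^sup>+g. d a g * (\<integral>\<^sup>+G. \<Psi> (\<lambda>i\<in>I. G i / g) \<partial>(\<Pi>\<^sub>M i\<in>I. gamma_law (b i))) \<partial>lborel)"
  proof -
    interpret G: prob_space "\<Pi>\<^sub>M i\<in>I. gamma_law (b i)"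
      using b by (intro prob_space_PiM prob_space_gamma_law)
    have [measurable_cong]: "sets (\<Pi>\<^sub>M i\<in>I. gamma_law (b i)) = sets ?P"
      by (rule sets_PiM_cong) simp_all
    have "(\<lambda>(g, G). \<lambda>i\<in>I. G i / g) \<in> (lborel \<Otimes>\<^sub>M (\<Pi>\<^sub>M i\<in>I. gamma_law (b i))) \<rightarrow>\<^sub>M (\<Pi>\<^sub>M i\<in>I. (borel :: real measure))"
      by measurable
    then have "(\<lambda>(g, G). \<Psi> (\<lambda>i\<in>I. G i / g)) \<in> borel_measurable (lborel \<Otimes>\<^sub>M (\<Pi>\<^sub>M i\<in>I. gamma_law (b i)))"
      using measurable_compose[OF _ \<Psi>] by (simp add: split_beta')
    then show ?thesis
      unfolding gl[of a] by (intro nn_integral_density G.borel_measurable_nn_integral) simp_all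
  qed
  also have "\<dots> = (\<integral>\<^sup>+g. (\<integral>\<^sup>+r. ennreal (1 / (Gamma a * ?C)) * (E g r * Q r) \<partial>?P) \<partial>lborel)"
    by (simp only: inner)
  also have "\<dots> = (\<integral>\<^sup>+r. (\<integral>\<^sup>+g. ennreal (1 / (Gamma a * ?C)) * (E g r * Q r) \<partial>lborel) \<partial>?P)"
    by (rule LP.Fubini'[symmetric]) measurable
  also have "\<dots> = (\<integral>\<^sup>+r. ennreal (1 / (Gamma a * ?C)) * (\<integral>\<^sup>+g. E g r \<partial>lborel) * Q r \<partial>?P)"
    by (intro nn_integral_cong) (simp add: nn_integral_cmult nn_integral_multc mult.assoc)
  also have "\<dots> = (\<integral>\<^sup>+r. ennreal (Gamma (a + sum b I) / (Gamma a * ?C)) *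
      ((\<Prod>i\<in>I. powr_pos (b i) (r i)) * ennreal ((1 + sum r I) powr (- (a + sum b I))) * \<Psi> r) \<partial>?P)"
  proof (intro nn_integral_cong)
    fix r
    show "ennreal (1 / (Gamma a * ?C)) * (\<integral>\<^sup>+g. E g r \<partial>lborel) * Q r =
      ennreal (Gamma (a + sum b I) / (Gamma a * ?C)) *
      ((\<Prod>i\<in>I. powr_pos (b i) (r i)) * ennreal ((1 + sum r I) powr (- (a + sum b I))) * \<Psi> r)"
    proof (cases "\<forall>i\<in>I. 0 < r i")
      \<comment> \<open>On the positive orthant the rate \<open>1 + R r\<close> is positive, as the
        gamma integral requires; elsewhere \<open>Q r\<close> is zero.\<close>
      case True
      then have R: "0 < 1 + R r" unfolding R_def by (intro add_pos_nonneg sum_nonneg) (auto simp: less_imp_le)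
      have ab: "0 < a + sum b I" using a b by (intro add_pos_nonneg sum_nonneg) (auto simp: less_imp_le)
      have "(\<integral>\<^sup>+g. E g r \<partial>lborel) = ennreal (Gamma (a + sum b I) * (1 + R r) powr (- (a + sum b I)))"
        unfolding E_def by (rule nn_integral_powr_exp[OF ab R])
      moreover have "ennreal (1 / (Gamma a * ?C)) * ennreal (Gamma (a + sum b I) * (1 + R r) powr (- (a + sum b I))) =
          ennreal (Gamma (a + sum b I) / (Gamma a * ?C)) * ennreal ((1 + R r) powr (- (a + sum b I)))"
        using Gamma_real_pos[OF a] Gamma_real_pos[OF ab] Cpos
        by (simp add: ennreal_mult[symmetric])
      ultimately show ?thesis by (simp add: Q_def R_def mult_ac)
    next
      case False
      then have z: "(\<Prod>i\<in>I. powr_pos (b i) (r i)) = 0"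
        using I by (auto simp: powr_pos_def)
      show ?thesis unfolding Q_def z by simp
    qed
  qed
  also have "\<dots> = ennreal (Gamma (a + sum b I) / (Gamma a * ?C)) *
      (\<integral>\<^sup>+r. (\<Prod>i\<in>I. powr_pos (b i) (r i)) * ennreal ((1 + sum r I) powr (- (a + sum b I))) * \<Psi> r \<partial>?P)"
    by (rule nn_integral_cmult) (unfold R_def[symmetric], measurable)
  finally show ?thesis .
qed

section \<open>The stable random measure\<close>

text \<open>The index \<open>None\<close> stands for the measure \<open>\<mu>\<close> itself, so
  that the whole object is a single \<open>sum_measure\<close>.\<close>

definition add_atoms :: "'i set \<Rightarrow> ('i \<Rightarrow> real) \<Rightarrow> ('i \<Rightarrow> 'b) \<Rightarrow> 'b measure \<Rightarrow> 'b measure" where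
  "add_atoms I s y \<mu> = sum_measure \<mu>
     (\<lambda>j. case j of None \<Rightarrow> \<mu> | Some i \<Rightarrow> scale_measure (ennreal (s i)) (return \<mu> (y i))) (insert None (Some ` I))"

lemma
  shows space_add_atoms: "space (add_atoms I s y \<mu>) = space \<mu>"
    and sets_add_atoms [simp, measurable_cong]: "sets (add_atoms I s y \<mu>) = sets \<mu>"
  by (simp_all add: add_atoms_def space_sum_measure)

lemma emeasure_add_atoms:
  assumes "finite I" "A \<in> sets \<mu>"
  shows "emeasure (add_atoms I s y \<mu>) A = emeasure \<mu> A + (\<Sum>i\<in>I. ennreal (s i) * indicator A (y i))"
proof -
  have "emeasure (add_atoms I s y \<mu>) A = (\<Sum>j\<in>insert None (Some ` I). emeasure (case j of None \<Rightarrow> \<mu>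
      | Some i \<Rightarrow> scale_measure (ennreal (s i)) (return \<mu> (y i))) A)"
    unfolding add_atoms_def using assms
    by (subst emeasure_sum_measure) (auto simp: nn_integral_count_space_finite)
  also have "\<dots> = emeasure \<mu> A + (\<Sum>i\<in>I. ennreal (s i) * indicator A (y i))"
    using assms by (simp add: sum.reindex)
  finally show ?thesis .
qed

lemma measurable_add_atoms [measurable (raw)]:
  assumes I: "finite I" and S [measurable]: "\<And>i. i \<in> I \<Longrightarrow> (\<lambda>x. S x i) \<in> borel_measurable M"
    and Y [measurable]: "\<And>i. i \<in> I \<Longrightarrow> (\<lambda>x. Y x i) \<in> M \<rightarrow>\<^sub>M K"
    and m [measurable]: "m \<in> M \<rightarrow>\<^sub>M measure_algebra K"
  shows "(\<lambda>x. add_atoms I (S x) (Y x) (m x)) \<in> M \<rightarrow>\<^sub>M measure_algebra K"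
proof (rule measurable_measure_algebraI)
  have s: "sets (m x) = sets K" if "x \<in> space M" for x
    using measurable_space[OF m that] by (simp add: space_measure_algebra)
  then show "sets (add_atoms I (S x) (Y x) (m x)) = sets K" if "x \<in> space M" for x
    using that by simp
  fix A assume A [measurable]: "A \<in> sets K"
  have "(\<lambda>x. emeasure (add_atoms I (S x) (Y x) (m x)) A) \<in> borel_measurable M \<longleftrightarrow>
     (\<lambda>x. emeasure (m x) A + (\<Sum>i\<in>I. ennreal (S x i) * indicator A (Y x i))) \<in> borel_measurable M"
    by (intro measurable_cong emeasure_add_atoms I) (use s A in auto)
  also have "\<dots>"
  proof -
    have [measurable]: "(\<lambda>x. \<Sum>i\<in>I. ennreal (S x i) * indicator A (Y x i)) \<in> borel_measurable M"
      by (intro borel_measurable_sum) measurable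
    show ?thesis by measurable
  qed
  finally show "(\<lambda>x. emeasure (add_atoms I (S x) (Y x) (m x)) A) \<in> borel_measurable M" .
qed

lemma add_atoms_insert:
  assumes "finite I" "k \<notin> I"
  shows "add_atoms (insert k I) s y \<mu> = add_atoms I s y (add_atoms {k} s y \<mu>)"
proof (rule measure_eqI)
  fix A assume "A \<in> sets (add_atoms (insert k I) s y \<mu>)"
  then have A: "A \<in> sets \<mu>" by simp
  have s: "(\<Sum>i\<in>{k}. f i) = f k" for f :: "'a \<Rightarrow> ennreal" by simp
  show "emeasure (add_atoms (insert k I) s y \<mu>) A = emeasure (add_atoms I s y (add_atoms {k} s y \<mu>)) A"
    unfolding emeasure_add_atoms[OF assms(1), of A "add_atoms {k} s y \<mu>", unfolded sets_add_atoms, OF A]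
      emeasure_add_atoms[OF finite.insertI[OF assms(1)] A] emeasure_add_atoms[OF finite.insertI[OF finite.emptyI] A]
      sum.insert[OF assms] by (simp only: s add_ac)
qed simp

section \<open>The stable intensity\<close>

locale stable_base = prob_space H for H :: "'a::polish_space measure" +
  fixes \<alpha> :: real
  assumes alpha: "0 < \<alpha>" "\<alpha> < 1"
    and sets_H [measurable_cong]: "sets H = sets borel"
begin

lemma space_H: "space H = UNIV"
  using sets_eq_imp_space_eq[OF sets_H] by simp

text \<open>\<open>s\<^sup>e\<close> times the Levy density\<close>

definition levy_weight :: "nat \<Rightarrow> real \<Rightarrow> ennreal" where
  "levy_weight e s = ennreal (if 0 < s then s powr (real e - \<alpha> - 1) / Gamma (1 - \<alpha>) else 0)"

lemma measurable_levy_weight [measurable]: "levy_weight e \<in> borel_measurable borel"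
  unfolding levy_weight_def by measurable

lemma Gamma_pos: "0 < Gamma (1 - \<alpha>)"
  using alpha by (simp add: Gamma_real_pos)

text \<open>Each further choice of an atom of size \<open>s\<close> contributes one factor
  \<open>s\<close>, so iterating the Mecke equation only changes the exponent.\<close>

lemma levy_weight_Suc: "levy_weight e s * ennreal s = levy_weight (Suc e) s"
proof (cases "0 < s")
  case True
  have "s powr (real e - \<alpha> - 1) * s = s powr (real (Suc e) - \<alpha> - 1)"
    using True powr_mult_base[of s "real e - \<alpha> - 1"] by (simp add: mult.commute algebra_simps)
  then show ?thesis using True Gamma_pos by (simp add: levy_weight_def flip: ennreal_mult)
qed (simp add: levy_weight_def)

lemma levy_weight_powr_pos: "levy_weight e s = ennreal (1 / Gamma (1 - \<alpha>)) * powr_pos (real e - \<alpha>) s"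
  using Gamma_pos by (simp add: levy_weight_def powr_pos_def flip: ennreal_mult)

abbreviation "\<nu> \<equiv> stable_intensity \<alpha> H"

abbreviation "MA \<equiv> measure_algebra (borel :: 'a measure)"

lemma sets_stable_intensity: "sets \<nu> = sets (restrict_space borel {0<..} \<Otimes>\<^sub>M borel)"
  unfolding stable_intensity_def
  by (intro sets_pair_measure_cong) (simp_all add: sets_H cong: sets_restrict_space_cong)

declare sets_stable_intensity [measurable_cong]

lemma space_stable_intensity: "space \<nu> = {0<..} \<times> UNIV"
  by (simp add: stable_intensity_def space_pair_measure space_restrict_space space_H)

lemma measurable_size [measurable]: "fst \<in> borel_measurable \<nu>"
proof -
  have "fst \<in> restrict_space borel {0<..} \<Otimes>\<^sub>M borel \<rightarrow>\<^sub>M restrict_space borel {0::real<..}" by measurable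
  from measurable_compose[OF this measurable_restrict_space1[OF measurable_ident]]
  show ?thesis by (simp add: measurable_cong_sets[OF sets_stable_intensity refl])
qed

text \<open>The Levy density is finite at every size, which is enough although its integral near 0
  is infinite.\<close>

lemma sigma_finite_levy:
  "sigma_finite_measure (density (restrict_space lborel {0<..}) (\<lambda>s. ennreal (s powr (- \<alpha> - 1) / Gamma (1 - \<alpha>))))"
proof -
  interpret sigma_finite_measure "restrict_space lborel {0::real<..}"
    by (rule sigma_finite_measure_restrict_space) (simp_all add: sigma_finite_lborel)
  show ?thesis
    by (subst sigma_finite_iff_density_finite) (auto intro!: measurable_restrict_space1)
qed

lemma sigma_finite_stable_intensity: "sigma_finite_measure \<nu>"
proof -
  interpret L: sigma_finite_measure
    "density (restrict_space lborel {0<..}) (\<lambda>s. ennreal (s powr (- \<alpha> - 1) / Gamma (1 - \<alpha>)))"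
    by (rule sigma_finite_levy)
  interpret pair_sigma_finite
    "density (restrict_space lborel {0<..}) (\<lambda>s. ennreal (s powr (- \<alpha> - 1) / Gamma (1 - \<alpha>)))" H ..
  show ?thesis unfolding stable_intensity_def ..
qed

text \<open>The restriction to positive sizes is moved into the weight, so that later integrals run
  over all of Lebesgue measure.\<close>

lemma nn_integral_stable_intensity:
  assumes f [measurable]: "f \<in> borel_measurable \<nu>"
  shows "(\<integral>\<^sup>+x. f x \<partial>\<nu>) = (\<integral>\<^sup>+s. levy_weight 0 s * (\<integral>\<^sup>+y. f (s, y) \<partial>H) \<partial>lborel)"
proof -
  let ?R = "restrict_space lborel {0::real<..}"
  let ?w = "\<lambda>s. ennreal (s powr (- \<alpha> - 1) / Gamma (1 - \<alpha>))"
  have [measurable]: "f \<in> borel_measurable (?R \<Otimes>\<^sub>M H)"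
  proof -
    have "sets (?R \<Otimes>\<^sub>M H) = sets \<nu>"
      unfolding stable_intensity_def by (intro sets_pair_measure_cong) simp_all
    from measurable_cong_sets[OF this refl] f show ?thesis by simp
  qed
  have w [measurable]: "?w \<in> borel_measurable ?R"
    by (intro measurable_restrict_space1) simp
  have "(\<integral>\<^sup>+x. f x \<partial>\<nu>) = (\<integral>\<^sup>+s. (\<integral>\<^sup>+y. f (s, y) \<partial>H) \<partial>density ?R ?w)"
    unfolding stable_intensity_def
    by (rule nn_integral_fst[symmetric]) measurable
  also have "\<dots> = (\<integral>\<^sup>+s. ?w s * (\<integral>\<^sup>+y. f (s, y) \<partial>H) \<partial>?R)"
    by (rule nn_integral_density) measurable
  also have "\<dots> = (\<integral>\<^sup>+s. ?w s * (\<integral>\<^sup>+y. f (s, y) \<partial>H) * indicator {0<..} s \<partial>lborel)"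
    by (rule nn_integral_restrict_space) simp
  also have "\<dots> = (\<integral>\<^sup>+s. levy_weight 0 s * (\<integral>\<^sup>+y. f (s, y) \<partial>H) \<partial>lborel)"
    by (intro nn_integral_cong) (simp add: levy_weight_def indicator_def)
  finally show ?thesis .
qed

lemma emeasure_crm:
  assumes N: "sets N = sets \<nu>" and B [measurable]: "B \<in> sets borel"
  shows "emeasure (crm N) B = (\<integral>\<^sup>+x. ennreal (fst x) * indicator B (snd x) \<partial>N)"
proof -
  have [measurable]: "fst \<in> borel_measurable N" "snd \<in> N \<rightarrow>\<^sub>M borel"
    by (simp_all add: measurable_cong_sets[OF N refl])
  have "emeasure (crm N) B = emeasure (density N (\<lambda>x. ennreal (fst x))) (snd -` B \<inter> space N)"
    unfolding crm_def by (subst emeasure_distr) (auto simp: split_beta')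
  also have "\<dots> = (\<integral>\<^sup>+x. ennreal (fst x) * indicator (snd -` B \<inter> space N) x \<partial>N)"
    by (rule emeasure_density) measurable
  also have "\<dots> = (\<integral>\<^sup>+x. ennreal (fst x) * indicator B (snd x) \<partial>N)"
    by (intro nn_integral_cong) (simp add: indicator_def)
  finally show ?thesis .
qed

lemma sets_crm [simp]: "sets (crm N) = sets borel" and space_crm [simp]: "space (crm N) = UNIV"
  by (simp_all add: crm_def)

lemma measurable_crm [measurable]: "crm \<in> measure_algebra \<nu> \<rightarrow>\<^sub>M MA"
proof (rule measurable_measure_algebraI)
  fix B :: "'a set" assume B [measurable]: "B \<in> sets borel"
  have "(\<lambda>N. emeasure (crm N) B) \<in> borel_measurable (measure_algebra \<nu>) \<longleftrightarrow>
      (\<lambda>N. \<integral>\<^sup>+x. ennreal (fst x) * indicator B (snd x) \<partial>N) \<in> borel_measurable (measure_algebra \<nu>)"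
    by (intro measurable_cong emeasure_crm B) (simp add: space_measure_algebra)
  then show "(\<lambda>N. emeasure (crm N) B) \<in> borel_measurable (measure_algebra \<nu>)"
    by simp
qed simp

text \<open>Translates the point inserted by the Mecke equation into an inserted atom; the index
  \<open>k\<close> is a mere label.\<close>

lemma crm_add_point:
  assumes N: "sets N = sets \<nu>" and x: "x \<in> space \<nu>"
  shows "crm (add_point N x) = add_atoms {k} (\<lambda>_. fst x) (\<lambda>_. snd x) (crm N)"
proof (rule measure_eqI)
  fix B assume "B \<in> sets (crm (add_point N x))"
  then have B [measurable]: "B \<in> sets borel" by simp
  have [measurable]: "fst \<in> borel_measurable N" "snd \<in> N \<rightarrow>\<^sub>M borel"
    by (simp_all add: measurable_cong_sets[OF N refl])
  show "emeasure (crm (add_point N x)) B = emeasure (add_atoms {k} (\<lambda>_. fst x) (\<lambda>_. snd x) (crm N)) B"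
    using N x sets_eq_imp_space_eq[OF N]
    by (simp add: emeasure_crm B emeasure_add_atoms nn_integral_add_point)
qed simp

abbreviation "L \<equiv> PRM_law \<nu>"

sublocale L: mecke L \<nu>
  by (rule mecke_PRM_law) (rule sigma_finite_stable_intensity)

section \<open>The law of the random measure and its Mecke equation\<close>

definition crm_law :: "'a measure measure" where
  "crm_law = distr L MA crm"

lemma sets_crm_law [simp, measurable_cong]: "sets crm_law = sets MA"
  by (simp add: crm_law_def)

lemma space_crm_law: "space crm_law = {\<mu>. sets \<mu> = sets borel}"
  using sets_eq_imp_space_eq[OF sets_crm_law] by (simp add: space_measure_algebra)

lemma measurable_crm_L [measurable]: "crm \<in> L \<rightarrow>\<^sub>M MA"
  by (simp add: L.measurable_L_iff)

lemma nn_integral_crm_law: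
  "f \<in> borel_measurable MA \<Longrightarrow> (\<integral>\<^sup>+\<mu>. f \<mu> \<partial>crm_law) = (\<integral>\<^sup>+N. f (crm N) \<partial>L)"
  unfolding crm_law_def by (rule nn_integral_distr) measurable

sublocale crm_law: prob_space crm_law
  unfolding crm_law_def by (rule L.prob_space_distr) measurable

text \<open>The Mecke equation with \<open>f (s, y) = s * indicator B y\<close>, whose factor
  \<open>s\<close> turns the Levy density into \<open>levy_weight 1\<close>. The index
  \<open>k\<close> is arbitrary; it names the new atom so that it can later be merged with atoms
  carrying other indices.\<close>

lemma mecke_crm_law:
  assumes B [measurable]: "B \<in> sets borel" and \<phi> [measurable]: "\<phi> \<in> borel_measurable MA"
  shows "(\<integral>\<^sup>+\<mu>. emeasure \<mu> B * \<phi> \<mu> \<partial>crm_law) =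
    (\<integral>\<^sup>+s. levy_weight 1 s *
      (\<integral>\<^sup>+y. indicator B y * (\<integral>\<^sup>+\<mu>. \<phi> (add_atoms {k} (\<lambda>_. s) (\<lambda>_. y) \<mu>) \<partial>crm_law) \<partial>H) \<partial>lborel)"
proof -
  define f where "f x = ennreal (fst x) * indicator B (snd x)" for x :: "real \<times> 'a"
  have f [measurable]: "f \<in> borel_measurable \<nu>" unfolding f_def by measurable
  define h where "h s y = (\<integral>\<^sup>+\<mu>. \<phi> (add_atoms {k} (\<lambda>_. s) (\<lambda>_. y) \<mu>) \<partial>crm_law)" for s y
  have h' [measurable]: "(\<lambda>(s, y). h s y) \<in> borel_measurable (borel \<Otimes>\<^sub>M borel)"
    unfolding h_def by measurable
  have h [measurable]: "(\<lambda>x. h (fst x) (snd x)) \<in> borel_measurable \<nu>"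
  proof -
    have "(\<lambda>x. (fst x, snd x)) \<in> \<nu> \<rightarrow>\<^sub>M borel \<Otimes>\<^sub>M borel" by (intro measurable_Pair) measurable
    from measurable_compose[OF this h'] show ?thesis by simp
  qed
  have "(\<integral>\<^sup>+\<mu>. emeasure \<mu> B * \<phi> \<mu> \<partial>crm_law) = (\<integral>\<^sup>+N. emeasure (crm N) B * \<phi> (crm N) \<partial>L)"
    by (rule nn_integral_crm_law) measurable
  also have "\<dots> = (\<integral>\<^sup>+N. (\<integral>\<^sup>+x. f x \<partial>N) * \<phi> (crm N) \<partial>L)"
    by (intro nn_integral_cong) (simp add: L.space_L emeasure_crm B f_def)
  also have "\<dots> = (\<integral>\<^sup>+x. f x * (\<integral>\<^sup>+N. \<phi> (crm (add_point N x)) \<partial>L) \<partial>\<nu>)"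
    by (rule L.mecke) measurable
  also have "\<dots> = (\<integral>\<^sup>+x. f x * h (fst x) (snd x) \<partial>\<nu>)"
  proof (intro nn_integral_cong)
    fix x assume x: "x \<in> space \<nu>"
    have "(\<integral>\<^sup>+N. \<phi> (crm (add_point N x)) \<partial>L) =
        (\<integral>\<^sup>+N. \<phi> (add_atoms {k} (\<lambda>_. fst x) (\<lambda>_. snd x) (crm N)) \<partial>L)"
      by (intro nn_integral_cong) (simp add: L.space_L crm_add_point[OF _ x, where k = k])
    also have "\<dots> = h (fst x) (snd x)"
      unfolding h_def by (rule nn_integral_crm_law[symmetric]) measurable
    finally show "f x * (\<integral>\<^sup>+N. \<phi> (crm (add_point N x)) \<partial>L) = f x * h (fst x) (snd x)" by simp
  qed
  also have "\<dots> = (\<integral>\<^sup>+s. levy_weight 0 s * (\<integral>\<^sup>+y. f (s, y) * h s y \<partial>H) \<partial>lborel)"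
    by (subst nn_integral_stable_intensity) simp_all
  also have "\<dots> = (\<integral>\<^sup>+s. levy_weight 1 s * (\<integral>\<^sup>+y. indicator B y * h s y \<partial>H) \<partial>lborel)"
  proof (intro nn_integral_cong)
    fix s
    have "(\<integral>\<^sup>+y. f (s, y) * h s y \<partial>H) = ennreal s * (\<integral>\<^sup>+y. indicator B y * h s y \<partial>H)"
      by (subst nn_integral_cmult[symmetric]) (simp_all add: f_def mult.assoc)
    then show "levy_weight 0 s * (\<integral>\<^sup>+y. f (s, y) * h s y \<partial>H) =
        levy_weight 1 s * (\<integral>\<^sup>+y. indicator B y * h s y \<partial>H)"
      by (simp add: levy_weight_Suc[of 0 s, simplified] mult.assoc[symmetric])
  qed
  finally show ?thesis unfolding h_def .
qed

section \<open>The total mass is positive and finite\<close>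

text \<open>On sizes below \<open>1 / m\<close> the Levy density is at least
  \<open>m powr (\<alpha> + 1) / Gamma (1 - \<alpha>)\<close>, so this interval alone carries mass
  at least \<open>m powr \<alpha> / Gamma (1 - \<alpha>)\<close>, which is unbounded in
  \<open>m\<close>.\<close>

lemma emeasure_stable_intensity_space: "emeasure \<nu> (space \<nu>) = \<infinity>"
proof -
  have "emeasure \<nu> (space \<nu>) = (\<integral>\<^sup>+x. 1 \<partial>\<nu>)" by simp
  also have "\<dots> = (\<integral>\<^sup>+s. levy_weight 0 s \<partial>lborel)"
    by (subst nn_integral_stable_intensity) (simp_all add: emeasure_space_1)
  finally have eq: "emeasure \<nu> (space \<nu>) = (\<integral>\<^sup>+s. levy_weight 0 s \<partial>lborel)" .
  have lower: "ennreal (m powr \<alpha> / Gamma (1 - \<alpha>)) \<le> (\<integral>\<^sup>+s. levy_weight 0 s \<partial>lborel)" if m: "m > 0" for m :: real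
  proof -
    have "ennreal (m powr \<alpha> / Gamma (1 - \<alpha>)) = ennreal (m powr (\<alpha> + 1) / Gamma (1 - \<alpha>)) * ennreal (1 / m)"
      using m Gamma_pos by (simp add: powr_add flip: ennreal_mult)
    also have "\<dots> = (\<integral>\<^sup>+s. ennreal (m powr (\<alpha> + 1) / Gamma (1 - \<alpha>)) * indicator {0<..<1 / m} s \<partial>lborel)"
      using m by (simp add: nn_integral_cmult_indicator)
    also have "\<dots> \<le> (\<integral>\<^sup>+s. levy_weight 0 s \<partial>lborel)"
    proof (intro nn_integral_mono)
      fix s :: real
      show "ennreal (m powr (\<alpha> + 1) / Gamma (1 - \<alpha>)) * indicator {0<..<1 / m} s \<le> levy_weight 0 s"
      proof (cases "s \<in> {0<..<1 / m}")
        case True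
        then have "(1 / m) powr (- \<alpha> - 1) \<le> s powr (- \<alpha> - 1)"
          using alpha by (intro powr_mono2') auto
        also have "(1 / m) powr (- \<alpha> - 1) = m powr (\<alpha> + 1)"
          using m powr_minus[of "1 / m" "\<alpha> + 1"] by (simp add: powr_divide inverse_eq_divide)
        finally show ?thesis using True Gamma_pos
          by (simp add: levy_weight_def divide_right_mono ennreal_leI)
      qed simp
    qed
    finally show ?thesis .
  qed
  show ?thesis
  proof (rule ccontr)
    assume "emeasure \<nu> (space \<nu>) \<noteq> \<infinity>"
    then obtain r where r: "(\<integral>\<^sup>+s. levy_weight 0 s \<partial>lborel) = ennreal r" "r \<ge> 0"
      unfolding eq by (cases "\<integral>\<^sup>+s. levy_weight 0 s \<partial>lborel") auto
    \<comment> \<open>Chosen so that the lower bound equals \<open>r + 1\<close>.\<close>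
    define m where "m = (Gamma (1 - \<alpha>) * (r + 1)) powr (1 / \<alpha>)"
    have m: "m > 0" using r Gamma_pos by (simp add: m_def)
    have "m powr \<alpha> = Gamma (1 - \<alpha>) * (r + 1)"
      using r Gamma_pos alpha by (simp add: m_def powr_powr)
    then have "m powr \<alpha> / Gamma (1 - \<alpha>) = r + 1" using Gamma_pos by simp
    with lower[OF m] r show False by simp
  qed
qed

text \<open>The point process has almost surely infinite mass and all its points have positive size,
  so the sum of the sizes cannot vanish.\<close>

lemma AE_crm_law_pos: "AE \<mu> in crm_law. emeasure \<mu> UNIV \<noteq> 0"
proof -
  have "AE N in L. emeasure (crm N) UNIV \<noteq> 0"
    using L.AE_infinite[OF sets.top emeasure_stable_intensity_space] AE_space
  proof eventually_elim
    case (elim N)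
    then have N: "sets N = sets \<nu>" by (simp add: L.space_L)
    have [measurable]: "fst \<in> borel_measurable N"
      by (simp_all add: measurable_cong_sets[OF N refl])
    show ?case
    proof
      assume "emeasure (crm N) UNIV = 0"
      then have "AE x in N. ennreal (fst x) = 0"
        by (simp add: emeasure_crm[OF N] nn_integral_0_iff_AE)
      moreover have "AE x in N. fst x > 0"
        by (rule AE_I2) (use sets_eq_imp_space_eq[OF N] in \<open>auto simp: space_stable_intensity\<close>)
      ultimately have "AE x in N. False" by eventually_elim (simp add: ennreal_eq_0_iff)
      then have "emeasure N (space N) = 0" using emeasure_eq_0_AE[of "\<lambda>_. True" N] by simp
      with elim sets_eq_imp_space_eq[OF N] show False by simp
    qed
  qed
  then show ?thesis
    unfolding crm_law_def by (subst AE_distr_iff) (auto intro!: measurable_sets_Collect)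
qed

text \<open>A beta integral. It is read off from \<open>nn_integral_gamma_ratio\<close> with a
  single ratio of shape \<open>1 - \<alpha>\<close> against shape \<open>a\<close>, where the test
  function 1 integrates to one.\<close>

lemma nn_integral_levy_weight_1:
  assumes a: "a > 0"
  shows "(\<integral>\<^sup>+s. levy_weight 1 s * ennreal ((1 + s) powr (- (a + 1 - \<alpha>))) \<partial>lborel) =
    ennreal (Gamma a / Gamma (a + 1 - \<alpha>))"
proof -
  interpret P: product_sigma_finite "\<lambda>i::unit. lborel :: real measure" ..
  interpret g: prob_space "gamma_law a" by (rule prob_space_gamma_law) fact
  interpret G: prob_space "\<Pi>\<^sub>M i\<in>{()}. gamma_law (1 - \<alpha>)"
    by (intro prob_space_PiM prob_space_gamma_law) (use alpha in simp)
  let ?X = "\<integral>\<^sup>+s. powr_pos (1 - \<alpha>) s * ennreal ((1 + s) powr (- (a + (1 - \<alpha>)))) \<partial>lborel"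
  have pos: "Gamma (a + (1 - \<alpha>)) > 0" "Gamma a > 0"
    using a alpha by (auto intro!: Gamma_real_pos)
  have "1 = ennreal (Gamma (a + (1 - \<alpha>)) / (Gamma a * Gamma (1 - \<alpha>))) *
      (\<integral>\<^sup>+r. powr_pos (1 - \<alpha>) (r ()) * ennreal ((1 + r ()) powr (- (a + (1 - \<alpha>))))
        \<partial>(\<Pi>\<^sub>M i\<in>{()}. lborel))"
    using nn_integral_gamma_ratio[of "{()}" a "\<lambda>_. 1 - \<alpha>" "\<lambda>_. 1"] a alpha
    by (simp add: G.emeasure_space_1 g.emeasure_space_1[simplified])
  also have "(\<integral>\<^sup>+r. powr_pos (1 - \<alpha>) (r ()) * ennreal ((1 + r ()) powr (- (a + (1 - \<alpha>))))
        \<partial>(\<Pi>\<^sub>M i\<in>{()}. lborel)) = ?X"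
    by (rule P.product_nn_integral_singleton) measurable
  finally have X: "1 = ennreal (Gamma (a + (1 - \<alpha>)) / (Gamma a * Gamma (1 - \<alpha>))) * ?X" .
  have "(\<integral>\<^sup>+s. levy_weight 1 s * ennreal ((1 + s) powr (- (a + 1 - \<alpha>))) \<partial>lborel) =
      (\<integral>\<^sup>+s. ennreal (1 / Gamma (1 - \<alpha>)) * (powr_pos (1 - \<alpha>) s * ennreal ((1 + s) powr (- (a + (1 - \<alpha>))))) \<partial>lborel)"
    by (simp add: levy_weight_powr_pos mult.assoc add_diff_eq)
  also have "\<dots> = ennreal (1 / Gamma (1 - \<alpha>)) * ?X"
    by (rule nn_integral_cmult) measurable
  also have "\<dots> = ennreal (Gamma a / Gamma (a + (1 - \<alpha>))) *
      (ennreal (Gamma (a + (1 - \<alpha>)) / (Gamma a * Gamma (1 - \<alpha>))) * ?X)"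
    using pos Gamma_pos by (simp add: mult.assoc[symmetric] ennreal_mult[symmetric])
  also have "\<dots> = ennreal (Gamma a / Gamma (a + (1 - \<alpha>)))"
    unfolding X[symmetric] by simp
  finally show ?thesis by (simp add: add_diff_eq)
qed

text \<open>The mean of the total mass is infinite, so finiteness cannot be read off from it.
  Instead \<open>s / (1 + s)\<close> has a finite integral, the beta integral with
  \<open>a = \<alpha>\<close>, which controls the small sizes. Large ones are excluded pathwise: the
  number of sizes above \<open>m + 1\<close> is a finite integer that decreases to zero, hence it is
  zero for some \<open>m\<close>, and then \<open>s\<close> is at most \<open>m + 2\<close> times
  \<open>s / (1 + s)\<close>.\<close>

lemma AE_crm_law_finite: "AE \<mu> in crm_law. emeasure \<mu> UNIV \<noteq> \<infinity>"
proof -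
  define f where "f x = ennreal (fst x / (1 + fst x))" for x :: "real \<times> 'a"
  have [measurable]: "f \<in> borel_measurable \<nu>" unfolding f_def by measurable
  have "(\<integral>\<^sup>+N. (\<integral>\<^sup>+x. f x \<partial>N) \<partial>L) = (\<integral>\<^sup>+x. f x \<partial>\<nu>)"
    using L.mecke[of f "\<lambda>_. 1"] by (simp add: L.emeasure_space_1)
  also have fin': "(\<integral>\<^sup>+x. f x \<partial>\<nu>) < \<infinity>"
  proof -
    have "(\<integral>\<^sup>+x. f x \<partial>\<nu>) = (\<integral>\<^sup>+s. levy_weight 0 s * ennreal (s / (1 + s)) \<partial>lborel)"
      by (subst nn_integral_stable_intensity) (simp_all add: f_def emeasure_space_1)
    also have "\<dots> = (\<integral>\<^sup>+s. levy_weight 1 s * ennreal ((1 + s) powr (- (\<alpha> + 1 - \<alpha>))) \<partial>lborel)"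
    proof (intro nn_integral_cong)
      fix s :: real
      show "levy_weight 0 s * ennreal (s / (1 + s)) = levy_weight 1 s * ennreal ((1 + s) powr (- (\<alpha> + 1 - \<alpha>)))"
      proof (cases "0 < s")
        case True
        then have "ennreal (s / (1 + s)) = ennreal s * ennreal ((1 + s) powr (- (\<alpha> + 1 - \<alpha>)))"
          by (simp add: ennreal_mult[symmetric] powr_minus divide_inverse)
        then show ?thesis by (simp add: mult.assoc[symmetric] levy_weight_Suc)
      qed (simp add: levy_weight_def)
    qed
    also have "\<dots> < \<infinity>" using alpha by (subst nn_integral_levy_weight_1) simp_all
    finally show ?thesis .
  qed
  finally have ae1: "AE N in L. (\<integral>\<^sup>+x. f x \<partial>N) \<noteq> \<infinity>"
    by (intro nn_integral_PInf_AE) (auto simp: L.measurable_L_iff)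
  define A where "A m = {x \<in> space \<nu>. fst x > real (Suc m)}" for m :: nat
  have A [measurable]: "A m \<in> sets \<nu>" for m unfolding A_def by measurable
  have Af: "indicator (A m) x \<le> 2 * f x" if "x \<in> space \<nu>" for m x
  proof (cases "x \<in> A m")
    case True
    then have "1 \<le> 2 * (fst x / (1 + fst x))" by (simp add: A_def field_simps)
    then have "ennreal 1 \<le> ennreal (2 * (fst x / (1 + fst x)))" by (rule ennreal_leI)
    also have "\<dots> = ennreal 2 * f x"
      unfolding f_def using True by (intro ennreal_mult) (auto simp: A_def)
    finally show ?thesis using True by simp
  qed simp
  have A2f: "emeasure N (A m) \<le> 2 * (\<integral>\<^sup>+x. f x \<partial>N)" if N: "sets N = sets \<nu>" for N m
  proof -
    have [measurable]: "f \<in> borel_measurable N" "A m \<in> sets N" by (simp_all add: measurable_cong_sets[OF N refl] N)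
    have "emeasure N (A m) = (\<integral>\<^sup>+x. indicator (A m) x \<partial>N)" by simp
    also have "\<dots> \<le> (\<integral>\<^sup>+x. 2 * f x \<partial>N)"
      by (intro nn_integral_mono Af) (use sets_eq_imp_space_eq[OF N] in simp)
    also have "\<dots> = 2 * (\<integral>\<^sup>+x. f x \<partial>N)" by (simp add: nn_integral_cmult)
    finally show ?thesis .
  qed
  have "emeasure \<nu> (A m) < \<infinity>" for m
    using A2f[of \<nu> m, OF refl] fin' by (auto simp: ennreal_mult_less_top intro: le_less_trans)
  then have "AE N in L. \<exists>k::nat. emeasure N (A m) = of_nat k" for m
    by (intro L.AE_integer_valued A)
  then have ae2: "AE N in L. \<forall>m. \<exists>k::nat. emeasure N (A m) = of_nat k"
    by (simp add: AE_all_countable)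
  have "AE N in L. emeasure (crm N) UNIV \<noteq> \<infinity>"
    using ae1 ae2 AE_space
  proof eventually_elim
    case (elim N)
    then have N: "sets N = sets \<nu>" by (simp add: L.space_L)
    note sp = sets_eq_imp_space_eq[OF N]
    have [measurable]: "f \<in> borel_measurable N" "A m \<in> sets N" "fst \<in> borel_measurable N" for m
      by (simp_all add: measurable_cong_sets[OF N refl] N)
    have "(\<lambda>m. emeasure N (A m)) \<longlonglongrightarrow> emeasure N (\<Inter>m. A m)"
    proof (rule Lim_emeasure_decseq)
      show "range A \<subseteq> sets N" by auto
      show "decseq A" by (rule decseq_SucI) (auto simp: A_def)
      show "emeasure N (A m) \<noteq> \<infinity>" for m
        using elim(1) A2f[OF N, of m] by (auto simp: ennreal_mult_eq_top_iff top_unique)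
    qed
    also have "(\<Inter>m. A m) = {}"
    proof -
      have "\<exists>m. x \<notin> A m" for x
      proof -
        obtain m :: nat where "fst x < real m" using reals_Archimedean2 by blast
        then have "x \<notin> A m" by (simp add: A_def)
        then show ?thesis ..
      qed
      then show ?thesis by blast
    qed
    finally have "(\<lambda>m. emeasure N (A m)) \<longlonglongrightarrow> 0" by simp
    then have "\<forall>\<^sub>F m in sequentially. emeasure N (A m) < 1"
      by (rule order_tendstoD) simp
    then obtain m where m: "emeasure N (A m) < 1" by (auto simp: eventually_sequentially)
    from elim(2) obtain k :: nat where k: "emeasure N (A m) = of_nat k" by blast
    with m have "k = 0" by (cases k) auto
    with k have null: "emeasure N (A m) = 0" by simp
    have "AE x in N. x \<notin> A m" by (rule AE_not_in) (simp add: null_sets_def null)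
    then have "AE x in N. ennreal (fst x) \<le> ennreal (real m + 2) * f x"
      using AE_space
    proof eventually_elim
      case (elim x)
      then have x: "0 < fst x" "fst x \<le> real m + 1"
        by (auto simp: sp A_def space_stable_intensity)
      then have "fst x * (1 + fst x) \<le> fst x * (real m + 2)" by (intro mult_left_mono) auto
      then have "fst x \<le> (real m + 2) * (fst x / (1 + fst x))"
        using x by (simp add: field_simps)
      then show ?case unfolding f_def by (subst ennreal_mult[symmetric]) (use x in \<open>auto intro: ennreal_leI\<close>)
    qed
    then have "(\<integral>\<^sup>+x. ennreal (fst x) \<partial>N) \<le> (\<integral>\<^sup>+x. ennreal (real m + 2) * f x \<partial>N)"
      by (rule nn_integral_mono_AE)
    also have "\<dots> = ennreal (real m + 2) * (\<integral>\<^sup>+x. f x \<partial>N)" by (rule nn_integral_cmult) measurable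
    also have "\<dots> < \<infinity>" using elim(1) by (simp add: ennreal_mult_less_top less_top)
    finally show ?case by (simp add: emeasure_crm[OF N])
  qed
  then show ?thesis
    unfolding crm_law_def by (subst AE_distr_iff) (auto intro!: measurable_sets_Collect)
qed

end

section \<open>Sampling from the random measure\<close>

context
  fixes A :: "'i set" and a :: 'i
  assumes a: "a \<notin> A"
begin

lemma partition_on_add_singleton:
  assumes p: "partition_on A p"
  shows "partition_on (insert a A) (insert {a} p)" "{a} \<notin> p"
proof -
  have sub: "\<And>D. D \<in> p \<Longrightarrow> a \<notin> D" using partition_onD1[OF p] a by blast
  have disj: "\<And>D E. D \<in> p \<Longrightarrow> E \<in> p \<Longrightarrow> D \<noteq> E \<Longrightarrow> disjnt D E"
    using p by (auto simp: partition_on_def pairwise_def)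
  show "partition_on (insert a A) (insert {a} p)"
  proof (rule partition_onI)
    show "\<Union> (insert {a} p) = insert a A" using p by (auto simp: partition_on_def)
    show "disjnt D E" if "D \<in> insert {a} p" "E \<in> insert {a} p" "D \<noteq> E" for D E
      using that disj[of D E] sub[of D] sub[of E] by (auto simp: disjnt_def)
    show "{} \<notin> insert {a} p" using p by (auto simp: partition_on_def)
  qed
  show "{a} \<notin> p" using sub by auto
qed

lemma partition_on_add_to_block:
  assumes p: "partition_on A p" and C: "C \<in> p"
  shows "partition_on (insert a A) (insert (insert a C) (p - {C}))"
    "{a} \<notin> insert (insert a C) (p - {C})" "insert a C \<notin> p"
proof -
  have sub: "\<And>D. D \<in> p \<Longrightarrow> a \<notin> D" using partition_onD1[OF p] a by blast
  have disj: "\<And>D E. D \<in> p \<Longrightarrow> E \<in> p \<Longrightarrow> D \<noteq> E \<Longrightarrow> disjnt D E"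
    using p by (auto simp: partition_on_def pairwise_def)
  show "partition_on (insert a A) (insert (insert a C) (p - {C}))"
  proof (rule partition_onI)
    show "\<Union> (insert (insert a C) (p - {C})) = insert a A"
      using p C by (auto simp: partition_on_def)
    show "disjnt D E" if "D \<in> insert (insert a C) (p - {C})" "E \<in> insert (insert a C) (p - {C})" "D \<noteq> E" for D E
      using that disj[of D E] disj[of C E] disj[of D C] sub[of D] sub[of E] C by (auto simp: disjnt_def)
    show "{} \<notin> insert (insert a C) (p - {C})"
      using partition_onD3[OF p] by auto
  qed
  show "insert a C \<notin> p" using sub by auto
  have "C \<noteq> {}" using partition_onD3[OF p] C by blast
  with sub C show "{a} \<notin> insert (insert a C) (p - {C})" by blast
qed

lemma partition_on_remove_singleton:
  assumes "partition_on (insert a A) q" "{a} \<in> q"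
  shows "partition_on A (q - {{a}})"
proof (rule partition_onI)
  have disj: "\<And>D E. D \<in> q \<Longrightarrow> E \<in> q \<Longrightarrow> D \<noteq> E \<Longrightarrow> disjnt D E"
    using assms by (auto simp: partition_on_def pairwise_def)
  show "\<Union> (q - {{a}}) = A"
  proof -
    have "\<Union> (q - {{a}}) = \<Union> q - {a}"
      using disj[OF _ assms(2)] by (auto simp: disjnt_def)
    then show ?thesis using assms a by (auto simp: partition_on_def)
  qed
  show "disjnt D E" if "D \<in> q - {{a}}" "E \<in> q - {{a}}" "D \<noteq> E" for D E
    using disj that by auto
  show "{} \<notin> q - {{a}}" using partition_onD3[OF assms(1)] by simp
qed

text \<open>Excluding the singleton block guarantees that the block left after deleting
  \<open>a\<close> is nonempty.\<close>

lemma partition_on_remove_from_block: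
  assumes q: "partition_on (insert a A) q" "{a} \<notin> q" and D: "D \<in> q" "a \<in> D"
  shows "partition_on A (insert (D - {a}) (q - {D}))" "D - {a} \<notin> q - {D}"
proof -
  have disj: "\<And>D E. D \<in> q \<Longrightarrow> E \<in> q \<Longrightarrow> D \<noteq> E \<Longrightarrow> disjnt D E"
    using q by (auto simp: partition_on_def pairwise_def)
  have ne: "D - {a} \<noteq> {}"
  proof
    assume "D - {a} = {}"
    then have "D = {a}" using D(2) by auto
    with q(2) D(1) show False by simp
  qed
  show "partition_on A (insert (D - {a}) (q - {D}))"
  proof (rule partition_onI)
    show "\<Union> (insert (D - {a}) (q - {D})) = A"
    proof -
      have "\<Union> (insert (D - {a}) (q - {D})) = \<Union> q - {a}"
        using disj[OF _ D(1)] D by (auto simp: disjnt_def)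
      then show ?thesis using partition_onD1[OF q(1)] a by auto
    qed
    show "disjnt E F" if "E \<in> insert (D - {a}) (q - {D})" "F \<in> insert (D - {a}) (q - {D})" "E \<noteq> F" for E F
      using that disj[of E F] disj[of D F] disj[of E D] D by (auto simp: disjnt_def)
    show "{} \<notin> insert (D - {a}) (q - {D})"
      using partition_onD3[OF q(1)] ne by auto
  qed
  show "D - {a} \<notin> q - {D}"
    using disj[OF _ D(1), of "D - {a}"] ne by (auto simp: disjnt_def)
qed

text \<open>A partition of the larger set arises either from a new singleton block or from adding
  \<open>a\<close> to one block \<open>C\<close>. Deleting \<open>a\<close> is the inverse operation
  and recovers \<open>p\<close> and \<open>C\<close>.\<close>

lemma sum_partition_on_insert:
  fixes f :: "'i set set \<Rightarrow> 'b::comm_monoid_add"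
  assumes A: "finite A"
  shows "(\<Sum>q | partition_on (insert a A) q. f q) =
    (\<Sum>p | partition_on A p. f (insert {a} p) + (\<Sum>C\<in>p. f (insert (insert a C) (p - {C}))))"
proof -
  have fin: "finite {p. partition_on A p}" "finite {q. partition_on (insert a A) q}"
    using A by (auto intro!: finitely_many_partition_on)
  have finp: "finite p" if "partition_on A p" for p
    using A that by (rule finite_elements)
  have "(\<Sum>q | partition_on (insert a A) q. f q) =
      (\<Sum>q | partition_on (insert a A) q \<and> {a} \<in> q. f q) + (\<Sum>q | partition_on (insert a A) q \<and> {a} \<notin> q. f q)"
    by (subst sum.union_disjoint[symmetric]) (use fin in \<open>auto intro!: sum.cong\<close>)
  also have "(\<Sum>q | partition_on (insert a A) q \<and> {a} \<in> q. f q) = (\<Sum>p | partition_on A p. f (insert {a} p))"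
    by (rule sum.reindex_bij_witness[where j = "\<lambda>q. q - {{a}}" and i = "insert {a}"])
      (use partition_on_add_singleton partition_on_remove_singleton in \<open>auto simp: insert_absorb\<close>)
  also have "(\<Sum>q | partition_on (insert a A) q \<and> {a} \<notin> q. f q) =
      (\<Sum>(p, C)\<in>Sigma {p. partition_on A p} (\<lambda>p. p). f (insert (insert a C) (p - {C})))"
  proof -
    \<comment> \<open>The union has a single member: \<open>D q\<close> is the block containing
      \<open>a\<close>.\<close>
    define D where "D q = \<Union>{E \<in> q. a \<in> E}" for q
    have D: "D q = E" if q: "partition_on (insert a A) q" and E: "E \<in> q" "a \<in> E" for q E
    proof -
      have "E' = E" if "E' \<in> q" "a \<in> E'" for E'
        using pairwiseD[OF partition_onD2[OF q] that(1) E(1)] that(2) E(2) by (auto simp: disjnt_def)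
      then have "{E' \<in> q. a \<in> E'} = {E}" using E by blast
      then show ?thesis by (simp add: D_def)
    qed
    have Dq: "D q \<in> q" "a \<in> D q" if q: "partition_on (insert a A) q" for q
    proof -
      obtain E where "E \<in> q" "a \<in> E" using partition_onD1[OF q] by blast
      with D[OF q this] show "D q \<in> q" "a \<in> D q" by simp_all
    qed
    show ?thesis
    proof (rule sum.reindex_bij_witness[where
          i = "\<lambda>(p, C). insert (insert a C) (p - {C})" and
          j = "\<lambda>q. (insert (D q - {a}) (q - {D q}), D q - {a})"])
      fix q assume "q \<in> {q. partition_on (insert a A) q \<and> {a} \<notin> q}"
      then have q: "partition_on (insert a A) q" "{a} \<notin> q" by auto
      note d = Dq[OF q(1)]
      note r = partition_on_remove_from_block[OF q d]
      have 1: "insert a (D q - {a}) = D q" using d(2) by auto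
      have "insert (D q - {a}) (q - {D q}) - {D q - {a}} = q - {D q}" using r(2) by simp
      then have 2: "insert (D q) (insert (D q - {a}) (q - {D q}) - {D q - {a}}) = q"
        using d(1) by (simp add: insert_absorb)
      show "(case (insert (D q - {a}) (q - {D q}), D q - {a}) of (p, C) \<Rightarrow> insert (insert a C) (p - {C})) = q"
        by (simp only: prod.case 1 2)
      show "(insert (D q - {a}) (q - {D q}), D q - {a}) \<in> Sigma {p. partition_on A p} (\<lambda>p. p)"
        using r(1) by simp
      show "(case (insert (D q - {a}) (q - {D q}), D q - {a}) of (p, C) \<Rightarrow> f (insert (insert a C) (p - {C}))) = f q"
        by (simp only: prod.case 1 2)
    next
      fix x assume x: "x \<in> Sigma {p. partition_on A p} (\<lambda>p. p)"
      obtain p C where pC: "x = (p, C)" "partition_on A p" "C \<in> p" using x by auto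
      note r = partition_on_add_to_block[OF pC(2,3)]
      have d: "D (insert (insert a C) (p - {C})) = insert a C" by (rule D[OF r(1)]) auto
      have aC: "a \<notin> C" using partition_onD1[OF pC(2)] pC(3) a by blast
      then have 1: "insert a C - {a} = C" by auto
      have "insert (insert a C) (p - {C}) - {insert a C} = p - {C}" using r(3) by auto
      then have 2: "insert C (insert (insert a C) (p - {C}) - {insert a C}) = p"
        using pC(3) by (simp add: insert_absorb)
      show "(case x of (p, C) \<Rightarrow> insert (insert a C) (p - {C})) \<in> {q. partition_on (insert a A) q \<and> {a} \<notin> q}"
        using r by (simp add: pC(1))
      show "(insert (D (case x of (p, C) \<Rightarrow> insert (insert a C) (p - {C})) - {a})
          ((case x of (p, C) \<Rightarrow> insert (insert a C) (p - {C})) - {D (case x of (p, C) \<Rightarrow> insert (insert a C) (p - {C}))}),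
          D (case x of (p, C) \<Rightarrow> insert (insert a C) (p - {C})) - {a}) = x"
        by (simp only: pC(1) prod.case d 1 2)
    qed
  qed
  also have "\<dots> = (\<Sum>p | partition_on A p. \<Sum>C\<in>p. f (insert (insert a C) (p - {C})))"
    using fin finp by (subst sum.Sigma) auto
  finally show ?thesis by (simp add: sum.distrib)
qed

end

section \<open>Relabelling coordinates\<close>

text \<open>Coordinates will be indexed by blocks, and a block becomes a different index when an
  element joins it; integrals over product spaces have to be carried along such renamings.\<close>

lemma nn_integral_PiM_reindex:
  fixes M :: "'b measure" and f :: "('j \<Rightarrow> 'b) \<Rightarrow> ennreal"
  assumes M: "sigma_finite_measure M" and I: "finite I" and g: "bij_betw g J I"
    and f [measurable]: "f \<in> borel_measurable (\<Pi>\<^sub>M j\<in>J. M)"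
  shows "(\<integral>\<^sup>+x. f x \<partial>(\<Pi>\<^sub>M j\<in>J. M)) = (\<integral>\<^sup>+x. f (\<lambda>j\<in>J. x (g j)) \<partial>(\<Pi>\<^sub>M i\<in>I. M))"
proof -
  interpret J: product_sigma_finite "\<lambda>_::'j. M" using M by (simp add: product_sigma_finite_def)
  interpret I: product_sigma_finite "\<lambda>_. M" using M by (simp add: product_sigma_finite_def)
  have J: "finite J" using I g by (simp add: bij_betw_finite)
  let ?h = "\<lambda>x. \<lambda>j\<in>J. x (g j)"
  have gI: "g j \<in> I" if "j \<in> J" for j using g that by (auto simp: bij_betw_def)
  have h [measurable]: "?h \<in> (\<Pi>\<^sub>M i\<in>I. M) \<rightarrow>\<^sub>M (\<Pi>\<^sub>M j\<in>J. M)"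
    by (intro measurable_restrict measurable_component_singleton gI)
  have "distr (\<Pi>\<^sub>M i\<in>I. M) (\<Pi>\<^sub>M j\<in>J. M) ?h = (\<Pi>\<^sub>M j\<in>J. M)"
  proof (rule J.PiM_eqI[OF J])
    fix A assume A: "\<And>j. j \<in> J \<Longrightarrow> A j \<in> sets M"
    define g' where "g' = inv_into J g"
    have g': "g' i \<in> J" "g (g' i) = i" if "i \<in> I" for i
      using that g by (auto simp: g'_def bij_betw_def inv_into_into f_inv_into_f)
    have g'g: "g' (g j) = j" if "j \<in> J" for j
      using that g by (auto simp: g'_def bij_betw_def inv_into_f_f)
    have "?h -` Pi\<^sub>E J A \<inter> space (\<Pi>\<^sub>M i\<in>I. M) = Pi\<^sub>E I (\<lambda>i. A (g' i))"
    proof (intro equalityI subsetI)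
      fix x assume x: "x \<in> ?h -` Pi\<^sub>E J A \<inter> space (\<Pi>\<^sub>M i\<in>I. M)"
      then have "x (g j) \<in> A j" if "j \<in> J" for j using that by (auto simp: PiE_iff)
      then have "x i \<in> A (g' i)" if "i \<in> I" for i using g'[OF that] by metis
      with x show "x \<in> Pi\<^sub>E I (\<lambda>i. A (g' i))" by (auto simp: space_PiM PiE_iff)
    next
      fix x assume x: "x \<in> Pi\<^sub>E I (\<lambda>i. A (g' i))"
      then have "x (g j) \<in> A j" if "j \<in> J" for j
        using gI[OF that] g'g[OF that] by (metis PiE_mem)
      moreover have "x i \<in> space M" if "i \<in> I" for i
        using x that A[OF g'(1)[OF that], THEN sets.sets_into_space] by auto
      ultimately show "x \<in> ?h -` Pi\<^sub>E J A \<inter> space (\<Pi>\<^sub>M i\<in>I. M)"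
        using x by (auto simp: space_PiM PiE_iff)
    qed
    then have "emeasure (distr (\<Pi>\<^sub>M i\<in>I. M) (\<Pi>\<^sub>M j\<in>J. M) ?h) (Pi\<^sub>E J A) =
        emeasure (\<Pi>\<^sub>M i\<in>I. M) (Pi\<^sub>E I (\<lambda>i. A (g' i)))"
      using A J by (subst emeasure_distr) (auto intro!: sets_PiM_I_finite)
    also have "\<dots> = (\<Prod>i\<in>I. emeasure M (A (g' i)))"
      using A g' I by (intro I.emeasure_PiM) auto
    also have "\<dots> = (\<Prod>j\<in>J. emeasure M (A j))"
      by (subst prod.reindex_bij_betw[OF g, symmetric]) (simp add: g'g cong: prod.cong)
    finally show "emeasure (distr (\<Pi>\<^sub>M i\<in>I. M) (\<Pi>\<^sub>M j\<in>J. M) ?h) (Pi\<^sub>E J A) = (\<Prod>j\<in>J. emeasure M (A j))" .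
  qed simp
  then have "(\<integral>\<^sup>+x. f x \<partial>(\<Pi>\<^sub>M j\<in>J. M)) = (\<integral>\<^sup>+x. f x \<partial>distr (\<Pi>\<^sub>M i\<in>I. M) (\<Pi>\<^sub>M j\<in>J. M) ?h)" by simp
  also have "\<dots> = (\<integral>\<^sup>+x. f (?h x) \<partial>(\<Pi>\<^sub>M i\<in>I. M))" by (rule nn_integral_distr) measurable
  finally show ?thesis .
qed

lemma add_atoms_reindex:
  assumes I: "finite I" and g: "bij_betw g J I"
    and eq: "\<And>j. j \<in> J \<Longrightarrow> s' j = s (g j)" "\<And>j. j \<in> J \<Longrightarrow> y' j = y (g j)"
  shows "add_atoms J s' y' \<mu> = add_atoms I s y \<mu>"
proof (rule measure_eqI)
  have J: "finite J" using I g by (simp add: bij_betw_finite)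
  fix A assume "A \<in> sets (add_atoms J s' y' \<mu>)"
  then have A: "A \<in> sets \<mu>" by simp
  have "(\<Sum>j\<in>J. ennreal (s' j) * indicator A (y' j)) = (\<Sum>j\<in>J. ennreal (s (g j)) * indicator A (y (g j)))"
    using eq by (intro sum.cong) auto
  also have "\<dots> = (\<Sum>i\<in>I. ennreal (s i) * indicator A (y i))"
    by (rule sum.reindex_bij_betw[OF g])
  finally show "emeasure (add_atoms J s' y' \<mu>) A = emeasure (add_atoms I s y \<mu>) A"
    unfolding emeasure_add_atoms[OF I A] emeasure_add_atoms[OF J A] by simp
qed simp

lemma add_atoms_cong:
  assumes "finite I" "\<And>i. i \<in> I \<Longrightarrow> s' i = s i" "\<And>i. i \<in> I \<Longrightarrow> y' i = y i"
  shows "add_atoms I s' y' \<mu> = add_atoms I s y \<mu>"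
  by (rule add_atoms_reindex[where g = id]) (use assms in auto)

section \<open>Iterating the Mecke equation\<close>

context stable_base
begin

lemma measurable_nn_integral_add_atoms [measurable (raw)]:
  assumes "finite I" "\<And>i. i \<in> I \<Longrightarrow> (\<lambda>x. S x i) \<in> borel_measurable M"
    and "\<And>i. i \<in> I \<Longrightarrow> (\<lambda>x. Y x i) \<in> M \<rightarrow>\<^sub>M borel" and \<phi> [measurable]: "\<phi> \<in> borel_measurable MA"
  shows "(\<lambda>x. \<integral>\<^sup>+\<mu>. \<phi> (add_atoms I (S x) (Y x) \<mu>) \<partial>crm_law) \<in> borel_measurable M"
proof (rule crm_law.borel_measurable_nn_integral)
  have "(\<lambda>z. add_atoms I (S (fst z)) (Y (fst z)) (snd z)) \<in> M \<Otimes>\<^sub>M crm_law \<rightarrow>\<^sub>M MA"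
    using assms(1)
  proof (rule measurable_add_atoms)
    show "(\<lambda>z. S (fst z) i) \<in> borel_measurable (M \<Otimes>\<^sub>M crm_law)" if "i \<in> I" for i
      by (rule measurable_compose[OF measurable_fst assms(2)[OF that]])
    show "(\<lambda>z. Y (fst z) i) \<in> M \<Otimes>\<^sub>M crm_law \<rightarrow>\<^sub>M borel" if "i \<in> I" for i
      by (rule measurable_compose[OF measurable_fst assms(3)[OF that]])
  qed measurable
  from measurable_compose[OF this \<phi>]
  show "(\<lambda>(x, \<mu>). \<phi> (add_atoms I (S x) (Y x) \<mu>)) \<in> borel_measurable (M \<Otimes>\<^sub>M crm_law)"
    by (simp add: split_beta')
qed

text \<open>
  The contribution of distinct atoms of the random measure, indexed by \<open>I\<close>, such that the
  atom \<open>i\<close> is chosen \<open>e i\<close> times and lies in \<open>B i\<close>.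
\<close>

definition atoms_integral ::
  "'i set \<Rightarrow> ('i \<Rightarrow> nat) \<Rightarrow> ('i \<Rightarrow> 'a set) \<Rightarrow> ('a measure \<Rightarrow> ennreal) \<Rightarrow> ennreal" where
  "atoms_integral I e B \<phi> =
     (\<integral>\<^sup>+s. (\<integral>\<^sup>+y. (\<Prod>i\<in>I. levy_weight (e i) (s i) * indicator (B i) (y i)) *
        (\<integral>\<^sup>+\<mu>. \<phi> (add_atoms I s y \<mu>) \<partial>crm_law) \<partial>(\<Pi>\<^sub>M i\<in>I. H)) \<partial>(\<Pi>\<^sub>M i\<in>I. lborel))"

lemma atoms_integral_cong:
  assumes "\<And>i. i \<in> I \<Longrightarrow> e i = e' i" "\<And>i. i \<in> I \<Longrightarrow> B i = B' i"
  shows "atoms_integral I e B \<phi> = atoms_integral I e' B' \<phi>"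
  unfolding atoms_integral_def using assms by (simp cong: prod.cong)

lemma sets_PiM_lborel_cong: "sets (\<Pi>\<^sub>M i\<in>I. (lborel :: real measure)) = sets (\<Pi>\<^sub>M i\<in>I. borel)"
  by (rule sets_PiM_cong) simp_all

lemma sets_PiM_H_cong: "sets (\<Pi>\<^sub>M i\<in>I. H) = sets (\<Pi>\<^sub>M i\<in>I. borel)"
  by (rule sets_PiM_cong) (simp_all add: sets_H)

declare sets_PiM_lborel_cong [measurable_cong] sets_PiM_H_cong [measurable_cong]

lemma measurable_atoms_weight:
  assumes "\<And>i. i \<in> I \<Longrightarrow> B i \<in> sets borel"
  shows "(\<lambda>(s, y). \<Prod>i\<in>I. levy_weight (e i) (s i) * indicator (B i) (y i))
    \<in> borel_measurable ((\<Pi>\<^sub>M i\<in>I. lborel) \<Otimes>\<^sub>M (\<Pi>\<^sub>M i\<in>I. H))"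
  unfolding split_beta'
proof (rule borel_measurable_prod_ennreal)
  fix i assume [simp]: "i \<in> I"
  have [measurable]: "B i \<in> sets borel" using assms by simp
  show "(\<lambda>x. levy_weight (e i) (fst x i) * indicator (B i) (snd x i))
      \<in> borel_measurable ((\<Pi>\<^sub>M i\<in>I. lborel) \<Otimes>\<^sub>M (\<Pi>\<^sub>M i\<in>I. H))"
    by measurable
qed

lemma measurable_atoms_integrand:
  assumes "finite I" "\<phi> \<in> borel_measurable MA"
  shows "(\<lambda>(s, y). \<integral>\<^sup>+\<mu>. \<phi> (add_atoms I s y \<mu>) \<partial>crm_law)
    \<in> borel_measurable ((\<Pi>\<^sub>M i\<in>I. lborel) \<Otimes>\<^sub>M (\<Pi>\<^sub>M i\<in>I. H))"
  unfolding split_beta'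
  by (rule measurable_nn_integral_add_atoms[OF assms(1) _ _ assms(2)]) measurable

lemma atoms_integral_reindex:
  assumes I: "finite I" and g: "bij_betw g J I"
    and eq: "\<And>j. j \<in> J \<Longrightarrow> e' j = e (g j)" "\<And>j. j \<in> J \<Longrightarrow> B' j = B (g j)"
    and B: "\<And>i. i \<in> I \<Longrightarrow> B i \<in> sets borel" and \<phi>: "\<phi> \<in> borel_measurable MA"
  shows "atoms_integral J e' B' \<phi> = atoms_integral I e B \<phi>"
proof -
  have J: "finite J" using I g by (simp add: bij_betw_finite)
  have gI: "g j \<in> I" if "j \<in> J" for j using g that by (auto simp: bij_betw_def)
  interpret HI: prob_space "\<Pi>\<^sub>M i\<in>I. H" by (rule prob_space_PiM) (rule prob_space_axioms)
  interpret HJ: prob_space "\<Pi>\<^sub>M i\<in>J. H" by (rule prob_space_PiM) (rule prob_space_axioms)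
  have B': "B' j \<in> sets borel" if "j \<in> J" for j using eq(2)[OF that] B[OF gI[OF that]] by simp
  have mJ [measurable]: "(\<lambda>(s, y). \<Prod>i\<in>J. levy_weight (e' i) (s i) * indicator (B' i) (y i))
      \<in> borel_measurable ((\<Pi>\<^sub>M i\<in>J. lborel) \<Otimes>\<^sub>M (\<Pi>\<^sub>M i\<in>J. H))"
    "(\<lambda>(s, y). \<integral>\<^sup>+\<mu>. \<phi> (add_atoms J s y \<mu>) \<partial>crm_law) \<in> borel_measurable ((\<Pi>\<^sub>M i\<in>J. lborel) \<Otimes>\<^sub>M (\<Pi>\<^sub>M i\<in>J. H))"
    by (rule measurable_atoms_weight, erule B', rule measurable_atoms_integrand[OF J \<phi>])
  let ?f = "\<lambda>s y. (\<Prod>i\<in>J. levy_weight (e' i) (s i) * indicator (B' i) (y i)) *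
        (\<integral>\<^sup>+\<mu>. \<phi> (add_atoms J s y \<mu>) \<partial>crm_law)"
  have f [measurable]: "(\<lambda>(s, y). ?f s y) \<in> borel_measurable ((\<Pi>\<^sub>M i\<in>J. lborel) \<Otimes>\<^sub>M (\<Pi>\<^sub>M i\<in>J. H))"
    using mJ unfolding split_beta' by (intro borel_measurable_times_ennreal)
  have "atoms_integral J e' B' \<phi> = (\<integral>\<^sup>+s. (\<integral>\<^sup>+y. ?f (\<lambda>j\<in>J. s (g j)) y \<partial>(\<Pi>\<^sub>M i\<in>J. H)) \<partial>(\<Pi>\<^sub>M i\<in>I. lborel))"
    unfolding atoms_integral_def
    by (rule nn_integral_PiM_reindex[OF sigma_finite_lborel I g HJ.borel_measurable_nn_integral]) (rule f)
  also have "\<dots> = (\<integral>\<^sup>+s. (\<integral>\<^sup>+y. ?f (\<lambda>j\<in>J. s (g j)) (\<lambda>j\<in>J. y (g j)) \<partial>(\<Pi>\<^sub>M i\<in>I. H)) \<partial>(\<Pi>\<^sub>M i\<in>I. lborel))"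
  proof (intro nn_integral_cong nn_integral_PiM_reindex[OF sigma_finite_measure_axioms I g])
    fix s :: "_ \<Rightarrow> real"
    have "(\<lambda>j\<in>J. s (g j)) \<in> space (\<Pi>\<^sub>M i\<in>J. lborel)" by (simp add: space_PiM)
    from measurable_compose[OF measurable_Pair1'[OF this] f]
    show "?f (\<lambda>j\<in>J. s (g j)) \<in> borel_measurable (\<Pi>\<^sub>M i\<in>J. H)" by simp
  qed
  also have "\<dots> = atoms_integral I e B \<phi>"
    unfolding atoms_integral_def
  proof (intro nn_integral_cong)
    fix s :: "_ \<Rightarrow> real" and y :: "_ \<Rightarrow> 'a"
    have "add_atoms J (\<lambda>j\<in>J. s (g j)) (\<lambda>j\<in>J. y (g j)) \<mu> = add_atoms I s y \<mu>" for \<mu>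
      by (rule add_atoms_reindex[OF I g]) auto
    moreover have "(\<Prod>j\<in>J. levy_weight (e' j) ((\<lambda>j\<in>J. s (g j)) j) * indicator (B' j) ((\<lambda>j\<in>J. y (g j)) j)) =
        (\<Prod>j\<in>J. levy_weight (e (g j)) (s (g j)) * indicator (B (g j)) (y (g j)) :: ennreal)"
      by (intro prod.cong) (auto simp: eq)
    moreover have "\<dots> = (\<Prod>i\<in>I. levy_weight (e i) (s i) * indicator (B i) (y i))"
      by (rule prod.reindex_bij_betw[OF g])
    ultimately show "?f (\<lambda>j\<in>J. s (g j)) (\<lambda>j\<in>J. y (g j)) =
        (\<Prod>i\<in>I. levy_weight (e i) (s i) * indicator (B i) (y i)) * (\<integral>\<^sup>+\<mu>. \<phi> (add_atoms I s y \<mu>) \<partial>crm_law)"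
      by simp
  qed
  finally show ?thesis .
qed

text \<open>Named, and with old and new coordinates as separate arguments, so that joint
  measurability can be stated once and used under every order of integration.\<close>

definition insert_integrand ::
  "'i \<Rightarrow> 'i set \<Rightarrow> ('a measure \<Rightarrow> ennreal) \<Rightarrow> ('i \<Rightarrow> real) \<Rightarrow> real \<Rightarrow> ('i \<Rightarrow> 'a) \<Rightarrow> 'a \<Rightarrow> ennreal" where
  "insert_integrand k I \<phi> s s' y y' =
     (\<integral>\<^sup>+\<mu>. \<phi> (add_atoms (insert k I) (s(k := s')) (y(k := y')) \<mu>) \<partial>crm_law)"

lemma measurable_insert_integrand:
  assumes I: "finite I" and \<phi>: "\<phi> \<in> borel_measurable MA"
    and a: "a \<in> M \<rightarrow>\<^sub>M (\<Pi>\<^sub>M i\<in>I. lborel)" and b: "b \<in> M \<rightarrow>\<^sub>M lborel"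
    and c: "c \<in> M \<rightarrow>\<^sub>M (\<Pi>\<^sub>M i\<in>I. H)" and d: "d \<in> M \<rightarrow>\<^sub>M H"
  shows "(\<lambda>x. insert_integrand k I \<phi> (a x) (b x) (c x) (d x)) \<in> borel_measurable M"
  unfolding insert_integrand_def
proof (rule measurable_nn_integral_add_atoms[OF _ _ _ \<phi>])
  fix i assume i: "i \<in> insert k I"
  have bd: "b \<in> borel_measurable M" "d \<in> M \<rightarrow>\<^sub>M borel"
    using b d by (simp_all add: measurable_cong_sets[OF refl sets_H])
  have ac: "(\<lambda>x. a x i) \<in> borel_measurable M" "(\<lambda>x. c x i) \<in> M \<rightarrow>\<^sub>M borel" if "i \<in> I"
    using measurable_compose[OF a measurable_component_singleton[OF that]]
      measurable_compose[OF c measurable_component_singleton[OF that]]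
    by (simp_all add: measurable_cong_sets[OF refl sets_H])
  show "(\<lambda>x. ((a x)(k := b x)) i) \<in> borel_measurable M" using i ac bd by (cases "i = k") auto
  show "(\<lambda>x. ((c x)(k := d x)) i) \<in> M \<rightarrow>\<^sub>M borel" using i ac bd by (cases "i = k") auto
qed (use I in simp)

text \<open>By Tonelli the coordinate \<open>k\<close> is integrated innermost. Its exponent is 1
  because a new atom has been chosen exactly once; this is the form that
  \<open>mecke_crm_law\<close> produces.\<close>

lemma atoms_integral_insert:
  assumes I: "finite I" and k: "k \<notin> I" and B: "\<And>i. i \<in> I \<Longrightarrow> B i \<in> sets borel"
    and C: "C \<in> sets borel" and \<phi> [measurable]: "\<phi> \<in> borel_measurable MA"
  shows "atoms_integral (insert k I) (e(k := 1)) (B(k := C)) \<phi> =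
    (\<integral>\<^sup>+s. (\<integral>\<^sup>+y. (\<Prod>i\<in>I. levy_weight (e i) (s i) * indicator (B i) (y i)) *
        (\<integral>\<^sup>+s'. levy_weight 1 s' * (\<integral>\<^sup>+y'. indicator C y' *
          (\<integral>\<^sup>+\<mu>. \<phi> (add_atoms (insert k I) (s(k := s')) (y(k := y')) \<mu>) \<partial>crm_law) \<partial>H) \<partial>lborel)
      \<partial>(\<Pi>\<^sub>M i\<in>I. H)) \<partial>(\<Pi>\<^sub>M i\<in>I. lborel))"
proof -
  let ?I = "insert k I" and ?B = "B(k := C)" and ?e = "e(k := 1)"
  interpret HI: prob_space "\<Pi>\<^sub>M i\<in>I. H" by (rule prob_space_PiM) (rule prob_space_axioms)
  interpret HJ: prob_space "\<Pi>\<^sub>M i\<in>?I. H" by (rule prob_space_PiM) (rule prob_space_axioms)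
  interpret PH: product_sigma_finite "\<lambda>_. H" by standard
  interpret PL: product_sigma_finite "\<lambda>_. lborel :: real measure" by standard
  interpret LH: pair_sigma_finite "lborel :: real measure" "\<Pi>\<^sub>M i\<in>I. H" ..
  have B': "?B i \<in> sets borel" if "i \<in> ?I" for i using B C that by auto
  note [measurable] = C
  have mI: "finite ?I" using I by simp
  have mJ: "(\<lambda>(s, y). \<Prod>i\<in>?I. levy_weight (?e i) (s i) * indicator (?B i) (y i))
      \<in> borel_measurable ((\<Pi>\<^sub>M i\<in>?I. lborel) \<Otimes>\<^sub>M (\<Pi>\<^sub>M i\<in>?I. H))"
    "(\<lambda>(s, y). \<integral>\<^sup>+\<mu>. \<phi> (add_atoms ?I s y \<mu>) \<partial>crm_law) \<in> borel_measurable ((\<Pi>\<^sub>M i\<in>?I. lborel) \<Otimes>\<^sub>M (\<Pi>\<^sub>M i\<in>?I. H))"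
    by (rule measurable_atoms_weight, erule B', rule measurable_atoms_integrand[OF mI \<phi>])
  let ?f = "\<lambda>s y. (\<Prod>i\<in>?I. levy_weight (?e i) (s i) * indicator (?B i) (y i)) *
        (\<integral>\<^sup>+\<mu>. \<phi> (add_atoms ?I s y \<mu>) \<partial>crm_law)"
  have f: "(\<lambda>(s, y). ?f s y) \<in> borel_measurable ((\<Pi>\<^sub>M i\<in>?I. lborel) \<Otimes>\<^sub>M (\<Pi>\<^sub>M i\<in>?I. H))"
    using mJ unfolding split_beta' by (intro borel_measurable_times_ennreal)
  define W where "W s y = (\<Prod>i\<in>I. levy_weight (e i) (s i) * indicator (B i) (y i))" for s y
  have W [measurable]: "(\<lambda>(s, y). W s y) \<in> borel_measurable ((\<Pi>\<^sub>M i\<in>I. lborel) \<Otimes>\<^sub>M (\<Pi>\<^sub>M i\<in>I. H))"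
    unfolding W_def by (rule measurable_atoms_weight) (rule B)
  define F where "F = insert_integrand k I \<phi>"
  note F_def' = F_def[unfolded fun_eq_iff, rule_format, unfolded insert_integrand_def]
  note [simp] = I
  note F [measurable (raw)] = measurable_insert_integrand[OF I \<phi>, of _ _ _ _ _ k, folded F_def]
  have "atoms_integral ?I ?e ?B \<phi> = (\<integral>\<^sup>+s. (\<integral>\<^sup>+s'. (\<integral>\<^sup>+y. ?f (s(k := s')) y \<partial>(\<Pi>\<^sub>M i\<in>?I. H)) \<partial>lborel) \<partial>(\<Pi>\<^sub>M i\<in>I. lborel))"
    unfolding atoms_integral_def
    by (rule PL.product_nn_integral_insert[OF I k HJ.borel_measurable_nn_integral]) (rule f)
  also have "\<dots> = (\<integral>\<^sup>+s. (\<integral>\<^sup>+s'. (\<integral>\<^sup>+y. (\<integral>\<^sup>+y'. ?f (s(k := s')) (y(k := y')) \<partial>H) \<partial>(\<Pi>\<^sub>M i\<in>I. H)) \<partial>lborel) \<partial>(\<Pi>\<^sub>M i\<in>I. lborel))"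
  proof (intro nn_integral_cong PH.product_nn_integral_insert[OF I k])
    fix s :: "_ \<Rightarrow> real" and s' :: real assume "s \<in> space (\<Pi>\<^sub>M i\<in>I. lborel)"
    then have "s(k := s') \<in> space (\<Pi>\<^sub>M i\<in>?I. lborel)" by (auto simp: space_PiM PiE_iff extensional_def)
    from measurable_compose[OF measurable_Pair1'[OF this] f]
    show "?f (s(k := s')) \<in> borel_measurable (\<Pi>\<^sub>M i\<in>?I. H)" by simp
  qed
  also have "\<dots> = (\<integral>\<^sup>+s. (\<integral>\<^sup>+s'. (\<integral>\<^sup>+y. (\<integral>\<^sup>+y'. W s y * (levy_weight 1 s' * (indicator C y' * F s s' y y')) \<partial>H) \<partial>(\<Pi>\<^sub>M i\<in>I. H)) \<partial>lborel) \<partial>(\<Pi>\<^sub>M i\<in>I. lborel))"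
  proof (intro nn_integral_cong)
    fix s :: "_ \<Rightarrow> real" and s' :: real and y :: "_ \<Rightarrow> 'a" and y' :: 'a
    have "(\<Prod>i\<in>I. levy_weight (?e i) ((s(k := s')) i) * indicator (?B i) ((y(k := y')) i)) = W s y"
      unfolding W_def using k by (intro prod.cong) auto
    then show "?f (s(k := s')) (y(k := y')) = W s y * (levy_weight 1 s' * (indicator C y' * F s s' y y'))"
      using I k by (simp add: F_def' mult_ac)
  qed
  also have "\<dots> = (\<integral>\<^sup>+s. (\<integral>\<^sup>+y. (\<integral>\<^sup>+s'. (\<integral>\<^sup>+y'. W s y * (levy_weight 1 s' * (indicator C y' * F s s' y y')) \<partial>H) \<partial>lborel) \<partial>(\<Pi>\<^sub>M i\<in>I. H)) \<partial>(\<Pi>\<^sub>M i\<in>I. lborel))"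
  proof (intro nn_integral_cong LH.Fubini'[symmetric])
    fix s :: "_ \<Rightarrow> real" assume [measurable]: "s \<in> space (\<Pi>\<^sub>M i\<in>I. lborel)"
    show "(\<lambda>(s', y). \<integral>\<^sup>+y'. W s y * (levy_weight 1 s' * (indicator C y' * F s s' y y')) \<partial>H)
        \<in> borel_measurable (lborel \<Otimes>\<^sub>M (\<Pi>\<^sub>M i\<in>I. H))"
      by measurable
  qed
  also have "\<dots> = (\<integral>\<^sup>+s. (\<integral>\<^sup>+y. W s y * (\<integral>\<^sup>+s'. levy_weight 1 s' * (\<integral>\<^sup>+y'. indicator C y' * F s s' y y' \<partial>H) \<partial>lborel) \<partial>(\<Pi>\<^sub>M i\<in>I. H)) \<partial>(\<Pi>\<^sub>M i\<in>I. lborel))"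
  proof (intro nn_integral_cong)
    fix s :: "_ \<Rightarrow> real" and y :: "_ \<Rightarrow> 'a"
    assume [measurable]: "s \<in> space (\<Pi>\<^sub>M i\<in>I. lborel)" "y \<in> space (\<Pi>\<^sub>M i\<in>I. H)"
    show "(\<integral>\<^sup>+s'. (\<integral>\<^sup>+y'. W s y * (levy_weight 1 s' * (indicator C y' * F s s' y y')) \<partial>H) \<partial>lborel) =
        W s y * (\<integral>\<^sup>+s'. levy_weight 1 s' * (\<integral>\<^sup>+y'. indicator C y' * F s s' y y' \<partial>H) \<partial>lborel)"
      by (simp add: nn_integral_cmult)
  qed
  finally show ?thesis unfolding W_def F_def' .
qed

text \<open>Given the atoms already extracted, a further factor evaluates either the remaining
  random measure, where the Mecke equation extracts a new atom \<open>k\<close>, or one of the old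
  atoms \<open>i\<close>, whose mass \<open>s i\<close> raises the exponent and whose location must
  now lie in \<open>C\<close> as well.\<close>

lemma atoms_integral_times_emeasure:
  fixes I :: "'i set"
  assumes I: "finite I" and k: "k \<notin> I" and B: "\<And>i. i \<in> I \<Longrightarrow> B i \<in> sets borel"
    and C: "C \<in> sets borel" and \<phi> [measurable]: "\<phi> \<in> borel_measurable MA"
  shows "atoms_integral I e B (\<lambda>\<mu>. \<phi> \<mu> * emeasure \<mu> C) =
    atoms_integral (insert k I) (e(k := 1)) (B(k := C)) \<phi> +
    (\<Sum>i\<in>I. atoms_integral I (e(i := Suc (e i))) (B(i := B i \<inter> C)) \<phi>)"
proof -
  let ?I = "insert k I"
  let ?P = "\<Pi>\<^sub>M i\<in>I. (lborel :: real measure)" and ?Q = "\<Pi>\<^sub>M i\<in>I. H"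
  interpret HI: prob_space ?Q by (rule prob_space_PiM) (rule prob_space_axioms)
  note [measurable] = C
  define W where "W s y = (\<Prod>i\<in>I. levy_weight (e i) (s i) * indicator (B i) (y i))" for s y
  have W [measurable]: "(\<lambda>(s, y). W s y) \<in> borel_measurable (?P \<Otimes>\<^sub>M ?Q)"
    unfolding W_def by (rule measurable_atoms_weight) (rule B)
  define F where "F s y = (\<integral>\<^sup>+\<mu>. \<phi> (add_atoms I s y \<mu>) \<partial>crm_law)" for s y
  have F [measurable]: "(\<lambda>(s, y). F s y) \<in> borel_measurable (?P \<Otimes>\<^sub>M ?Q)"
    unfolding F_def by (rule measurable_atoms_integrand[OF I \<phi>])
  define F' where "F' = insert_integrand k I \<phi>"
  note F'_def' = F'_def[unfolded fun_eq_iff, rule_format, unfolded insert_integrand_def]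
  note [measurable (raw)] = measurable_insert_integrand[OF I \<phi>, of _ _ _ _ _ k, folded F'_def]
  define X where "X s y = (\<integral>\<^sup>+s'. levy_weight 1 s' * (\<integral>\<^sup>+y'. indicator C y' * F' s s' y y' \<partial>H) \<partial>lborel)" for s y
  have X [measurable]: "(\<lambda>(s, y). X s y) \<in> borel_measurable (?P \<Otimes>\<^sub>M ?Q)"
    unfolding X_def by measurable
  have Z [measurable]: "(\<lambda>(s, y). \<Sum>i\<in>I. W s y * (ennreal (s i) * indicator C (y i) * F s y)) \<in> borel_measurable (?P \<Otimes>\<^sub>M ?Q)"
    unfolding split_beta' by (intro borel_measurable_sum) measurable
  have Zi [measurable]: "(\<lambda>(s, y). W s y * (ennreal (s i) * indicator C (y i) * F s y)) \<in> borel_measurable (?P \<Otimes>\<^sub>M ?Q)"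
    if "i \<in> I" for i using that by measurable
  have expand: "(\<integral>\<^sup>+\<mu>. \<phi> (add_atoms I s y \<mu>) * emeasure (add_atoms I s y \<mu>) C \<partial>crm_law) =
      X s y + (\<Sum>i\<in>I. ennreal (s i) * indicator C (y i)) * F s y" for s y
  proof -
    define \<phi>' where "\<phi>' \<mu> = \<phi> (add_atoms I s y \<mu>)" for \<mu>
    have a [measurable]: "(\<lambda>\<mu>. add_atoms I s y \<mu>) \<in> MA \<rightarrow>\<^sub>M MA"
      by (rule measurable_add_atoms[OF I]) simp_all
    have [measurable]: "\<phi>' \<in> borel_measurable MA" unfolding \<phi>'_def by measurable
    have "(\<integral>\<^sup>+\<mu>. \<phi> (add_atoms I s y \<mu>) * emeasure (add_atoms I s y \<mu>) C \<partial>crm_law) =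
        (\<integral>\<^sup>+\<mu>. emeasure \<mu> C * \<phi>' \<mu> + (\<Sum>i\<in>I. ennreal (s i) * indicator C (y i)) * \<phi>' \<mu> \<partial>crm_law)"
      by (intro nn_integral_cong)
        (simp add: space_crm_law emeasure_add_atoms[OF I] C \<phi>'_def distrib_left mult.commute del: sum_mult_indicator)
    also have "\<dots> = (\<integral>\<^sup>+\<mu>. emeasure \<mu> C * \<phi>' \<mu> \<partial>crm_law) + (\<Sum>i\<in>I. ennreal (s i) * indicator C (y i)) * F s y"
      unfolding F_def \<phi>'_def[symmetric] by (subst nn_integral_add) (simp_all add: nn_integral_cmult)
    also have "(\<integral>\<^sup>+\<mu>. emeasure \<mu> C * \<phi>' \<mu> \<partial>crm_law) = X s y"
    proof -
      \<comment> \<open>The Mecke equation adds the new atom before the old ones; addition of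
        measures makes the order immaterial.\<close>
      have "add_atoms I s y (add_atoms {k} (\<lambda>_. s') (\<lambda>_. y') \<mu>) = add_atoms ?I (s(k := s')) (y(k := y')) \<mu>" for s' y' \<mu>
      proof -
        have "add_atoms ?I (s(k := s')) (y(k := y')) \<mu> =
            add_atoms I (s(k := s')) (y(k := y')) (add_atoms {k} (s(k := s')) (y(k := y')) \<mu>)"
          by (rule add_atoms_insert[OF I k])
        also have "add_atoms {k} (s(k := s')) (y(k := y')) \<mu> = add_atoms {k} (\<lambda>_. s') (\<lambda>_. y') \<mu>"
          by (rule add_atoms_cong) auto
        also have "add_atoms I (s(k := s')) (y(k := y')) (add_atoms {k} (\<lambda>_. s') (\<lambda>_. y') \<mu>) =
            add_atoms I s y (add_atoms {k} (\<lambda>_. s') (\<lambda>_. y') \<mu>)"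
          using k by (intro add_atoms_cong I) auto
        finally show ?thesis ..
      qed
      then show ?thesis
        unfolding X_def F'_def' using mecke_crm_law[OF C, of \<phi>' k] by (simp add: \<phi>'_def)
    qed
    finally show ?thesis .
  qed
  have "atoms_integral I e B (\<lambda>\<mu>. \<phi> \<mu> * emeasure \<mu> C) =
      (\<integral>\<^sup>+s. (\<integral>\<^sup>+y. W s y * X s y + (\<Sum>i\<in>I. W s y * (ennreal (s i) * indicator C (y i) * F s y)) \<partial>?Q) \<partial>?P)"
    unfolding atoms_integral_def W_def[symmetric] expand
    by (intro nn_integral_cong) (simp only: distrib_left sum_distrib_right sum_distrib_left)
  also have "\<dots> = (\<integral>\<^sup>+s. (\<integral>\<^sup>+y. W s y * X s y \<partial>?Q) + (\<Sum>i\<in>I. \<integral>\<^sup>+y. W s y * (ennreal (s i) * indicator C (y i) * F s y) \<partial>?Q) \<partial>?P)"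
  proof (intro nn_integral_cong)
    fix s :: "'i \<Rightarrow> real" assume s [measurable]: "s \<in> space ?P"
    have m [measurable]: "(\<lambda>y. W s y * (ennreal (s i) * indicator C (y i) * F s y)) \<in> borel_measurable ?Q" if [simp]: "i \<in> I" for i
      by measurable
    have "(\<integral>\<^sup>+y. W s y * X s y + (\<Sum>i\<in>I. W s y * (ennreal (s i) * indicator C (y i) * F s y)) \<partial>?Q) =
        (\<integral>\<^sup>+y. W s y * X s y \<partial>?Q) + (\<integral>\<^sup>+y. (\<Sum>i\<in>I. W s y * (ennreal (s i) * indicator C (y i) * F s y)) \<partial>?Q)"
    proof (rule nn_integral_add)
      show "(\<lambda>y. W s y * X s y) \<in> borel_measurable ?Q" by measurable
      show "(\<lambda>y. \<Sum>i\<in>I. W s y * (ennreal (s i) * indicator C (y i) * F s y)) \<in> borel_measurable ?Q"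
        by (rule borel_measurable_sum) (rule m)
    qed
    also have "(\<integral>\<^sup>+y. (\<Sum>i\<in>I. W s y * (ennreal (s i) * indicator C (y i) * F s y)) \<partial>?Q) =
        (\<Sum>i\<in>I. \<integral>\<^sup>+y. W s y * (ennreal (s i) * indicator C (y i) * F s y) \<partial>?Q)"
      by (rule nn_integral_sum) (rule m)
    finally show "(\<integral>\<^sup>+y. W s y * X s y + (\<Sum>i\<in>I. W s y * (ennreal (s i) * indicator C (y i) * F s y)) \<partial>?Q) =
        (\<integral>\<^sup>+y. W s y * X s y \<partial>?Q) + (\<Sum>i\<in>I. \<integral>\<^sup>+y. W s y * (ennreal (s i) * indicator C (y i) * F s y) \<partial>?Q)" .
  qed
  also have "\<dots> = (\<integral>\<^sup>+s. (\<integral>\<^sup>+y. W s y * X s y \<partial>?Q) \<partial>?P) +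
      (\<Sum>i\<in>I. \<integral>\<^sup>+s. (\<integral>\<^sup>+y. W s y * (ennreal (s i) * indicator C (y i) * F s y) \<partial>?Q) \<partial>?P)"
  proof -
    have m: "(\<lambda>s. \<integral>\<^sup>+y. W s y * (ennreal (s i) * indicator C (y i) * F s y) \<partial>?Q) \<in> borel_measurable ?P" if "i \<in> I" for i
      using Zi[OF that] by (rule HI.borel_measurable_nn_integral)
    have m1: "(\<lambda>s. \<integral>\<^sup>+y. W s y * X s y \<partial>?Q) \<in> borel_measurable ?P" by measurable
    have m2: "(\<lambda>s. \<Sum>i\<in>I. \<integral>\<^sup>+y. W s y * (ennreal (s i) * indicator C (y i) * F s y) \<partial>?Q) \<in> borel_measurable ?P"
      by (rule borel_measurable_sum) (rule m)
    show ?thesis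
      unfolding nn_integral_add[OF m1 m2] by (subst nn_integral_sum) (simp_all add: m)
  qed
  also have "(\<integral>\<^sup>+s. (\<integral>\<^sup>+y. W s y * X s y \<partial>?Q) \<partial>?P) = atoms_integral ?I (e(k := 1)) (B(k := C)) \<phi>"
    unfolding W_def X_def F'_def' by (rule atoms_integral_insert[OF I k B C \<phi>, symmetric])
  also have "(\<Sum>i\<in>I. \<integral>\<^sup>+s. (\<integral>\<^sup>+y. W s y * (ennreal (s i) * indicator C (y i) * F s y) \<partial>?Q) \<partial>?P) =
      (\<Sum>i\<in>I. atoms_integral I (e(i := Suc (e i))) (B(i := B i \<inter> C)) \<phi>)"
    unfolding atoms_integral_def F_def[symmetric]
  proof (intro sum.cong refl nn_integral_cong)
    fix i and s :: "'i \<Rightarrow> real" and y :: "'i \<Rightarrow> 'a" assume i: "i \<in> I"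
    let ?W = "\<lambda>e B i. levy_weight (e i) (s i) * indicator (B i) (y i)"
    \<comment> \<open>Only the factor of \<open>i\<close> changes: one more power of
      \<open>s i\<close> and one more constraint on \<open>y i\<close>.\<close>
    have "W s y * (ennreal (s i) * indicator C (y i)) =
        ?W e B i * (ennreal (s i) * indicator C (y i)) * (\<Prod>j\<in>I - {i}. ?W e B j)"
      unfolding W_def prod.remove[OF I i] by (simp add: mult_ac)
    also have "?W e B i * (ennreal (s i) * indicator C (y i)) = ?W (e(i := Suc (e i))) (B(i := B i \<inter> C)) i"
      using levy_weight_Suc[of "e i" "s i"] by (simp add: indicator_def)
    also have "(\<Prod>j\<in>I - {i}. ?W e B j) = (\<Prod>j\<in>I - {i}. ?W (e(i := Suc (e i))) (B(i := B i \<inter> C)) j)"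
      by (intro prod.cong) auto
    also have "?W (e(i := Suc (e i))) (B(i := B i \<inter> C)) i * \<dots> =
        (\<Prod>j\<in>I. ?W (e(i := Suc (e i))) (B(i := B i \<inter> C)) j)"
      by (rule prod.remove[OF I i, symmetric])
    finally show "W s y * (ennreal (s i) * indicator C (y i) * F s y) =
        (\<Prod>j\<in>I. ?W (e(i := Suc (e i))) (B(i := B i \<inter> C)) j) * F s y"
      by (simp only: mult.assoc[symmetric])
  qed
  finally show ?thesis .
qed

text \<open>Induction on \<open>n\<close>: the last factor is absorbed into \<open>\<phi>\<close>,
  which is why \<open>\<phi>\<close> is generalized, and
  \<open>atoms_integral_times_emeasure\<close> then distributes it. Its two kinds of terms are those
  in which \<open>n + 1\<close> opens a block and those in which it joins one.\<close>

lemma nn_integral_crm_law_power: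
  fixes n :: nat
  assumes "\<And>i. i \<in> {1..n} \<Longrightarrow> B i \<in> sets borel" and "\<phi> \<in> borel_measurable MA"
  shows "(\<integral>\<^sup>+\<mu>. \<phi> \<mu> * (\<Prod>i\<in>{1..n}. emeasure \<mu> (B i)) \<partial>crm_law) =
    (\<Sum>p | partition_on {1..n} p. atoms_integral p card (\<lambda>C. \<Inter>i\<in>C. B i) \<phi>)"
  using assms
proof (induction n arbitrary: \<phi>)
  case 0
  have "add_atoms {} s y \<mu> = \<mu>" for s and y :: "nat set \<Rightarrow> 'a" and \<mu>
    by (rule measure_eqI) (simp_all add: emeasure_add_atoms)
  then show ?case
    by (simp add: partition_on_empty atoms_integral_def PiM_empty
        nn_integral_count_space_finite)
next
  case (Suc n)
  note \<phi> [measurable] = Suc.prems(2)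
  have Bn [measurable]: "B (Suc n) \<in> sets borel" using Suc.prems by simp
  let ?a = "Suc n"
  have "(\<integral>\<^sup>+\<mu>. \<phi> \<mu> * (\<Prod>i\<in>{1..Suc n}. emeasure \<mu> (B i)) \<partial>crm_law) =
      (\<integral>\<^sup>+\<mu>. (\<phi> \<mu> * emeasure \<mu> (B ?a)) * (\<Prod>i\<in>{1..n}. emeasure \<mu> (B i)) \<partial>crm_law)"
    by (intro nn_integral_cong) (simp add: mult_ac)
  also have "\<dots> = (\<Sum>p | partition_on {1..n} p. atoms_integral p card (\<lambda>C. \<Inter>i\<in>C. B i) (\<lambda>\<mu>. \<phi> \<mu> * emeasure \<mu> (B ?a)))"
    using Suc.prems by (intro Suc.IH) auto
  also have "\<dots> = (\<Sum>p | partition_on {1..n} p.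
      atoms_integral (insert {?a} p) card (\<lambda>C. \<Inter>i\<in>C. B i) \<phi> +
      (\<Sum>C\<in>p. atoms_integral (insert (insert ?a C) (p - {C})) card (\<lambda>C. \<Inter>i\<in>C. B i) \<phi>))"
  proof (intro sum.cong refl)
    fix p assume "p \<in> {p. partition_on {1..n} p}"
    then have p: "partition_on {1..n} p" by simp
    have fin: "finite p" by (rule finite_elements[OF _ p]) simp
    have a: "?a \<notin> {1..n}" by simp
    have sub: "C \<subseteq> {1..n}" "C \<noteq> {}" "finite C" if "C \<in> p" for C
    proof -
      show "C \<subseteq> {1..n}" using partition_onD1[OF p] that by blast
      then show "finite C" by (rule finite_subset) simp
      show "C \<noteq> {}" using partition_onD3[OF p] that by blast
    qed
    have B: "(\<Inter>i\<in>C. B i) \<in> sets borel" if "C \<in> p" for C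
      using sub[OF that] Suc.prems by (intro sets.finite_INT) auto
    have "atoms_integral p card (\<lambda>C. \<Inter>i\<in>C. B i) (\<lambda>\<mu>. \<phi> \<mu> * emeasure \<mu> (B ?a)) =
        atoms_integral (insert {?a} p) (card({?a} := 1)) ((\<lambda>C. \<Inter>i\<in>C. B i)({?a} := B ?a)) \<phi> +
        (\<Sum>C\<in>p. atoms_integral p (card(C := Suc (card C))) ((\<lambda>C. \<Inter>i\<in>C. B i)(C := (\<Inter>i\<in>C. B i) \<inter> B ?a)) \<phi>)"
      by (rule atoms_integral_times_emeasure[OF fin partition_on_add_singleton(2)[OF a p] B Bn \<phi>])
    also have "atoms_integral (insert {?a} p) (card({?a} := 1)) ((\<lambda>C. \<Inter>i\<in>C. B i)({?a} := B ?a)) \<phi> =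
        atoms_integral (insert {?a} p) card (\<lambda>C. \<Inter>i\<in>C. B i) \<phi>"
      by (rule atoms_integral_cong) auto
    also have "(\<Sum>C\<in>p. atoms_integral p (card(C := Suc (card C))) ((\<lambda>C. \<Inter>i\<in>C. B i)(C := (\<Inter>i\<in>C. B i) \<inter> B ?a)) \<phi>) =
        (\<Sum>C\<in>p. atoms_integral (insert (insert ?a C) (p - {C})) card (\<lambda>C. \<Inter>i\<in>C. B i) \<phi>)"
    proof (intro sum.cong refl)
      fix C assume C: "C \<in> p"
      note r = partition_on_add_to_block[OF a p C]
      have aD: "?a \<notin> D" if "D \<in> p" for D using sub(1)[OF that] by auto
      \<comment> \<open>Renames the enlarged block back to \<open>C\<close>; its cardinality and its
        location constraint are exactly the updated exponent and set.\<close>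
      define g where "g D = (if D = insert ?a C then C else D)" for D
      have g: "bij_betw g (insert (insert ?a C) (p - {C})) p"
        unfolding bij_betw_def
      proof
        show "inj_on g (insert (insert ?a C) (p - {C}))" using r by (auto simp: inj_on_def g_def)
        show "g ` insert (insert ?a C) (p - {C}) = p" using r C by (auto simp: g_def image_iff)
      qed
      show "atoms_integral p (card(C := Suc (card C))) ((\<lambda>C. \<Inter>i\<in>C. B i)(C := (\<Inter>i\<in>C. B i) \<inter> B ?a)) \<phi> =
        atoms_integral (insert (insert ?a C) (p - {C})) card (\<lambda>C. \<Inter>i\<in>C. B i) \<phi>"
      proof (rule atoms_integral_reindex[OF fin g, symmetric])
        fix D assume D: "D \<in> insert (insert ?a C) (p - {C})"
        show "card D = (card(C := Suc (card C))) (g D)"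
          using D sub[OF C] aD[OF C] r by (auto simp: g_def)
        show "(\<Inter>i\<in>D. B i) = ((\<lambda>C. \<Inter>i\<in>C. B i)(C := (\<Inter>i\<in>C. B i) \<inter> B ?a)) (g D)"
          using D r by (auto simp: g_def)
      next
        fix D assume "D \<in> p"
        then show "((\<lambda>C. \<Inter>i\<in>C. B i)(C := (\<Inter>i\<in>C. B i) \<inter> B ?a)) D \<in> sets borel"
          using B C by auto
      qed (rule \<phi>)
    qed
    finally show "atoms_integral p card (\<lambda>C. \<Inter>i\<in>C. B i) (\<lambda>\<mu>. \<phi> \<mu> * emeasure \<mu> (B ?a)) =
      atoms_integral (insert {?a} p) card (\<lambda>C. \<Inter>i\<in>C. B i) \<phi> +
      (\<Sum>C\<in>p. atoms_integral (insert (insert ?a C) (p - {C})) card (\<lambda>C. \<Inter>i\<in>C. B i) \<phi>)" .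
  qed
  also have "\<dots> = (\<Sum>q | partition_on (insert ?a {1..n}) q. atoms_integral q card (\<lambda>C. \<Inter>i\<in>C. B i) \<phi>)"
    by (rule sum_partition_on_insert[symmetric]) simp_all
  also have "insert ?a {1..n} = {1..Suc n}" by auto
  finally show ?case .
qed

end

section \<open>Normalization\<close>

lemma measurable_scale_measure [measurable (raw)]:
  assumes r [measurable]: "r \<in> borel_measurable M" and m: "m \<in> M \<rightarrow>\<^sub>M measure_algebra K"
  shows "(\<lambda>x. scale_measure (r x) (m x)) \<in> M \<rightarrow>\<^sub>M measure_algebra K"
proof (rule measurable_measure_algebraI)
  show "sets (scale_measure (r x) (m x)) = sets K" if "x \<in> space M" for x
    using measurable_space[OF m that] by (simp add: space_measure_algebra)
  fix A assume A: "A \<in> sets K"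
  have "(\<lambda>x. emeasure (m x) A) \<in> borel_measurable M"
    by (rule measurable_compose[OF m measurable_emeasure_measure_algebra[OF A]])
  then show "(\<lambda>x. emeasure (scale_measure (r x) (m x)) A) \<in> borel_measurable M" by simp
qed

lemma measurable_prob_algebra_measure_algebra [measurable (raw)]:
  assumes f: "f \<in> M \<rightarrow>\<^sub>M prob_algebra K"
  shows "f \<in> M \<rightarrow>\<^sub>M measure_algebra K"
proof (rule measurable_measure_algebraI)
  show "sets (f x) = sets K" if "x \<in> space M" for x
    using measurable_space[OF f that] by (simp add: space_prob_algebra)
  fix A assume "A \<in> sets K"
  from measurable_compose[OF measurable_prob_algebraD[OF f] measurable_emeasure_subprob_algebra[OF this]]
  show "(\<lambda>x. emeasure (f x) A) \<in> borel_measurable M" .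
qed

text \<open>\<open>measure_of\<close> does not by itself guarantee that the given set function is a
  measure; this identifies it with one. The two \<open>max 0\<close> reproduce the truncation in
  \<open>ennreal\<close>, since the product of two negative reals would otherwise count.\<close>

lemma mix_measure_eq_add_atoms:
  fixes Q :: "'a::topological_space measure"
  assumes p: "finite p" and Q: "sets Q = sets borel"
  shows "mix_measure p Q g G y =
    add_atoms p (\<lambda>C. max 0 (1 - g / (g + sum G p)) * max 0 (G C / sum G p)) y
      (scale_measure (ennreal (g / (g + sum G p))) Q)" (is "_ = ?M")
proof -
  have "mix_measure p Q g G y = measure_of UNIV (sets borel) (emeasure ?M)"
    unfolding mix_measure_def Let_def
  proof (rule measure_of_eq)
    fix B :: "'a set" assume "B \<in> sigma_sets UNIV (sets borel)"
    then have B: "B \<in> sets borel" using sets.sigma_sets_eq[of "borel :: 'a measure"] by simp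
    have e: "ennreal a * ennreal b = ennreal (max 0 a * max 0 b)" for a b :: real
      by (cases "a \<ge> 0"; cases "b \<ge> 0") (auto simp: ennreal_mult max_def ennreal_neg)
    show "ennreal (g / (g + sum G p)) * emeasure Q B +
        ennreal (1 - g / (g + sum G p)) * (\<Sum>C\<in>p. ennreal (G C / sum G p) * emeasure (return borel (y C)) B) =
        emeasure ?M B"
      using B Q by (subst emeasure_add_atoms[OF p])
        (simp_all only: sets_scale_measure emeasure_scale_measure emeasure_return sum_distrib_left e mult.assoc[symmetric])
  qed simp
  also have "\<dots> = measure_of (space ?M) (sets ?M) (emeasure ?M)"
    using Q sets_eq_imp_space_eq[OF Q] by (simp add: space_add_atoms space_scale_measure)
  also have "\<dots> = ?M" by (rule measure_of_of_measure)
  finally show ?thesis .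
qed

lemma measurable_mix_measure [measurable (raw)]:
  assumes p: "finite p" and Q [measurable]: "Q \<in> M \<rightarrow>\<^sub>M measure_algebra (borel :: 'a::topological_space measure)"
    and g [measurable]: "g \<in> borel_measurable M"
    and G [measurable]: "\<And>C. C \<in> p \<Longrightarrow> (\<lambda>x. G x C) \<in> borel_measurable M"
    and y: "\<And>C. C \<in> p \<Longrightarrow> (\<lambda>x. y x C) \<in> M \<rightarrow>\<^sub>M borel"
  shows "(\<lambda>x. mix_measure p (Q x) (g x) (G x) (y x)) \<in> M \<rightarrow>\<^sub>M measure_algebra borel"
proof -
  have S [measurable]: "(\<lambda>x. sum (G x) p) \<in> borel_measurable M"
    by (rule borel_measurable_sum) (rule G)
  have "(\<lambda>x. mix_measure p (Q x) (g x) (G x) (y x)) \<in> M \<rightarrow>\<^sub>M measure_algebra borel \<longleftrightarrow>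
    (\<lambda>x. add_atoms p (\<lambda>C. max 0 (1 - g x / (g x + sum (G x) p)) * max 0 (G x C / sum (G x) p)) (y x)
      (scale_measure (ennreal (g x / (g x + sum (G x) p))) (Q x))) \<in> M \<rightarrow>\<^sub>M measure_algebra borel"
    by (intro measurable_cong mix_measure_eq_add_atoms p)
      (use measurable_space[OF Q] in \<open>simp add: space_measure_algebra\<close>)
  also have "\<dots>"
  proof (rule measurable_add_atoms[OF p _ y])
    fix C assume "C \<in> p"
    note [measurable] = G[OF this]
    show "(\<lambda>x. max 0 (1 - g x / (g x + sum (G x) p)) * max 0 (G x C / sum (G x) p)) \<in> borel_measurable M"
      by measurable
  qed measurable
  finally show ?thesis .
qed

lemma mix_measure_cong:
  assumes "\<And>C. C \<in> p \<Longrightarrow> G C = G' C" "\<And>C. C \<in> p \<Longrightarrow> y C = y' C"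
  shows "mix_measure p Q g G y = mix_measure p Q g G' y'"
  unfolding mix_measure_def Let_def using assms by (simp cong: sum.cong)

text \<open>Only ratios of the weights enter, so one may divide by \<open>g\<close>. This reduces
  the gamma variables to the ratios \<open>G C / g\<close>.\<close>

lemma mix_measure_rescale:
  assumes "g > 0"
  shows "mix_measure p Q 1 (\<lambda>C. G C / g) y = mix_measure p Q g G y"
proof -
  have S: "(\<Sum>C\<in>p. G C / g) = sum G p / g" by (simp add: sum_divide_distrib)
  have 1: "1 / (1 + sum G p / g) = g / (g + sum G p)"
    using assms by (simp add: field_simps)
  have 2: "G C / g / (sum G p / g) = G C / sum G p" for C
    using assms by simp
  show ?thesis unfolding mix_measure_def Let_def S 1 2 ..
qed

section \<open>Normalizing and tilting the random measure\<close>

context stable_base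
begin

lemma prob_space_iff: "sets m = sets borel \<Longrightarrow> prob_space (m :: 'a measure) \<longleftrightarrow> emeasure m UNIV = 1"
  using sets_eq_imp_space_eq[of m borel] by (auto intro: prob_spaceI dest: prob_space.emeasure_space_1)

text \<open>Being a probability measure amounts to total mass one, a condition that is measurable in
  the measure.\<close>

lemma measurable_prob_or [measurable (raw)]:
  assumes f: "f \<in> M \<rightarrow>\<^sub>M MA"
  shows "(\<lambda>x. prob_or H (f x)) \<in> M \<rightarrow>\<^sub>M prob_algebra borel"
proof (rule measurable_prob_algebraI)
  have s: "sets (f x) = sets borel" if "x \<in> space M" for x
    using measurable_space[OF f that] by (simp add: space_measure_algebra)
  show pr: "prob_space (prob_or H (f x))" for x
    by (simp add: prob_or_def prob_space_axioms)
  show "(\<lambda>x. prob_or H (f x)) \<in> M \<rightarrow>\<^sub>M subprob_algebra borel"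
  proof (rule measurable_subprob_algebra)
    show "subprob_space (prob_or H (f x))" for x by (rule prob_space_imp_subprob_space[OF pr])
    show "sets (prob_or H (f x)) = sets borel" if "x \<in> space M" for x
      using s[OF that] by (simp add: prob_or_def sets_H)
    fix A :: "'a set" assume A: "A \<in> sets borel"
    have [measurable]: "(\<lambda>x. emeasure (f x) B) \<in> borel_measurable M" if "B \<in> sets borel" for B
      by (rule measurable_compose[OF f measurable_emeasure_measure_algebra[OF that]])
    note [measurable] = A
    have "(\<lambda>x. emeasure (prob_or H (f x)) A) \<in> borel_measurable M \<longleftrightarrow>
        (\<lambda>x. if emeasure (f x) UNIV = 1 then emeasure (f x) A else emeasure H A) \<in> borel_measurable M"
      by (intro measurable_cong) (simp add: prob_or_def prob_space_iff[OF s])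
    then show "(\<lambda>x. emeasure (prob_or H (f x)) A) \<in> borel_measurable M" by simp
  qed
qed

text \<open>For total mass 0 or \<open>\<infinity>\<close> the scaled measure is the zero measure,
  and the value is \<open>H\<close>.\<close>

definition normalize :: "'a measure \<Rightarrow> 'a measure" where
  "normalize \<mu> = prob_or H (scale_measure (1 / emeasure \<mu> UNIV) \<mu>)"

lemma measurable_normalize [measurable]: "normalize \<in> MA \<rightarrow>\<^sub>M prob_algebra borel"
  unfolding normalize_def by measurable

definition tilt :: "real \<Rightarrow> 'a measure \<Rightarrow> ennreal" where
  "tilt \<theta> \<mu> = ennreal (enn2real (emeasure \<mu> UNIV) powr (- \<theta>))"

lemma measurable_tilt [measurable]: "tilt \<theta> \<in> borel_measurable MA"
  unfolding tilt_def by measurable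

lemma normalize_eq:
  assumes "sets \<mu> = sets borel" "emeasure \<mu> UNIV = ennreal t" "t > 0"
  shows "normalize \<mu> = scale_measure (ennreal (1 / t)) \<mu>"
proof -
  have t: "1 / ennreal t = ennreal (1 / t)"
    using assms divide_ennreal[of 1 t] by simp
  have "emeasure (scale_measure (ennreal (1 / t)) \<mu>) UNIV = 1"
    using assms by (simp flip: ennreal_mult)
  then have "prob_space (scale_measure (ennreal (1 / t)) \<mu>)"
    by (subst prob_space_iff) (use assms in simp_all)
  then show ?thesis by (simp add: normalize_def prob_or_def assms(2) t)
qed

text \<open>With \<open>R = sum r p\<close>, the enlarged measure has mass
  \<open>t * (1 + R)\<close>. The original part keeps the share \<open>1 / (1 + R)\<close>, which is
  the mixing weight for \<open>g = 1\<close>, and the atom of \<open>C\<close> receives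
  \<open>r C / (1 + R)\<close>, the complementary weight times \<open>r C / R\<close>.\<close>

lemma normalize_add_atoms:
  fixes \<mu> :: "'a measure"
  assumes p: "finite p" "p \<noteq> {}" and \<mu>: "sets \<mu> = sets borel" "emeasure \<mu> UNIV = ennreal t" "t > 0"
    and r: "\<And>C. C \<in> p \<Longrightarrow> r C > 0"
  shows "normalize (add_atoms p (\<lambda>C. t * r C) y \<mu>) = prob_or H (mix_measure p (normalize \<mu>) 1 r y)"
    and "emeasure (add_atoms p (\<lambda>C. t * r C) y \<mu>) UNIV = ennreal (t * (1 + sum r p))"
proof -
  define R where "R = sum r p"
  have R: "R > 0" unfolding R_def using p r by (intro sum_pos) auto
  let ?A = "add_atoms p (\<lambda>C. t * r C) y \<mu>"
  have "emeasure ?A UNIV = ennreal t + (\<Sum>C\<in>p. ennreal (t * r C))"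
    using p \<mu> by (subst emeasure_add_atoms) (auto simp: sum_ennreal)
  also have "(\<Sum>C\<in>p. ennreal (t * r C)) = ennreal (t * R)"
    using \<mu> r by (subst sum_ennreal) (auto simp: R_def sum_distrib_left less_imp_le)
  also have "ennreal t + ennreal (t * R) = ennreal (t * (1 + R))"
    using \<mu> R by (simp add: distrib_left flip: ennreal_plus)
  finally show mass: "emeasure ?A UNIV = ennreal (t * (1 + sum r p))" unfolding R_def .
  have tR: "t * (1 + R) > 0" using \<mu> R by simp
  have N: "normalize \<mu> = scale_measure (ennreal (1 / t)) \<mu>" by (rule normalize_eq[OF \<mu>])
  have "scale_measure (ennreal (1 / (t * (1 + R)))) ?A = mix_measure p (normalize \<mu>) 1 r y"
  proof (rule measure_eqI)
    show "sets (scale_measure (ennreal (1 / (t * (1 + R)))) ?A) = sets (mix_measure p (normalize \<mu>) 1 r y)"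
      using \<mu> p by (subst mix_measure_eq_add_atoms) (simp_all add: N)
    fix B assume "B \<in> sets (scale_measure (ennreal (1 / (t * (1 + R)))) ?A)"
    then have B: "B \<in> sets \<mu>" by simp
    have "emeasure (scale_measure (ennreal (1 / (t * (1 + R)))) ?A) B =
        ennreal (1 / (t * (1 + R))) * emeasure \<mu> B +
        (\<Sum>C\<in>p. ennreal (1 / (t * (1 + R))) * ennreal (t * r C) * indicator B (y C))"
      by (simp only: emeasure_scale_measure emeasure_add_atoms[OF p(1) B] distrib_left sum_distrib_left mult.assoc)
    also have "\<dots> = ennreal (1 / (1 + R)) * ennreal (1 / t) * emeasure \<mu> B +
        (\<Sum>C\<in>p. ennreal (1 / (1 + R)) * ennreal (1 / t) * ennreal (t * r C) * indicator B (y C))"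
    proof -
      have "ennreal (1 / (t * (1 + R))) = ennreal (1 / (1 + R)) * ennreal (1 / t)"
        using \<mu> R by (simp add: mult.commute flip: ennreal_mult)
      then show ?thesis by simp
    qed
    also have "(\<Sum>C\<in>p. ennreal (1 / (1 + R)) * ennreal (1 / t) * ennreal (t * r C) * indicator B (y C)) =
        (\<Sum>C\<in>p. ennreal (max 0 (1 - 1 / (1 + R)) * max 0 (r C / R)) * indicator B (y C))"
    proof (intro sum.cong refl arg_cong2[where f = "(*)"])
      fix C assume "C \<in> p"
      then have rC: "r C > 0" by (rule r)
      have "1 / (1 + R) * (1 / t) * (t * r C) = max 0 (1 - 1 / (1 + R)) * max 0 (r C / R)"
      proof -
        have "1 - 1 / (1 + R) = R / (1 + R)" using R by (simp add: field_simps)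
        then have "max 0 (1 - 1 / (1 + R)) * max 0 (r C / R) = R / (1 + R) * (r C / R)"
          using R rC by simp
        also have "\<dots> = 1 / (1 + R) * (1 / t) * (t * r C)" using R \<mu>(3) by simp
        finally show ?thesis ..
      qed
      then show "ennreal (1 / (1 + R)) * ennreal (1 / t) * ennreal (t * r C) =
          ennreal (max 0 (1 - 1 / (1 + R)) * max 0 (r C / R))"
        using R rC \<mu> by (simp only: ennreal_mult[symmetric] less_imp_le divide_nonneg_nonneg mult_nonneg_nonneg
            add_nonneg_nonneg zero_le_one)
    qed
    also have "ennreal (1 / (1 + R)) * ennreal (1 / t) * emeasure \<mu> B + \<dots> =
        emeasure (mix_measure p (normalize \<mu>) 1 r y) B"
      using \<mu> p B by (subst mix_measure_eq_add_atoms)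
        (simp_all only: N sets_scale_measure emeasure_add_atoms emeasure_scale_measure R_def[symmetric] mult.assoc)
    finally show "emeasure (scale_measure (ennreal (1 / (t * (1 + R)))) ?A) B =
        emeasure (mix_measure p (normalize \<mu>) 1 r y) B" .
  qed
  moreover have "1 / ennreal (t * (1 + R)) = ennreal (1 / (t * (1 + R)))"
    using tR divide_ennreal[of 1 "t * (1 + R)"] by simp
  ultimately show "normalize ?A = prob_or H (mix_measure p (normalize \<mu>) 1 r y)"
    by (simp add: normalize_def mass R_def)
qed

lemma levy_weight_scale:
  assumes "t > 0"
  shows "levy_weight e (t * s) = ennreal (t powr (real e - \<alpha> - 1)) * levy_weight e s"
proof (cases "s > 0")
  case True
  then show ?thesis using assms Gamma_pos
    by (simp add: levy_weight_def powr_mult flip: ennreal_mult)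
qed (use assms in \<open>simp add: levy_weight_def zero_less_mult_iff\<close>)

text \<open>The change of variables \<open>s = T r\<close>, where \<open>T\<close> is the total mass of the random measure.\<close>

lemma atoms_integral_rescale:
  fixes p :: "nat set set"
  assumes p: "finite p" "p \<noteq> {}" and B: "\<And>C. C \<in> p \<Longrightarrow> B C \<in> sets borel"
    and \<psi> [measurable]: "\<psi> \<in> borel_measurable (prob_algebra borel)"
    and n: "n = (\<Sum>C\<in>p. e C)"
  shows "atoms_integral p e B (\<lambda>\<mu>. tilt (\<theta> + real n) \<mu> * \<psi> (normalize \<mu>)) =
    (\<integral>\<^sup>+r. (\<integral>\<^sup>+y. (\<Prod>C\<in>p. levy_weight (e C) (r C) * indicator (B C) (y C)) *
        (ennreal ((1 + sum r p) powr (- (\<theta> + real n))) *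
        (\<integral>\<^sup>+\<mu>. tilt (\<theta> + real (card p) * \<alpha>) \<mu> * \<psi> (prob_or H (mix_measure p (normalize \<mu>) 1 r y)) \<partial>crm_law))
      \<partial>(\<Pi>\<^sub>M C\<in>p. H)) \<partial>(\<Pi>\<^sub>M C\<in>p. lborel))"
proof -
  let ?P = "\<Pi>\<^sub>M C\<in>p. (lborel :: real measure)" and ?Q = "\<Pi>\<^sub>M C\<in>p. H"
  interpret HI: prob_space ?Q by (rule prob_space_PiM) (rule prob_space_axioms)
  interpret PL: product_sigma_finite "\<lambda>_::nat set. lborel :: real measure" by standard
  interpret PL: finite_product_sigma_finite "\<lambda>_::nat set. lborel :: real measure" p by standard (rule p)
  interpret QC: pair_sigma_finite ?Q crm_law ..
  interpret PC: pair_sigma_finite ?P crm_law ..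
  define \<phi> where "\<phi> \<mu> = tilt (\<theta> + real n) \<mu> * \<psi> (normalize \<mu>)" for \<mu>
  have \<phi> [measurable]: "\<phi> \<in> borel_measurable MA" unfolding \<phi>_def by measurable
  define W where "W s y = (\<Prod>C\<in>p. levy_weight (e C) (s C) * indicator (B C) (y C))" for s y
  have W [measurable]: "(\<lambda>(s, y). W s y) \<in> borel_measurable (?P \<Otimes>\<^sub>M ?Q)"
    unfolding W_def by (rule measurable_atoms_weight) (rule B)
  note [simp] = p(1)
  have m1 [measurable]: "(\<lambda>((s, y), \<mu>). \<phi> (add_atoms p s y \<mu>)) \<in> borel_measurable ((?P \<Otimes>\<^sub>M ?Q) \<Otimes>\<^sub>M crm_law)"
  proof -
    have "(\<lambda>z. add_atoms p (fst (fst z)) (snd (fst z)) (snd z)) \<in> (?P \<Otimes>\<^sub>M ?Q) \<Otimes>\<^sub>M crm_law \<rightarrow>\<^sub>M MA"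
      by (rule measurable_add_atoms[OF p(1)]) measurable
    from measurable_compose[OF this \<phi>] show ?thesis by (simp add: split_beta')
  qed
  define K where "K r y \<mu> = ennreal ((1 + sum r p) powr (- (\<theta> + real n))) *
     (tilt (\<theta> + real (card p) * \<alpha>) \<mu> * \<psi> (prob_or H (mix_measure p (normalize \<mu>) 1 r y)))" for r y \<mu>
  have m2 [measurable]: "(\<lambda>((r, y), \<mu>). \<psi> (prob_or H (mix_measure p (normalize \<mu>) 1 r y)))
      \<in> borel_measurable ((?P \<Otimes>\<^sub>M ?Q) \<Otimes>\<^sub>M crm_law)"
  proof -
    have "(\<lambda>z. mix_measure p (normalize (snd z)) 1 (fst (fst z)) (snd (fst z))) \<in> (?P \<Otimes>\<^sub>M ?Q) \<Otimes>\<^sub>M crm_law \<rightarrow>\<^sub>M MA"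
      by (rule measurable_mix_measure[OF p(1)]) measurable
    from measurable_compose[OF measurable_prob_or[OF this] \<psi>] show ?thesis by (simp add: split_beta')
  qed
  have R [measurable]: "(\<lambda>r. sum r p) \<in> borel_measurable ?P"
    by (rule borel_measurable_sum) simp
  have W': "(\<lambda>z. W (fst (fst z)) (snd (fst z))) \<in> borel_measurable ((?P \<Otimes>\<^sub>M ?Q) \<Otimes>\<^sub>M crm_law)"
    using measurable_compose[OF measurable_fst W] by (simp add: split_beta')
  have f [measurable]: "(\<lambda>((s, y), \<mu>). W s y * \<phi> (add_atoms p s y \<mu>)) \<in> borel_measurable ((?P \<Otimes>\<^sub>M ?Q) \<Otimes>\<^sub>M crm_law)"
    using borel_measurable_times_ennreal[OF W' m1[unfolded split_beta']] by (simp add: split_beta')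
  have k [measurable]: "(\<lambda>((r, y), \<mu>). W r y * K r y \<mu>) \<in> borel_measurable ((?P \<Otimes>\<^sub>M ?Q) \<Otimes>\<^sub>M crm_law)"
  proof -
    have "(\<lambda>z. ennreal ((1 + sum (fst (fst z)) p) powr (- (\<theta> + real n)))) \<in> borel_measurable ((?P \<Otimes>\<^sub>M ?Q) \<Otimes>\<^sub>M crm_law)"
      "(\<lambda>z. tilt (\<theta> + real (card p) * \<alpha>) (snd z)) \<in> borel_measurable ((?P \<Otimes>\<^sub>M ?Q) \<Otimes>\<^sub>M crm_law)"
      by measurable
    from borel_measurable_times_ennreal[OF W' borel_measurable_times_ennreal[OF this(1)
          borel_measurable_times_ennreal[OF this(2) m2[unfolded split_beta']]]]
    show ?thesis by (simp add: K_def split_beta')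
  qed
  \<comment> \<open>The scale of the substitution is the total mass of \<open>\<mu>\<close>, so
    \<open>\<mu>\<close> must be fixed first; its integral is moved outside before the substitution
    and back inside after it.\<close>
  have swap: "(\<integral>\<^sup>+s. (\<integral>\<^sup>+y. (\<integral>\<^sup>+\<mu>. f s y \<mu> \<partial>crm_law) \<partial>?Q) \<partial>?P) = (\<integral>\<^sup>+\<mu>. (\<integral>\<^sup>+s. (\<integral>\<^sup>+y. f s y \<mu> \<partial>?Q) \<partial>?P) \<partial>crm_law)"
    if f [measurable]: "(\<lambda>((s, y), \<mu>). f s y \<mu>) \<in> borel_measurable ((?P \<Otimes>\<^sub>M ?Q) \<Otimes>\<^sub>M crm_law)" for f :: "_ \<Rightarrow> _ \<Rightarrow> _ \<Rightarrow> ennreal"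
  proof -
    have "(\<integral>\<^sup>+s. (\<integral>\<^sup>+y. (\<integral>\<^sup>+\<mu>. f s y \<mu> \<partial>crm_law) \<partial>?Q) \<partial>?P) = (\<integral>\<^sup>+s. (\<integral>\<^sup>+\<mu>. (\<integral>\<^sup>+y. f s y \<mu> \<partial>?Q) \<partial>crm_law) \<partial>?P)"
    proof (intro nn_integral_cong QC.Fubini'[symmetric])
      fix s assume s: "s \<in> space ?P"
      have "(\<lambda>z. ((s, fst z), snd z)) \<in> ?Q \<Otimes>\<^sub>M crm_law \<rightarrow>\<^sub>M ((?P \<Otimes>\<^sub>M ?Q) \<Otimes>\<^sub>M crm_law)"
        using s by measurable
      from measurable_compose[OF this f]
      show "(\<lambda>(y, \<mu>). f s y \<mu>) \<in> borel_measurable (?Q \<Otimes>\<^sub>M crm_law)" by (simp add: split_beta')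
    qed
    also have "\<dots> = (\<integral>\<^sup>+\<mu>. (\<integral>\<^sup>+s. (\<integral>\<^sup>+y. f s y \<mu> \<partial>?Q) \<partial>?P) \<partial>crm_law)"
    proof (rule PC.Fubini'[symmetric])
      have "(\<lambda>z. ((fst (fst z), snd z), snd (fst z))) \<in> (?P \<Otimes>\<^sub>M crm_law) \<Otimes>\<^sub>M ?Q \<rightarrow>\<^sub>M ((?P \<Otimes>\<^sub>M ?Q) \<Otimes>\<^sub>M crm_law)"
        by measurable
      from measurable_compose[OF this f]
      have "(\<lambda>((s, \<mu>), y). f s y \<mu>) \<in> borel_measurable ((?P \<Otimes>\<^sub>M crm_law) \<Otimes>\<^sub>M ?Q)"
        by (simp add: split_beta')
      from HI.borel_measurable_nn_integral[of "\<lambda>(s, \<mu>) y. f s y \<mu>", unfolded split_beta'] this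
      show "(\<lambda>(s, \<mu>). \<integral>\<^sup>+y. f s y \<mu> \<partial>?Q) \<in> borel_measurable (?P \<Otimes>\<^sub>M crm_law)"
        by (simp add: split_beta')
    qed
    finally show ?thesis .
  qed
  have "atoms_integral p e B \<phi> = (\<integral>\<^sup>+s. (\<integral>\<^sup>+y. (\<integral>\<^sup>+\<mu>. W s y * \<phi> (add_atoms p s y \<mu>) \<partial>crm_law) \<partial>?Q) \<partial>?P)"
    unfolding atoms_integral_def W_def[symmetric]
  proof (intro nn_integral_cong nn_integral_cmult[symmetric])
    fix s y
    have "(\<lambda>\<mu>. add_atoms p s y \<mu>) \<in> crm_law \<rightarrow>\<^sub>M MA"
      by (rule measurable_add_atoms[OF p(1)]) (simp_all add: measurable_ident_sets)
    from measurable_compose[OF this \<phi>]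
    show "(\<lambda>\<mu>. \<phi> (add_atoms p s y \<mu>)) \<in> borel_measurable crm_law" .
  qed
  also have "\<dots> = (\<integral>\<^sup>+\<mu>. (\<integral>\<^sup>+s. (\<integral>\<^sup>+y. W s y * \<phi> (add_atoms p s y \<mu>) \<partial>?Q) \<partial>?P) \<partial>crm_law)"
    by (rule swap) (rule f)
  also have "\<dots> = (\<integral>\<^sup>+\<mu>. (\<integral>\<^sup>+r. (\<integral>\<^sup>+y. W r y * K r y \<mu> \<partial>?Q) \<partial>?P) \<partial>crm_law)"
  proof (rule nn_integral_cong_AE)
    show "AE \<mu> in crm_law. (\<integral>\<^sup>+s. (\<integral>\<^sup>+y. W s y * \<phi> (add_atoms p s y \<mu>) \<partial>?Q) \<partial>?P) =
        (\<integral>\<^sup>+r. (\<integral>\<^sup>+y. W r y * K r y \<mu> \<partial>?Q) \<partial>?P)"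
      using AE_crm_law_pos AE_crm_law_finite AE_space
    proof eventually_elim
      case (elim \<mu>)
      then have \<mu>: "sets \<mu> = sets borel" by (simp add: space_crm_law)
      obtain t where t: "emeasure \<mu> UNIV = ennreal t" "t > 0"
        using elim by (cases "emeasure \<mu> UNIV") (auto simp: ennreal_eq_0_iff)
      have fm: "(\<lambda>(s, y). W s y * \<phi> (add_atoms p s y \<mu>)) \<in> borel_measurable (?P \<Otimes>\<^sub>M ?Q)"
      proof -
        have "(\<lambda>z. (z, \<mu>)) \<in> ?P \<Otimes>\<^sub>M ?Q \<rightarrow>\<^sub>M ((?P \<Otimes>\<^sub>M ?Q) \<Otimes>\<^sub>M crm_law)"
          using elim(3) by measurable
        from measurable_compose[OF this f] show ?thesis by (simp add: split_beta')
      qed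
      have Wm: "(\<lambda>y. W s y * \<phi> (add_atoms p s y \<mu>)) \<in> borel_measurable ?Q" if "s \<in> space ?P" for s
        using measurable_compose[OF measurable_Pair1'[OF that] fm] by simp
      have "(\<integral>\<^sup>+s. (\<integral>\<^sup>+y. W s y * \<phi> (add_atoms p s y \<mu>) \<partial>?Q) \<partial>?P) =
          ennreal (t ^ card p) * (\<integral>\<^sup>+r. (\<integral>\<^sup>+y. W (\<lambda>C\<in>p. t * r C) y * \<phi> (add_atoms p (\<lambda>C\<in>p. t * r C) y \<mu>) \<partial>?Q) \<partial>?P)"
        by (rule nn_integral_PiM_lborel_scale[OF p(1) t(2) HI.borel_measurable_nn_integral[OF fm]])
      also have "\<dots> = (\<integral>\<^sup>+r. (\<integral>\<^sup>+y. ennreal (t ^ card p) * (W (\<lambda>C\<in>p. t * r C) y * \<phi> (add_atoms p (\<lambda>C\<in>p. t * r C) y \<mu>)) \<partial>?Q) \<partial>?P)"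
      proof -
        have h: "(\<lambda>r. \<lambda>C\<in>p. t * r C) \<in> ?P \<rightarrow>\<^sub>M ?P" by measurable
        have "(\<lambda>r. \<integral>\<^sup>+y. W (\<lambda>C\<in>p. t * r C) y * \<phi> (add_atoms p (\<lambda>C\<in>p. t * r C) y \<mu>) \<partial>?Q) \<in> borel_measurable ?P"
          using measurable_compose[OF h HI.borel_measurable_nn_integral[OF fm]] by simp
        from nn_integral_cmult[OF this, symmetric]
        show ?thesis
          by (simp only:) (intro nn_integral_cong nn_integral_cmult[symmetric] Wm, simp add: space_PiM)
      qed
      also have "\<dots> = (\<integral>\<^sup>+r. (\<integral>\<^sup>+y. W r y * K r y \<mu> \<partial>?Q) \<partial>?P)"
      proof (intro nn_integral_cong)
        fix r y
        have a: "add_atoms p (\<lambda>C\<in>p. t * r C) y \<mu> = add_atoms p (\<lambda>C. t * r C) y \<mu>"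
          by (rule add_atoms_cong) auto
        have W1: "W (\<lambda>C\<in>p. t * r C) y = ennreal (\<Prod>C\<in>p. t powr (real (e C) - \<alpha> - 1)) * W r y"
          unfolding W_def
          by (subst prod_ennreal[symmetric]) (simp_all add: levy_weight_scale[OF t(2)] mult.assoc flip: prod.distrib cong: prod.cong)
        have W2: "(\<Prod>C\<in>p. t powr (real (e C) - \<alpha> - 1)) = t powr (real n - real (card p) * \<alpha> - real (card p))"
          using p t by (simp add: powr_sum[symmetric] sum_subtractf n)
        show "ennreal (t ^ card p) * (W (\<lambda>C\<in>p. t * r C) y * \<phi> (add_atoms p (\<lambda>C\<in>p. t * r C) y \<mu>)) = W r y * K r y \<mu>"
        proof (cases "\<forall>C\<in>p. r C > 0")
          case True
          have na: "normalize (add_atoms p (\<lambda>C. t * r C) y \<mu>) = prob_or H (mix_measure p (normalize \<mu>) 1 r y)"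
            "emeasure (add_atoms p (\<lambda>C. t * r C) y \<mu>) UNIV = ennreal (t * (1 + sum r p))"
            by (rule normalize_add_atoms[OF p \<mu> t], use True in blast)+
          have R1: "1 + sum r p > 0" using True by (intro add_pos_nonneg sum_nonneg) (auto simp: less_imp_le)
          have tl: "tilt (\<theta> + real n) (add_atoms p (\<lambda>C. t * r C) y \<mu>) =
              ennreal (t powr (- (\<theta> + real n)) * (1 + sum r p) powr (- (\<theta> + real n)))"
            using t R1 na(2) by (simp add: tilt_def powr_mult)
          have tl': "tilt (\<theta> + real (card p) * \<alpha>) \<mu> = ennreal (t powr (- (\<theta> + real (card p) * \<alpha>)))"
            using t by (simp add: tilt_def)
          \<comment> \<open>The exponents come from the Jacobian, the atom weights and the tilt;
            they add up to the new tilting exponent.\<close>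
          have "t ^ card p * t powr (real n - real (card p) * \<alpha> - real (card p)) * t powr (- (\<theta> + real n)) =
              t powr (- (\<theta> + real (card p) * \<alpha>))"
            using t by (simp add: powr_realpow[symmetric] powr_add[symmetric] algebra_simps)
          then have e: "t ^ card p * t powr (real n - real (card p) * \<alpha> - real (card p)) *
              (t powr (- (\<theta> + real n)) * (1 + sum r p) powr (- (\<theta> + real n))) =
              (1 + sum r p) powr (- (\<theta> + real n)) * t powr (- (\<theta> + real (card p) * \<alpha>))"
            by (simp only: mult.assoc[symmetric]) (simp only: mult.commute)
          have c: "ennreal (t ^ card p) * ennreal (t powr (real n - real (card p) * \<alpha> - real (card p))) *
              ennreal (t powr (- (\<theta> + real n)) * (1 + sum r p) powr (- (\<theta> + real n))) =
              ennreal ((1 + sum r p) powr (- (\<theta> + real n))) * ennreal (t powr (- (\<theta> + real (card p) * \<alpha>)))"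
            using t e by (simp only: ennreal_mult[symmetric] powr_ge_zero mult_nonneg_nonneg zero_le_power less_imp_le)
          have "ennreal (t ^ card p) * (W (\<lambda>C\<in>p. t * r C) y * \<phi> (add_atoms p (\<lambda>C\<in>p. t * r C) y \<mu>)) =
              (ennreal (t ^ card p) * ennreal (t powr (real n - real (card p) * \<alpha> - real (card p))) *
              ennreal (t powr (- (\<theta> + real n)) * (1 + sum r p) powr (- (\<theta> + real n)))) * W r y *
              \<psi> (prob_or H (mix_measure p (normalize \<mu>) 1 r y))"
            unfolding a W1 W2 \<phi>_def tl na(1) by (simp only: mult_ac)
          then show ?thesis unfolding c K_def tl' by (simp only: mult_ac)
        next
          \<comment> \<open>If some \<open>r C\<close> is not positive, its
            \<open>levy_weight\<close> vanishes and so do both sides.\<close>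
          case False
          then obtain C where C: "C \<in> p" "\<not> r C > 0" by auto
          then have "levy_weight (e C) (r C) * indicator (B C) (y C) = 0" by (simp add: levy_weight_def)
          with C(1) p(1) have "W r y = 0"
            unfolding W_def by (intro prod_zero) blast+
          then show ?thesis unfolding W1 by simp
        qed
      qed
      finally show ?case .
    qed
  qed
  also have "\<dots> = (\<integral>\<^sup>+r. (\<integral>\<^sup>+y. (\<integral>\<^sup>+\<mu>. W r y * K r y \<mu> \<partial>crm_law) \<partial>?Q) \<partial>?P)"
    by (rule swap[symmetric]) (rule k)
  also have "\<dots> = (\<integral>\<^sup>+r. (\<integral>\<^sup>+y. W r y * (ennreal ((1 + sum r p) powr (- (\<theta> + real n))) *
        (\<integral>\<^sup>+\<mu>. tilt (\<theta> + real (card p) * \<alpha>) \<mu> * \<psi> (prob_or H (mix_measure p (normalize \<mu>) 1 r y)) \<partial>crm_law))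
      \<partial>?Q) \<partial>?P)"
  proof (intro nn_integral_cong)
    fix r y assume ry: "r \<in> space ?P" "y \<in> space ?Q"
    have "(\<lambda>\<mu>. ((r, y), \<mu>)) \<in> crm_law \<rightarrow>\<^sub>M ((?P \<Otimes>\<^sub>M ?Q) \<Otimes>\<^sub>M crm_law)"
      using ry by (intro measurable_Pair1') (simp add: space_pair_measure)
    from measurable_compose[OF this m2]
    have "(\<lambda>\<mu>. \<psi> (prob_or H (mix_measure p (normalize \<mu>) 1 r y))) \<in> borel_measurable crm_law" by simp
    moreover have "tilt (\<theta> + real (card p) * \<alpha>) \<in> borel_measurable crm_law"
      using measurable_tilt by (simp add: measurable_cong_sets[OF sets_crm_law refl])
    ultimately have m3: "(\<lambda>\<mu>. tilt (\<theta> + real (card p) * \<alpha>) \<mu> * \<psi> (prob_or H (mix_measure p (normalize \<mu>) 1 r y)))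
        \<in> borel_measurable crm_law"
      by (intro borel_measurable_times_ennreal)
    show "(\<integral>\<^sup>+\<mu>. W r y * K r y \<mu> \<partial>crm_law) = W r y * (ennreal ((1 + sum r p) powr (- (\<theta> + real n))) *
        (\<integral>\<^sup>+\<mu>. tilt (\<theta> + real (card p) * \<alpha>) \<mu> * \<psi> (prob_or H (mix_measure p (normalize \<mu>) 1 r y)) \<partial>crm_law))"
      unfolding K_def
      by (subst nn_integral_cmult[OF borel_measurable_times_ennreal[OF borel_measurable_const m3]],
        subst nn_integral_cmult[OF m3]) (rule refl)
  qed
  finally show ?thesis unfolding W_def \<phi>_def .
qed

end

section \<open>Moments of the total mass\<close>

context stable_base
begin

lemma measurable_crm_law_iff: "f \<in> crm_law \<rightarrow>\<^sub>M M \<longleftrightarrow> f \<in> MA \<rightarrow>\<^sub>M M"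
  by (rule measurable_cong_sets[OF sets_crm_law refl, THEN eqset_imp_iff])

abbreviation gammas :: "nat set set \<Rightarrow> (nat set \<Rightarrow> real) measure" where
  "gammas p \<equiv> \<Pi>\<^sub>M C\<in>p. gamma_law (real (card C) - \<alpha>)"

lemma sets_gammas_cong: "sets (gammas p) = sets (\<Pi>\<^sub>M C\<in>p. (borel :: real measure))"
  by (rule sets_PiM_cong) simp_all

declare sets_gammas_cong [measurable_cong]

lemma prob_space_gammas:
  assumes "\<And>C. C \<in> p \<Longrightarrow> card C \<ge> 1"
  shows "prob_space (gammas p)"
proof (intro prob_space_PiM prob_space_gamma_law)
  fix C assume "C \<in> p"
  then show "0 < real (card C) - \<alpha>" using assms[of C] alpha by linarith
qed

lemma prob_space_PiM_H: "prob_space (\<Pi>\<^sub>M C\<in>p. H)"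
  by (rule prob_space_PiM) (rule prob_space_axioms)

lemma measurable_mix:
  assumes p: "finite p" and \<psi>: "\<psi> \<in> borel_measurable (prob_algebra borel)"
    and "Q \<in> M \<rightarrow>\<^sub>M MA" "g \<in> borel_measurable M" "G \<in> M \<rightarrow>\<^sub>M (\<Pi>\<^sub>M C\<in>p. borel)" "y \<in> M \<rightarrow>\<^sub>M (\<Pi>\<^sub>M C\<in>p. borel)"
  shows "(\<lambda>x. \<psi> (prob_or H (mix_measure p (Q x) (g x) (G x) (y x)))) \<in> borel_measurable M"
proof (rule measurable_compose[OF measurable_prob_or \<psi>])
  show "(\<lambda>x. mix_measure p (Q x) (g x) (G x) (y x)) \<in> M \<rightarrow>\<^sub>M MA"
  proof (rule measurable_mix_measure[OF p assms(3,4)])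
    fix C assume "C \<in> p"
    then show "(\<lambda>x. G x C) \<in> borel_measurable M" "(\<lambda>x. y x C) \<in> M \<rightarrow>\<^sub>M borel"
      using measurable_compose[OF assms(5) measurable_component_singleton]
        measurable_compose[OF assms(6) measurable_component_singleton] by blast+
  qed
qed

text \<open>The weights and the power of \<open>1 + sum r p\<close> form, up to a constant, the
  density of the gamma ratios, because the shapes \<open>\<theta> + real (card p) * \<alpha>\<close>
  and \<open>real (card C) - \<alpha>\<close> sum to \<open>\<theta> + real n\<close>. The constant
  is the quotient of the factors \<open>1 / Gamma (1 - \<alpha>)\<close> by the normalization in
  \<open>nn_integral_gamma_ratio\<close>.\<close>

lemma atoms_integral_gamma:
  fixes p :: "nat set set"
  assumes p: "finite p" "p \<noteq> {}" and card: "\<And>C. C \<in> p \<Longrightarrow> card C \<ge> 1"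
    and B: "\<And>C. C \<in> p \<Longrightarrow> B C \<in> sets borel"
    and \<psi> [measurable]: "\<psi> \<in> borel_measurable (prob_algebra borel)"
    and n: "n = (\<Sum>C\<in>p. card C)" and \<theta>: "\<theta> + real (card p) * \<alpha> > 0"
  shows "atoms_integral p card B (\<lambda>\<mu>. tilt (\<theta> + real n) \<mu> * \<psi> (normalize \<mu>)) =
    ennreal (Gamma (\<theta> + real (card p) * \<alpha>) / Gamma (\<theta> + real n) *
      (\<Prod>C\<in>p. Gamma (real (card C) - \<alpha>) / Gamma (1 - \<alpha>))) *
    (\<integral>\<^sup>+g. (\<integral>\<^sup>+G. (\<integral>\<^sup>+y. (\<Prod>C\<in>p. indicator (B C) (y C)) *
        (\<integral>\<^sup>+\<mu>. tilt (\<theta> + real (card p) * \<alpha>) \<mu> * \<psi> (prob_or H (mix_measure p (normalize \<mu>) g G y)) \<partial>crm_law)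
      \<partial>(\<Pi>\<^sub>M C\<in>p. H)) \<partial>gammas p) \<partial>gamma_law (\<theta> + real (card p) * \<alpha>))"
proof -
  let ?P = "\<Pi>\<^sub>M C\<in>p. (lborel :: real measure)" and ?Q = "\<Pi>\<^sub>M C\<in>p. H"
  let ?a = "\<theta> + real (card p) * \<alpha>" and ?b = "\<lambda>C. real (card C) - \<alpha>"
  interpret HI: prob_space ?Q by (rule prob_space_PiM_H)
  have b: "?b C > 0" if "C \<in> p" for C using card[OF that] alpha by linarith
  have sumb: "sum ?b p = real n - real (card p) * \<alpha>" by (simp add: sum_subtractf n)
  have ab: "?a + sum ?b p = \<theta> + real n" by (simp add: sumb)
  have npos: "\<theta> + real n > 0"
  proof -
    have "0 \<le> sum ?b p" using b by (intro sum_nonneg) (simp add: less_imp_le)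
    with \<theta> show ?thesis unfolding ab[symmetric] by linarith
  qed
  define I where "I y = (\<Prod>C\<in>p. indicator (B C) (y C) :: ennreal)" for y
  have I [measurable]: "I \<in> borel_measurable (\<Pi>\<^sub>M C\<in>p. borel)"
    unfolding I_def
  proof (rule borel_measurable_prod_ennreal)
    fix C assume [simp]: "C \<in> p"
    have [measurable]: "B C \<in> sets borel" using B by simp
    show "(\<lambda>y. indicator (B C) (y C)) \<in> borel_measurable (\<Pi>\<^sub>M C\<in>p. borel)" by measurable
  qed
  define X where "X g G y = (\<integral>\<^sup>+\<mu>. tilt ?a \<mu> * \<psi> (prob_or H (mix_measure p (normalize \<mu>) g G y)) \<partial>crm_law)"
    for g :: real and G :: "nat set \<Rightarrow> real" and y :: "nat set \<Rightarrow> 'a"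
  have X1 [measurable]: "(\<lambda>(r, y). X 1 r y) \<in> borel_measurable (?P \<Otimes>\<^sub>M ?Q)"
    unfolding X_def split_beta'
  proof (rule crm_law.borel_measurable_nn_integral)
    have "(\<lambda>z. \<psi> (prob_or H (mix_measure p (normalize (snd z)) 1 (fst (fst z)) (snd (fst z)))))
        \<in> borel_measurable ((?P \<Otimes>\<^sub>M ?Q) \<Otimes>\<^sub>M crm_law)"
      by (rule measurable_mix[OF p(1) \<psi>]) measurable
    moreover have "(\<lambda>z. tilt ?a (snd z)) \<in> borel_measurable ((?P \<Otimes>\<^sub>M ?Q) \<Otimes>\<^sub>M crm_law)"
      by measurable
    ultimately show "(\<lambda>(x, \<mu>). tilt ?a \<mu> * \<psi> (prob_or H (mix_measure p (normalize \<mu>) 1 (fst x) (snd x))))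
        \<in> borel_measurable ((?P \<Otimes>\<^sub>M ?Q) \<Otimes>\<^sub>M crm_law)"
      unfolding split_beta' by (intro borel_measurable_times_ennreal)
  qed
  define \<Psi> where "\<Psi> r = (\<integral>\<^sup>+y. I y * X 1 r y \<partial>?Q)" for r
  have \<Psi>P [measurable]: "\<Psi> \<in> borel_measurable ?P" unfolding \<Psi>_def by measurable
  then have \<Psi>: "\<Psi> \<in> borel_measurable (\<Pi>\<^sub>M C\<in>p. borel)"
    by (simp add: measurable_cong_sets[OF sets_PiM_lborel_cong refl])
  define J where "J = (\<integral>\<^sup>+r. (\<Prod>C\<in>p. powr_pos (?b C) (r C)) * ennreal ((1 + sum r p) powr (- (\<theta> + real n))) * \<Psi> r \<partial>?P)"
  have Gp: "Gamma (1 - \<alpha>) > 0" by (rule Gamma_pos)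
  have "atoms_integral p card B (\<lambda>\<mu>. tilt (\<theta> + real n) \<mu> * \<psi> (normalize \<mu>)) =
      (\<integral>\<^sup>+r. (\<integral>\<^sup>+y. (\<Prod>C\<in>p. levy_weight (card C) (r C) * indicator (B C) (y C)) *
        (ennreal ((1 + sum r p) powr (- (\<theta> + real n))) * X 1 r y) \<partial>?Q) \<partial>?P)"
    unfolding X_def by (rule atoms_integral_rescale[OF p B \<psi> n])
  also have "\<dots> = (\<integral>\<^sup>+r. ennreal (\<Prod>C\<in>p. 1 / Gamma (1 - \<alpha>)) *
      ((\<Prod>C\<in>p. powr_pos (?b C) (r C)) * ennreal ((1 + sum r p) powr (- (\<theta> + real n))) * \<Psi> r) \<partial>?P)"
  proof (intro nn_integral_cong)
    fix r assume r: "r \<in> space ?P"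
    have m: "(\<lambda>y. I y * X 1 r y) \<in> borel_measurable ?Q"
      using r by measurable
    define c where "c = ennreal (\<Prod>C\<in>p. 1 / Gamma (1 - \<alpha>)) *
      ((\<Prod>C\<in>p. powr_pos (?b C) (r C)) * ennreal ((1 + sum r p) powr (- (\<theta> + real n))))"
    have "(\<Prod>C\<in>p. levy_weight (card C) (r C)) = (\<Prod>C\<in>p. ennreal (1 / Gamma (1 - \<alpha>))) * (\<Prod>C\<in>p. powr_pos (?b C) (r C))"
      by (simp only: levy_weight_powr_pos prod.distrib)
    also have "(\<Prod>C\<in>p. ennreal (1 / Gamma (1 - \<alpha>))) = ennreal (\<Prod>C\<in>p. 1 / Gamma (1 - \<alpha>))"
      using Gp by (intro prod_ennreal) simp
    finally have c: "(\<Prod>C\<in>p. levy_weight (card C) (r C)) * ennreal ((1 + sum r p) powr (- (\<theta> + real n))) = c"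
      by (simp only: c_def mult.assoc)
    have "(\<integral>\<^sup>+y. (\<Prod>C\<in>p. levy_weight (card C) (r C) * indicator (B C) (y C)) *
        (ennreal ((1 + sum r p) powr (- (\<theta> + real n))) * X 1 r y) \<partial>?Q) = (\<integral>\<^sup>+y. c * (I y * X 1 r y) \<partial>?Q)"
      unfolding I_def c[symmetric] prod.distrib by (intro nn_integral_cong) (simp only: mult_ac)
    also have "\<dots> = c * \<Psi> r" unfolding \<Psi>_def by (rule nn_integral_cmult[OF m])
    finally show "(\<integral>\<^sup>+y. (\<Prod>C\<in>p. levy_weight (card C) (r C) * indicator (B C) (y C)) *
        (ennreal ((1 + sum r p) powr (- (\<theta> + real n))) * X 1 r y) \<partial>?Q) = ennreal (\<Prod>C\<in>p. 1 / Gamma (1 - \<alpha>)) *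
      ((\<Prod>C\<in>p. powr_pos (?b C) (r C)) * ennreal ((1 + sum r p) powr (- (\<theta> + real n))) * \<Psi> r)"
      unfolding c_def by (simp only: mult.assoc)
  qed
  also have "\<dots> = ennreal (\<Prod>C\<in>p. 1 / Gamma (1 - \<alpha>)) * J"
    unfolding J_def
  proof (rule nn_integral_cmult, intro borel_measurable_times_ennreal)
    show "(\<lambda>r. \<Prod>C\<in>p. powr_pos (?b C) (r C)) \<in> borel_measurable ?P"
      by (intro borel_measurable_prod_ennreal) measurable
    have [measurable]: "(\<lambda>r. sum r p) \<in> borel_measurable ?P"
      by (rule borel_measurable_sum) simp
    show "(\<lambda>r. ennreal ((1 + sum r p) powr (- (\<theta> + real n)))) \<in> borel_measurable ?P" by measurable
  qed (rule \<Psi>P)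
  finally have 1: "atoms_integral p card B (\<lambda>\<mu>. tilt (\<theta> + real n) \<mu> * \<psi> (normalize \<mu>)) =
      ennreal (\<Prod>C\<in>p. 1 / Gamma (1 - \<alpha>)) * J" .
  define Z where "Z = (\<integral>\<^sup>+g. (\<integral>\<^sup>+G. (\<integral>\<^sup>+y. I y * X g G y \<partial>?Q) \<partial>gammas p) \<partial>gamma_law ?a)"
  have "Z = (\<integral>\<^sup>+g. (\<integral>\<^sup>+G. \<Psi> (\<lambda>C\<in>p. G C / g) \<partial>gammas p) \<partial>gamma_law ?a)"
    unfolding Z_def
  proof (rule nn_integral_cong_AE)
    show "AE g in gamma_law ?a. (\<integral>\<^sup>+G. (\<integral>\<^sup>+y. I y * X g G y \<partial>?Q) \<partial>gammas p) =
        (\<integral>\<^sup>+G. \<Psi> (\<lambda>C\<in>p. G C / g) \<partial>gammas p)"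
      using AE_gamma_law_pos
    proof eventually_elim
      case (elim g)
      \<comment> \<open>The mixture depends on the weights through their ratios only; this needs
        \<open>g > 0\<close>, hence holds for almost every \<open>g\<close>.\<close>
      have "X g G y = X 1 (\<lambda>C\<in>p. G C / g) y" for G y
      proof -
        have "mix_measure p Q 1 (\<lambda>C\<in>p. G C / g) y = mix_measure p Q g G y" for Q :: "'a measure"
          unfolding mix_measure_rescale[OF elim, symmetric] by (rule mix_measure_cong) simp_all
        then show ?thesis by (simp add: X_def)
      qed
      then show ?case by (simp add: \<Psi>_def)
    qed
  qed
  also have "\<dots> = ennreal (Gamma (\<theta> + real n) / (Gamma ?a * (\<Prod>C\<in>p. Gamma (?b C)))) * J"
    unfolding J_def ab[symmetric] by (rule nn_integral_gamma_ratio[OF p(1) \<theta> _ \<Psi>]) (rule b)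
  finally have 2: "Z = ennreal (Gamma (\<theta> + real n) / (Gamma ?a * (\<Prod>C\<in>p. Gamma (?b C)))) * J" .
  have pos: "Gamma ?a > 0" "Gamma (\<theta> + real n) > 0" "(\<Prod>C\<in>p. Gamma (?b C)) > 0" "(\<Prod>C\<in>p. Gamma (?b C) / Gamma (1 - \<alpha>)) > 0"
    using \<theta> npos b Gp by (auto intro!: Gamma_real_pos prod_pos divide_pos_pos)
  \<comment> \<open>The gamma constants cancel up to one factor
    \<open>1 / Gamma (1 - \<alpha>)\<close> per block.\<close>
  have "Gamma ?a / Gamma (\<theta> + real n) * (\<Prod>C\<in>p. Gamma (?b C) / Gamma (1 - \<alpha>)) *
      (Gamma (\<theta> + real n) / (Gamma ?a * (\<Prod>C\<in>p. Gamma (?b C)))) = (\<Prod>C\<in>p. 1 / Gamma (1 - \<alpha>))"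
    using pos Gp unfolding prod_dividef by (simp add: field_simps)
  then have "ennreal (Gamma ?a / Gamma (\<theta> + real n) * (\<Prod>C\<in>p. Gamma (?b C) / Gamma (1 - \<alpha>))) *
      ennreal (Gamma (\<theta> + real n) / (Gamma ?a * (\<Prod>C\<in>p. Gamma (?b C)))) = ennreal (\<Prod>C\<in>p. 1 / Gamma (1 - \<alpha>))"
    using pos by (simp only: ennreal_mult[symmetric] less_imp_le divide_nonneg_nonneg mult_nonneg_nonneg)
  then have "ennreal (Gamma ?a / Gamma (\<theta> + real n) * (\<Prod>C\<in>p. Gamma (?b C) / Gamma (1 - \<alpha>))) * Z =
      ennreal (\<Prod>C\<in>p. 1 / Gamma (1 - \<alpha>)) * J"
    unfolding 2 by (simp only: mult.assoc[symmetric])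
  with 1 show ?thesis unfolding Z_def I_def X_def by simp
qed

section \<open>Finiteness and recursion of the normalizing constants\<close>

text \<open>The moment of order -\<theta> of the total mass, which is the normalizing constant of
  \<open>PD_law\<close>. It lives in \<open>ennreal\<close> so that it can be handled before its
  finiteness is known.\<close>

definition mass :: "real \<Rightarrow> ennreal" where
  "mass \<theta> = (\<integral>\<^sup>+\<mu>. tilt \<theta> \<mu> \<partial>crm_law)"

lemma tilt_Suc_times:
  assumes "emeasure \<mu> UNIV = ennreal t" "t > 0"
  shows "tilt (\<theta> + 1) \<mu> * emeasure \<mu> UNIV = tilt \<theta> \<mu>"
proof -
  have "t powr (- (\<theta> + 1)) * t = t powr (- \<theta>)"
    using assms powr_mult_base[of t "- (\<theta> + 1)"] by (simp add: mult.commute)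
  then show ?thesis using assms by (simp add: tilt_def flip: ennreal_mult)
qed

lemma AE_crm_law_total_mass: "AE \<mu> in crm_law. sets \<mu> = sets borel \<and> (\<exists>t>0. emeasure \<mu> UNIV = ennreal t)"
  using AE_crm_law_pos AE_crm_law_finite AE_space
proof eventually_elim
  case (elim \<mu>)
  obtain t where "emeasure \<mu> UNIV = ennreal t" "t > 0"
    using elim by (cases "emeasure \<mu> UNIV") (auto simp: ennreal_eq_0_iff)
  with elim show ?case by (auto simp: space_crm_law)
qed

text \<open>
  The case \<open>n = 1\<close> of the sampling formula. It is valid even if both sides are infinite, so it
  also carries finiteness of the moments from \<open>\<theta>\<close> to \<open>\<theta> + \<alpha>\<close>.
\<close>

lemma mass_add_alpha:
  assumes \<theta>: "\<theta> > - \<alpha>"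
  shows "mass \<theta> = ennreal (Gamma (\<theta> + \<alpha>) / Gamma (\<theta> + 1)) * mass (\<theta> + \<alpha>)"
proof -
  interpret g: prob_space "gamma_law (\<theta> + \<alpha>)" by (rule prob_space_gamma_law) (use \<theta> in simp)
  interpret G: prob_space "gammas {{1}}" by (rule prob_space_gammas) simp
  interpret Q: prob_space "\<Pi>\<^sub>M C\<in>{{1::nat}}. H" by (rule prob_space_PiM_H)
  let ?\<phi> = "\<lambda>\<mu>. tilt (\<theta> + 1) \<mu> * (\<lambda>_. 1) (normalize \<mu>)"
  \<comment> \<open>One factor of the total mass is split off from the tilt; it plays the role of a
    single sampled atom without constraint on its location.\<close>
  have "mass \<theta> = (\<integral>\<^sup>+\<mu>. ?\<phi> \<mu> * emeasure \<mu> UNIV \<partial>crm_law)"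
    unfolding mass_def
  proof (rule nn_integral_cong_AE)
    show "AE \<mu> in crm_law. tilt \<theta> \<mu> = ?\<phi> \<mu> * emeasure \<mu> UNIV"
      using AE_crm_law_total_mass
    proof eventually_elim
      case (elim \<mu>)
      then obtain t where "emeasure \<mu> UNIV = ennreal t" "t > 0" by blast
      from tilt_Suc_times[OF this, of \<theta>] show ?case by simp
    qed
  qed
  also have "\<dots> = (\<Sum>p | partition_on {1..1::nat} p. atoms_integral p card (\<lambda>C. \<Inter>i\<in>C. UNIV) ?\<phi>)"
    using nn_integral_crm_law_power[of 1 "\<lambda>_. UNIV" ?\<phi>] by simp
  also have "{p. partition_on {1..1::nat} p} = {{{1}}}"
  proof -
    have "p = {{1}}" if "partition_on {1::nat} p" for p
    proof -
      have "p \<subseteq> {{1}}"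
      proof
        fix C assume C: "C \<in> p"
        have "C \<subseteq> {1}" using partition_onD1[OF that] C by blast
        moreover have "C \<noteq> {}" using partition_onD3[OF that] C by blast
        ultimately show "C \<in> {{1}}" by auto
      qed
      moreover have "p \<noteq> {}" using partition_onD1[OF that] by auto
      ultimately show ?thesis by auto
    qed
    note unique = this
    show ?thesis
    proof (intro equalityI subsetI)
      fix p assume "p \<in> {p. partition_on {1..1::nat} p}"
      then have "partition_on {1::nat} p" by simp
      from unique[OF this] show "p \<in> {{{1}}}" by simp
    next
      fix p :: "nat set set" assume "p \<in> {{{1}}}"
      then have p: "p = {{1}}" by simp
      show "p \<in> {p. partition_on {1..1::nat} p}"
        unfolding p using partition_on_space[of "{1::nat}"] by simp
    qed
  qed
  also have "(\<Sum>p\<in>{{{1::nat}}}. atoms_integral p card (\<lambda>C. \<Inter>i\<in>C. UNIV) ?\<phi>) =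
      ennreal (Gamma (\<theta> + \<alpha>) / Gamma (\<theta> + 1) * (Gamma (1 - \<alpha>) / Gamma (1 - \<alpha>))) * mass (\<theta> + \<alpha>)"
  proof -
    have "(\<integral>\<^sup>+y. (\<Prod>C\<in>{{1}}. indicator (\<Inter>i\<in>C. UNIV) (y C)) * mass (\<theta> + \<alpha>)
        \<partial>(\<Pi>\<^sub>M C\<in>{{1::nat}}. H)) = (\<integral>\<^sup>+y. mass (\<theta> + \<alpha>) \<partial>(\<Pi>\<^sub>M C\<in>{{1::nat}}. H))"
      by (intro nn_integral_cong) simp
    also have "\<dots> = mass (\<theta> + \<alpha>)"
      by (simp only: nn_integral_const Q.emeasure_space_1 mult_1_right)
    finally have y: "(\<integral>\<^sup>+y. (\<Prod>C\<in>{{1}}. indicator (\<Inter>i\<in>C. UNIV) (y C)) * mass (\<theta> + \<alpha>)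
        \<partial>(\<Pi>\<^sub>M C\<in>{{1::nat}}. H)) = mass (\<theta> + \<alpha>)" .
    have c: "real (card {{1::nat}}) * \<alpha> = \<alpha>" "real 1 = 1"
      "(\<Prod>C\<in>{{1::nat}}. Gamma (real (card C) - \<alpha>) / Gamma (1 - \<alpha>)) = Gamma (1 - \<alpha>) / Gamma (1 - \<alpha>)"
      by simp_all
    have "atoms_integral {{1::nat}} card (\<lambda>C. \<Inter>i\<in>C. UNIV) (\<lambda>\<mu>. tilt (\<theta> + real 1) \<mu> * (\<lambda>_. 1) (normalize \<mu>)) =
        ennreal (Gamma (\<theta> + \<alpha>) / Gamma (\<theta> + 1) * (Gamma (1 - \<alpha>) / Gamma (1 - \<alpha>))) * mass (\<theta> + \<alpha>)"
    proof -
      have p: "finite {{1::nat}}" "{{1::nat}} \<noteq> {}" "\<And>C. C \<in> {{1::nat}} \<Longrightarrow> 1 \<le> card C"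
        "\<And>C. C \<in> {{1::nat}} \<Longrightarrow> (\<Inter>i\<in>C. UNIV) \<in> sets (borel :: 'a measure)"
        "(\<lambda>_. 1 :: ennreal) \<in> borel_measurable (prob_algebra (borel :: 'a measure))"
        "1 = (\<Sum>C\<in>{{1::nat}}. card C)" "0 < \<theta> + real (card {{1::nat}}) * \<alpha>"
        using \<theta> by simp_all
      have m: "integral\<^sup>N crm_law (tilt (\<theta> + \<alpha>)) = mass (\<theta> + \<alpha>)" by (simp add: mass_def)
      have "atoms_integral {{1::nat}} card (\<lambda>C. \<Inter>i\<in>C. UNIV) (\<lambda>\<mu>. tilt (\<theta> + real 1) \<mu> * (\<lambda>_. 1) (normalize \<mu>)) =
          ennreal (Gamma (\<theta> + real (card {{1::nat}}) * \<alpha>) / Gamma (\<theta> + real 1) *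
            (\<Prod>C\<in>{{1::nat}}. Gamma (real (card C) - \<alpha>) / Gamma (1 - \<alpha>))) *
          (\<integral>\<^sup>+g. (\<integral>\<^sup>+G. (\<integral>\<^sup>+y. (\<Prod>C\<in>{{1}}. indicator (\<Inter>i\<in>C. UNIV) (y C)) *
              (\<integral>\<^sup>+\<mu>. tilt (\<theta> + real (card {{1::nat}}) * \<alpha>) \<mu> *
                (\<lambda>_. 1) (prob_or H (mix_measure {{1}} (normalize \<mu>) g G y)) \<partial>crm_law)
            \<partial>(\<Pi>\<^sub>M C\<in>{{1::nat}}. H)) \<partial>gammas {{1}}) \<partial>gamma_law (\<theta> + real (card {{1::nat}}) * \<alpha>))"
        by (rule atoms_integral_gamma) (rule p, assumption?)+
      then show ?thesis
        by (simp only: c m y nn_integral_const g.emeasure_space_1 G.emeasure_space_1 mult_1_right)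
    qed
    then show ?thesis by simp
  qed
  finally show ?thesis using Gamma_pos by simp
qed

lemma mass_pos:
  shows "mass \<theta> \<noteq> 0"
proof
  assume "mass \<theta> = 0"
  then have "AE \<mu> in crm_law. tilt \<theta> \<mu> = 0"
    unfolding mass_def by (subst (asm) nn_integral_0_iff_AE) (simp_all add: measurable_crm_law_iff)
  with AE_crm_law_total_mass have "AE \<mu> in crm_law. False"
    by eventually_elim (auto simp: tilt_def)
  then show False by simp
qed

text \<open>This is a moment of nonnegative order below \<open>\<alpha>\<close>. On masses T of at
  least 1 it is written as T * T powr (- \<theta> - 1), and the Mecke equation replaces the first
  factor by an inserted atom of size \<open>s\<close>. The other factor is then a negative power of
  a mass of at least (1 + s) / 2, which leaves the beta integral with
  \<open>a = \<alpha> + \<theta>\<close>; this is where \<open>- \<alpha> < \<theta>\<close>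
  enters.\<close>

lemma mass_finite_nonpos:
  assumes \<theta>: "- \<alpha> < \<theta>" "\<theta> \<le> 0"
  shows "mass \<theta> < \<infinity>"
proof -
  \<comment> \<open>The cut at 1 keeps the negative power \<open>- \<theta> - 1\<close> bounded;
    below it \<open>tilt \<theta>\<close> is at most 1.\<close>
  define \<phi> where "\<phi> \<mu> = ennreal (enn2real (emeasure \<mu> UNIV) powr (- \<theta> - 1)) *
      (if enn2real (emeasure \<mu> UNIV) \<ge> 1 then 1 else 0)" for \<mu> :: "'a measure"
  have \<phi> [measurable]: "\<phi> \<in> borel_measurable MA" unfolding \<phi>_def by measurable
  have le: "tilt \<theta> \<mu> \<le> 1 + emeasure \<mu> UNIV * \<phi> \<mu>" if t: "emeasure \<mu> UNIV = ennreal t" "t > 0" for \<mu> t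
  proof (cases "t \<ge> 1")
    case True
    have "t powr (- \<theta>) = t * t powr (- \<theta> - 1)"
      using t powr_mult_base[of t "- \<theta> - 1"] by simp
    then have "tilt \<theta> \<mu> = emeasure \<mu> UNIV * \<phi> \<mu>"
      using t True by (simp add: tilt_def \<phi>_def flip: ennreal_mult)
    then show ?thesis by simp
  next
    case False
    have "t powr (- \<theta>) \<le> 1" using False t \<theta> by (intro powr_le1) auto
    then have "tilt \<theta> \<mu> \<le> 1" using t by (simp add: tilt_def)
    also have "\<dots> \<le> 1 + emeasure \<mu> UNIV * \<phi> \<mu>" by simp
    finally show ?thesis .
  qed
  have "mass \<theta> \<le> (\<integral>\<^sup>+\<mu>. 1 + emeasure \<mu> UNIV * \<phi> \<mu> \<partial>crm_law)"
    unfolding mass_def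
  proof (rule nn_integral_mono_AE)
    show "AE \<mu> in crm_law. tilt \<theta> \<mu> \<le> 1 + emeasure \<mu> UNIV * \<phi> \<mu>"
      using AE_crm_law_total_mass by eventually_elim (auto intro: le)
  qed
  also have "\<dots> = 1 + (\<integral>\<^sup>+\<mu>. emeasure \<mu> UNIV * \<phi> \<mu> \<partial>crm_law)"
    by (subst nn_integral_add) (simp_all add: crm_law.emeasure_space_1 measurable_crm_law_iff)
  also have "(\<integral>\<^sup>+\<mu>. emeasure \<mu> UNIV * \<phi> \<mu> \<partial>crm_law) =
     (\<integral>\<^sup>+s. levy_weight 1 s * (\<integral>\<^sup>+y. indicator UNIV y *
        (\<integral>\<^sup>+\<mu>. \<phi> (add_atoms {()} (\<lambda>_. s) (\<lambda>_. y) \<mu>) \<partial>crm_law) \<partial>H) \<partial>lborel)"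
    by (rule mecke_crm_law) simp_all
  also have "\<dots> \<le> (\<integral>\<^sup>+s. ennreal (2 powr (1 + \<theta>)) * (levy_weight 1 s * ennreal ((1 + s) powr (- ((\<alpha> + \<theta>) + 1 - \<alpha>)))) \<partial>lborel)"
  proof (intro nn_integral_mono)
    fix s :: real
    show "levy_weight 1 s * (\<integral>\<^sup>+y. indicator UNIV y * (\<integral>\<^sup>+\<mu>. \<phi> (add_atoms {()} (\<lambda>_. s) (\<lambda>_. y) \<mu>) \<partial>crm_law) \<partial>H) \<le>
        ennreal (2 powr (1 + \<theta>)) * (levy_weight 1 s * ennreal ((1 + s) powr (- ((\<alpha> + \<theta>) + 1 - \<alpha>))))"
    proof (cases "s > 0")
      case s: True
      let ?c = "ennreal (2 powr (1 + \<theta>)) * ennreal ((1 + s) powr (- ((\<alpha> + \<theta>) + 1 - \<alpha>)))"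
      have bound: "\<phi> (add_atoms {()} (\<lambda>_. s) (\<lambda>_. y) \<mu>) \<le> ?c" if "\<mu> \<in> space crm_law" for \<mu> y
      proof -
        define t' where "t' = enn2real (emeasure (add_atoms {()} (\<lambda>_. s) (\<lambda>_. y) \<mu>) UNIV)"
        have \<mu>: "sets \<mu> = sets borel" using that by (simp add: space_crm_law)
        have t': "emeasure (add_atoms {()} (\<lambda>_. s) (\<lambda>_. y) \<mu>) UNIV = emeasure \<mu> UNIV + ennreal s"
          using \<mu> by (subst emeasure_add_atoms) auto
        show ?thesis
        proof (cases "t' \<ge> 1")
          case True
          have "s \<le> t'"
          proof (cases "emeasure \<mu> UNIV")
            case (real x)
            then have "t' = x + s" unfolding t'_def t' using s by (simp flip: ennreal_plus)
            with real show ?thesis by simp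
          next
            \<comment> \<open>For infinite mass \<open>enn2real\<close> returns 0, which contradicts
              \<open>t' \<ge> 1\<close>.\<close>
            case top
            then show ?thesis using True unfolding t'_def t' by simp
          qed
          \<comment> \<open>The average of the two lower bounds 1 and \<open>s\<close>; this is the
            source of the constant \<open>2 powr (1 + \<theta>)\<close>.\<close>
          then have "(1 + s) / 2 \<le> t'" using True by simp
          then have "t' powr (- \<theta> - 1) \<le> ((1 + s) / 2) powr (- \<theta> - 1)"
            using s alpha \<theta> by (intro powr_mono2') auto
          also have "\<dots> = 2 powr (1 + \<theta>) * (1 + s) powr (- ((\<alpha> + \<theta>) + 1 - \<alpha>))"
          proof -
            have q: "- \<theta> - 1 = - (1 + \<theta>)" "- ((\<alpha> + \<theta>) + 1 - \<alpha>) = - (1 + \<theta>)" by simp_all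
            show ?thesis unfolding q
              using s by (simp add: powr_divide powr_minus_divide del: minus_add_distrib)
          qed
          finally have "ennreal (t' powr (- \<theta> - 1)) \<le> ?c"
            by (simp add: ennreal_leI flip: ennreal_mult)
          then show ?thesis by (simp add: \<phi>_def t'_def[symmetric])
        qed (simp add: \<phi>_def t'_def[symmetric])
      qed
      have "(\<integral>\<^sup>+\<mu>. \<phi> (add_atoms {()} (\<lambda>_. s) (\<lambda>_. y) \<mu>) \<partial>crm_law) \<le> ?c" for y
        using crm_law.nn_integral_le_const[OF _ AE_I2, of ?c] bound by simp
      then have "(\<integral>\<^sup>+y. indicator UNIV y * (\<integral>\<^sup>+\<mu>. \<phi> (add_atoms {()} (\<lambda>_. s) (\<lambda>_. y) \<mu>) \<partial>crm_law) \<partial>H) \<le> ?c"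
        by (intro nn_integral_le_const AE_I2) simp_all
      then have "levy_weight 1 s * (\<integral>\<^sup>+y. indicator UNIV y * (\<integral>\<^sup>+\<mu>. \<phi> (add_atoms {()} (\<lambda>_. s) (\<lambda>_. y) \<mu>) \<partial>crm_law) \<partial>H)
          \<le> levy_weight 1 s * ?c" by (rule mult_left_mono) simp
      then show ?thesis by (simp only: mult_ac)
    qed (simp add: levy_weight_def)
  qed
  also have "\<dots> = ennreal (2 powr (1 + \<theta>)) * ennreal (Gamma (\<alpha> + \<theta>) / Gamma ((\<alpha> + \<theta>) + 1 - \<alpha>))"
    using \<theta> by (subst nn_integral_cmult) (simp_all add: nn_integral_levy_weight_1[of "\<alpha> + \<theta>", simplified])
  also have "1 + \<dots> < \<infinity>" by (simp add: ennreal_mult_less_top)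
  finally show ?thesis by (simp add: add_left_mono)
qed

text \<open>Each positive \<open>\<theta>\<close> comes down to the interval between -\<alpha> and 0
  in finitely many steps of \<open>\<alpha>\<close>. Finiteness travels back up because the gamma
  factor in \<open>mass_add_alpha\<close> is strictly positive.\<close>

lemma mass_finite:
  assumes "\<theta> > - \<alpha>"
  shows "mass \<theta> < \<infinity>"
proof -
  have "mass \<theta> < \<infinity>" if "\<theta> > - \<alpha>" "\<theta> \<le> real m * \<alpha>" for m :: nat and \<theta>
    using that
  proof (induction m arbitrary: \<theta>)
    case 0
    then show ?case by (intro mass_finite_nonpos) auto
  next
    case (Suc m)
    show ?case
    proof (cases "\<theta> \<le> 0")
      case True
      then show ?thesis using Suc.prems by (intro mass_finite_nonpos)
    next
      case False
      then have "mass (\<theta> - \<alpha>) < \<infinity>"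
        using Suc.prems by (intro Suc.IH) (auto simp: algebra_simps)
      moreover have "mass (\<theta> - \<alpha>) = ennreal (Gamma \<theta> / Gamma (\<theta> - \<alpha> + 1)) * mass \<theta>"
        using mass_add_alpha[of "\<theta> - \<alpha>"] False by simp
      moreover have "Gamma \<theta> / Gamma (\<theta> - \<alpha> + 1) > 0"
        using False alpha by (intro divide_pos_pos Gamma_real_pos) auto
      ultimately show ?thesis by (auto simp: ennreal_mult_less_top less_top)
    qed
  qed
  moreover obtain m :: nat where "\<theta> / \<alpha> \<le> real m" using real_arch_simple by blast
  then have "\<theta> \<le> real m * \<alpha>" using alpha by (simp add: field_simps)
  ultimately show ?thesis using assms by blast
qed

text \<open>Iterating \<open>mass_add_alpha\<close>, the rule
  \<open>Gamma (b + 1) = b * Gamma b\<close> makes the gamma factors telescope and leaves the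
  product of the \<open>\<theta> + real j * \<alpha>\<close>, the numerator in
  \<open>PD_eppf\<close>. The first step keeps its \<open>Gamma (\<theta> + 1)\<close>, since
  \<open>\<theta>\<close> itself may be negative or zero.\<close>

lemma mass_add_multiple:
  assumes \<theta>: "\<theta> > - \<alpha>" and k: "k \<ge> 1"
  shows "mass (\<theta> + real k * \<alpha>) =
    ennreal (Gamma (\<theta> + 1) / Gamma (\<theta> + real k * \<alpha>) * (\<Prod>j = 1..k - 1. \<theta> + real j * \<alpha>)) * mass \<theta>"
  using k
proof (induction k rule: dec_induct)
  case base
  have pos: "Gamma (\<theta> + \<alpha>) > 0" "Gamma (\<theta> + 1) > 0"
    using \<theta> alpha by (auto intro!: Gamma_real_pos)
  have "ennreal (Gamma (\<theta> + 1) / Gamma (\<theta> + \<alpha>)) * mass \<theta> =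
      ennreal (Gamma (\<theta> + 1) / Gamma (\<theta> + \<alpha>)) * ennreal (Gamma (\<theta> + \<alpha>) / Gamma (\<theta> + 1)) * mass (\<theta> + \<alpha>)"
    unfolding mass_add_alpha[OF \<theta>] by (simp only: mult.assoc)
  also have "\<dots> = mass (\<theta> + \<alpha>)"
    using pos by (simp flip: ennreal_mult)
  finally show ?case by simp
next
  case (step k)
  let ?b = "\<theta> + real k * \<alpha>"
  have "1 * \<alpha> \<le> real k * \<alpha>" using step(1) alpha by (intro mult_right_mono) auto
  then have b: "?b > 0" using \<theta> by simp
  have pos: "Gamma (?b + \<alpha>) > 0" "Gamma (?b + 1) > 0" "Gamma ?b > 0" "Gamma (\<theta> + 1) > 0"
    using b \<theta> alpha by (auto intro!: Gamma_real_pos)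
  have Gb: "Gamma (?b + 1) = ?b * Gamma ?b"
    using b by (intro Gamma_plus1) (auto elim!: nonpos_Ints_cases)
  have prodpos: "0 \<le> (\<Prod>j = 1..k - 1. \<theta> + real j * \<alpha>)"
  proof (intro prod_nonneg)
    fix j assume "j \<in> {1..k - 1}"
    then have "1 * \<alpha> \<le> real j * \<alpha>" using alpha by (intro mult_right_mono) auto
    then show "0 \<le> \<theta> + real j * \<alpha>" using \<theta> by simp
  qed
  have "mass (?b + \<alpha>) = ennreal (Gamma (?b + 1) / Gamma (?b + \<alpha>)) * (ennreal (Gamma (?b + \<alpha>) / Gamma (?b + 1)) * mass (?b + \<alpha>))"
    using pos by (simp add: mult.assoc[symmetric] flip: ennreal_mult)
  also have "ennreal (Gamma (?b + \<alpha>) / Gamma (?b + 1)) * mass (?b + \<alpha>) = mass ?b"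
    using b alpha by (intro mass_add_alpha[symmetric]) auto
  also have "ennreal (Gamma (?b + 1) / Gamma (?b + \<alpha>)) * mass ?b =
     ennreal (Gamma (?b + 1) / Gamma (?b + \<alpha>) * (Gamma (\<theta> + 1) / Gamma ?b * (\<Prod>j = 1..k - 1. \<theta> + real j * \<alpha>))) * mass \<theta>"
    unfolding step.IH using pos prodpos
    by (subst ennreal_mult) (simp_all only: mult.assoc less_imp_le divide_nonneg_nonneg mult_nonneg_nonneg)
  also have "Gamma (?b + 1) / Gamma (?b + \<alpha>) * (Gamma (\<theta> + 1) / Gamma ?b * (\<Prod>j = 1..k - 1. \<theta> + real j * \<alpha>)) =
      Gamma (\<theta> + 1) / Gamma (?b + \<alpha>) * (?b * (\<Prod>j = 1..k - 1. \<theta> + real j * \<alpha>))"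
    unfolding Gb using pos by simp
  also have "?b * (\<Prod>j = 1..k - 1. \<theta> + real j * \<alpha>) = (\<Prod>j = 1..k. \<theta> + real j * \<alpha>)"
    using step(1) by (cases k) (simp_all add: mult.commute)
  finally show ?case by (simp add: algebra_simps)
qed

section \<open>Integrals against the Poisson--Dirichlet law\<close>

text \<open>Stated in multiplied form, which combines with sums and with
  \<open>mass_add_multiple\<close> without division in \<open>ennreal\<close>.\<close>

lemma nn_integral_PD_law:
  assumes \<theta>: "\<theta> > - \<alpha>" and \<psi> [measurable]: "\<psi> \<in> borel_measurable (prob_algebra borel)"
  shows "mass \<theta> * (\<integral>\<^sup>+Q. \<psi> Q \<partial>PD_law \<alpha> \<theta> H) = (\<integral>\<^sup>+\<mu>. tilt \<theta> \<mu> * \<psi> (normalize \<mu>) \<partial>crm_law)"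
proof -
  have m: "mass \<theta> \<noteq> 0" "mass \<theta> \<noteq> \<infinity>" using mass_pos mass_finite[OF \<theta>] by auto
  have mass: "(\<integral>\<^sup>+N. tilt \<theta> (crm N) \<partial>L) = mass \<theta>"
    unfolding mass_def by (rule nn_integral_crm_law[symmetric]) measurable
  have [measurable]: "(\<lambda>N. normalize (crm N)) \<in> L \<rightarrow>\<^sub>M prob_algebra borel" by measurable
  have PD: "PD_law \<alpha> \<theta> H = distr (density L (\<lambda>N. tilt \<theta> (crm N) / mass \<theta>)) (prob_algebra borel) (\<lambda>N. normalize (crm N))"
    unfolding PD_law_def Let_def total_mass_def normalize_def tilt_def[symmetric] mass ..
  have "(\<integral>\<^sup>+Q. \<psi> Q \<partial>PD_law \<alpha> \<theta> H) = (\<integral>\<^sup>+N. tilt \<theta> (crm N) / mass \<theta> * \<psi> (normalize (crm N)) \<partial>L)"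
    unfolding PD by (subst nn_integral_distr) (simp_all add: nn_integral_density)
  then have "mass \<theta> * (\<integral>\<^sup>+Q. \<psi> Q \<partial>PD_law \<alpha> \<theta> H) =
      (\<integral>\<^sup>+N. mass \<theta> * (tilt \<theta> (crm N) / mass \<theta> * \<psi> (normalize (crm N))) \<partial>L)"
    by (simp add: nn_integral_cmult)
  also have "\<dots> = (\<integral>\<^sup>+N. tilt \<theta> (crm N) * \<psi> (normalize (crm N)) \<partial>L)"
  proof (intro nn_integral_cong)
    fix N
    have "mass \<theta> * (tilt \<theta> (crm N) / mass \<theta>) = tilt \<theta> (crm N)"
      unfolding ennreal_times_divide by (subst mult.commute) (use m in \<open>simp add: ennreal_mult_divide_eq\<close>)
    then show "mass \<theta> * (tilt \<theta> (crm N) / mass \<theta> * \<psi> (normalize (crm N))) = tilt \<theta> (crm N) * \<psi> (normalize (crm N))"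
      by (simp only: mult.assoc[symmetric])
  qed
  also have "\<dots> = (\<integral>\<^sup>+\<mu>. tilt \<theta> \<mu> * \<psi> (normalize \<mu>) \<partial>crm_law)"
    by (rule nn_integral_crm_law[symmetric]) measurable
  finally show ?thesis .
qed

lemma sets_PD_law [simp, measurable_cong]: "sets (PD_law \<alpha> \<theta> H) = sets (prob_algebra borel)"
  by (simp add: PD_law_def Let_def)

lemma space_PD_law: "space (PD_law \<alpha> \<theta> H) = space (prob_algebra borel)"
  by (rule sets_eq_imp_space_eq) simp

lemma prob_space_PD_law:
  assumes \<theta>: "\<theta> > - \<alpha>"
  shows "prob_space (PD_law \<alpha> \<theta> H)"
proof
  let ?x = "emeasure (PD_law \<alpha> \<theta> H) (space (PD_law \<alpha> \<theta> H))"
  have m: "mass \<theta> \<noteq> 0" "mass \<theta> \<noteq> \<infinity>" using mass_pos mass_finite[OF \<theta>] by auto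
  have "mass \<theta> * ?x = mass \<theta>"
    using nn_integral_PD_law[OF \<theta>, of "\<lambda>_. 1"] by (simp add: mass_def)
  then have "?x * mass \<theta> / mass \<theta> = mass \<theta> / mass \<theta>"
    by (simp add: mult.commute)
  then show "?x = 1"
    using m mass_finite[OF \<theta>] by (simp add: ennreal_mult_divide_eq ennreal_divide_self)
qed

end

section \<open>The Poisson--Dirichlet sampling formula\<close>

context stable_base
begin

section \<open>Mixtures for a fixed partition\<close>

context
  fixes p :: "nat set set" and \<theta> :: real
  assumes p: "finite p" and card: "\<And>C. C \<in> p \<Longrightarrow> card C \<ge> 1"
    and \<theta>: "\<theta> + real (card p) * \<alpha> > 0"
begin

abbreviation (input) "shape \<equiv> \<theta> + real (card p) * \<alpha>"
abbreviation (input) "PDp \<equiv> PD_law \<alpha> shape H"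
abbreviation (input) "weights \<equiv> gamma_law shape \<Otimes>\<^sub>M gammas p"
abbreviation (input) "Hp \<equiv> \<Pi>\<^sub>M C\<in>p. H"

lemma prob_space_PDp: "prob_space PDp"
  by (rule prob_space_PD_law) (use \<theta> alpha in simp)

lemma prob_space_weights: "prob_space weights"
  by (intro prob_space_pair prob_space_gamma_law prob_space_gammas \<theta> card)

lemma nn_integral_weights:
  assumes "f \<in> borel_measurable weights"
  shows "(\<integral>\<^sup>+x. f x \<partial>weights) = (\<integral>\<^sup>+g. (\<integral>\<^sup>+G. f (g, G) \<partial>gammas p) \<partial>gamma_law shape)"
proof -
  interpret G: prob_space "gammas p" by (rule prob_space_gammas) (rule card)
  show ?thesis by (rule G.nn_integral_fst[symmetric]) (rule assms)
qed

lemma measurable_mix_kernel: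
  assumes "\<psi> \<in> borel_measurable (prob_algebra borel)"
  shows "(\<lambda>((Q, x), y). \<psi> (prob_or H (mix_measure p Q (fst x) (snd x) y))) \<in> borel_measurable ((PDp \<Otimes>\<^sub>M weights) \<Otimes>\<^sub>M Hp)"
  unfolding split_beta'
proof (rule measurable_mix[OF p assms])
  have "(\<lambda>z. fst (fst z)) \<in> (PDp \<Otimes>\<^sub>M weights) \<Otimes>\<^sub>M Hp \<rightarrow>\<^sub>M prob_algebra borel" by measurable
  then show "(\<lambda>z. fst (fst z)) \<in> (PDp \<Otimes>\<^sub>M weights) \<Otimes>\<^sub>M Hp \<rightarrow>\<^sub>M MA"
    by (rule measurable_prob_algebra_measure_algebra)
qed measurable

lemma measurable_mix_map:
  "(\<lambda>x. prob_or H (mix_measure p (fst x) (fst (snd x)) (snd (snd x)) y)) \<in> PDp \<Otimes>\<^sub>M weights \<rightarrow>\<^sub>M prob_algebra borel"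
proof (intro measurable_prob_or measurable_mix_measure p)
  have "fst \<in> PDp \<Otimes>\<^sub>M weights \<rightarrow>\<^sub>M prob_algebra borel" by measurable
  then show "fst \<in> PDp \<Otimes>\<^sub>M weights \<rightarrow>\<^sub>M MA" by (rule measurable_prob_algebra_measure_algebra)
qed measurable

lemma sets_mix_law_fixed: "sets (mix_law_fixed \<alpha> \<theta> H p y) = sets (prob_algebra borel)"
  by (simp add: mix_law_fixed_def)

lemma nn_integral_mix_law_fixed:
  assumes \<psi>: "\<psi> \<in> borel_measurable (prob_algebra borel)"
  shows "(\<integral>\<^sup>+Q. \<psi> Q \<partial>mix_law_fixed \<alpha> \<theta> H p y) =
    (\<integral>\<^sup>+Q. (\<integral>\<^sup>+x. \<psi> (prob_or H (mix_measure p Q (fst x) (snd x) y)) \<partial>weights) \<partial>PDp)"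
proof -
  interpret W: prob_space weights by (rule prob_space_weights)
  have "(\<integral>\<^sup>+Q. \<psi> Q \<partial>mix_law_fixed \<alpha> \<theta> H p y) =
      (\<integral>\<^sup>+x. \<psi> (prob_or H (mix_measure p (fst x) (fst (snd x)) (snd (snd x)) y)) \<partial>(PDp \<Otimes>\<^sub>M weights))"
    unfolding mix_law_fixed_def split_beta' by (rule nn_integral_distr[OF measurable_mix_map]) (simp add: \<psi>)
  also have "\<dots> = (\<integral>\<^sup>+Q. (\<integral>\<^sup>+x. \<psi> (prob_or H (mix_measure p Q (fst x) (snd x) y)) \<partial>weights) \<partial>PDp)"
    by (subst W.nn_integral_fst[symmetric]) (simp_all add: measurable_compose[OF measurable_mix_map \<psi>])
  finally show ?thesis .
qed

lemma prob_space_mix_law_fixed: "prob_space (mix_law_fixed \<alpha> \<theta> H p y)"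
proof
  interpret W: prob_space weights by (rule prob_space_weights)
  interpret PD: prob_space PDp by (rule prob_space_PDp)
  show "emeasure (mix_law_fixed \<alpha> \<theta> H p y) (space (mix_law_fixed \<alpha> \<theta> H p y)) = 1"
    using nn_integral_mix_law_fixed[of "\<lambda>_. 1" y] by (simp add: W.emeasure_space_1 PD.emeasure_space_1)
qed

lemma mix_law_fixed_cong:
  assumes "\<And>C. C \<in> p \<Longrightarrow> y C = y' C"
  shows "mix_law_fixed \<alpha> \<theta> H p y = mix_law_fixed \<alpha> \<theta> H p y'"
  unfolding mix_law_fixed_def using mix_measure_cong[of p _ _ y y', OF refl assms] by simp

lemma measurable_nn_integral_mix_law_fixed:
  assumes \<psi>: "\<psi> \<in> borel_measurable (prob_algebra borel)"
  shows "(\<lambda>y. \<integral>\<^sup>+Q. \<psi> Q \<partial>mix_law_fixed \<alpha> \<theta> H p y) \<in> borel_measurable Hp"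
proof -
  interpret W: prob_space weights by (rule prob_space_weights)
  interpret PD: prob_space PDp by (rule prob_space_PDp)
  have "(\<lambda>z. ((snd (fst z), snd z), fst (fst z))) \<in> (Hp \<Otimes>\<^sub>M PDp) \<Otimes>\<^sub>M weights \<rightarrow>\<^sub>M (PDp \<Otimes>\<^sub>M weights) \<Otimes>\<^sub>M Hp"
    by measurable
  from measurable_compose[OF this measurable_mix_kernel[OF \<psi>]]
  have m: "(\<lambda>(z, x). \<psi> (prob_or H (mix_measure p (snd z) (fst x) (snd x) (fst z)))) \<in> borel_measurable ((Hp \<Otimes>\<^sub>M PDp) \<Otimes>\<^sub>M weights)"
    by (simp add: split_beta')
  have "(\<lambda>(y, Q). \<integral>\<^sup>+x. \<psi> (prob_or H (mix_measure p Q (fst x) (snd x) y)) \<partial>weights) \<in> borel_measurable (Hp \<Otimes>\<^sub>M PDp)"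
    using W.borel_measurable_nn_integral[OF m] by (simp add: split_beta')
  from PD.borel_measurable_nn_integral[OF this]
  show ?thesis by (simp add: nn_integral_mix_law_fixed[OF \<psi>])
qed

lemma nn_integral_mix_law_fixed_swap:
  assumes \<psi>: "\<psi> \<in> borel_measurable (prob_algebra borel)" and I: "I \<in> borel_measurable Hp"
  shows "(\<integral>\<^sup>+x. (\<integral>\<^sup>+y. I y * (\<integral>\<^sup>+Q. \<psi> (prob_or H (mix_measure p Q (fst x) (snd x) y)) \<partial>PDp) \<partial>Hp) \<partial>weights) =
    (\<integral>\<^sup>+y. I y * (\<integral>\<^sup>+Q. \<psi> Q \<partial>mix_law_fixed \<alpha> \<theta> H p y) \<partial>Hp)"
proof -
  interpret W: prob_space weights by (rule prob_space_weights)
  interpret PD: prob_space PDp by (rule prob_space_PDp)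
  interpret HI: prob_space Hp by (rule prob_space_PiM_H)
  interpret WH: pair_sigma_finite weights Hp ..
  interpret PW: pair_sigma_finite PDp weights ..
  define f where "f Q x y = \<psi> (prob_or H (mix_measure p Q (fst x) (snd x) y))" for Q x y
  have f: "(\<lambda>((Q, x), y). f Q x y) \<in> borel_measurable ((PDp \<Otimes>\<^sub>M weights) \<Otimes>\<^sub>M Hp)"
    unfolding f_def by (rule measurable_mix_kernel[OF \<psi>])
  have "(\<lambda>z. ((snd z, fst (fst z)), snd (fst z))) \<in> (weights \<Otimes>\<^sub>M Hp) \<Otimes>\<^sub>M PDp \<rightarrow>\<^sub>M (PDp \<Otimes>\<^sub>M weights) \<Otimes>\<^sub>M Hp"
    by measurable
  from measurable_compose[OF this f]
  have "(\<lambda>(z, Q). f Q (fst z) (snd z)) \<in> borel_measurable ((weights \<Otimes>\<^sub>M Hp) \<Otimes>\<^sub>M PDp)"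
    by (simp add: split_beta')
  from PD.borel_measurable_nn_integral[OF this]
  have F: "(\<lambda>z. \<integral>\<^sup>+Q. f Q (fst z) (snd z) \<partial>PDp) \<in> borel_measurable (weights \<Otimes>\<^sub>M Hp)" .
  have IF: "(\<lambda>(x, y). I y * (\<integral>\<^sup>+Q. f Q x y \<partial>PDp)) \<in> borel_measurable (weights \<Otimes>\<^sub>M Hp)"
    using borel_measurable_times_ennreal[OF measurable_compose[OF measurable_snd I] F] by (simp add: split_beta')
  have "(\<integral>\<^sup>+x. (\<integral>\<^sup>+y. I y * (\<integral>\<^sup>+Q. f Q x y \<partial>PDp) \<partial>Hp) \<partial>weights) =
      (\<integral>\<^sup>+y. (\<integral>\<^sup>+x. I y * (\<integral>\<^sup>+Q. f Q x y \<partial>PDp) \<partial>weights) \<partial>Hp)"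
    by (rule WH.Fubini'[symmetric]) (rule IF)
  also have "\<dots> = (\<integral>\<^sup>+y. I y * (\<integral>\<^sup>+Q. (\<integral>\<^sup>+x. f Q x y \<partial>weights) \<partial>PDp) \<partial>Hp)"
  proof (intro nn_integral_cong)
    fix y assume y: "y \<in> space Hp"
    have "(\<lambda>x. (x, y)) \<in> weights \<rightarrow>\<^sub>M weights \<Otimes>\<^sub>M Hp" using y by measurable
    from measurable_compose[OF this F]
    have Fy: "(\<lambda>x. \<integral>\<^sup>+Q. f Q x y \<partial>PDp) \<in> borel_measurable weights" by simp
    have "(\<lambda>z. (z, y)) \<in> PDp \<Otimes>\<^sub>M weights \<rightarrow>\<^sub>M (PDp \<Otimes>\<^sub>M weights) \<Otimes>\<^sub>M Hp" using y by measurable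
    from measurable_compose[OF this f]
    have fy: "(\<lambda>(Q, x). f Q x y) \<in> borel_measurable (PDp \<Otimes>\<^sub>M weights)" by (simp add: split_beta')
    show "(\<integral>\<^sup>+x. I y * (\<integral>\<^sup>+Q. f Q x y \<partial>PDp) \<partial>weights) = I y * (\<integral>\<^sup>+Q. (\<integral>\<^sup>+x. f Q x y \<partial>weights) \<partial>PDp)"
      unfolding nn_integral_cmult[OF Fy] using PW.Fubini'[OF fy] by simp
  qed
  finally show ?thesis
    unfolding f_def nn_integral_mix_law_fixed[OF \<psi>] .
qed

text \<open>The locations are independent of the other variables, so by Tonelli they can be held
  fixed first and averaged last.\<close>

lemma nn_integral_mix_law:
  assumes \<psi>: "\<psi> \<in> borel_measurable (prob_algebra borel)"
  shows "(\<integral>\<^sup>+Q. \<psi> Q \<partial>mix_law \<alpha> \<theta> H p) = (\<integral>\<^sup>+y. (\<integral>\<^sup>+Q. \<psi> Q \<partial>mix_law_fixed \<alpha> \<theta> H p y) \<partial>Hp)"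
proof -
  interpret g: prob_space "gamma_law shape" by (rule prob_space_gamma_law) (rule \<theta>)
  interpret G: prob_space "gammas p" by (rule prob_space_gammas) (rule card)
  interpret W: prob_space weights by (rule prob_space_weights)
  interpret PD: prob_space PDp by (rule prob_space_PDp)
  interpret HI: prob_space Hp by (rule prob_space_PiM_H)
  interpret GH: pair_prob_space "gammas p" Hp ..
  interpret gGH: pair_prob_space "gamma_law shape" "gammas p \<Otimes>\<^sub>M Hp" ..
  interpret PW: pair_sigma_finite PDp weights ..
  define f where "f Q x y = \<psi> (prob_or H (mix_measure p Q (fst x) (snd x) y))" for Q x y
  have f: "(\<lambda>((Q, x), y). f Q x y) \<in> borel_measurable ((PDp \<Otimes>\<^sub>M weights) \<Otimes>\<^sub>M Hp)"
    unfolding f_def by (rule measurable_mix_kernel[OF \<psi>])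
  let ?N = "PDp \<Otimes>\<^sub>M gamma_law shape \<Otimes>\<^sub>M gammas p \<Otimes>\<^sub>M Hp"
  have "(\<lambda>z. prob_or H (mix_measure p (fst z) (fst (snd z)) (fst (snd (snd z))) (snd (snd (snd z))))) \<in> ?N \<rightarrow>\<^sub>M prob_algebra borel"
  proof (intro measurable_prob_or measurable_mix_measure p)
    have "fst \<in> ?N \<rightarrow>\<^sub>M prob_algebra borel" by measurable
    then show "fst \<in> ?N \<rightarrow>\<^sub>M MA" by (rule measurable_prob_algebra_measure_algebra)
  qed measurable
  then have 1: "(\<integral>\<^sup>+Q. \<psi> Q \<partial>mix_law \<alpha> \<theta> H p) =
      (\<integral>\<^sup>+z. f (fst z) (fst (snd z), fst (snd (snd z))) (snd (snd (snd z))) \<partial>?N)"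
    unfolding mix_law_def split_beta' f_def fst_conv snd_conv by (rule nn_integral_distr) (simp add: \<psi>)
  have "(\<lambda>z. ((fst z, (fst (snd z), fst (snd (snd z)))), snd (snd (snd z)))) \<in> ?N \<rightarrow>\<^sub>M (PDp \<Otimes>\<^sub>M weights) \<Otimes>\<^sub>M Hp"
    by measurable
  from measurable_compose[OF this f]
  have m: "(\<lambda>z. f (fst z) (fst (snd z), fst (snd (snd z))) (snd (snd (snd z)))) \<in> borel_measurable ?N"
    by (simp add: split_beta')
  have "(\<integral>\<^sup>+Q. \<psi> Q \<partial>mix_law \<alpha> \<theta> H p) =
      (\<integral>\<^sup>+Q. (\<integral>\<^sup>+z. f Q (fst z, fst (snd z)) (snd (snd z)) \<partial>(gamma_law shape \<Otimes>\<^sub>M gammas p \<Otimes>\<^sub>M Hp)) \<partial>PDp)"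
    unfolding 1 by (subst gGH.nn_integral_fst[symmetric]) (simp_all add: m)
  also have "\<dots> = (\<integral>\<^sup>+Q. (\<integral>\<^sup>+x. (\<integral>\<^sup>+y. f Q x y \<partial>Hp) \<partial>weights) \<partial>PDp)"
  proof (intro nn_integral_cong)
    fix Q assume Q: "Q \<in> space PDp"
    have "(\<lambda>z. (Q, z)) \<in> gamma_law shape \<Otimes>\<^sub>M gammas p \<Otimes>\<^sub>M Hp \<rightarrow>\<^sub>M ?N" using Q by measurable
    from measurable_compose[OF this m]
    have mQ: "(\<lambda>z. f Q (fst z, fst (snd z)) (snd (snd z))) \<in> borel_measurable (gamma_law shape \<Otimes>\<^sub>M gammas p \<Otimes>\<^sub>M Hp)"
      by simp
    have "(\<lambda>z. ((Q, fst z), snd z)) \<in> weights \<Otimes>\<^sub>M Hp \<rightarrow>\<^sub>M (PDp \<Otimes>\<^sub>M weights) \<Otimes>\<^sub>M Hp" using Q by measurable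
    from measurable_compose[OF this f]
    have "(\<lambda>(x, y). f Q x y) \<in> borel_measurable (weights \<Otimes>\<^sub>M Hp)" by (simp add: split_beta')
    from HI.borel_measurable_nn_integral[OF this]
    have mx: "(\<lambda>x. \<integral>\<^sup>+y. f Q x y \<partial>Hp) \<in> borel_measurable weights" .
    have "(\<integral>\<^sup>+z. f Q (fst z, fst (snd z)) (snd (snd z)) \<partial>(gamma_law shape \<Otimes>\<^sub>M gammas p \<Otimes>\<^sub>M Hp)) =
        (\<integral>\<^sup>+g. (\<integral>\<^sup>+z. f Q (g, fst z) (snd z) \<partial>(gammas p \<Otimes>\<^sub>M Hp)) \<partial>gamma_law shape)"
      by (subst GH.nn_integral_fst[symmetric]) (simp_all add: mQ)
    also have "\<dots> = (\<integral>\<^sup>+g. (\<integral>\<^sup>+G. (\<integral>\<^sup>+y. f Q (g, G) y \<partial>Hp) \<partial>gammas p) \<partial>gamma_law shape)"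
    proof (intro nn_integral_cong)
      fix g assume g: "g \<in> space (gamma_law shape)"
      have "(\<lambda>z. (g, z)) \<in> gammas p \<Otimes>\<^sub>M Hp \<rightarrow>\<^sub>M gamma_law shape \<Otimes>\<^sub>M gammas p \<Otimes>\<^sub>M Hp" using g by measurable
      from measurable_compose[OF this mQ]
      have "(\<lambda>z. f Q (g, fst z) (snd z)) \<in> borel_measurable (gammas p \<Otimes>\<^sub>M Hp)" by simp
      then show "(\<integral>\<^sup>+z. f Q (g, fst z) (snd z) \<partial>(gammas p \<Otimes>\<^sub>M Hp)) = (\<integral>\<^sup>+G. (\<integral>\<^sup>+y. f Q (g, G) y \<partial>Hp) \<partial>gammas p)"
        by (subst HI.nn_integral_fst[symmetric]) simp_all
    qed
    also have "\<dots> = (\<integral>\<^sup>+x. (\<integral>\<^sup>+y. f Q x y \<partial>Hp) \<partial>weights)"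
      by (rule nn_integral_weights[symmetric]) (rule mx)
    finally show "(\<integral>\<^sup>+z. f Q (fst z, fst (snd z)) (snd (snd z)) \<partial>(gamma_law shape \<Otimes>\<^sub>M gammas p \<Otimes>\<^sub>M Hp)) =
        (\<integral>\<^sup>+x. (\<integral>\<^sup>+y. f Q x y \<partial>Hp) \<partial>weights)" .
  qed
  also have "\<dots> = (\<integral>\<^sup>+z. (\<integral>\<^sup>+y. f (fst z) (snd z) y \<partial>Hp) \<partial>(PDp \<Otimes>\<^sub>M weights))"
    using HI.borel_measurable_nn_integral[OF f[unfolded split_beta', folded split_beta'[of "\<lambda>z y. f (fst z) (snd z) y"]]]
    by (subst W.nn_integral_fst[symmetric]) (simp_all add: split_beta')
  also have "\<dots> = (\<integral>\<^sup>+y. (\<integral>\<^sup>+z. f (fst z) (snd z) y \<partial>(PDp \<Otimes>\<^sub>M weights)) \<partial>Hp)"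
  proof -
    interpret pair_prob_space PDp weights ..
    interpret X: pair_sigma_finite "PDp \<Otimes>\<^sub>M weights" Hp ..
    show ?thesis using X.Fubini'[of "\<lambda>z y. f (fst z) (snd z) y"] f by (simp add: split_beta')
  qed
  also have "\<dots> = (\<integral>\<^sup>+y. (\<integral>\<^sup>+Q. \<psi> Q \<partial>mix_law_fixed \<alpha> \<theta> H p y) \<partial>Hp)"
  proof (intro nn_integral_cong)
    fix y assume y: "y \<in> space Hp"
    have "(\<lambda>z. (z, y)) \<in> PDp \<Otimes>\<^sub>M weights \<rightarrow>\<^sub>M (PDp \<Otimes>\<^sub>M weights) \<Otimes>\<^sub>M Hp" using y by measurable
    from measurable_compose[OF this f]
    have "(\<lambda>z. f (fst z) (snd z) y) \<in> borel_measurable (PDp \<Otimes>\<^sub>M weights)" by (simp add: split_beta')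
    then show "(\<integral>\<^sup>+z. f (fst z) (snd z) y \<partial>(PDp \<Otimes>\<^sub>M weights)) = (\<integral>\<^sup>+Q. \<psi> Q \<partial>mix_law_fixed \<alpha> \<theta> H p y)"
      unfolding nn_integral_mix_law_fixed[OF \<psi>]
      by (subst W.nn_integral_fst[symmetric]) (simp_all add: f_def)
  qed
  finally show ?thesis .
qed

lemma prob_space_mix_law: "prob_space (mix_law \<alpha> \<theta> H p)"
proof
  interpret HI: prob_space Hp by (rule prob_space_PiM_H)
  interpret m: prob_space "mix_law_fixed \<alpha> \<theta> H p y" for y by (rule prob_space_mix_law_fixed)
  show "emeasure (mix_law \<alpha> \<theta> H p) (space (mix_law \<alpha> \<theta> H p)) = 1"
    using nn_integral_mix_law[of "\<lambda>_. 1"] by (simp add: m.emeasure_space_1 HI.emeasure_space_1)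
qed

text \<open>The tilted integral over \<open>crm_law\<close> is \<open>mass shape\<close> times an
  integral over the Poisson--Dirichlet law with the raised parameter, which supplies the random
  measure of the mixture. The gamma variables come from \<open>atoms_integral_gamma\<close>.\<close>

lemma atoms_integral_eq_mix_law_fixed:
  assumes ne: "p \<noteq> {}" and B: "\<And>C. C \<in> p \<Longrightarrow> B C \<in> sets borel"
    and \<psi>: "\<psi> \<in> borel_measurable (prob_algebra borel)" and n: "n = (\<Sum>C\<in>p. card C)"
  shows "atoms_integral p card B (\<lambda>\<mu>. tilt (\<theta> + real n) \<mu> * \<psi> (normalize \<mu>)) =
    ennreal (Gamma shape / Gamma (\<theta> + real n) * (\<Prod>C\<in>p. Gamma (real (card C) - \<alpha>) / Gamma (1 - \<alpha>))) *
    (mass shape * (\<integral>\<^sup>+y. (\<Prod>C\<in>p. indicator (B C) (y C)) * (\<integral>\<^sup>+Q. \<psi> Q \<partial>mix_law_fixed \<alpha> \<theta> H p y) \<partial>Hp))"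
proof -
  interpret PD: prob_space PDp by (rule prob_space_PDp)
  interpret HI: prob_space Hp by (rule prob_space_PiM_H)
  define I where "I y = (\<Prod>C\<in>p. indicator (B C) (y C) :: ennreal)" for y
  have I: "I \<in> borel_measurable Hp"
    unfolding I_def
  proof (rule borel_measurable_prod_ennreal)
    fix C assume [simp]: "C \<in> p"
    have [measurable]: "B C \<in> sets borel" using B by simp
    show "(\<lambda>y. indicator (B C) (y C)) \<in> borel_measurable Hp" by measurable
  qed
  define f where "f Q x y = \<psi> (prob_or H (mix_measure p Q (fst x) (snd x) y))" for Q x y
  have f: "(\<lambda>((Q, x), y). f Q x y) \<in> borel_measurable ((PDp \<Otimes>\<^sub>M weights) \<Otimes>\<^sub>M Hp)"
    unfolding f_def by (rule measurable_mix_kernel[OF \<psi>])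
  have "(\<lambda>z. ((snd z, fst (fst z)), snd (fst z))) \<in> (weights \<Otimes>\<^sub>M Hp) \<Otimes>\<^sub>M PDp \<rightarrow>\<^sub>M (PDp \<Otimes>\<^sub>M weights) \<Otimes>\<^sub>M Hp"
    by measurable
  from measurable_compose[OF this f]
  have "(\<lambda>(z, Q). f Q (fst z) (snd z)) \<in> borel_measurable ((weights \<Otimes>\<^sub>M Hp) \<Otimes>\<^sub>M PDp)"
    by (simp add: split_beta')
  from PD.borel_measurable_nn_integral[OF this]
  have F: "(\<lambda>z. \<integral>\<^sup>+Q. f Q (fst z) (snd z) \<partial>PDp) \<in> borel_measurable (weights \<Otimes>\<^sub>M Hp)" .
  have IF: "(\<lambda>(x, y). I y * (\<integral>\<^sup>+Q. f Q x y \<partial>PDp)) \<in> borel_measurable (weights \<Otimes>\<^sub>M Hp)"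
    using borel_measurable_times_ennreal[OF measurable_compose[OF measurable_snd I] F] by (simp add: split_beta')
  have IFx: "(\<lambda>y. I y * (\<integral>\<^sup>+Q. f Q x y \<partial>PDp)) \<in> borel_measurable Hp" if "x \<in> space weights" for x
    using measurable_compose[OF measurable_Pair1'[OF that] IF] by simp
  have Fx: "(\<lambda>x. \<integral>\<^sup>+y. I y * (\<integral>\<^sup>+Q. f Q x y \<partial>PDp) \<partial>Hp) \<in> borel_measurable weights"
    by (rule HI.borel_measurable_nn_integral[OF IF])
  have Fg: "(\<lambda>x. mass shape * (\<integral>\<^sup>+y. I y * (\<integral>\<^sup>+Q. f Q x y \<partial>PDp) \<partial>Hp)) \<in> borel_measurable weights"
    using Fx by (intro borel_measurable_times_ennreal) simp_all
  \<comment> \<open>Before normalization, the tilted law of \<open>normalize \<mu>\<close> is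
    \<open>mass shape\<close> times \<open>PDp\<close>.\<close>
  have PD: "(\<integral>\<^sup>+\<mu>. tilt shape \<mu> * \<psi> (prob_or H (mix_measure p (normalize \<mu>) g G y)) \<partial>crm_law) =
      mass shape * (\<integral>\<^sup>+Q. f Q (g, G) y \<partial>PDp)" for g G y
  proof -
    have "(\<lambda>Q. mix_measure p Q g G y) \<in> prob_algebra borel \<rightarrow>\<^sub>M MA"
    proof (rule measurable_mix_measure[OF p])
      show "(\<lambda>Q. Q) \<in> prob_algebra borel \<rightarrow>\<^sub>M MA"
        by (rule measurable_prob_algebra_measure_algebra) simp
    qed simp_all
    from measurable_compose[OF measurable_prob_or[OF this] \<psi>]
    have "(\<lambda>Q. f Q (g, G) y) \<in> borel_measurable (prob_algebra borel)" by (simp add: f_def)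
    from nn_integral_PD_law[OF _ this, of shape]
    show ?thesis using \<theta> alpha by (simp add: f_def)
  qed
  have "(\<integral>\<^sup>+g. (\<integral>\<^sup>+G. (\<integral>\<^sup>+y. I y * (mass shape * (\<integral>\<^sup>+Q. f Q (g, G) y \<partial>PDp)) \<partial>Hp) \<partial>gammas p) \<partial>gamma_law shape) =
      (\<integral>\<^sup>+g. (\<integral>\<^sup>+G. mass shape * (\<integral>\<^sup>+y. I y * (\<integral>\<^sup>+Q. f Q (g, G) y \<partial>PDp) \<partial>Hp) \<partial>gammas p) \<partial>gamma_law shape)"
  proof (intro nn_integral_cong)
    fix g G assume "g \<in> space (gamma_law shape)" "G \<in> space (gammas p)"
    then have "(g, G) \<in> space weights" by (simp add: space_pair_measure)
    from nn_integral_cmult[OF IFx[OF this], of "mass shape"]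
    show "(\<integral>\<^sup>+y. I y * (mass shape * (\<integral>\<^sup>+Q. f Q (g, G) y \<partial>PDp)) \<partial>Hp) =
        mass shape * (\<integral>\<^sup>+y. I y * (\<integral>\<^sup>+Q. f Q (g, G) y \<partial>PDp) \<partial>Hp)"
      by (simp only: mult.left_commute)
  qed
  also have "\<dots> = (\<integral>\<^sup>+x. mass shape * (\<integral>\<^sup>+y. I y * (\<integral>\<^sup>+Q. f Q x y \<partial>PDp) \<partial>Hp) \<partial>weights)"
    by (rule nn_integral_weights[OF Fg, symmetric])
  also have "\<dots> = mass shape * (\<integral>\<^sup>+x. (\<integral>\<^sup>+y. I y * (\<integral>\<^sup>+Q. f Q x y \<partial>PDp) \<partial>Hp) \<partial>weights)"
    by (rule nn_integral_cmult[OF Fx])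
  also have "(\<integral>\<^sup>+x. (\<integral>\<^sup>+y. I y * (\<integral>\<^sup>+Q. f Q x y \<partial>PDp) \<partial>Hp) \<partial>weights) =
      (\<integral>\<^sup>+y. I y * (\<integral>\<^sup>+Q. \<psi> Q \<partial>mix_law_fixed \<alpha> \<theta> H p y) \<partial>Hp)"
    unfolding f_def by (rule nn_integral_mix_law_fixed_swap[OF \<psi> I])
  finally have main: "(\<integral>\<^sup>+g. (\<integral>\<^sup>+G. (\<integral>\<^sup>+y. I y * (mass shape * (\<integral>\<^sup>+Q. f Q (g, G) y \<partial>PDp)) \<partial>Hp) \<partial>gammas p) \<partial>gamma_law shape) =
      mass shape * (\<integral>\<^sup>+y. I y * (\<integral>\<^sup>+Q. \<psi> Q \<partial>mix_law_fixed \<alpha> \<theta> H p y) \<partial>Hp)" .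
  have "atoms_integral p card B (\<lambda>\<mu>. tilt (\<theta> + real n) \<mu> * \<psi> (normalize \<mu>)) =
    ennreal (Gamma shape / Gamma (\<theta> + real n) * (\<Prod>C\<in>p. Gamma (real (card C) - \<alpha>) / Gamma (1 - \<alpha>))) *
    (\<integral>\<^sup>+g. (\<integral>\<^sup>+G. (\<integral>\<^sup>+y. I y * (\<integral>\<^sup>+\<mu>. tilt shape \<mu> * \<psi> (prob_or H (mix_measure p (normalize \<mu>) g G y)) \<partial>crm_law)
      \<partial>Hp) \<partial>gammas p) \<partial>gamma_law shape)"
    unfolding I_def by (rule atoms_integral_gamma; (rule p ne \<psi> n \<theta> | erule card | erule B))
  then show ?thesis
    unfolding PD main by (simp only: I_def)
qed

end

section \<open>Assembling the sampling formula\<close>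

text \<open>The product starts at \<open>j = 1\<close> because \<open>\<theta> + 1\<close> and all
  later arguments are positive for \<open>\<theta> > - 1\<close>, whereas \<open>\<theta>\<close>
  itself may be a pole of Gamma.\<close>

lemma prod_rising_eq_Gamma:
  assumes \<theta>: "\<theta> > - 1" and n: "n \<ge> 1"
  shows "(\<Prod>j = 1..n - 1. \<theta> + real j) = Gamma (\<theta> + real n) / Gamma (\<theta> + 1)"
  using n
proof (induction n rule: dec_induct)
  case base
  have "Gamma (\<theta> + 1) > 0" using \<theta> by (intro Gamma_real_pos) simp
  then show ?case by simp
next
  case (step n)
  have pos: "\<theta> + real n > 0" using \<theta> step(1) by simp
  have "(\<Prod>j = 1..Suc n - 1. \<theta> + real j) = (\<theta> + real n) * (\<Prod>j = 1..n - 1. \<theta> + real j)"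
    using step(1) by (cases n) (simp_all add: mult.commute)
  also have "\<dots> = Gamma (\<theta> + real n + 1) / Gamma (\<theta> + 1)"
    using pos unfolding step.IH by (subst Gamma_plus1) (auto elim!: nonpos_Ints_cases)
  finally show ?case by (simp add: add_ac)
qed

lemma partition_on_block:
  fixes n :: nat
  assumes "partition_on {1..n} p" "C \<in> p"
  shows "C \<subseteq> {1..n}" "finite C" "C \<noteq> {}" "card C \<ge> 1"
proof -
  show sub: "C \<subseteq> {1..n}" using partition_onD1[OF assms(1)] assms(2) by blast
  then show fin: "finite C" by (rule finite_subset) simp
  show ne: "C \<noteq> {}" using partition_onD3[OF assms(1)] assms(2) by blast
  show "card C \<ge> 1" using fin ne by (simp add: Suc_le_eq card_gt_0_iff)
qed

lemma partition_on_shape_pos: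
  fixes n :: nat
  assumes p: "partition_on {1..n} p" and n: "n \<ge> 1" and \<theta>: "\<theta> > - \<alpha>"
  shows "finite p" "p \<noteq> {}" "card p \<ge> 1" "\<theta> + real (card p) * \<alpha> > 0"
proof -
  show fin: "finite p" by (rule finite_elements[OF _ p]) simp
  show ne: "p \<noteq> {}" using partition_onD1[OF p] n by auto
  show c: "card p \<ge> 1" using fin ne by (simp add: Suc_le_eq card_gt_0_iff)
  have "1 * \<alpha> \<le> real (card p) * \<alpha>" using c alpha by (intro mult_right_mono) auto
  with \<theta> show "\<theta> + real (card p) * \<alpha> > 0" by simp
qed

text \<open>This encodes the joint law of the random measure and a conditionally independent sample,
  tested against \<open>\<psi>\<close> and a box. All constants are collected here: the gamma
  factors cancel and leave \<open>PD_eppf\<close>.\<close>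

lemma nn_integral_PD_law_power:
  fixes n :: nat
  assumes \<theta>: "\<theta> > - \<alpha>" and n: "n \<ge> 1" and \<psi>: "\<psi> \<in> borel_measurable (prob_algebra borel)"
    and B: "\<And>i. i \<in> {1..n} \<Longrightarrow> B i \<in> sets borel"
  shows "(\<integral>\<^sup>+Q. \<psi> Q * (\<Prod>i\<in>{1..n}. emeasure Q (B i)) \<partial>PD_law \<alpha> \<theta> H) =
    (\<Sum>p | partition_on {1..n} p. ennreal (PD_eppf \<alpha> \<theta> n p) *
      (\<integral>\<^sup>+y. (\<Prod>C\<in>p. indicator (\<Inter>i\<in>C. B i) (y C)) * (\<integral>\<^sup>+Q. \<psi> Q \<partial>mix_law_fixed \<alpha> \<theta> H p y) \<partial>(\<Pi>\<^sub>M C\<in>p. H)))"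
    (is "?L = (\<Sum>p | _. ?R p)")
proof -
  have m: "mass \<theta> \<noteq> 0" "mass \<theta> \<noteq> \<infinity>" using mass_pos mass_finite[OF \<theta>] by auto
  let ?\<phi> = "\<lambda>\<mu>. tilt (\<theta> + real n) \<mu> * \<psi> (normalize \<mu>)"
  have \<phi>: "?\<phi> \<in> borel_measurable MA"
    by (intro borel_measurable_times_ennreal measurable_tilt measurable_compose[OF measurable_normalize \<psi>])
  have "(\<lambda>Q. \<psi> Q * (\<Prod>i\<in>{1..n}. emeasure Q (B i))) \<in> borel_measurable (prob_algebra borel)"
  proof (intro borel_measurable_times_ennreal \<psi> borel_measurable_prod_ennreal)
    fix i assume "i \<in> {1..n}"
    have "(\<lambda>Q :: 'a measure. Q) \<in> prob_algebra borel \<rightarrow>\<^sub>M MA"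
      by (rule measurable_prob_algebra_measure_algebra) simp
    from measurable_compose[OF this measurable_emeasure_measure_algebra[OF B[OF \<open>i \<in> {1..n}\<close>]]]
    show "(\<lambda>Q. emeasure Q (B i)) \<in> borel_measurable (prob_algebra borel)" .
  qed
  from nn_integral_PD_law[OF \<theta> this]
  have "mass \<theta> * ?L = (\<integral>\<^sup>+\<mu>. tilt \<theta> \<mu> * (\<psi> (normalize \<mu>) * (\<Prod>i\<in>{1..n}. emeasure (normalize \<mu>) (B i))) \<partial>crm_law)" .
  \<comment> \<open>Each of the \<open>n\<close> normalized factors contributes one division by the
    total mass, which raises the tilt from \<open>\<theta>\<close> to
    \<open>\<theta> + real n\<close>.\<close>
  also have "\<dots> = (\<integral>\<^sup>+\<mu>. ?\<phi> \<mu> * (\<Prod>i\<in>{1..n}. emeasure \<mu> (B i)) \<partial>crm_law)"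
  proof (rule nn_integral_cong_AE)
    show "AE \<mu> in crm_law. tilt \<theta> \<mu> * (\<psi> (normalize \<mu>) * (\<Prod>i\<in>{1..n}. emeasure (normalize \<mu>) (B i))) =
        ?\<phi> \<mu> * (\<Prod>i\<in>{1..n}. emeasure \<mu> (B i))"
      using AE_crm_law_total_mass
    proof eventually_elim
      case (elim \<mu>)
      then obtain t where t: "sets \<mu> = sets borel" "emeasure \<mu> UNIV = ennreal t" "t > 0" by blast
      have "(\<Prod>i\<in>{1..n}. emeasure (normalize \<mu>) (B i)) = (\<Prod>i\<in>{1..n}. ennreal (1 / t) * emeasure \<mu> (B i))"
        unfolding normalize_eq[OF t] by simp
      also have "\<dots> = ennreal ((1 / t) ^ n) * (\<Prod>i\<in>{1..n}. emeasure \<mu> (B i))"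
        using t by (simp add: prod.distrib ennreal_power)
      finally have 1: "(\<Prod>i\<in>{1..n}. emeasure (normalize \<mu>) (B i)) = ennreal ((1 / t) ^ n) * (\<Prod>i\<in>{1..n}. emeasure \<mu> (B i))" .
      have "t powr (- \<theta>) * (1 / t) ^ n = t powr (- \<theta>) * t powr (- real n)"
        using t by (simp add: powr_minus powr_realpow power_one_over inverse_eq_divide)
      also have "\<dots> = t powr (- (\<theta> + real n))" by (simp add: powr_add[symmetric])
      finally have 2: "tilt \<theta> \<mu> * ennreal ((1 / t) ^ n) = tilt (\<theta> + real n) \<mu>"
        using t by (simp add: tilt_def flip: ennreal_mult)
      show ?case unfolding 1 2[symmetric] by (simp only: mult_ac)
    qed
  qed
  also have "\<dots> = (\<Sum>p | partition_on {1..n} p. atoms_integral p card (\<lambda>C. \<Inter>i\<in>C. B i) ?\<phi>)"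
    by (rule nn_integral_crm_law_power[OF B \<phi>])
  also have "\<dots> = (\<Sum>p | partition_on {1..n} p. mass \<theta> * ?R p)"
  proof (intro sum.cong refl)
    fix p assume "p \<in> {p. partition_on {1..n} p}"
    then have p: "partition_on {1..n} p" by simp
    note blk = partition_on_block[OF p]
    note sh = partition_on_shape_pos[OF p n \<theta>]
    let ?a = "\<theta> + real (card p) * \<alpha>" and ?P = "\<Prod>C\<in>p. Gamma (real (card C) - \<alpha>) / Gamma (1 - \<alpha>)"
    have B': "(\<Inter>i\<in>C. B i) \<in> sets borel" if "C \<in> p" for C
      using blk[OF that] B by (intro sets.finite_INT) auto
    have "card {1..n} = (\<Sum>C\<in>p. card C)" by (rule product_partition[OF p]) (rule blk(2))
    then have nc: "n = (\<Sum>C\<in>p. card C)" by simp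
    let ?Y = "\<integral>\<^sup>+y. (\<Prod>C\<in>p. indicator (\<Inter>i\<in>C. B i) (y C)) * (\<integral>\<^sup>+Q. \<psi> Q \<partial>mix_law_fixed \<alpha> \<theta> H p y) \<partial>(\<Pi>\<^sub>M C\<in>p. H)"
    have pos: "Gamma ?a > 0" "Gamma (\<theta> + real n) > 0" "Gamma (\<theta> + 1) > 0"
      using sh(4) \<theta> alpha n by (auto intro!: Gamma_real_pos)
    have P: "?P > 0"
    proof (intro prod_pos ballI divide_pos_pos Gamma_pos Gamma_real_pos)
      fix C assume "C \<in> p"
      then show "0 < real (card C) - \<alpha>" using blk(4)[of C] alpha by simp
    qed
    have prodpos: "0 \<le> (\<Prod>j = 1..card p - 1. \<theta> + real j * \<alpha>)"
    proof (intro prod_nonneg)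
      fix j assume "j \<in> {1..card p - 1}"
      then have "1 * \<alpha> \<le> real j * \<alpha>" using alpha by (intro mult_right_mono) auto
      then show "0 \<le> \<theta> + real j * \<alpha>" using \<theta> by simp
    qed
    \<comment> \<open>The constant in front of \<open>mass ?a\<close> and the one from
      \<open>mass_add_multiple\<close> cancel in \<open>Gamma ?a\<close>; what remains is the
      partition probability.\<close>
    have eppf: "Gamma ?a / Gamma (\<theta> + real n) * ?P *
        (Gamma (\<theta> + 1) / Gamma ?a * (\<Prod>j = 1..card p - 1. \<theta> + real j * \<alpha>)) = PD_eppf \<alpha> \<theta> n p"
    proof -
      have "PD_eppf \<alpha> \<theta> n p = (\<Prod>j = 1..card p - 1. \<theta> + real j * \<alpha>) / (Gamma (\<theta> + real n) / Gamma (\<theta> + 1)) * ?P"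
        unfolding PD_eppf_def using \<theta> alpha n by (subst prod_rising_eq_Gamma) auto
      then show ?thesis using pos by simp
    qed
    have "atoms_integral p card (\<lambda>C. \<Inter>i\<in>C. B i) ?\<phi> =
        ennreal (Gamma ?a / Gamma (\<theta> + real n) * ?P) * (mass ?a * ?Y)"
      by (rule atoms_integral_eq_mix_law_fixed[OF sh(1) blk(4) sh(4) sh(2) B' \<psi> nc])
    also have "\<dots> = ennreal (Gamma ?a / Gamma (\<theta> + real n) * ?P) *
        ennreal (Gamma (\<theta> + 1) / Gamma ?a * (\<Prod>j = 1..card p - 1. \<theta> + real j * \<alpha>)) * (mass \<theta> * ?Y)"
      unfolding mass_add_multiple[OF \<theta> sh(3)] by (simp only: mult.assoc)
    also have "ennreal (Gamma ?a / Gamma (\<theta> + real n) * ?P) *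
        ennreal (Gamma (\<theta> + 1) / Gamma ?a * (\<Prod>j = 1..card p - 1. \<theta> + real j * \<alpha>)) = ennreal (PD_eppf \<alpha> \<theta> n p)"
      unfolding eppf[symmetric] using pos P prodpos
      by (intro ennreal_mult[symmetric] mult_nonneg_nonneg divide_nonneg_nonneg) (simp_all add: less_imp_le)
    finally show "atoms_integral p card (\<lambda>C. \<Inter>i\<in>C. B i) ?\<phi> = mass \<theta> * ?R p"
      by (simp only: mult.left_commute)
  qed
  also have "\<dots> = mass \<theta> * (\<Sum>p | partition_on {1..n} p. ?R p)"
    by (rule sum_distrib_left[symmetric])
  finally have eq: "mass \<theta> * ?L = mass \<theta> * (\<Sum>p | partition_on {1..n} p. ?R p)" .
  \<comment> \<open>Cancellation in \<open>ennreal\<close> requires \<open>mass \<theta>\<close> to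
    be neither 0 nor infinite.\<close>
  have c: "mass \<theta> * x / mass \<theta> = x" for x
    using m by (simp add: mult.commute[of "mass \<theta>"] ennreal_mult_divide_eq)
  have "?L = mass \<theta> * ?L / mass \<theta>" by (rule c[symmetric])
  also have "\<dots> = (\<Sum>p | partition_on {1..n} p. ?R p)" unfolding eq by (rule c)
  finally show ?thesis .
qed

end

section \<open>Posterior distribution\<close>

definition block :: "nat set set \<Rightarrow> nat \<Rightarrow> nat set" where
  "block p i = (THE C. C \<in> p \<and> i \<in> C)"

lemma block_eq:
  assumes "partition_on A p" "C \<in> p" "i \<in> C"
  shows "block p i = C"
  unfolding block_def
proof (rule the_equality)
  fix D assume "D \<in> p \<and> i \<in> D"
  then show "D = C"
    using pairwiseD[OF partition_onD2[OF assms(1)], of D C] assms by (auto simp: disjnt_def)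
qed (use assms in simp)

lemma block:
  assumes "partition_on A p" "i \<in> A"
  shows "block p i \<in> p" "i \<in> block p i"
proof -
  obtain C where "C \<in> p" "i \<in> C" using partition_onD1[OF assms(1)] assms(2) by blast
  with block_eq[OF assms(1) this] show "block p i \<in> p" "i \<in> block p i" by auto
qed

text \<open>The sample whose value at every index in \<open>C\<close> is \<open>y C\<close>; for
  injective \<open>y\<close> it inverts the passage from a sample to its partition and block
  values.\<close>

definition spread :: "nat \<Rightarrow> nat set set \<Rightarrow> (nat set \<Rightarrow> 'a) \<Rightarrow> nat \<Rightarrow> 'a" where
  "spread n p y = (\<lambda>i\<in>{1..n}. y (block p i))"

lemma partition_on_sample_partition: "partition_on {1..n} (sample_partition n y)"
  unfolding sample_partition_def
  by (rule partition_onI) (auto simp: disjnt_def)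

text \<open>Expresses the event through finitely many equalities between coordinates, from which its
  measurability follows.\<close>

lemma sample_partition_eq_iff:
  assumes p: "partition_on {1..n} p"
  shows "sample_partition n y = p \<longleftrightarrow> (\<forall>i\<in>{1..n}. \<forall>j\<in>{1..n}. y i = y j \<longleftrightarrow> block p i = block p j)"
proof
  assume eq: "sample_partition n y = p"
  have blk: "block p i = {j \<in> {1..n}. y j = y i}" if "i \<in> {1..n}" for i
    by (rule block_eq[OF p]) (use that in \<open>auto simp: eq[symmetric] sample_partition_def\<close>)
  show "\<forall>i\<in>{1..n}. \<forall>j\<in>{1..n}. y i = y j \<longleftrightarrow> block p i = block p j"
  proof (intro ballI)
    fix i j assume ij: "i \<in> {1..n}" "j \<in> {1..n}"
    show "y i = y j \<longleftrightarrow> block p i = block p j"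
      unfolding blk[OF ij(1)] blk[OF ij(2)] using ij by auto
  qed
next
  assume eq: "\<forall>i\<in>{1..n}. \<forall>j\<in>{1..n}. y i = y j \<longleftrightarrow> block p i = block p j"
  have blk: "block p i = {j \<in> {1..n}. y j = y i}" if i: "i \<in> {1..n}" for i
  proof (intro equalityI subsetI)
    fix j assume j: "j \<in> block p i"
    have "block p i \<in> p" by (rule block[OF p i])
    then have "j \<in> {1..n}" using j partition_onD1[OF p] by blast
    moreover have "block p j = block p i" by (rule block_eq[OF p \<open>block p i \<in> p\<close> j])
    ultimately show "j \<in> {j \<in> {1..n}. y j = y i}" using eq i by simp
  next
    fix j assume "j \<in> {j \<in> {1..n}. y j = y i}"
    then have j: "j \<in> {1..n}" "block p j = block p i" using eq i by auto
    show "j \<in> block p i" using block(2)[OF p j(1)] unfolding j(2) .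
  qed
  have "sample_partition n y = block p ` {1..n}"
    unfolding sample_partition_def by (rule image_cong[OF refl]) (simp add: blk)
  also have "\<dots> = p"
  proof (intro equalityI subsetI)
    fix C assume C: "C \<in> p"
    then obtain i where i: "i \<in> C" using partition_onD3[OF p] by (cases "C = {}") auto
    then have "i \<in> {1..n}" using C partition_onD1[OF p] by blast
    with block_eq[OF p C i] show "C \<in> block p ` {1..n}" by auto
  qed (use block(1)[OF p] in auto)
  finally show "sample_partition n y = p" .
qed

lemma sample_value_eq:
  assumes "C \<in> sample_partition n y" "i \<in> C"
  shows "sample_value y C = y i"
proof -
  have "y ` C = {y i}" using assms by (auto simp: sample_partition_def image_iff)
  then show ?thesis by (simp add: sample_value_def)
qed

text \<open>Injectivity matters because two blocks with a common value would be merged in the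
  sample.\<close>

lemma
  assumes p: "partition_on {1..n} p" and y: "inj_on y p"
  shows sample_partition_spread: "sample_partition n (spread n p y) = p"
    and sample_value_spread: "C \<in> p \<Longrightarrow> sample_value (spread n p y) C = y C"
proof -
  show eq: "sample_partition n (spread n p y) = p"
    unfolding sample_partition_eq_iff[OF p]
  proof (intro ballI)
    fix i j assume "i \<in> {1..n}" "j \<in> {1..n}"
    then show "spread n p y i = spread n p y j \<longleftrightarrow> block p i = block p j"
      using inj_on_eq_iff[OF y block(1)[OF p] block(1)[OF p]] by (simp add: spread_def)
  qed
  assume C: "C \<in> p"
  then obtain i where i: "i \<in> C" using partition_onD3[OF p] by (cases "C = {}") auto
  then have "i \<in> {1..n}" using C partition_onD1[OF p] by blast
  then have "spread n p y i = y C" using block_eq[OF p C i] by (simp add: spread_def)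
  moreover have "sample_value (spread n p y) C = spread n p y i"
    by (rule sample_value_eq[where n = n]) (simp_all add: eq C i)
  ultimately show "sample_value (spread n p y) C = y C" by simp
qed

context stable_base
begin

text \<open>For two blocks, integrating one coordinate first with the others fixed leaves the
  \<open>H\<close>-measure of a single point, which is zero; there are only finitely many
  pairs.\<close>

lemma AE_PiM_H_inj:
  assumes p: "finite p" and na: "\<And>x. emeasure H {x} = 0"
  shows "AE y in (\<Pi>\<^sub>M C\<in>p. H). inj_on y p"
proof -
  interpret PH: product_sigma_finite "\<lambda>_. H" by standard
  have ae: "AE y in (\<Pi>\<^sub>M C\<in>p. H). y C \<noteq> y D" if CD: "C \<in> p" "D \<in> p" "C \<noteq> D" for C D
  proof -
    have [measurable]: "(\<lambda>y. y C) \<in> (\<Pi>\<^sub>M C\<in>p. H) \<rightarrow>\<^sub>M borel" "(\<lambda>y. y D) \<in> (\<Pi>\<^sub>M C\<in>p. H) \<rightarrow>\<^sub>M borel"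
      using measurable_component_singleton[OF CD(1), of "\<lambda>_. H"] measurable_component_singleton[OF CD(2), of "\<lambda>_. H"]
      by (simp_all add: measurable_cong_sets[OF refl sets_H])
    let ?E = "{y \<in> space (\<Pi>\<^sub>M C\<in>p. H). y C = y D}"
    have E: "?E \<in> sets (\<Pi>\<^sub>M C\<in>p. H)" by measurable
    have ins: "insert C (p - {C}) = p" using CD by auto
    have "emeasure (\<Pi>\<^sub>M C\<in>p. H) ?E = (\<integral>\<^sup>+y. indicator ?E y \<partial>(\<Pi>\<^sub>M C\<in>p. H))"
      using E by simp
    also have "\<dots> = (\<integral>\<^sup>+y. (\<integral>\<^sup>+z. indicator ?E (y(C := z)) \<partial>H) \<partial>(\<Pi>\<^sub>M C\<in>p - {C}. H))"
      using PH.product_nn_integral_insert[of "p - {C}" C "indicator ?E"] p E unfolding ins by simp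
    also have "\<dots> = (\<integral>\<^sup>+y. 0 \<partial>(\<Pi>\<^sub>M C\<in>p - {C}. H))"
    proof (rule nn_integral_cong)
      fix y
      have "(\<integral>\<^sup>+z. indicator ?E (y(C := z)) \<partial>H) \<le> (\<integral>\<^sup>+z. indicator {y D} z \<partial>H)"
        using CD by (intro nn_integral_mono) (auto simp: indicator_def)
      also have "\<dots> = 0" by (simp add: na sets_H)
      finally show "(\<integral>\<^sup>+z. indicator ?E (y(C := z)) \<partial>H) = 0" by simp
    qed
    finally have "?E \<in> null_sets (\<Pi>\<^sub>M C\<in>p. H)" using E by (simp add: null_sets_def)
    then show ?thesis by (rule AE_I') auto
  qed
  have "AE y in (\<Pi>\<^sub>M C\<in>p. H). \<forall>C\<in>p. \<forall>D\<in>p. C \<noteq> D \<longrightarrow> y C \<noteq> y D"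
    using p by (intro AE_finite_allI) (use ae in \<open>auto intro: AE_I2\<close>)
  then show ?thesis by eventually_elim (auto simp: inj_on_def)
qed

lemma finite_partitions: "finite {p. partition_on {1..n::nat} p}"
  by (rule finitely_many_partition_on) simp

lemma measurable_spread:
  assumes p: "partition_on {1..n} p"
  shows "spread n p \<in> (\<Pi>\<^sub>M C\<in>p. H) \<rightarrow>\<^sub>M (\<Pi>\<^sub>M i\<in>{1..n}. borel)"
  unfolding spread_def
proof (rule measurable_restrict)
  fix i assume "i \<in> {1..n}"
  from measurable_component_singleton[OF block(1)[OF p this], of "\<lambda>_. H"]
  show "(\<lambda>y. y (block p i)) \<in> (\<Pi>\<^sub>M C\<in>p. H) \<rightarrow>\<^sub>M borel"
    by (simp add: measurable_cong_sets[OF refl sets_H])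
qed

text \<open>The sampling formula constrains locations block by block, a box constrains the sample
  index by index; both require that \<open>y C\<close> lie in \<open>B i\<close> for all
  \<open>i\<close> in \<open>C\<close>.\<close>

lemma indicator_spread:
  assumes p: "partition_on {1..n} p"
  shows "indicator (Pi\<^sub>E {1..n} B) (spread n p y) = (\<Prod>C\<in>p. indicator (\<Inter>i\<in>C. B i) (y C) :: ennreal)"
proof -
  have fin: "finite p" by (rule finite_elements[OF _ p]) simp
  have "spread n p y \<in> Pi\<^sub>E {1..n} B \<longleftrightarrow> (\<forall>C\<in>p. y C \<in> (\<Inter>i\<in>C. B i))"
  proof
    assume s: "spread n p y \<in> Pi\<^sub>E {1..n} B"
    show "\<forall>C\<in>p. y C \<in> (\<Inter>i\<in>C. B i)"
    proof (intro ballI INT_I)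
      fix C i assume C: "C \<in> p" "i \<in> C"
      then have i: "i \<in> {1..n}" using partition_onD1[OF p] by blast
      from PiE_mem[OF s i] i block_eq[OF p C] show "y C \<in> B i" by (simp add: spread_def)
    qed
  next
    assume "\<forall>C\<in>p. y C \<in> (\<Inter>i\<in>C. B i)"
    then have "y (block p i) \<in> B i" if "i \<in> {1..n}" for i
      using block[OF p that] by blast
    then show "spread n p y \<in> Pi\<^sub>E {1..n} B" by (auto simp: spread_def)
  qed
  moreover have "(\<Prod>C\<in>p. indicator (\<Inter>i\<in>C. B i) (y C) :: ennreal) = (if \<forall>C\<in>p. y C \<in> (\<Inter>i\<in>C. B i) then 1 else 0)"
  proof (cases "\<forall>C\<in>p. y C \<in> (\<Inter>i\<in>C. B i)")
    case True
    then have "(\<Prod>C\<in>p. indicator (\<Inter>i\<in>C. B i) (y C) :: ennreal) = (\<Prod>C\<in>p. 1)"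
      by (intro prod.cong) (auto simp: indicator_def)
    with True show ?thesis by simp
  next
    case False
    then obtain C where "C \<in> p" "y C \<notin> (\<Inter>i\<in>C. B i)" by blast
    then have "\<exists>C\<in>p. (indicator (\<Inter>i\<in>C. B i) (y C) :: ennreal) = 0" by (intro bexI[of _ C]) simp_all
    from prod_zero[OF fin this] show ?thesis using False by simp
  qed
  ultimately show ?thesis by (simp add: indicator_def)
qed

section \<open>The mixture identity and the posterior law\<close>

context
  fixes \<theta> :: real and n :: nat
  assumes \<theta>: "\<theta> > - \<alpha>" and n: "n \<ge> 1"
  notes One_nat_def [simp del]
begin

abbreviation (input) "parts \<equiv> {p. partition_on {1..n} p}"
abbreviation (input) "samples \<equiv> \<Pi>\<^sub>M i\<in>{1..n}. (borel :: 'a measure)"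
abbreviation (input) "laws \<equiv> prob_algebra (borel :: 'a measure)"

lemma parts_mix:
  assumes "p \<in> parts"
  shows "finite p" "\<And>C. C \<in> p \<Longrightarrow> 1 \<le> card C" "\<theta> + real (card p) * \<alpha> > 0"
  using partition_on_shape_pos[OF _ n \<theta>, of p] partition_on_block(4)[of n p] assms by auto

lemma space_PD_partition: "space (PD_partition \<alpha> \<theta> n) = parts"
  by (simp add: PD_partition_def space_point_measure)

lemma parts_nonempty: "parts \<noteq> {}"
  using partition_on_space[of "{1..n}"] n by auto

lemma measurable_PD_partition_iff: "f \<in> PD_partition \<alpha> \<theta> n \<rightarrow>\<^sub>M M \<longleftrightarrow> f \<in> parts \<rightarrow> space M"
  by (simp add: PD_partition_def)

lemma nn_integral_PD_partition:
  "(\<integral>\<^sup>+p. f p \<partial>PD_partition \<alpha> \<theta> n) = (\<Sum>p | partition_on {1..n} p. ennreal (PD_eppf \<alpha> \<theta> n p) * f p)"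
  unfolding PD_partition_def by (rule nn_integral_point_measure_finite) (rule finite_partitions)

text \<open>The sampling formula with every \<open>B i = UNIV\<close>: all factors are one and the
  constraints on the locations disappear.\<close>

lemma PD_law_eq_bind: "PD_law \<alpha> \<theta> H = PD_partition \<alpha> \<theta> n \<bind> mix_law \<alpha> \<theta> H"
proof (rule measure_eqI)
  have sm: "sets (mix_law \<alpha> \<theta> H p) = sets laws" for p by (simp add: mix_law_def)
  have m: "mix_law \<alpha> \<theta> H \<in> PD_partition \<alpha> \<theta> n \<rightarrow>\<^sub>M subprob_algebra laws"
    unfolding measurable_PD_partition_iff
    using prob_space_mix_law[OF parts_mix] by (auto simp: space_subprob_algebra sm intro: prob_space_imp_subprob_space)
  have ne: "space (PD_partition \<alpha> \<theta> n) \<noteq> {}" unfolding space_PD_partition by (rule parts_nonempty)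
  show sets: "sets (PD_law \<alpha> \<theta> H) = sets (PD_partition \<alpha> \<theta> n \<bind> mix_law \<alpha> \<theta> H)"
    using sets_bind[OF sm ne] by simp
  fix A assume "A \<in> sets (PD_law \<alpha> \<theta> H)"
  then have A: "A \<in> sets laws" by simp
  then have ind: "indicator A \<in> borel_measurable laws" by simp
  have "emeasure (PD_law \<alpha> \<theta> H) A = (\<integral>\<^sup>+Q. indicator A Q \<partial>PD_law \<alpha> \<theta> H)"
    using A by simp
  also have "\<dots> = (\<integral>\<^sup>+Q. indicator A Q * (\<Prod>i\<in>{1..n}. emeasure Q UNIV) \<partial>PD_law \<alpha> \<theta> H)"
  proof (intro nn_integral_cong)
    fix Q assume "Q \<in> space (PD_law \<alpha> \<theta> H)"
    then have "prob_space Q" "sets Q = sets borel" by (simp_all add: space_PD_law space_prob_algebra)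
    then have "emeasure Q UNIV = 1" by (simp add: prob_space_iff)
    then show "indicator A Q = indicator A Q * (\<Prod>i\<in>{1..n}. emeasure Q UNIV)" by simp
  qed
  also have "\<dots> = (\<Sum>p | partition_on {1..n} p. ennreal (PD_eppf \<alpha> \<theta> n p) *
      (\<integral>\<^sup>+y. (\<Prod>C\<in>p. indicator (\<Inter>i\<in>C. UNIV) (y C)) * (\<integral>\<^sup>+Q. indicator A Q \<partial>mix_law_fixed \<alpha> \<theta> H p y) \<partial>(\<Pi>\<^sub>M C\<in>p. H)))"
    by (rule nn_integral_PD_law_power[OF \<theta> n ind]) simp
  also have "\<dots> = (\<Sum>p | partition_on {1..n} p. ennreal (PD_eppf \<alpha> \<theta> n p) * emeasure (mix_law \<alpha> \<theta> H p) A)"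
  proof (intro sum.cong refl arg_cong2[where f = "(*)"])
    fix p assume p: "p \<in> parts"
    have "emeasure (mix_law \<alpha> \<theta> H p) A = (\<integral>\<^sup>+Q. indicator A Q \<partial>mix_law \<alpha> \<theta> H p)" using A sm by simp
    also have "\<dots> = (\<integral>\<^sup>+y. (\<integral>\<^sup>+Q. indicator A Q \<partial>mix_law_fixed \<alpha> \<theta> H p y) \<partial>(\<Pi>\<^sub>M C\<in>p. H))"
      by (rule nn_integral_mix_law[OF parts_mix[OF p] ind])
    finally show "(\<integral>\<^sup>+y. (\<Prod>C\<in>p. indicator (\<Inter>i\<in>C. UNIV) (y C)) * (\<integral>\<^sup>+Q. indicator A Q \<partial>mix_law_fixed \<alpha> \<theta> H p y) \<partial>(\<Pi>\<^sub>M C\<in>p. H)) =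
        emeasure (mix_law \<alpha> \<theta> H p) A" by simp
  qed
  also have "\<dots> = emeasure (PD_partition \<alpha> \<theta> n \<bind> mix_law \<alpha> \<theta> H) A"
    unfolding emeasure_bind[OF ne m A] nn_integral_PD_partition ..
  finally show "emeasure (PD_law \<alpha> \<theta> H) A = emeasure (PD_partition \<alpha> \<theta> n \<bind> mix_law \<alpha> \<theta> H) A" .
qed

abbreviation (input) "posterior y \<equiv> mix_law_fixed \<alpha> \<theta> H (sample_partition n y) (sample_value y)"

text \<open>The partition takes finitely many values, so it suffices to have a measurable kernel for
  each fixed one and to select among them measurably.\<close>

lemma measurable_posterior: "(\<lambda>y. posterior y) \<in> samples \<rightarrow>\<^sub>M prob_algebra laws"
proof -
  \<comment> \<open>Reading the value of a block at its least index is measurable in the sample for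
    fixed \<open>p\<close>, and it agrees with \<open>sample_value\<close> when \<open>p\<close> is
    the partition of the sample.\<close>
  define \<kappa> where "\<kappa> p y = mix_law_fixed \<alpha> \<theta> H p (\<lambda>C\<in>p. y (Min C))" for p and y :: "nat \<Rightarrow> 'a"
  have \<kappa>: "\<kappa> p \<in> samples \<rightarrow>\<^sub>M prob_algebra laws" if p: "p \<in> parts" for p
  proof (rule measurable_prob_algebraI)
    show pr: "prob_space (\<kappa> p y)" for y
      unfolding \<kappa>_def by (rule prob_space_mix_law_fixed[OF parts_mix[OF p]])
    have y: "(\<lambda>y. \<lambda>C\<in>p. y (Min C)) \<in> samples \<rightarrow>\<^sub>M (\<Pi>\<^sub>M C\<in>p. H)"
    proof (rule measurable_restrict)
      fix C assume C: "C \<in> p"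
      note blk = partition_on_block[OF p[simplified] C]
      then have "Min C \<in> {1..n}" using Min_in by blast
      from measurable_component_singleton[OF this, of "\<lambda>_. borel"]
      show "(\<lambda>y. y (Min C)) \<in> samples \<rightarrow>\<^sub>M H" by (simp add: measurable_cong_sets[OF refl sets_H])
    qed
    show "\<kappa> p \<in> samples \<rightarrow>\<^sub>M subprob_algebra laws"
    proof (rule measurable_subprob_algebra)
      show "subprob_space (\<kappa> p y)" for y by (rule prob_space_imp_subprob_space[OF pr])
      show s: "sets (\<kappa> p y) = sets laws" for y
        by (simp add: \<kappa>_def mix_law_fixed_def)
      fix A assume A: "A \<in> sets laws"
      then have ind: "indicator A \<in> borel_measurable laws" by simp
      have "(\<lambda>y. \<integral>\<^sup>+Q. indicator A Q \<partial>\<kappa> p y) \<in> borel_measurable samples"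
        unfolding \<kappa>_def
        by (rule measurable_compose[OF y measurable_nn_integral_mix_law_fixed[OF parts_mix[OF p] ind]])
      then show "(\<lambda>y. emeasure (\<kappa> p y) A) \<in> borel_measurable samples" using A s by simp
    qed
  qed
  have sp: "sample_partition n \<in> samples \<rightarrow>\<^sub>M count_space parts"
  proof (subst measurable_count_space_eq2)
    show "finite parts" by (rule finite_partitions)
    show "sample_partition n \<in> space samples \<rightarrow> parts \<and>
        (\<forall>p\<in>parts. sample_partition n -` {p} \<inter> space samples \<in> sets samples)"
    proof (intro conjI ballI)
      show "sample_partition n \<in> space samples \<rightarrow> parts" using partition_on_sample_partition by auto
      fix p assume p: "p \<in> parts"
      have "sample_partition n -` {p} \<inter> space samples =
          {y \<in> space samples. \<forall>i\<in>{1..n}. \<forall>j\<in>{1..n}. y i = y j \<longleftrightarrow> block p i = block p j}"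
      proof -
        have "sample_partition n y = p \<longleftrightarrow> (\<forall>i\<in>{1..n}. \<forall>j\<in>{1..n}. y i = y j \<longleftrightarrow> block p i = block p j)"
          for y :: "nat \<Rightarrow> 'a"
          by (rule sample_partition_eq_iff) (use p in simp)
        then show ?thesis by (simp only: vimage_def Int_def singleton_iff mem_Collect_eq conj_commute)
      qed
      also have "\<dots> \<in> sets samples"
      proof (intro sets.sets_Collect_finite_All finite_atLeastAtMost)
        fix i j assume ij: "i \<in> {1..n}" "j \<in> {1..n}"
        \<comment> \<open>The diagonal is measurable in a Polish space.\<close>
        have eq: "{y \<in> space samples. y i = y j} \<in> sets samples"
          by (rule measurable_equality_set) (rule measurable_component_singleton, fact)+
        show "{y \<in> space samples. y i = y j \<longleftrightarrow> block p i = block p j} \<in> sets samples"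
        proof (cases "block p i = block p j")
          case False
          have "{y \<in> space samples. \<not> y i = y j} \<in> sets samples" by (rule sets.sets_Collect_neg[OF eq])
          with False show ?thesis by simp
        qed (use eq in simp)
      qed
      finally show "sample_partition n -` {p} \<inter> space samples \<in> sets samples" .
    qed
  qed
  have "(\<lambda>y. \<kappa> (sample_partition n y) y) \<in> samples \<rightarrow>\<^sub>M prob_algebra laws"
    by (rule measurable_compose_countable'[OF \<kappa> sp]) (auto intro: countable_finite finite_partitions)
  moreover have "\<kappa> (sample_partition n y) y = posterior y" for y
  proof -
    have part: "sample_partition n y \<in> parts" using partition_on_sample_partition by simp
    show ?thesis
      unfolding \<kappa>_def
    proof (rule mix_law_fixed_cong[OF parts_mix[OF part]])
    fix C assume C: "C \<in> sample_partition n y"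
    have "Min C \<in> C" using partition_on_block[OF partition_on_sample_partition C] by (intro Min_in)
    from sample_value_eq[OF C this] C
    show "(\<lambda>C\<in>sample_partition n y. y (Min C)) C = sample_value y C" by simp
    qed
  qed
  ultimately show ?thesis by simp
qed

text \<open>The law of the sample restricted to the event that the random measure lies in
  \<open>D\<close>, in the form given by the sampling formula. \<open>D\<close> enters through a
  density, so in general this is a subprobability.\<close>

definition sample_mixture :: "'a measure set \<Rightarrow> (nat \<Rightarrow> 'a) measure" where
  "sample_mixture D = PD_partition \<alpha> \<theta> n \<bind>
     (\<lambda>p. distr (density (\<Pi>\<^sub>M C\<in>p. H) (\<lambda>y. emeasure (mix_law_fixed \<alpha> \<theta> H p y) D)) samples (spread n p))"

lemma measurable_emeasure_mix_law_fixed: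
  assumes D: "D \<in> sets laws" and p: "p \<in> parts"
  shows "(\<lambda>y. emeasure (mix_law_fixed \<alpha> \<theta> H p y) D) \<in> borel_measurable (\<Pi>\<^sub>M C\<in>p. H)"
proof -
  have "indicator D \<in> borel_measurable laws" using D by simp
  from measurable_nn_integral_mix_law_fixed[OF parts_mix[OF p] this]
  show ?thesis using D by (simp add: sets_mix_law_fixed[OF parts_mix[OF p]])
qed

lemma measurable_sample_mixture_kernel:
  assumes D: "D \<in> sets laws"
  shows "(\<lambda>p. distr (density (\<Pi>\<^sub>M C\<in>p. H) (\<lambda>y. emeasure (mix_law_fixed \<alpha> \<theta> H p y) D)) samples (spread n p))
    \<in> PD_partition \<alpha> \<theta> n \<rightarrow>\<^sub>M subprob_algebra samples"
  unfolding measurable_PD_partition_iff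
proof
  fix p assume p: "p \<in> parts"
  interpret HI: prob_space "\<Pi>\<^sub>M C\<in>p. H" by (rule prob_space_PiM_H)
  interpret F: prob_space "mix_law_fixed \<alpha> \<theta> H p y" for y by (rule prob_space_mix_law_fixed[OF parts_mix[OF p]])
  let ?d = "density (\<Pi>\<^sub>M C\<in>p. H) (\<lambda>y. emeasure (mix_law_fixed \<alpha> \<theta> H p y) D)"
  have "emeasure ?d (space ?d) = (\<integral>\<^sup>+y. emeasure (mix_law_fixed \<alpha> \<theta> H p y) D * indicator (space (\<Pi>\<^sub>M C\<in>p. H)) y \<partial>(\<Pi>\<^sub>M C\<in>p. H))"
    unfolding space_density by (rule emeasure_density[OF measurable_emeasure_mix_law_fixed[OF D p] sets.top])
  also have "\<dots> \<le> (\<integral>\<^sup>+y. 1 \<partial>(\<Pi>\<^sub>M C\<in>p. H))"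
    by (intro nn_integral_mono) (auto simp: indicator_def F.emeasure_le_1)
  also have "\<dots> = 1" by (simp add: HI.emeasure_space_1)
  finally have "subprob_space ?d"
    using HI.not_empty by (intro subprob_spaceI) (simp_all only: space_density simp_thms)
  moreover have "spread n p \<in> ?d \<rightarrow>\<^sub>M samples" using measurable_spread[of n p] p by simp
  moreover have "space samples \<noteq> {}" by (simp add: space_PiM PiE_eq_empty_iff)
  ultimately have "subprob_space (distr ?d samples (spread n p))"
    by (rule subprob_space.subprob_space_distr)
  then show "distr ?d samples (spread n p) \<in> space (subprob_algebra samples)"
    by (simp add: space_subprob_algebra)
qed

lemma nn_integral_sample_mixture:
  assumes D: "D \<in> sets laws" and h: "h \<in> borel_measurable samples"
  shows "(\<integral>\<^sup>+z. h z \<partial>sample_mixture D) = (\<Sum>p | partition_on {1..n} p. ennreal (PD_eppf \<alpha> \<theta> n p) *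
    (\<integral>\<^sup>+y. emeasure (mix_law_fixed \<alpha> \<theta> H p y) D * h (spread n p y) \<partial>(\<Pi>\<^sub>M C\<in>p. H)))"
  unfolding sample_mixture_def nn_integral_bind[OF h measurable_sample_mixture_kernel[OF D]] nn_integral_PD_partition
proof (intro sum.cong refl arg_cong2[where f = "(*)"])
  fix p assume p: "p \<in> parts"
  have s: "spread n p \<in> (\<Pi>\<^sub>M C\<in>p. H) \<rightarrow>\<^sub>M samples" using measurable_spread[of n p] p by simp
  show "(\<integral>\<^sup>+z. h z \<partial>distr (density (\<Pi>\<^sub>M C\<in>p. H) (\<lambda>y. emeasure (mix_law_fixed \<alpha> \<theta> H p y) D)) samples (spread n p)) =
      (\<integral>\<^sup>+y. emeasure (mix_law_fixed \<alpha> \<theta> H p y) D * h (spread n p y) \<partial>(\<Pi>\<^sub>M C\<in>p. H))"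
    using s h by (subst nn_integral_distr)
      (simp_all add: nn_integral_density[OF measurable_emeasure_mix_law_fixed[OF D p] measurable_compose[OF s h]])
qed

lemma sets_sample_mixture: "D \<in> sets laws \<Longrightarrow> sets (sample_mixture D) = sets samples"
  unfolding sample_mixture_def
  by (rule sets_bind) (simp, unfold space_PD_partition, rule parts_nonempty)

text \<open>It is enough to compare finite measures on boxes. There conditional independence gives
  the product of the \<open>emeasure (P \<omega>) (B i)\<close>, which is the integrand of the
  sampling formula.\<close>

lemma joint_law_eq_sample_mixture:
  fixes M :: "'w measure" and P :: "'w \<Rightarrow> 'a measure" and Y :: "'w \<Rightarrow> nat \<Rightarrow> 'a"
  assumes M: "prob_space M" and PD: "distr M laws P = PD_law \<alpha> \<theta> H"
    and rcd: "regular_cond_distr M Y samples P laws (\<lambda>Q. \<Pi>\<^sub>M i\<in>{1..n}. Q)"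
    and D: "D \<in> sets laws"
  shows "distr (density M (\<lambda>\<omega>. indicator D (P \<omega>))) samples Y = sample_mixture D"
proof (rule measure_eqI_PiM_finite[where I = "{1..n}" and M = "\<lambda>_. borel" and A = "\<lambda>_. space samples"])
  interpret M: prob_space M by (rule M)
  have P [measurable]: "P \<in> M \<rightarrow>\<^sub>M laws" and Y [measurable]: "Y \<in> M \<rightarrow>\<^sub>M samples"
    and joint: "\<And>A B. A \<in> sets samples \<Longrightarrow> B \<in> sets laws \<Longrightarrow>
        emeasure M {\<omega> \<in> space M. Y \<omega> \<in> A \<and> P \<omega> \<in> B} =
        (\<integral>\<^sup>+\<omega>. emeasure (\<Pi>\<^sub>M i\<in>{1..n}. P \<omega>) A * indicator B (P \<omega>) \<partial>M)"
    using rcd unfolding regular_cond_distr_def by auto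
  note [measurable] = D
  let ?L = "distr (density M (\<lambda>\<omega>. indicator D (P \<omega>))) samples Y"
  have L: "emeasure ?L A = emeasure M {\<omega> \<in> space M. Y \<omega> \<in> A \<and> P \<omega> \<in> D}" if A [measurable]: "A \<in> sets samples" for A
  proof -
    have "emeasure ?L A = (\<integral>\<^sup>+\<omega>. indicator D (P \<omega>) * indicator (Y -` A \<inter> space M) \<omega> \<partial>M)"
      using A by (subst emeasure_distr) (simp_all add: emeasure_density)
    also have "\<dots> = (\<integral>\<^sup>+\<omega>. indicator {\<omega> \<in> space M. Y \<omega> \<in> A \<and> P \<omega> \<in> D} \<omega> \<partial>M)"
      by (intro nn_integral_cong) (auto simp: indicator_def)
    finally show ?thesis by simp
  qed
  show "sets ?L = sets samples" by simp
  show "sets (sample_mixture D) = sets samples" by (rule sets_sample_mixture[OF D])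
  show "finite {1..n}" by simp
  show "emeasure ?L (space samples) \<noteq> \<infinity>" for i :: nat
    unfolding L[OF sets.top] by simp
  show "range (\<lambda>_::nat. space samples) \<subseteq> prod_algebra {1..n} (\<lambda>_. borel)"
    using space_in_prod_algebra[of "{1..n}" "\<lambda>_. borel :: 'a measure"] by (auto simp: space_PiM)
  show "(\<Union>i::nat. space samples) = space samples" by simp
  fix B :: "nat \<Rightarrow> 'a set" assume B: "\<And>i. i \<in> {1..n} \<Longrightarrow> B i \<in> sets borel"
  have box: "Pi\<^sub>E {1..n} B \<in> sets samples" using B by (intro sets_PiM_I_finite) auto
  have ind: "indicator D \<in> borel_measurable laws" using D by simp
  have mprod: "(\<lambda>Q. indicator D Q * (\<Prod>i\<in>{1..n}. emeasure Q (B i)) :: ennreal) \<in> borel_measurable laws"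
  proof (intro borel_measurable_times_ennreal ind borel_measurable_prod_ennreal)
    fix i assume "i \<in> {1..n}"
    have "(\<lambda>Q :: 'a measure. Q) \<in> laws \<rightarrow>\<^sub>M MA"
      by (rule measurable_prob_algebra_measure_algebra) simp
    from measurable_compose[OF this measurable_emeasure_measure_algebra[OF B[OF \<open>i \<in> {1..n}\<close>]]]
    show "(\<lambda>Q. emeasure Q (B i)) \<in> borel_measurable laws" .
  qed
  have "emeasure ?L (Pi\<^sub>E {1..n} B) = (\<integral>\<^sup>+\<omega>. emeasure (\<Pi>\<^sub>M i\<in>{1..n}. P \<omega>) (Pi\<^sub>E {1..n} B) * indicator D (P \<omega>) \<partial>M)"
    unfolding L[OF box] by (rule joint[OF box D])
  also have "\<dots> = (\<integral>\<^sup>+\<omega>. indicator D (P \<omega>) * (\<Prod>i\<in>{1..n}. emeasure (P \<omega>) (B i)) \<partial>M)"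
  proof (intro nn_integral_cong)
    fix \<omega> assume "\<omega> \<in> space M"
    then have P\<omega>: "prob_space (P \<omega>)" "sets (P \<omega>) = sets borel"
      using measurable_space[OF P] by (auto simp: space_prob_algebra)
    interpret Q: prob_space "P \<omega>" by (rule P\<omega>)
    interpret Q: product_sigma_finite "\<lambda>_::nat. P \<omega>" by standard
    have "emeasure (\<Pi>\<^sub>M i\<in>{1..n}. P \<omega>) (Pi\<^sub>E {1..n} B) = (\<Prod>i\<in>{1..n}. emeasure (P \<omega>) (B i))"
      by (rule Q.emeasure_PiM) (use B P\<omega> in auto)
    then show "emeasure (\<Pi>\<^sub>M i\<in>{1..n}. P \<omega>) (Pi\<^sub>E {1..n} B) * indicator D (P \<omega>) =
        indicator D (P \<omega>) * (\<Prod>i\<in>{1..n}. emeasure (P \<omega>) (B i))" by (simp only: mult.commute)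
  qed
  also have "\<dots> = (\<integral>\<^sup>+Q. indicator D Q * (\<Prod>i\<in>{1..n}. emeasure Q (B i)) \<partial>distr M laws P)"
    using mprod by (subst nn_integral_distr[OF P]) simp_all
  also have "\<dots> = (\<Sum>p | partition_on {1..n} p. ennreal (PD_eppf \<alpha> \<theta> n p) *
      (\<integral>\<^sup>+y. (\<Prod>C\<in>p. indicator (\<Inter>i\<in>C. B i) (y C)) * (\<integral>\<^sup>+Q. indicator D Q \<partial>mix_law_fixed \<alpha> \<theta> H p y) \<partial>(\<Pi>\<^sub>M C\<in>p. H)))"
    unfolding PD by (rule nn_integral_PD_law_power[OF \<theta> n ind B])
  also have "\<dots> = (\<integral>\<^sup>+z. indicator (Pi\<^sub>E {1..n} B) z \<partial>sample_mixture D)"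
  proof -
    have ibox: "indicator (Pi\<^sub>E {1..n} B) \<in> borel_measurable samples" using box by simp
    show ?thesis
      unfolding nn_integral_sample_mixture[OF D ibox]
    proof (intro sum.cong refl, rule arg_cong2[where f = "(*)", OF refl nn_integral_cong])
      fix p y assume p: "p \<in> parts"
      then have "indicator (Pi\<^sub>E {1..n} B) (spread n p y) = (\<Prod>C\<in>p. indicator (\<Inter>i\<in>C. B i) (y C) :: ennreal)"
        by (intro indicator_spread) simp
      moreover have "(\<integral>\<^sup>+Q. indicator D Q \<partial>mix_law_fixed \<alpha> \<theta> H p y) = emeasure (mix_law_fixed \<alpha> \<theta> H p y) D"
        using D by (simp add: sets_mix_law_fixed[OF parts_mix[OF p]])
      ultimately show "(\<Prod>C\<in>p. indicator (\<Inter>i\<in>C. B i) (y C)) * (\<integral>\<^sup>+Q. indicator D Q \<partial>mix_law_fixed \<alpha> \<theta> H p y) =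
          emeasure (mix_law_fixed \<alpha> \<theta> H p y) D * indicator (Pi\<^sub>E {1..n} B) (spread n p y)"
        by (simp only: mult.commute)
    qed
  qed
  also have "\<dots> = emeasure (sample_mixture D) (Pi\<^sub>E {1..n} B)"
    using box sets_sample_mixture[OF D] by simp
  finally show "emeasure ?L (Pi\<^sub>E {1..n} B) = emeasure (sample_mixture D) (Pi\<^sub>E {1..n} B)" .
qed

text \<open>For almost all \<open>y\<close> the locations are distinct, so
  \<open>spread n p y\<close> determines \<open>p\<close> and the values of \<open>y\<close> on it,
  and \<open>mix_law_fixed \<alpha> \<theta> H p y\<close> becomes a function of the sample. Taking
  it out as a weight leaves the mixture for the whole space of laws, which is the law of the
  sample.\<close>

lemma posterior_law:
  fixes M :: "'w measure" and P :: "'w \<Rightarrow> 'a measure" and Y :: "'w \<Rightarrow> nat \<Rightarrow> 'a"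
  assumes M: "prob_space M" and PD: "distr M laws P = PD_law \<alpha> \<theta> H"
    and rcd: "regular_cond_distr M Y samples P laws (\<lambda>Q. \<Pi>\<^sub>M i\<in>{1..n}. Q)"
    and na: "\<And>x. emeasure H {x} = 0"
  shows "regular_cond_distr M P laws Y samples (\<lambda>y. posterior y)"
  unfolding regular_cond_distr_def
proof (intro conjI ballI)
  interpret M: prob_space M by (rule M)
  show P: "P \<in> M \<rightarrow>\<^sub>M laws" and Y: "Y \<in> M \<rightarrow>\<^sub>M samples"
    using rcd unfolding regular_cond_distr_def by auto
  show post: "(\<lambda>y. posterior y) \<in> samples \<rightarrow>\<^sub>M prob_algebra laws" by (rule measurable_posterior)
  note [measurable] = P Y
  note joint = joint_law_eq_sample_mixture[OF M PD rcd]
  fix A B assume A [measurable]: "A \<in> sets laws" and B [measurable]: "B \<in> sets samples"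
  have "emeasure M {\<omega> \<in> space M. P \<omega> \<in> A \<and> Y \<omega> \<in> B} =
      emeasure (distr (density M (\<lambda>\<omega>. indicator A (P \<omega>))) samples Y) B"
  proof -
    have "emeasure (distr (density M (\<lambda>\<omega>. indicator A (P \<omega>))) samples Y) B =
        (\<integral>\<^sup>+\<omega>. indicator A (P \<omega>) * indicator (Y -` B \<inter> space M) \<omega> \<partial>M)"
      by (subst emeasure_distr) (simp_all add: emeasure_density)
    also have "\<dots> = (\<integral>\<^sup>+\<omega>. indicator {\<omega> \<in> space M. P \<omega> \<in> A \<and> Y \<omega> \<in> B} \<omega> \<partial>M)"
      by (intro nn_integral_cong) (auto simp: indicator_def)
    finally show ?thesis by simp
  qed
  also have "\<dots> = (\<integral>\<^sup>+z. indicator B z \<partial>sample_mixture A)"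
    unfolding joint[OF A] using B sets_sample_mixture[OF A] by simp
  also have "\<dots> = (\<Sum>p | partition_on {1..n} p. ennreal (PD_eppf \<alpha> \<theta> n p) *
      (\<integral>\<^sup>+y. emeasure (mix_law_fixed \<alpha> \<theta> H p y) A * indicator B (spread n p y) \<partial>(\<Pi>\<^sub>M C\<in>p. H)))"
    by (rule nn_integral_sample_mixture[OF A]) simp
  \<comment> \<open>A factor equal to one, the mass of the whole space of laws, is inserted to match
    the form of \<open>sample_mixture (space laws)\<close>.\<close>
  also have "\<dots> = (\<Sum>p | partition_on {1..n} p. ennreal (PD_eppf \<alpha> \<theta> n p) *
      (\<integral>\<^sup>+y. emeasure (mix_law_fixed \<alpha> \<theta> H p y) (space laws) *
        (emeasure (posterior (spread n p y)) A * indicator B (spread n p y)) \<partial>(\<Pi>\<^sub>M C\<in>p. H)))"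
  proof (intro sum.cong refl arg_cong2[where f = "(*)"] nn_integral_cong_AE)
    fix p assume p: "p \<in> parts"
    then have p': "partition_on {1..n} p" by simp
    show "AE y in \<Pi>\<^sub>M C\<in>p. H. emeasure (mix_law_fixed \<alpha> \<theta> H p y) A * indicator B (spread n p y) =
        emeasure (mix_law_fixed \<alpha> \<theta> H p y) (space laws) *
        (emeasure (posterior (spread n p y)) A * indicator B (spread n p y))"
      using AE_PiM_H_inj[OF parts_mix(1)[OF p] na]
    proof eventually_elim
      case (elim y)
      interpret F: prob_space "mix_law_fixed \<alpha> \<theta> H p y" by (rule prob_space_mix_law_fixed[OF parts_mix[OF p]])
      have "emeasure (mix_law_fixed \<alpha> \<theta> H p y) (space laws) = 1"
        using F.emeasure_space_1 sets_eq_imp_space_eq[OF sets_mix_law_fixed[OF parts_mix[OF p]], of y] by simp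
      moreover have "posterior (spread n p y) = mix_law_fixed \<alpha> \<theta> H p y"
        unfolding sample_partition_spread[OF p' elim]
        by (rule mix_law_fixed_cong[OF parts_mix[OF p]], assumption) (rule sample_value_spread[OF p' elim])
      ultimately show ?case by simp
    qed
  qed
  also have "\<dots> = (\<integral>\<^sup>+z. emeasure (posterior z) A * indicator B z \<partial>sample_mixture (space laws))"
  proof (rule nn_integral_sample_mixture[symmetric])
    have "(\<lambda>z. emeasure (posterior z) A) \<in> borel_measurable samples"
      by (rule measurable_compose[OF measurable_prob_algebraD[OF post] measurable_emeasure_subprob_algebra[OF A]])
    then show "(\<lambda>z. emeasure (posterior z) A * indicator B z) \<in> borel_measurable samples"
      by (intro borel_measurable_times_ennreal) simp_all
  qed simp
  \<comment> \<open>For the whole space the restriction on \<open>P\<close> is void, so the joint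
    law reduces to the law of the sample.\<close>
  also have "sample_mixture (space laws) = distr M samples Y"
  proof -
    have "distr (density M (\<lambda>\<omega>. indicator (space laws) (P \<omega>))) samples Y = distr (density M (\<lambda>_. 1)) samples Y"
      by (intro distr_cong density_cong) (use measurable_space[OF P] in auto)
    also have "density M (\<lambda>_. 1) = M"
      by (rule density_1)
    finally show ?thesis using joint[OF sets.top] by simp
  qed
  also have "(\<integral>\<^sup>+z. emeasure (posterior z) A * indicator B z \<partial>distr M samples Y) =
      (\<integral>\<^sup>+\<omega>. emeasure (posterior (Y \<omega>)) A * indicator B (Y \<omega>) \<partial>M)"
  proof (rule nn_integral_distr[OF Y])
    have "(\<lambda>z. emeasure (posterior z) A) \<in> borel_measurable samples"
      by (rule measurable_compose[OF measurable_prob_algebraD[OF post] measurable_emeasure_subprob_algebra[OF A]])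
    then show "(\<lambda>z. emeasure (posterior z) A * indicator B z) \<in> borel_measurable (distr M samples Y)"
      unfolding measurable_distr_eq1 by (intro borel_measurable_times_ennreal borel_measurable_indicator B)
  qed
  finally show "emeasure M {\<omega> \<in> space M. P \<omega> \<in> A \<and> Y \<omega> \<in> B} =
      (\<integral>\<^sup>+\<omega>. emeasure (posterior (Y \<omega>)) A * indicator B (Y \<omega>) \<partial>M)" .
qed

end

end

theorem proposition5p6:
  fixes \<alpha> \<theta> :: real and n :: nat and H :: "'a::polish_space measure"
  assumes "0 < \<alpha>" and "\<alpha> < 1" and "\<theta> > - \<alpha>" and "n \<ge> 1"
    and "prob_space H" and "sets H = sets borel"
    and non_atomic: "\<forall>x. emeasure H {x} = 0"
  shows "PD_law \<alpha> \<theta> H = PD_partition \<alpha> \<theta> n \<bind> mix_law \<alpha> \<theta> H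
    \<and> (\<forall>(M :: 'w measure) (P :: 'w \<Rightarrow> 'a measure) (Y :: nat \<Rightarrow> 'w \<Rightarrow> 'a).
          prob_space M
          \<longrightarrow> P \<in> M \<rightarrow>\<^sub>M prob_algebra borel
          \<longrightarrow> distr M (prob_algebra borel) P = PD_law \<alpha> \<theta> H
          \<longrightarrow> regular_cond_distr M
                (\<lambda>\<omega>. \<lambda>i\<in>{1..n}. Y i \<omega>) (\<Pi>\<^sub>M i\<in>{1..n}. borel)
                P (prob_algebra borel)
                (\<lambda>Q. \<Pi>\<^sub>M i\<in>{1..n}. Q)
          \<longrightarrow> regular_cond_distr M
                P (prob_algebra borel)
                (\<lambda>\<omega>. \<lambda>i\<in>{1..n}. Y i \<omega>) (\<Pi>\<^sub>M i\<in>{1..n}. borel)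
                (\<lambda>y. mix_law_fixed \<alpha> \<theta> H (sample_partition n y) (sample_value y)))"
proof -
  interpret stable_base H \<alpha>
    using assms by (simp add: stable_base_def stable_base_axioms_def)
  have na: "\<And>x. emeasure H {x} = 0" using non_atomic by blast
  show ?thesis
  proof (intro conjI allI impI)
    show "PD_law \<alpha> \<theta> H = PD_partition \<alpha> \<theta> n \<bind> mix_law \<alpha> \<theta> H"
      by (rule PD_law_eq_bind) fact+
  next
    fix M :: "'w measure" and P :: "'w \<Rightarrow> 'a measure" and Y :: "nat \<Rightarrow> 'w \<Rightarrow> 'a"
    assume M: "prob_space M" "P \<in> M \<rightarrow>\<^sub>M prob_algebra borel"
      "distr M (prob_algebra borel) P = PD_law \<alpha> \<theta> H"
      "regular_cond_distr M (\<lambda>\<omega>. \<lambda>i\<in>{1..n}. Y i \<omega>) (\<Pi>\<^sub>M i\<in>{1..n}. borel)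
        P (prob_algebra borel) (\<lambda>Q. \<Pi>\<^sub>M i\<in>{1..n}. Q)"
    show "regular_cond_distr M P (prob_algebra borel) (\<lambda>\<omega>. \<lambda>i\<in>{1..n}. Y i \<omega>) (\<Pi>\<^sub>M i\<in>{1..n}. borel)
        (\<lambda>y. mix_law_fixed \<alpha> \<theta> H (sample_partition n y) (sample_value y))"
      by (rule posterior_law[OF assms(3,4) M(1,3,4) na])
  qed
qed

end
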